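(* Let $n,g\geq 1$. Then there exists a surjective homomorphism of $B_n(U_g)$ onto $B_n(\Sigma_{g-1})$ if and only if $g=1$ and $n\in\{1,2\}$.
   Context: For a compact, connected surface $\Sigma$ and $n\geq 1$, let $\mathbb{F}_n(\Sigma)$ be the configuration space of $n$-tuples $(x_1,\ldots,x_n)\in\Sigma^n$ with $x_i\neq x_j$ for all $i\neq j$. The symmetric group $S_n$ acts freely on $\mathbb{F}_n(\Sigma)$ by permuting coordinates, and the $n$-string braid group of $\Sigma$ is $B_n(\Sigma)=\pi_1(\mathbb{F}_n(\Sigma)/S_n)$. $\Sigma_g$ ($g\geq 0$) denotes the compact, connected, orientable surface of genus $g$ without boundary (so $\Sigma_0$ is the $2$-sphere). $U_g$ ($g\geq 1$) denotes the compact, connected, non-orientable surface of genus $g$ without boundary, i.e. the connected sum of $g$ projective planes. *)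

theory Defs
  imports "HOL-Analysis.Analysis" "HOL-Algebra.Group"
begin

section \<open>Closed surfaces as polygons with identified edges\<close>

text \<open>
  A labelling scheme lists, in cyclic order, the edges of a polygon; an edge is a label together
  with its direction (\<open>True\<close>: counterclockwise). The polygon is realised as the closed unit disc,
  its \<open>m\<close> edges being equal arcs of the unit circle, so that \<open>m = 2\<close> is allowed.
\<close>

type_synonym scheme = "(nat \<times> bool) list"

definition edge_point :: "nat \<Rightarrow> nat \<Rightarrow> real \<Rightarrow> complex" where
  "edge_point m i t = cis (2 * pi * (real i + t) / real m)"

definition edge_glued :: "scheme \<Rightarrow> complex \<Rightarrow> complex \<Rightarrow> bool" where
  "edge_glued w z z' \<longleftrightarrow>
     (\<exists>i<length w. \<exists>j<length w. \<exists>t\<in>{0..1}.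
        fst (w ! i) = fst (w ! j) \<and>
        z = edge_point (length w) i t \<and>
        z' = edge_point (length w) j (if snd (w ! i) = snd (w ! j) then t else 1 - t))"

text \<open>
  \<open>X\<close> is homeomorphic to the quotient space of the polygon by the equivalence relation generated
  by the edge identifications. Vertices get identified through the generated equivalence.
\<close>

definition polygon_surface :: "scheme \<Rightarrow> 'a topology \<Rightarrow> bool" where
  "polygon_surface w X \<longleftrightarrow>
     (\<exists>q. quotient_map (top_of_set (cball (0::complex) 1)) X q \<and>
          (\<forall>z\<in>cball 0 1. \<forall>z'\<in>cball 0 1. q z = q z' \<longleftrightarrow> equivclp (edge_glued w) z z'))"

text \<open>
  Connected sums of polygonal surfaces are formed by concatenating labelling schemes (with disjoint
  labels): \<open>a b a\<^sup>-\<^sup>1 b\<^sup>-\<^sup>1\<close> is the torus and \<open>a a\<close> is the projective plane (the disc with antipodal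
  boundary points identified).
\<close>

definition tori_scheme :: "nat \<Rightarrow> scheme" where
  "tori_scheme g =
     concat (map (\<lambda>i. [(2*i, True), (2*i + 1, True), (2*i, False), (2*i + 1, False)]) [0..<g])"

definition projective_planes_scheme :: "nat \<Rightarrow> scheme" where
  "projective_planes_scheme g = concat (map (\<lambda>i. [(i, True), (i, True)]) [0..<g])"

definition orientable_surface :: "nat \<Rightarrow> 'a topology \<Rightarrow> bool" where
  "orientable_surface g X \<longleftrightarrow>
     (if g = 0 then X homeomorphic_space top_of_set (sphere (0 :: real^3) 1)
      else polygon_surface (tori_scheme g) X)"

text \<open>Only meaningful for \<open>g \<ge> 1\<close>.\<close>

definition nonorientable_surface :: "nat \<Rightarrow> 'a topology \<Rightarrow> bool" where
  "nonorientable_surface g X \<longleftrightarrow> polygon_surface (projective_planes_scheme g) X"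


section \<open>Configuration spaces\<close>

text \<open>An \<open>n\<close>-tuple is a function that is \<open>undefined\<close> outside \<open>{..<n}\<close>.\<close>

definition config_space :: "nat \<Rightarrow> 'a topology \<Rightarrow> (nat \<Rightarrow> 'a) topology" where
  "config_space n X = subtopology (product_topology (\<lambda>_. X) {..<n}) {x. inj_on x {..<n}}"

definition perm_orbit :: "nat \<Rightarrow> (nat \<Rightarrow> 'a) \<Rightarrow> (nat \<Rightarrow> 'a) set" where
  "perm_orbit n x = {x \<circ> \<pi> | \<pi>. \<pi> permutes {..<n}}"

definition quotient_topology :: "'a topology \<Rightarrow> ('a \<Rightarrow> 'b) \<Rightarrow> 'b topology" where
  "quotient_topology X q =
     topology (\<lambda>V. V \<subseteq> q ` topspace X \<and> openin X {x \<in> topspace X. q x \<in> V})"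

lemma openin_quotient_topology:
  "openin (quotient_topology X q) V \<longleftrightarrow>
     V \<subseteq> q ` topspace X \<and> openin X {x \<in> topspace X. q x \<in> V}"
proof -
  have "istopology (\<lambda>V. V \<subseteq> q ` topspace X \<and> openin X {x \<in> topspace X. q x \<in> V})"
    unfolding istopology_def
  proof (intro conjI allI impI)
    fix S T
    assume S: "S \<subseteq> q ` topspace X \<and> openin X {x \<in> topspace X. q x \<in> S}"
      and T: "T \<subseteq> q ` topspace X \<and> openin X {x \<in> topspace X. q x \<in> T}"
    show "S \<inter> T \<subseteq> q ` topspace X" using S by blast
    have "{x \<in> topspace X. q x \<in> S \<inter> T} =
        {x \<in> topspace X. q x \<in> S} \<inter> {x \<in> topspace X. q x \<in> T}" by blast
    then show "openin X {x \<in> topspace X. q x \<in> S \<inter> T}"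
      using S T by (simp add: openin_Int)
  next
    fix \<K>
    assume K: "\<forall>K\<in>\<K>. K \<subseteq> q ` topspace X \<and> openin X {x \<in> topspace X. q x \<in> K}"
    show "\<Union>\<K> \<subseteq> q ` topspace X" using K by blast
    have "{x \<in> topspace X. q x \<in> \<Union>\<K>} = (\<Union>K\<in>\<K>. {x \<in> topspace X. q x \<in> K})" by blast
    then show "openin X {x \<in> topspace X. q x \<in> \<Union>\<K>}"
      using K by (simp add: openin_clauses(3))
  qed
  then show ?thesis
    by (simp add: quotient_topology_def)
qed

lemma topspace_quotient_topology [simp]:
  "topspace (quotient_topology X q) = q ` topspace X"
proof -
  have "{x \<in> topspace X. q x \<in> q ` topspace X} = topspace X" by blast
  then have "openin (quotient_topology X q) (q ` topspace X)"
    by (simp add: openin_quotient_topology)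
  then show ?thesis
    by (metis openin_quotient_topology openin_subset openin_topspace subset_antisym)
qed

lemma quotient_map_quotient_topology: "quotient_map X (quotient_topology X q) q"
  by (auto simp: quotient_map_def openin_quotient_topology)

definition unordered_config_space :: "nat \<Rightarrow> 'a topology \<Rightarrow> (nat \<Rightarrow> 'a) set topology" where
  "unordered_config_space n X = quotient_topology (config_space n X) (perm_orbit n)"


section \<open>Fundamental groups and braid groups\<close>

text \<open>
  Paths are functions on the reals of which only the restriction to \<open>{0..1}\<close> matters.
\<close>

definition loop_homotopic :: "'a topology \<Rightarrow> 'a \<Rightarrow> (real \<Rightarrow> 'a) \<Rightarrow> (real \<Rightarrow> 'a) \<Rightarrow> bool" where
  "loop_homotopic X x0 =
     homotopic_with (\<lambda>h. h 0 = x0 \<and> h 1 = x0) (top_of_set {0..1::real}) X"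

definition loop_class :: "'a topology \<Rightarrow> 'a \<Rightarrow> (real \<Rightarrow> 'a) \<Rightarrow> (real \<Rightarrow> 'a) set" where
  "loop_class X x0 p = {q. loop_homotopic X x0 p q}"

text \<open>
  The library's \<open>joinpaths\<close> is restricted to types of class \<open>topological_space\<close>, whereas here the
  topology is a value.
\<close>

definition path_concat :: "(real \<Rightarrow> 'a) \<Rightarrow> (real \<Rightarrow> 'a) \<Rightarrow> real \<Rightarrow> 'a" where
  "path_concat p q = (\<lambda>t. if t \<le> 1/2 then p (2 * t) else q (2 * t - 1))"

definition fundamental_group :: "'a topology \<Rightarrow> 'a \<Rightarrow> (real \<Rightarrow> 'a) set monoid" where
  "fundamental_group X x0 =
     \<lparr> carrier = {loop_class X x0 p | p. pathin X p \<and> p 0 = x0 \<and> p 1 = x0},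
       mult = (\<lambda>A B. {r. \<exists>p\<in>A. \<exists>q\<in>B. loop_homotopic X x0 (path_concat p q) r}),
       one = loop_class X x0 (\<lambda>_. x0) \<rparr>"

definition braid_group ::
    "nat \<Rightarrow> 'a topology \<Rightarrow> (nat \<Rightarrow> 'a) set \<Rightarrow> (real \<Rightarrow> (nat \<Rightarrow> 'a) set) set monoid" where
  "braid_group n X c = fundamental_group (unordered_config_space n X) c"

end

theory Submission
  imports Defs "HOL-Combinatorics.Permutations"
begin

text \<open>
  We work with functionals on paths, with values in \<open>\<complex> - {0}\<close>, that are multiplicative under
  concatenation and invariant under homotopy; a surjective homomorphism of braid groups pulls such
  functionals on the target back to the source. On the configurations of \<open>U\<^sub>g\<close>, let \<open>\<alpha>\<^sub>k\<close> (\<open>k < g\<close>) move one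
  point along the \<open>k\<close>-th edge of the polygon. For every such functional \<open>\<Phi>\<close>, going around the boundary gives
  \<open>\<Prod>\<^sub>k \<Phi>(\<alpha>\<^sub>k)\<^sup>2 = 1\<close>; the braid relation and the sliding of a pair of points across an edge show that
  exchanging two points has value \<open>\<plusminus>1\<close>; and hence \<open>\<Phi>\<^sup>2\<close> is trivial on loops once it is trivial on the \<open>\<alpha>\<^sub>k\<close>.

  For \<open>g \<ge> 2\<close>, the \<open>2(g - 1)\<close> circle-valued functions dual to the handles of \<open>\<Sigma>\<^sub>g\<^sub>-\<^sub>1\<close> yield \<open>3\<^bsup>2(g-1)\<^esup>\<close> characters
  with values in the cube roots of unity, more than the \<open>3\<^bsup>g-1\<^esup>\<close> that the source can distinguish. For \<open>g = 1\<close> and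
  \<open>n \<ge> 3\<close>, lifting points of the sphere to spinors yields a character of \<open>B\<^sub>n(S\<^sup>2)\<close> whose square is not trivial.
  For \<open>g = 1\<close> and \<open>n \<le> 2\<close>, a braid of the sphere is determined by its permutation.
\<close>


section \<open>Homotopy of paths in abstract topologies\<close>

text \<open>All comparisons take place in first homology, without presentations of the groups: for n
  \<ge> 2 the group H_1 of B_n(U_g) is Z^(g-1) + (Z/2)^2, that of B_n of the sphere is Z/(2(n-1)),
  and that of B_n(\<Sigma>_h) has rank 2h. The values \<plusminus>1 of exchanges are removed by
  squaring, and squaring loses nothing on cube roots of unity; hence the cubic characters. The
  boundary relation determines the square of the last of the g values \<Phi>(\<alpha>_k) from the
  others, hence the exponent g - 1.

  The obstacle is to prove that a functional with trivial values on exchanges and on the \<alpha>_k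
  is trivial on all loops. The map \<open>q\<close> from the disc to U is not a covering, so a path
  crossing edges need not lift. Instead a potential h with \<Phi> p = h(p 1)/h(p 0) is built on
  configurations in the disc, shown to agree on glued points, and verified on short paths of U by
  means of neighbourhoods whose contractions do lift. In a square, the potential comes from convex
  pieces of the configuration space, cut out by strict inequalities between coordinates.\<close>

abbreviation unit_square :: "(real \<times> real) set" where "unit_square \<equiv> {0..1} \<times> {0..1}"

text \<open>Homotopy relative to both endpoints for arbitrary paths; \<open>loop_homotopic\<close>
  is the case of loops at a fixed point. Open paths are needed because functionals are evaluated on
  pieces of loops.\<close>

definition path_hom :: "'a topology \<Rightarrow> (real \<Rightarrow> 'a) \<Rightarrow> (real \<Rightarrow> 'a) \<Rightarrow> bool" where
  "path_hom X p q \<longleftrightarrow> homotopic_with (\<lambda>h. h 0 = p 0 \<and> h 1 = p 1) (top_of_set {0..1}) X p q"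

definition path_rev :: "(real \<Rightarrow> 'a) \<Rightarrow> real \<Rightarrow> 'a" where
  "path_rev p = (\<lambda>t. p (1 - t))"

lemma path_hom_imp:
  assumes "path_hom X p q"
  shows "pathin X p" "pathin X q" "q 0 = p 0" "q 1 = p 1"
proof -
  note h = assms[unfolded path_hom_def]
  show "pathin X p" "pathin X q"
    using homotopic_with_imp_continuous_maps[OF h] by (simp_all add: pathin_def)
  show "q 0 = p 0" "q 1 = p 1"
    using homotopic_with_imp_property[OF h] by auto
qed

lemma path_hom_refl [simp]: "path_hom X p p \<longleftrightarrow> pathin X p"
  by (simp add: path_hom_def pathin_def)

lemma path_hom_sym: "path_hom X p q \<Longrightarrow> path_hom X q p"
  using path_hom_imp(3,4)[of X p q] by (simp add: path_hom_def homotopic_with_sym)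

lemma path_hom_trans [trans]: "path_hom X p q \<Longrightarrow> path_hom X q r \<Longrightarrow> path_hom X p r"
  using path_hom_imp(3,4)[of X p q] unfolding path_hom_def by (auto intro: homotopic_with_trans)

lemma path_homI:
  assumes "continuous_map (top_of_set unit_square) X h"
    and "\<And>s. s \<in> {0..1} \<Longrightarrow> h (0, s) = p s" "\<And>s. s \<in> {0..1} \<Longrightarrow> h (1, s) = q s"
    and "\<And>t. t \<in> {0..1} \<Longrightarrow> h (t, 0) = p 0" "\<And>t. t \<in> {0..1} \<Longrightarrow> h (t, 1) = p 1"
  shows "path_hom X p q"
  unfolding path_hom_def
proof (subst homotopic_with)
  show "\<exists>h. continuous_map (prod_topology (top_of_set {0..1::real}) (top_of_set {0..1})) X h \<and>
        (\<forall>x\<in>topspace (top_of_set {0..1}). h (0, x) = p x) \<and>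
        (\<forall>x\<in>topspace (top_of_set {0..1}). h (1, x) = q x) \<and>
        (\<forall>t\<in>{0..1}. h (t, 0) = p 0 \<and> h (t, 1) = p 1)"
    by (rule exI[of _ h]) (use assms in \<open>auto simp: prod_topology_subtopology_eu\<close>)
qed auto

lemma path_homD:
  assumes "path_hom X p q"
  obtains h where "continuous_map (top_of_set unit_square) X h"
    "\<And>s. h (0, s) = p s" "\<And>s. h (1, s) = q s"
    "\<And>t. t \<in> {0..1} \<Longrightarrow> h (t, 0) = p 0" "\<And>t. t \<in> {0..1} \<Longrightarrow> h (t, 1) = p 1"
  using assms unfolding path_hom_def homotopic_with_def prod_topology_subtopology_eu by metis

text \<open>The straight-line homotopy lives in the convex parameter set \<open>K\<close> and is
  pushed forward by \<open>P\<close>, since \<open>X\<close> itself has no linear structure. With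
  \<open>K\<close> the unit interval it yields the reparametrisations below.\<close>

lemma path_hom_convex:
  fixes K :: "'b::real_normed_vector set"
  assumes "convex K" "continuous_map (top_of_set K) X P"
    and f: "continuous_on {0..1} f" "f ` {0..1} \<subseteq> K" and g: "continuous_on {0..1} g" "g ` {0..1} \<subseteq> K"
    and "f 0 = g 0" "f 1 = g 1"
  shows "path_hom X (P \<circ> f) (P \<circ> g)"
proof (rule path_homI)
  let ?h = "\<lambda>(t, s). (1 - t) *\<^sub>R f s + t *\<^sub>R g s"
  have "continuous_on unit_square ?h"
    unfolding case_prod_beta
    by (intro continuous_intros continuous_on_compose2[OF f(1)] continuous_on_compose2[OF g(1)]) auto
  moreover have "?h ` unit_square \<subseteq> K"
    using \<open>convex K\<close> f(2) g(2) by (auto intro!: convexD_alt[OF \<open>convex K\<close>])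
  ultimately have "continuous_map (top_of_set unit_square) (top_of_set K) ?h"
    by (auto simp: continuous_map_in_subtopology)
  then show "continuous_map (top_of_set unit_square) X (P \<circ> ?h)"
    using assms(2) continuous_map_compose by blast
qed (use assms in \<open>auto simp flip: scaleR_left_distrib\<close>)

lemma path_hom_reparam:
  assumes "pathin X p" "continuous_on {0..1} f" "f ` {0..1} \<subseteq> {0..1}"
    "continuous_on {0..1} g" "g ` {0..1} \<subseteq> {0..1}" "f 0 = g 0" "f 1 = g 1"
  shows "path_hom X (p \<circ> f) (p \<circ> g)"
  using path_hom_convex[of "{0..1::real}" X p f g] assms by (simp add: pathin_def)

lemma path_hom_cong:
  assumes "pathin X p" "\<And>t. t \<in> {0..1} \<Longrightarrow> q t = p t"
  shows "path_hom X p q"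
proof (rule path_homI)
  have "continuous_map (top_of_set unit_square) (top_of_set {0..1}) (snd :: real \<times> real \<Rightarrow> real)"
    by (auto simp: continuous_map_in_subtopology intro!: continuous_intros)
  then show "continuous_map (top_of_set unit_square) X (p \<circ> (snd :: real \<times> real \<Rightarrow> real))"
    using assms(1) continuous_map_compose unfolding pathin_def by blast
qed (use assms in auto)

lemma pathin_concat:
  assumes "pathin X p" "pathin X q" "p 1 = q 0"
  shows "pathin X (path_concat p q)"
  unfolding pathin_def path_concat_def
proof (rule continuous_map_cases_le)
  have "continuous_map (top_of_set {0..1/2}) (top_of_set {0..1}) (\<lambda>t::real. 2 * t)"
    by (auto simp: continuous_map_in_subtopology intro!: continuous_intros)
  then have "continuous_map (top_of_set {0..1/2}) X (p \<circ> (\<lambda>t::real. 2 * t))"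
    using assms(1) continuous_map_compose unfolding pathin_def by blast
  moreover have "{0..1} \<inter> {x \<in> topspace (top_of_set {0..1}). x \<le> 1 / 2} = {0..1/2::real}" by auto
  ultimately show "continuous_map (subtopology (top_of_set {0..1}) {x \<in> topspace (top_of_set {0..1}). x \<le> 1 / 2}) X
     (\<lambda>x. p (2 * x))"
    by (simp only: subtopology_subtopology o_def)
  have "continuous_map (top_of_set {1/2..1}) (top_of_set {0..1}) (\<lambda>x::real. 2*x-1)"
    by (auto simp: continuous_map_in_subtopology intro!: continuous_intros)
  then have "continuous_map (top_of_set {1/2..1}) X (q \<circ> (\<lambda>x::real. 2*x-1))"
    using assms(2) continuous_map_compose unfolding pathin_def by blast
  moreover have "{0..1} \<inter> {x \<in> topspace (top_of_set {0..1}). 1 / 2 \<le> x} = {1/2..1::real}" by auto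
  ultimately show "continuous_map (subtopology (top_of_set {0..1}) {x \<in> topspace (top_of_set {0..1}). 1 / 2 \<le> x}) X
     (\<lambda>x. q (2 * x - 1))"
    by (simp only: subtopology_subtopology o_def)
  show "p (2 * x) = q (2 * x - 1)" if "x \<in> topspace (top_of_set {0..1})" "x = 1/2" for x
    unfolding that(2) using assms(3) by simp
qed (auto intro!: continuous_intros)

lemma path_concat_ends [simp]: "path_concat p q 0 = p 0" "path_concat p q 1 = q 1"
  by (auto simp: path_concat_def)

lemma path_rev_ends [simp]: "path_rev p 0 = p 1" "path_rev p 1 = p 0"
  by (auto simp: path_rev_def)

lemma pathin_reparam:
  assumes "pathin X p" "continuous_on {0..1} f" "f ` {0..1} \<subseteq> {0..1}"
  shows "pathin X (p \<circ> f)"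
  using assms path_hom_reparam[of X p f f] by simp

lemma pathin_rev: "pathin X p \<Longrightarrow> pathin X (path_rev p)"
  using pathin_reparam[of X p "\<lambda>t. 1 - t"] by (simp add: path_rev_def o_def continuous_intros image_subset_iff)

lemma path_hom_concat:
  assumes "path_hom X p p'" "path_hom X q q'" "p 1 = q 0"
  shows "path_hom X (path_concat p q) (path_concat p' q')"
proof -
  obtain h where h: "continuous_map (top_of_set unit_square) X h"
    "\<And>s. h (0, s) = p s" "\<And>s. h (1, s) = p' s"
    "\<And>t. t \<in> {0..1} \<Longrightarrow> h (t, 0) = p 0" "\<And>t. t \<in> {0..1} \<Longrightarrow> h (t, 1) = p 1"
    using assms(1) path_homD by blast
  obtain k where k: "continuous_map (top_of_set unit_square) X k"
    "\<And>s. k (0, s) = q s" "\<And>s. k (1, s) = q' s"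
    "\<And>t. t \<in> {0..1} \<Longrightarrow> k (t, 0) = q 0" "\<And>t. t \<in> {0..1} \<Longrightarrow> k (t, 1) = q 1"
    using assms(2) path_homD by blast
  let ?H = "\<lambda>z. if snd z \<le> 1/2 then h (fst z, 2 * snd z) else k (fst z, 2 * snd z - 1)"
  have "continuous_map (top_of_set unit_square) X ?H"
  proof (rule continuous_map_cases_le)
    have e: "unit_square \<inter> {x \<in> topspace (top_of_set unit_square). snd x \<le> 1 / 2} = {0..1} \<times> {0..1/2}" by auto
    have "continuous_map (top_of_set ({0..1} \<times> {0..1/2})) (top_of_set unit_square)
        (\<lambda>z. (fst z, 2 * snd z) :: real \<times> real)"
      by (auto simp: continuous_map_in_subtopology intro!: continuous_intros)
    from continuous_map_compose[OF this h(1)] e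
    show "continuous_map (subtopology (top_of_set unit_square)
       {x \<in> topspace (top_of_set unit_square). snd x \<le> 1 / 2}) X (\<lambda>z. h (fst z, 2 * snd z))"
      by (simp only: subtopology_subtopology o_def)
    have e: "unit_square \<inter> {x \<in> topspace (top_of_set unit_square). 1 / 2 \<le> snd x} = {0..1} \<times> {1/2..1}" by auto
    have "continuous_map (top_of_set ({0..1} \<times> {1/2..1})) (top_of_set unit_square)
        (\<lambda>z. (fst z, 2 * snd z - 1) :: real \<times> real)"
      by (auto simp: continuous_map_in_subtopology intro!: continuous_intros)
    from continuous_map_compose[OF this k(1)] e
    show "continuous_map (subtopology (top_of_set unit_square)
       {x \<in> topspace (top_of_set unit_square). 1/2 \<le> snd x}) X (\<lambda>z. k (fst z, 2 * snd z - 1))"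
      by (simp only: subtopology_subtopology o_def)
    show "h (fst z, 2 * snd z) = k (fst z, 2 * snd z - 1)"
      if "z \<in> topspace (top_of_set unit_square)" "snd z = 1/2" for z
      unfolding that(2) using that(1) h(5) k(4) assms(3) by auto
  qed (auto intro!: continuous_intros)
  then show ?thesis
    by (rule path_homI) (use h k in \<open>auto simp: path_concat_def\<close>)
qed

lemma path_concat_assoc:
  assumes "pathin X p" "pathin X q" "pathin X r" "p 1 = q 0" "q 1 = r 0"
  shows "path_hom X (path_concat (path_concat p q) r) (path_concat p (path_concat q r))"
proof -
  let ?P = "path_concat p (path_concat q r)"
  \<comment> \<open>The slopes 2, 1 and 1/2 carry the breakpoints 1/4 and 1/2 of the left bracketing
    to 1/2 and 3/4; the slopes decrease, so the piecewise linear map is the minimum of its three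
    pieces.\<close>
  define f :: "real \<Rightarrow> real" where "f x = min (2 * x) (min (x + 1/4) (x/2 + 1/2))" for x
  have P: "pathin X ?P" using assms by (simp add: pathin_concat)
  have "path_hom X (?P \<circ> f) (?P \<circ> (\<lambda>x. x))"
    by (rule path_hom_reparam[OF P]) (auto simp: f_def intro!: continuous_intros)
  moreover have "path_concat (path_concat p q) r = ?P \<circ> f"
    by (rule ext) (simp add: path_concat_def f_def min_def algebra_simps)
  ultimately show ?thesis by (simp add: o_def)
qed

lemma path_concat_const_left:
  assumes "pathin X p"
  shows "path_hom X (path_concat (\<lambda>_. p 0) p) p"
proof -
  have "path_hom X (p \<circ> (\<lambda>x. max 0 (2 * x - 1))) (p \<circ> (\<lambda>x. x))"
    by (rule path_hom_reparam[OF assms]) (auto intro!: continuous_intros)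
  moreover have "path_concat (\<lambda>_. p 0) p = p \<circ> (\<lambda>x. max 0 (2 * x - 1))"
    by (rule ext) (auto simp: path_concat_def max_def intro!: arg_cong[of _ _ p])
  ultimately show ?thesis by (simp add: o_def)
qed

lemma path_concat_rev_right:
  assumes "pathin X p"
  shows "path_hom X (path_concat p (path_rev p)) (\<lambda>_. p 0)"
proof -
  have "path_hom X (p \<circ> (\<lambda>x. min (2 * x) (2 - 2 * x))) (p \<circ> (\<lambda>x. 0))"
    by (rule path_hom_reparam[OF assms]; (intro continuous_intros | force simp: min_def))
  moreover have "path_concat p (path_rev p) = p \<circ> (\<lambda>x. min (2 * x) (2 - 2 * x))"
    by (rule ext) (auto simp: path_concat_def path_rev_def min_def intro!: arg_cong[of _ _ p])
  ultimately show ?thesis by (simp add: o_def)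
qed

lemma path_rev_rev [simp]: "path_rev (path_rev p) = p"
  by (simp add: path_rev_def)

lemma path_concat_rev_left:
  assumes "pathin X p"
  shows "path_hom X (path_concat (path_rev p) p) (\<lambda>_. p 1)"
  using path_concat_rev_right[OF pathin_rev[OF assms]] by simp

section \<open>Loops and their classes\<close>

definition loopin :: "'a topology \<Rightarrow> 'a \<Rightarrow> (real \<Rightarrow> 'a) \<Rightarrow> bool" where
  "loopin X c p \<longleftrightarrow> pathin X p \<and> p 0 = c \<and> p 1 = c"

lemma loop_homotopic_iff: "loop_homotopic X c p q \<longleftrightarrow> path_hom X p q \<and> p 0 = c \<and> p 1 = c"
proof
  assume "loop_homotopic X c p q"
  moreover from this have "p 0 = c \<and> p 1 = c"
    unfolding loop_homotopic_def by (drule_tac homotopic_with_imp_property) simp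
  ultimately show "path_hom X p q \<and> p 0 = c \<and> p 1 = c"
    unfolding loop_homotopic_def path_hom_def by simp
qed (auto simp: loop_homotopic_def path_hom_def)

lemma loop_class_eq_iff:
  assumes "loopin X c p" "loopin X c q"
  shows "loop_class X c p = loop_class X c q \<longleftrightarrow> path_hom X p q"
proof
  assume "loop_class X c p = loop_class X c q"
  moreover have "q \<in> loop_class X c q"
    using assms by (simp add: loop_class_def loop_homotopic_iff loopin_def)
  ultimately show "path_hom X p q"
    by (auto simp: loop_class_def loop_homotopic_iff)
next
  assume *: "path_hom X p q"
  show "loop_class X c p = loop_class X c q"
  proof -
    have "path_hom X p r \<longleftrightarrow> path_hom X q r" for r
      using path_hom_trans[OF *] path_hom_trans[OF path_hom_sym[OF *]] by metis
    then show ?thesis using assms by (simp add: loop_class_def loop_homotopic_iff loopin_def)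
  qed
qed

lemma loopin_concat: "loopin X c p \<Longrightarrow> loopin X c q \<Longrightarrow> loopin X c (path_concat p q)"
  by (auto simp: loopin_def pathin_concat)

lemma fundamental_group_carrier:
  "carrier (fundamental_group X c) = {loop_class X c p | p. loopin X c p}"
  by (simp add: fundamental_group_def loopin_def)

text \<open>The product in \<open>fundamental_group\<close> ranges over all pairs of
  representatives; homotopy invariance of concatenation makes all of them yield the class of one
  concatenation.\<close>

lemma fundamental_group_mult:
  assumes "loopin X c p" "loopin X c q"
  shows "loop_class X c p \<otimes>\<^bsub>fundamental_group X c\<^esub> loop_class X c q = loop_class X c (path_concat p q)"
proof -
  have "loop_homotopic X c (path_concat p' q') r \<longleftrightarrow> loop_homotopic X c (path_concat p q) r"
    if "path_hom X p p'" "path_hom X q q'" for p' q' r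
  proof -
    have "path_hom X (path_concat p q) (path_concat p' q')"
      using that assms by (intro path_hom_concat) (auto simp: loopin_def)
    then show ?thesis
      using path_hom_trans path_hom_sym assms path_hom_imp[OF that(1)] path_hom_imp[OF that(2)]
      unfolding loop_homotopic_iff loopin_def path_concat_ends by metis
  qed
  moreover have "path_hom X p p" "path_hom X q q" "p 0 = c" "p 1 = c" "q 0 = c" "q 1 = c"
    using assms by (auto simp: loopin_def)
  ultimately have "(\<exists>p'. loop_homotopic X c p p' \<and> (\<exists>q'. loop_homotopic X c q q' \<and> loop_homotopic X c (path_concat p' q') r)) \<longleftrightarrow>
      loop_homotopic X c (path_concat p q) r" for r
    unfolding loop_homotopic_iff[of _ _ p] loop_homotopic_iff[of _ _ q] by metis
  then show ?thesis
    unfolding fundamental_group_def loop_class_def by simp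
qed

section \<open>Multiplicative path functionals\<close>

text \<open>A functor from the fundamental groupoid of \<open>X\<close> to the multiplicative group
  of nonzero complex numbers. Rescaling by h(p 1)/h(p 0) changes its values on open paths but not on
  loops.\<close>

definition path_char :: "'a topology \<Rightarrow> ((real \<Rightarrow> 'a) \<Rightarrow> complex) \<Rightarrow> bool" where
  "path_char X \<Phi> \<longleftrightarrow>
     (\<forall>p. pathin X p \<longrightarrow> \<Phi> p \<noteq> 0) \<and>
     (\<forall>p q. pathin X p \<longrightarrow> pathin X q \<longrightarrow> p 1 = q 0 \<longrightarrow> \<Phi> (path_concat p q) = \<Phi> p * \<Phi> q) \<and>
     (\<forall>p q. path_hom X p q \<longrightarrow> \<Phi> p = \<Phi> q)"

lemma path_char_nonzero: "path_char X \<Phi> \<Longrightarrow> pathin X p \<Longrightarrow> \<Phi> p \<noteq> 0"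
  and path_char_concat: "path_char X \<Phi> \<Longrightarrow> pathin X p \<Longrightarrow> pathin X q \<Longrightarrow> p 1 = q 0 \<Longrightarrow>
    \<Phi> (path_concat p q) = \<Phi> p * \<Phi> q"
  and path_char_hom: "path_char X \<Phi> \<Longrightarrow> path_hom X p q \<Longrightarrow> \<Phi> p = \<Phi> q"
  unfolding path_char_def by blast+

lemma path_char_cong:
  "path_char X \<Phi> \<Longrightarrow> pathin X p \<Longrightarrow> (\<And>t. t \<in> {0..1} \<Longrightarrow> q t = p t) \<Longrightarrow> \<Phi> q = \<Phi> p"
  using path_char_hom path_hom_cong by metis

lemma path_char_const:
  assumes "path_char X \<Phi>" "a \<in> topspace X"
  shows "\<Phi> (\<lambda>_. a) = 1"
proof -
  have "path_concat (\<lambda>_. a) (\<lambda>_. a) = (\<lambda>_. a)" by (auto simp: path_concat_def)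
  then have "\<Phi> (\<lambda>_. a) = \<Phi> (\<lambda>_. a) * \<Phi> (\<lambda>_. a)"
    using path_char_concat[OF assms(1), of "\<lambda>_. a" "\<lambda>_. a"] assms(2) by simp
  then show ?thesis using path_char_nonzero[OF assms(1), of "\<lambda>_. a"] assms(2) by simp
qed

lemma path_char_rev:
  assumes "path_char X \<Phi>" "pathin X p"
  shows "\<Phi> (path_rev p) = inverse (\<Phi> p)"
proof -
  have "\<Phi> p * \<Phi> (path_rev p) = 1"
    using path_char_concat[OF assms(1,2) pathin_rev[OF assms(2)]]
      path_char_hom[OF assms(1) path_concat_rev_right[OF assms(2)]]
      path_char_const[OF assms(1) path_start_in_topspace[OF assms(2)]] by simp
  then show ?thesis by (simp add: inverse_unique)
qed

lemma path_char_mult: "path_char X \<Phi> \<Longrightarrow> path_char X \<Psi> \<Longrightarrow> path_char X (\<lambda>p. \<Phi> p * \<Psi> p)"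
  unfolding path_char_def by (auto simp: algebra_simps)

lemma path_char_inverse: "path_char X \<Phi> \<Longrightarrow> path_char X (\<lambda>p. inverse (\<Phi> p))"
  unfolding path_char_def by auto

lemma path_char_one: "path_char X (\<lambda>p. 1)"
  unfolding path_char_def by auto

lemma path_char_prod:
  "(\<And>i. i \<in> A \<Longrightarrow> path_char X (\<Phi> i)) \<Longrightarrow> path_char X (\<lambda>p. \<Prod>i\<in>A. \<Phi> i p)"
  by (induction A rule: infinite_finite_induct) (simp_all add: path_char_one path_char_mult)

lemma path_char_power: "path_char X \<Phi> \<Longrightarrow> path_char X (\<lambda>p. \<Phi> p ^ k)"
  by (induction k) (simp_all add: path_char_one path_char_mult)

lemma path_char_compose:
  assumes "path_char Y \<Phi>" "continuous_map X Y f"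
  shows "path_char X (\<lambda>p. \<Phi> (f \<circ> p))"
proof -
  have *: "path_hom Y (f \<circ> p) (f \<circ> q)" if pq: "path_hom X p q" for p q
    unfolding path_hom_def
    by (rule homotopic_with_compose_continuous_map_left[OF pq[unfolded path_hom_def] assms(2)]) auto
  have "f \<circ> path_concat p q = path_concat (f \<circ> p) (f \<circ> q)" for p q
    by (auto simp: path_concat_def)
  then show ?thesis
    using assms * pathin_compose[OF _ assms(2)] unfolding path_char_def by auto
qed

lemma path_char_convex:
  fixes K :: "'b::real_normed_vector set"
  assumes "path_char X \<Phi>" "convex K" "continuous_map (top_of_set K) X P"
    and "continuous_on {0..1} f" "f ` {0..1} \<subseteq> K" and "continuous_on {0..1} g" "g ` {0..1} \<subseteq> K"
    and "f 0 = g 0" "f 1 = g 1"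
  shows "\<Phi> (P \<circ> f) = \<Phi> (P \<circ> g)"
  using path_char_hom[OF assms(1) path_hom_convex[OF assms(2-)]] .

text \<open>In a convex parameter set the broken path over \<open>b\<close> and the direct segment
  are homotopic, so on such a set a functional is determined by segments.\<close>

lemma path_char_triangle:
  fixes K :: "'b::real_normed_vector set"
  assumes "path_char X \<Phi>" "convex K" "continuous_map (top_of_set K) X P" "a \<in> K" "b \<in> K" "c \<in> K"
  shows "\<Phi> (P \<circ> linepath a b) * \<Phi> (P \<circ> linepath b c) = \<Phi> (P \<circ> linepath a c)"
proof -
  have seg: "linepath x y ` {0..1} \<subseteq> K" if "x \<in> K" "y \<in> K" for x y
    using that \<open>convex K\<close> closed_segment_subset[of x K y] by (simp add: linepath_image_01)
  have pin: "pathin X (P \<circ> linepath x y)" if "x \<in> K" "y \<in> K" for x y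
    using path_hom_convex[OF assms(2,3), of "linepath x y" "linepath x y"] seg[OF that] by (simp add: continuous_on_linepath)
  have "path_concat (P \<circ> linepath a b) (P \<circ> linepath b c) = P \<circ> (linepath a b +++ linepath b c)"
    by (auto simp: path_concat_def joinpaths_def)
  then have "\<Phi> (P \<circ> linepath a b) * \<Phi> (P \<circ> linepath b c) = \<Phi> (P \<circ> (linepath a b +++ linepath b c))"
    using path_char_concat[OF assms(1) pin pin, of a b b c] assms by (simp add: linepath_def)
  also have "\<dots> = \<Phi> (P \<circ> linepath a c)"
  proof (rule path_char_convex[OF assms(1-3)])
    show "continuous_on {0..1} (linepath a b +++ linepath b c)"
      using path_join_imp[of "linepath a b" "linepath b c"] unfolding path_def by (simp add: continuous_on_linepath)
    have "(linepath a b +++ linepath b c) ` {0..1} \<subseteq> linepath a b ` {0..1} \<union> linepath b c ` {0..1}"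
      using path_image_join_subset[of "linepath a b" "linepath b c"] by (simp add: path_image_def)
    then show "(linepath a b +++ linepath b c) ` {0..1} \<subseteq> K" using seg assms by blast
  qed (use seg assms in \<open>simp_all add: continuous_on_linepath joinpaths_def linepath_0' linepath_1'\<close>)
  finally show ?thesis .
qed

text \<open>The two ways around the square are homotopic, by two triangles with a common diagonal.
  This is the form in which homotopies with moving endpoints enter.\<close>

lemma path_char_square:
  assumes "path_char X \<Phi>" "continuous_map (top_of_set unit_square) X h"
  shows "\<Phi> (\<lambda>s. h (0, s)) * \<Phi> (\<lambda>t. h (t, 1)) = \<Phi> (\<lambda>t. h (t, 0)) * \<Phi> (\<lambda>s. h (1, s))"
proof -
  have K: "convex unit_square" by (intro convex_Times) auto
  have "(\<lambda>s. h (0, s)) = h \<circ> linepath (0,0) (0,1)" "(\<lambda>t. h (t, 1)) = h \<circ> linepath (0,1) (1,1)"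
    "(\<lambda>t. h (t, 0)) = h \<circ> linepath (0,0) (1,0)" "(\<lambda>s. h (1, s)) = h \<circ> linepath (1,0) (1,1)"
    by (auto simp: linepath_def fun_eq_iff)
  then show ?thesis
    using path_char_triangle[OF assms(1) K assms(2), of "(0,0)" "(0,1)" "(1,1)"]
      path_char_triangle[OF assms(1) K assms(2), of "(0,0)" "(1,0)" "(1,1)"] by simp
qed

text \<open>The path is cut into pieces that stay in the neighbourhoods, and the quotients
  telescope. As \<open>h\<close> is a single function on the whole space, the conclusion makes
  \<open>\<Phi>\<close> trivial on loops.\<close>

lemma path_char_local_potential:
  assumes "path_char X \<Phi>" and h: "\<And>x. x \<in> topspace X \<Longrightarrow> h x \<noteq> 0"
    and loc: "\<And>x. x \<in> topspace X \<Longrightarrow> \<exists>V. openin X V \<and> x \<in> V \<and>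
        (\<forall>p. pathin X p \<longrightarrow> p ` {0..1} \<subseteq> V \<longrightarrow> \<Phi> p = h (p 1) / h (p 0))"
    and p: "pathin X p"
  shows "\<Phi> p = h (p 1) / h (p 0)"
proof -
  have px: "p t \<in> topspace X" if "t \<in> {0..1}" for t
    using p that path_image_subset_topspace by fastforce
    \<comment> \<open>The premises restrict to the unit interval because \<open>Bolzano\<close> also
      considers intervals that stick out of it.\<close>
    define P where "P u v \<longleftrightarrow> (u \<in> {0..1} \<longrightarrow> v \<in> {0..1} \<longrightarrow> \<Phi> (p \<circ> linepath u v) = h (p v) / h (p u))" for u v
    have "P 0 1"
    proof (rule Bolzano)
      fix a b c :: real assume *: "P a b" "P b c" "a \<le> b" "b \<le> c"
      show "P a c" unfolding P_def
      proof (intro impI)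
        assume ac: "a \<in> {0..1}" "c \<in> {0..1}"
        then have "b \<in> {0..1}" using * by auto
        then show "\<Phi> (p \<circ> linepath a c) = h (p c) / h (p a)"
          using path_char_triangle[OF assms(1), of "{0..1}" p a b c] p * ac h[OF px[of b]]
          unfolding P_def pathin_def by (auto simp: field_simps)
      qed
    next
      fix x :: real assume x: "0 \<le> x" "x \<le> 1"
      obtain V where V: "openin X V" "p x \<in> V"
        "\<And>p. pathin X p \<Longrightarrow> p ` {0..1} \<subseteq> V \<Longrightarrow> \<Phi> p = h (p 1) / h (p 0)"
        using loc[OF px] x by (metis atLeastAtMost_iff)
      have "openin (top_of_set {0..1}) {t \<in> {0..1}. p t \<in> V}"
        using openin_continuous_map_preimage[OF p[unfolded pathin_def] V(1)] by simp
      then obtain d where d: "d > 0" "\<And>t. t \<in> {0..1} \<Longrightarrow> dist t x < d \<Longrightarrow> p t \<in> V"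
        unfolding openin_euclidean_subtopology_iff using x V(2) by (metis (no_types, lifting) atLeastAtMost_iff mem_Collect_eq)
      have "P a b" if "a \<le> x" "x \<le> b" "b - a < d" for a b
        unfolding P_def
      proof (intro impI)
        assume ab: "a \<in> {0..1}" "b \<in> {0..1}"
        have seg: "linepath a b t \<in> {a..b}" if "t \<in> {0..1}" for t
          using linepath_in_path[of t a b] that \<open>a \<le> x\<close> \<open>x \<le> b\<close> by (simp add: closed_segment_eq_real_ivl split: if_splits)
        have "(p \<circ> linepath a b) ` {0..1} \<subseteq> V"
        proof clarify
          fix t :: real assume "t \<in> {0..1}"
          then have "linepath a b t \<in> {a..b}" by (rule seg)
          then show "(p \<circ> linepath a b) t \<in> V" using that ab by (auto intro!: d(2) simp: dist_real_def)
        qed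
        moreover have "pathin X (p \<circ> linepath a b)"
          using seg ab by (intro pathin_reparam[OF p] continuous_on_linepath) fastforce
        ultimately show "\<Phi> (p \<circ> linepath a b) = h (p b) / h (p a)"
          using V(3) by (simp add: linepath_def)
      qed
      then show "\<exists>d>0. \<forall>a b. a \<le> x \<and> x \<le> b \<and> b - a < d \<longrightarrow> P a b" using d(1) by blast
    qed simp
    then show ?thesis by (simp add: P_def linepath_def o_def)
qed

text \<open>The composite of \<open>f\<close> with \<open>\<psi>\<close> is defined only on loops at
  \<open>c\<close>. A choice of paths \<open>k y\<close> from \<open>c\<close> closes every path up
  to such a loop; values on genuine loops at \<open>c\<close> are unaffected because the target is
  commutative.\<close>

lemma path_char_extend:
  assumes Y: "path_connected_space Y" "c \<in> topspace Y"
    and f: "f \<in> hom (fundamental_group Y c) (fundamental_group Z d)" and "path_char Z \<psi>"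
  obtains \<Phi> where "path_char Y \<Phi>"
    "\<And>p r. loopin Y c p \<Longrightarrow> loopin Z d r \<Longrightarrow> f (loop_class Y c p) = loop_class Z d r \<Longrightarrow> \<Phi> p = \<psi> r"
proof -
  obtain k where k: "\<And>y. y \<in> topspace Y \<Longrightarrow> pathin Y (k y) \<and> k y 0 = c \<and> k y 1 = y"
    using Y unfolding path_connected_space_def by metis
  define L where "L p = path_concat (path_concat (k (p 0)) p) (path_rev (k (p 1)))" for p
  \<comment> \<open>\<open>f\<close> acts on classes, so a representative of the image class is
    chosen; homotopy invariance of \<open>\<psi>\<close> makes the choice harmless.\<close>
  define \<Theta> where "\<Theta> l = \<psi> (SOME r. loopin Z d r \<and> f (loop_class Y c l) = loop_class Z d r)" for l
  have ex: "\<exists>r. loopin Z d r \<and> f (loop_class Y c l) = loop_class Z d r" if "loopin Y c l" for l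
  proof -
    have "loop_class Y c l \<in> carrier (fundamental_group Y c)"
      using that by (auto simp: fundamental_group_carrier)
    then have "f (loop_class Y c l) \<in> carrier (fundamental_group Z d)" using f by (auto simp: hom_def)
    then show ?thesis by (auto simp: fundamental_group_carrier)
  qed
  have \<Theta>: "\<Theta> l = \<psi> r" if "loopin Y c l" "loopin Z d r" "f (loop_class Y c l) = loop_class Z d r" for l r
  proof -
    let ?r = "SOME r. loopin Z d r \<and> f (loop_class Y c l) = loop_class Z d r"
    have "loopin Z d ?r \<and> f (loop_class Y c l) = loop_class Z d ?r"
      using someI_ex[OF ex[OF that(1)]] .
    then have "path_hom Z ?r r" using loop_class_eq_iff[of Z d ?r r] that by simp
    then show ?thesis unfolding \<Theta>_def using path_char_hom[OF assms(4)] by blast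
  qed
  have \<Theta>0: "\<Theta> l \<noteq> 0" if l: "loopin Y c l" for l
  proof -
    obtain r where r: "loopin Z d r" "f (loop_class Y c l) = loop_class Z d r" using ex[OF l] by blast
    then show ?thesis using \<Theta>[OF l r] path_char_nonzero[OF assms(4), of r] by (simp add: loopin_def)
  qed
  have \<Theta>h: "\<Theta> l = \<Theta> l'" if "loopin Y c l" "path_hom Y l l'" for l l'
  proof -
    have "loopin Y c l'" using that(1) path_hom_imp[OF that(2)] unfolding loopin_def by simp
    from loop_class_eq_iff[OF that(1) this] have "loop_class Y c l = loop_class Y c l'" using that(2) by simp
    then show ?thesis unfolding \<Theta>_def by simp
  qed
  have \<Theta>m: "\<Theta> (path_concat l l') = \<Theta> l * \<Theta> l'" if l: "loopin Y c l" "loopin Y c l'" for l l'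
  proof -
    obtain r r' where r: "loopin Z d r" "f (loop_class Y c l) = loop_class Z d r"
      "loopin Z d r'" "f (loop_class Y c l') = loop_class Z d r'" using ex l by meson
    have lc: "loop_class Y c l \<in> carrier (fundamental_group Y c)" "loop_class Y c l' \<in> carrier (fundamental_group Y c)"
      using l by (auto simp: fundamental_group_carrier)
    have "f (loop_class Y c (path_concat l l')) = f (loop_class Y c l \<otimes>\<^bsub>fundamental_group Y c\<^esub> loop_class Y c l')"
      by (simp only: fundamental_group_mult[OF l])
    also have "\<dots> = loop_class Z d (path_concat r r')"
      by (simp only: hom_mult[OF f lc] r fundamental_group_mult[OF r(1,3)])
    finally have "f (loop_class Y c (path_concat l l')) = loop_class Z d (path_concat r r')" .
    then show ?thesis
      using \<Theta>[OF loopin_concat[OF l] loopin_concat[OF r(1,3)]] \<Theta>[OF l(1) r(1,2)] \<Theta>[OF l(2) r(3,4)]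
        path_char_concat[OF assms(4), of r r'] r by (simp add: loopin_def)
  qed
  have Lp: "loopin Y c (L p)" if "pathin Y p" for p
    using that k[OF path_start_in_topspace[OF that]] k[OF path_finish_in_topspace[OF that]]
    by (simp add: loopin_def L_def pathin_concat pathin_rev)
  have Lm: "path_hom Y (path_concat (L p) (L q)) (L (path_concat p q))"
    if pq: "pathin Y p" "pathin Y q" "p 1 = q 0" for p q
  proof -
    note k' = k[OF path_start_in_topspace[OF pq(1)]] k[OF path_finish_in_topspace[OF pq(1)]]
      k[OF path_finish_in_topspace[OF pq(2)]]
    let ?a = "k (p 0)" and ?b = "k (p 1)" and ?c = "k (q 1)"
    note [simp] = k' pathin_concat pathin_rev pq(1,2) pq(3)[symmetric]
    have [simp]: "q 0 \<in> topspace Y" "p 1 \<in> topspace Y"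
      using path_finish_in_topspace[OF pq(1)] by auto
    have "path_hom Y (path_concat (L p) (L q))
       (path_concat (path_concat ?a p) (path_concat (path_rev ?b) (path_concat (path_concat ?b q) (path_rev ?c))))"
      unfolding L_def pq(3)[symmetric] by (intro path_concat_assoc) simp_all
    also have "path_hom Y \<dots>
       (path_concat (path_concat ?a p) (path_concat (path_concat (path_rev ?b) (path_concat ?b q)) (path_rev ?c)))"
      by (intro path_hom_concat path_hom_sym[OF path_concat_assoc]) simp_all
    also have "path_hom Y \<dots>
       (path_concat (path_concat ?a p) (path_concat (path_concat (path_concat (path_rev ?b) ?b) q) (path_rev ?c)))"
      by (intro path_hom_concat path_hom_sym[OF path_concat_assoc]) simp_all
    also have "path_hom Y \<dots>
       (path_concat (path_concat ?a p) (path_concat (path_concat (\<lambda>_. q 0) q) (path_rev ?c)))"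
      using path_concat_rev_left[of Y ?b] by (intro path_hom_concat) simp_all
    also have "path_hom Y \<dots> (path_concat (path_concat ?a p) (path_concat q (path_rev ?c)))"
      using path_concat_const_left[of Y q] by (intro path_hom_concat) simp_all
    also have "path_hom Y \<dots> (path_concat (path_concat (path_concat ?a p) q) (path_rev ?c))"
      by (intro path_hom_sym[OF path_concat_assoc]) simp_all
    also have "path_hom Y \<dots> (path_concat (path_concat ?a (path_concat p q)) (path_rev ?c))"
      by (intro path_hom_concat path_concat_assoc) simp_all
    finally show ?thesis by (simp add: L_def)
  qed
  define \<Phi> where "\<Phi> p = \<Theta> (L p)" for p
  have "path_char Y \<Phi>"
    unfolding path_char_def
  proof (intro conjI allI impI)
    fix p q assume pq: "pathin Y p" "pathin Y q" "p 1 = q 0"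
    show "\<Phi> (path_concat p q) = \<Phi> p * \<Phi> q"
      using \<Theta>h[OF _ Lm[OF pq]] \<Theta>m[OF Lp[OF pq(1)] Lp[OF pq(2)]] loopin_concat[OF Lp[OF pq(1)] Lp[OF pq(2)]]
      by (simp add: \<Phi>_def)
  next
    fix p q assume pq: "path_hom Y p q"
    note i = path_hom_imp[OF pq]
    have "path_hom Y (L p) (L q)"
      using pq k[OF path_start_in_topspace[OF i(1)]] k[OF path_finish_in_topspace[OF i(1)]] i
      unfolding L_def by (auto intro!: path_hom_concat pathin_rev)
    then show "\<Phi> p = \<Phi> q" using \<Theta>h[OF Lp[OF i(1)]] by (simp add: \<Phi>_def)
  qed (use \<Theta>0 Lp in \<open>auto simp: \<Phi>_def\<close>)
  moreover have "\<Phi> p = \<psi> r"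
    if pr: "loopin Y c p" "loopin Z d r" "f (loop_class Y c p) = loop_class Z d r" for p r
  proof -
    \<comment> \<open>\<open>k c\<close> is a loop that may be nonconstant, but its contributions at
      the two ends cancel.\<close>
    have kc: "loopin Y c (k c)" using k[OF Y(2)] by (simp add: loopin_def)
    have "\<Theta> (path_rev (k c)) * \<Theta> (k c) = 1"
    proof -
      have r: "loopin Y c (path_rev (k c))" using kc by (simp add: loopin_def pathin_rev)
      have cc: "loopin Y c (\<lambda>_. c)" using Y by (simp add: loopin_def)
      have "path_concat (\<lambda>_. c) (\<lambda>_. c) = (\<lambda>_. c)" by (auto simp: path_concat_def)
      then have "\<Theta> (\<lambda>_. c) = 1" using \<Theta>m[OF cc cc] \<Theta>0[OF cc] by simp
      moreover have "\<Theta> (path_concat (path_rev (k c)) (k c)) = \<Theta> (\<lambda>_. c)"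
        using \<Theta>h[OF loopin_concat[OF r kc]] path_concat_rev_left[of Y "k c"] kc by (simp add: loopin_def)
      ultimately show ?thesis using \<Theta>m[OF r kc] by simp
    qed
    moreover have "\<Phi> p = \<Theta> (k c) * \<Theta> p * \<Theta> (path_rev (k c))"
    proof -
      have "loopin Y c (path_rev (k c))" using kc by (simp add: loopin_def pathin_rev)
      moreover have "L p = path_concat (path_concat (k c) p) (path_rev (k c))"
        using pr(1) by (simp add: L_def loopin_def)
      ultimately show ?thesis using pr(1) kc by (simp add: \<Phi>_def \<Theta>m loopin_concat)
    qed
    ultimately have "\<Phi> p = \<Theta> p" by (simp add: algebra_simps)
    then show ?thesis using \<Theta>[OF pr] by simp
  qed
  ultimately show ?thesis by (rule that)
qed

section \<open>Lifting through maps with local sections\<close>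

text \<open>Replaces evenly covered neighbourhoods: local injectivity gives uniqueness of lifts, and
  a local section through every point of a fibre gives existence. For the orbit map all these
  sections arise from one by permuting.\<close>

definition section_covering :: "'e topology \<Rightarrow> 'y topology \<Rightarrow> ('e \<Rightarrow> 'y) \<Rightarrow> bool" where
  "section_covering E Y \<rho> \<longleftrightarrow> Hausdorff_space E \<and> continuous_map E Y \<rho> \<and>
     (\<forall>e\<in>topspace E. \<exists>W. openin E W \<and> e \<in> W \<and> inj_on \<rho> W) \<and>
     (\<forall>y\<in>topspace Y. \<exists>V. openin Y V \<and> y \<in> V \<and>
        (\<forall>e\<in>topspace E. \<rho> e \<in> V \<longrightarrow>
           (\<exists>\<sigma>. continuous_map (subtopology Y V) E \<sigma> \<and> (\<forall>v\<in>V. \<rho> (\<sigma> v) = v) \<and> \<sigma> (\<rho> e) = e)))"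

text \<open>The set where the lifts agree is closed since \<open>E\<close> is Hausdorff and open
  since \<open>\<rho>\<close> is locally injective, and \<open>C\<close> is connected.\<close>

lemma lift_unique:
  assumes cov: "section_covering E Y \<rho>" and C: "connected C" "c \<in> C" "z \<in> C"
    and g: "continuous_map (top_of_set C) E g" and g': "continuous_map (top_of_set C) E g'"
    and eq: "\<And>x. x \<in> C \<Longrightarrow> \<rho> (g x) = \<rho> (g' x)" and "g c = g' c"
  shows "g z = g' z"
proof -
  let ?A = "{x \<in> C. g x = g' x}"
  have "closedin (top_of_set C) ?A"
    using closedin_continuous_maps_eq[OF _ g g'] cov by (simp add: section_covering_def)
  moreover have "openin (top_of_set C) ?A"
  proof (subst openin_subopen, intro ballI)
    fix x assume x: "x \<in> ?A"
    have "g ` C \<subseteq> topspace E" using g by (auto simp: continuous_map_def)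
    then have "g x \<in> topspace E" using x by blast
    then obtain W where W: "openin E W" "g x \<in> W" "inj_on \<rho> W"
      using cov unfolding section_covering_def by metis
    have "openin (top_of_set C) ({x \<in> C. g x \<in> W} \<inter> {x \<in> C. g' x \<in> W})"
      using openin_continuous_map_preimage[OF g W(1)] openin_continuous_map_preimage[OF g' W(1)]
      by (intro openin_Int) simp_all
    moreover have "{x \<in> C. g x \<in> W} \<inter> {x \<in> C. g' x \<in> W} \<subseteq> ?A"
      using W(3) eq by (auto simp: inj_on_def)
    ultimately show "\<exists>T. openin (top_of_set C) T \<and> x \<in> T \<and> T \<subseteq> ?A"
      using x W(2) by (intro exI[of _ "{x \<in> C. g x \<in> W} \<inter> {x \<in> C. g' x \<in> W}"]) auto
  qed
  ultimately have "?A = {} \<or> ?A = C"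
    using C(1) by (meson connected_clopen)
  then show ?thesis using assms by blast
qed

text \<open>One argument for paths and homotopies alike: \<open>K\<close> is contracted radially to
  \<open>k0\<close> in \<open>N\<close> small steps, and stage \<open>j\<close> lifts
  \<open>f\<close> precomposed with the contraction of ratio \<open>j / N\<close>. Stage 0 is
  constant, stage \<open>N\<close> is the lift.\<close>

lemma lift_exists:
  fixes K :: "'k::real_normed_vector set"
  assumes cov: "section_covering E Y \<rho>" and K: "convex K" "compact K" "k0 \<in> K"
    and f: "continuous_map (top_of_set K) Y f" and e0: "e0 \<in> topspace E" "\<rho> e0 = f k0"
  obtains g where "continuous_map (top_of_set K) E g" "\<And>k. k \<in> K \<Longrightarrow> \<rho> (g k) = f k" "g k0 = e0"
proof -
  define nice where "nice V \<longleftrightarrow> openin Y V \<and> (\<forall>e\<in>topspace E. \<rho> e \<in> V \<longrightarrow>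
           (\<exists>\<sigma>. continuous_map (subtopology Y V) E \<sigma> \<and> (\<forall>v\<in>V. \<rho> (\<sigma> v) = v) \<and> \<sigma> (\<rho> e) = e))" for V
  have fK: "f k \<in> topspace Y" if "k \<in> K" for k using f that by (auto simp: continuous_map_def)
  define \<C> where "\<C> = {T. open T \<and> (\<exists>V. nice V \<and> f ` (K \<inter> T) \<subseteq> V)}"
  have "K \<subseteq> \<Union>\<C>"
  proof
    fix k assume k: "k \<in> K"
    obtain V where V: "nice V" "f k \<in> V" using cov fK[OF k] unfolding section_covering_def nice_def by metis
    have "openin (top_of_set K) {x \<in> K. f x \<in> V}"
      using openin_continuous_map_preimage[OF f, of V] V(1) by (simp add: nice_def)
    then obtain T where "open T" "{x \<in> K. f x \<in> V} = K \<inter> T" unfolding openin_open by blast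
    then show "k \<in> \<Union>\<C>" unfolding \<C>_def using V k by blast
  qed
  moreover have "{} \<in> \<C>"
  proof -
    have "nice {}" by (simp add: nice_def)
    then show ?thesis unfolding \<C>_def by (auto intro!: exI[of _ "{}"])
  qed
  ultimately obtain \<delta> where \<delta>: "\<delta> > 0" "\<And>T. \<lbrakk>T \<subseteq> K; diameter T < \<delta>\<rbrakk> \<Longrightarrow> \<exists>B \<in> \<C>. T \<subseteq> B"
  proof -
    assume *: "K \<subseteq> \<Union>\<C>" "{} \<in> \<C>"
    have "\<C> \<noteq> {}" using *(2) by blast
    moreover have "open B" if "B \<in> \<C>" for B using that by (simp add: \<C>_def)
    ultimately show ?thesis using Lebesgue_number_lemma[OF K(2) _ *(1)] that by metis
  qed
  \<comment> \<open>A ball of radius \<open>\<epsilon>\<close> then has diameter at most two thirds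
    of the Lebesgue number.\<close>
  define \<epsilon> where "\<epsilon> = \<delta> / 3"
  have "\<epsilon> > 0" using \<delta> by (simp add: \<epsilon>_def)
  have "\<exists>V. nice V \<and> f ` (K \<inter> ball x \<epsilon>) \<subseteq> V" for x
  proof -
    have "dist a b \<le> 2 * \<epsilon>" if "a \<in> ball x \<epsilon>" "b \<in> ball x \<epsilon>" for a b
      using dist_triangle3[of a b x] that by (simp add: dist_commute)
    then have "diameter (K \<inter> ball x \<epsilon>) \<le> 2 * \<epsilon>"
      using \<open>\<epsilon> > 0\<close> by (intro diameter_le) (auto simp: dist_norm)
    then have "diameter (K \<inter> ball x \<epsilon>) < \<delta>" using \<delta>(1) by (simp add: \<epsilon>_def)
    then obtain B where "B \<in> \<C>" "K \<inter> ball x \<epsilon> \<subseteq> B" using \<delta>(2)[of "K \<inter> ball x \<epsilon>"] by auto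
    then show ?thesis unfolding \<C>_def by blast
  qed
  then obtain V where V: "\<And>x. nice (V x)" "\<And>x. f ` (K \<inter> ball x \<epsilon>) \<subseteq> V x" by metis
  obtain D where D: "D > 0" "\<And>k. k \<in> K \<Longrightarrow> norm (k - k0) \<le> D"
  proof -
    obtain D where "\<forall>k\<in>K. dist k0 k \<le> D" using compact_imp_bounded[OF K(2)] bounded_any_center[of K k0] by blast
    then show ?thesis by (intro that[of "max D 1"]) (auto simp: dist_norm norm_minus_commute max_def intro: order_trans)
  qed
  \<comment> \<open>One stage moves a point by at most \<open>D / N\<close>, less than
    \<open>\<epsilon> / 2\<close>; the other half of \<open>\<epsilon>\<close> is left for passing
    from \<open>k\<close> to a neighbour \<open>k1\<close>.\<close>
  obtain N :: nat where N: "D / (\<epsilon> / 2) < real N" using reals_Archimedean2 by blast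
  have N0: "N > 0" using N D \<open>\<epsilon> > 0\<close> by (metis divide_pos_pos half_gt_zero less_imp_of_nat_less not_gr_zero of_nat_0 order_less_asym)
  have ND: "D / N < \<epsilon> / 2" using N N0 \<open>\<epsilon> > 0\<close> by (simp add: field_simps)
  define r where "r a k = k0 + a *\<^sub>R (k - k0)" for a :: real and k
  have r_eq: "r a k = (1 - a) *\<^sub>R k0 + a *\<^sub>R k" for a k by (simp add: r_def algebra_simps)
  have rK: "r a k \<in> K" if "k \<in> K" "a \<in> {0..1}" for a k
    unfolding r_eq using that K by (auto intro: convexD_alt)
  have rcont: "continuous_on A (\<lambda>k. r (a k) (b k))"
    if "continuous_on A a" "continuous_on A b" for A :: "'z::topological_space set" and a b
    unfolding r_def by (intro continuous_intros that)
  have main: "\<exists>g. continuous_map (top_of_set K) E g \<and> (\<forall>k\<in>K. \<rho> (g k) = f (r (j / N) k)) \<and> g k0 = e0"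
    if "j \<le> N" for j using that
  proof (induction j)
    case 0
    show ?case by (rule exI[of _ "\<lambda>_. e0"]) (use e0 in \<open>auto simp: r_def\<close>)
  next
    case (Suc j)
    then obtain g where g: "continuous_map (top_of_set K) E g" "\<And>k. k \<in> K \<Longrightarrow> \<rho> (g k) = f (r (j / N) k)" "g k0 = e0"
      by auto
    have gE: "g k \<in> topspace E" if "k \<in> K" for k using g(1) that by (auto simp: continuous_map_def)
    define a a' where "a = j / N" and "a' = Suc j / N"
    have a: "a \<in> {0..1}" "a' \<in> {0..1}" "a \<le> a'" "a' - a = 1 / N"
      using Suc.prems N0 by (auto simp: a_def a'_def field_simps)
    have near: "r b k \<in> K \<inter> ball (r a k1) \<epsilon>"
      if "k \<in> K" "k1 \<in> K" "dist k k1 < \<epsilon> / 2" "b \<in> {a..a'}" for b k k1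
    proof -
      have "r b k - r a k1 = (b - a) *\<^sub>R (k - k0) + a *\<^sub>R (k - k1)" by (simp add: r_def algebra_simps)
      also have "norm \<dots> \<le> \<bar>b - a\<bar> * norm (k - k0) + \<bar>a\<bar> * norm (k - k1)"
        by (rule order_trans[OF norm_triangle_ineq]) simp
      also have "\<dots> \<le> (1 / N) * D + 1 * norm (k - k1)"
        using a that D(2)[OF that(1)] by (intro add_mono mult_mono) auto
      also have "\<dots> = D / N + norm (k - k1)" by simp
      also have "\<dots> < \<epsilon>" using ND that(3) unfolding dist_norm by linarith
      finally have "dist (r a k1) (r b k) < \<epsilon>" by (simp add: dist_norm norm_minus_commute)
      then show ?thesis using rK[OF that(1), of b] that(4) a by auto
    qed
    have Vin: "f (r b k) \<in> V (r a k1)"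
      if "k \<in> K" "k1 \<in> K" "dist k k1 < \<epsilon> / 2" "b \<in> {a..a'}" for b k k1
      using V(2)[of "r a k1"] near[OF that] by blast
    have "\<exists>\<sigma>. continuous_map (subtopology Y (V (r a k))) E \<sigma> \<and> (\<forall>v\<in>V (r a k). \<rho> (\<sigma> v) = v) \<and> \<sigma> (f (r a k)) = g k"
      if k: "k \<in> K" for k
    proof -
      have "\<rho> (g k) = f (r a k)" "f (r a k) \<in> V (r a k)"
        using Vin[OF k k, of a] g(2)[OF k] a \<open>\<epsilon> > 0\<close> by (auto simp: a_def)
      then show ?thesis using V(1)[of "r a k"] gE[OF k] unfolding nice_def by metis
    qed
    then obtain \<sigma> where \<sigma>: "\<And>k. k \<in> K \<Longrightarrow> continuous_map (subtopology Y (V (r a k))) E (\<sigma> k)"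
      "\<And>k v. k \<in> K \<Longrightarrow> v \<in> V (r a k) \<Longrightarrow> \<rho> (\<sigma> k v) = v"
      "\<And>k. k \<in> K \<Longrightarrow> \<sigma> k (f (r a k)) = g k" by metis
    \<comment> \<open>Each point continues along the section chosen at its own position. The
      sections vary with \<open>k\<close>, so continuity has to be recovered.\<close>
    define g' where "g' k = \<sigma> k (f (r a' k))" for k
    have comp: "continuous_map (top_of_set A) E (\<lambda>x. \<sigma> k1 (f (r (b x) (q x))))"
      if "k1 \<in> K" "continuous_on A b" "continuous_on A q" "\<And>x. x \<in> A \<Longrightarrow> q x \<in> K"
        "\<And>x. x \<in> A \<Longrightarrow> b x \<in> {0..1}" "\<And>x. x \<in> A \<Longrightarrow> f (r (b x) (q x)) \<in> V (r a k1)"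
      for A :: "'z::topological_space set" and b q k1
    proof -
      have "continuous_map (top_of_set A) (top_of_set K) (\<lambda>x. r (b x) (q x))"
        using that rK rcont by (auto simp: continuous_map_in_subtopology)
      from continuous_map_compose[OF this f] have "continuous_map (top_of_set A) (subtopology Y (V (r a k1))) (f \<circ> (\<lambda>x. r (b x) (q x)))"
        using that(6) by (auto simp: continuous_map_in_subtopology)
      from continuous_map_compose[OF this \<sigma>(1)[OF that(1)]] show ?thesis by (simp add: o_def)
    qed
    \<comment> \<open>Uniqueness over the connected set of points near \<open>k1\<close>: the
      section chosen at \<open>k1\<close> reproduces \<open>g\<close> on a whole
      neighbourhood.\<close>
    have claim1: "g k = \<sigma> k1 (f (r a k))" if k: "k \<in> K" "k1 \<in> K" "dist k k1 < \<epsilon> / 2" for k k1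
    proof (rule lift_unique[OF cov, where C = "K \<inter> ball k1 (\<epsilon>/2)" and c = k1 and z = k and g = g
          and g' = "\<lambda>k. \<sigma> k1 (f (r a k))"])
      show "connected (K \<inter> ball k1 (\<epsilon>/2))" using K by (intro convex_connected convex_Int) auto
      show "k1 \<in> K \<inter> ball k1 (\<epsilon>/2)" "k \<in> K \<inter> ball k1 (\<epsilon>/2)" using k \<open>\<epsilon> > 0\<close> by (auto simp: dist_commute)
      show "continuous_map (top_of_set (K \<inter> ball k1 (\<epsilon>/2))) E g"
        using g(1) continuous_map_from_subtopology[of "top_of_set K" E g "ball k1 (\<epsilon>/2)"] by (simp add: subtopology_subtopology)
      show "continuous_map (top_of_set (K \<inter> ball k1 (\<epsilon> / 2))) E (\<lambda>k. \<sigma> k1 (f (r a k)))"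
        using a k by (intro comp Vin) (auto simp: dist_commute continuous_intros)
      show "\<rho> (g x) = \<rho> (\<sigma> k1 (f (r a x)))" if "x \<in> K \<inter> ball k1 (\<epsilon> / 2)" for x
        using g(2)[of x] \<sigma>(2)[OF k(2) Vin[of x k1 a]] that k a by (auto simp: dist_commute a_def)
      show "g k1 = \<sigma> k1 (f (r a k1))" using \<sigma>(3)[OF k(2)] by simp
    qed
    \<comment> \<open>Uniqueness along the parameter interval: near \<open>k1\<close> the map
      \<open>g'\<close> is given by the single section \<open>\<sigma> k1\<close>, hence
      continuous.\<close>
    have claim2: "g' k = \<sigma> k1 (f (r a' k))" if k: "k \<in> K" "k1 \<in> K" "dist k k1 < \<epsilon> / 2" for k k1
      unfolding g'_def
    proof (rule lift_unique[OF cov, where C = "{a..a'}" and c = a and z = a' and g = "\<lambda>b. \<sigma> k (f (r b k))"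
          and g' = "\<lambda>b. \<sigma> k1 (f (r b k))"])
      show "continuous_map (top_of_set {a..a'}) E (\<lambda>b. \<sigma> k (f (r b k)))"
        using a k \<open>\<epsilon> > 0\<close> by (intro comp Vin) (auto simp: continuous_intros)
      show "continuous_map (top_of_set {a..a'}) E (\<lambda>b. \<sigma> k1 (f (r b k)))"
        using a k by (intro comp Vin) (auto simp: continuous_intros)
      show "\<rho> (\<sigma> k (f (r b k))) = \<rho> (\<sigma> k1 (f (r b k)))" if "b \<in> {a..a'}" for b
        using \<sigma>(2) Vin k that \<open>\<epsilon> > 0\<close> by simp
      show "\<sigma> k (f (r a k)) = \<sigma> k1 (f (r a k))" using \<sigma>(3) claim1 k by simp
    qed (use a in auto)
    have "continuous_map (top_of_set K) E g'"
      unfolding continuous_map_eq_topcontinuous_at topcontinuous_at_def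
    proof (intro ballI conjI allI impI)
      have "g' k \<in> topspace E" if k: "k \<in> K" for k
      proof -
        have "f (r a' k) \<in> topspace (subtopology Y (V (r a k)))"
          using Vin[OF k k] fK[OF rK[OF k, of a']] a \<open>\<epsilon> > 0\<close> by simp
        then show ?thesis using \<sigma>(1)[OF k] unfolding g'_def continuous_map_def by blast
      qed
      then show "g' \<in> topspace (top_of_set K) \<rightarrow> topspace E" by simp
    next
      fix k1 assume k1: "k1 \<in> topspace (top_of_set K)"
      then have k1K: "k1 \<in> K" by simp
      let ?B = "K \<inter> ball k1 (\<epsilon>/2)"
      have c: "continuous_map (top_of_set ?B) E (\<lambda>k. \<sigma> k1 (f (r a' k)))"
        using a k1 by (intro comp Vin) (auto simp: dist_commute continuous_intros)
      fix W assume W: "openin E W \<and> g' k1 \<in> W"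
      have "openin (top_of_set ?B) {k \<in> ?B. \<sigma> k1 (f (r a' k)) \<in> W}"
        using openin_continuous_map_preimage[OF c, of W] W by simp
      moreover have "openin (top_of_set K) ?B" by (intro openin_open_Int) simp
      ultimately have "openin (top_of_set K) {k \<in> ?B. \<sigma> k1 (f (r a' k)) \<in> W}"
        using openin_trans by blast
      moreover have "k1 \<in> {k \<in> ?B. \<sigma> k1 (f (r a' k)) \<in> W}"
        using claim2[OF k1K k1K] W k1K \<open>\<epsilon> > 0\<close> by auto
      moreover have "\<forall>y\<in>{k \<in> ?B. \<sigma> k1 (f (r a' k)) \<in> W}. g' y \<in> W"
        using claim2 k1K by (auto simp: dist_commute)
      ultimately show "\<exists>U. openin (top_of_set K) U \<and> k1 \<in> U \<and> (\<forall>y\<in>U. g' y \<in> W)" by blast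
    qed simp
    moreover have "\<rho> (g' k) = f (r a' k)" if "k \<in> K" for k
      unfolding g'_def using \<sigma>(2)[OF that Vin[OF that that]] a \<open>\<epsilon> > 0\<close> by simp
    moreover have "g' k0 = e0" using \<sigma>(3)[OF K(3)] g(3) by (simp add: g'_def r_def)
    ultimately show ?case unfolding a'_def by blast
  qed
  from main[of N] obtain g where g: "continuous_map (top_of_set K) E g" "\<forall>k\<in>K. \<rho> (g k) = f (r (real N / real N) k)" "g k0 = e0"
    by auto
  then show ?thesis using that[of g] N0 by (simp add: r_def)
qed

section \<open>Configuration spaces\<close>

lemma topspace_config_space:
  "x \<in> topspace (config_space n X) \<longleftrightarrow>
     x \<in> extensional {..<n} \<and> (\<forall>i<n. x i \<in> topspace X) \<and> inj_on x {..<n}"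
  by (auto simp: config_space_def PiE_iff)

lemma continuous_map_config:
  "continuous_map Z (config_space n X) f \<longleftrightarrow>
     (\<forall>i<n. continuous_map Z X (\<lambda>z. f z i)) \<and>
     (\<forall>z\<in>topspace Z. f z \<in> extensional {..<n} \<and> inj_on (f z) {..<n})"
  unfolding config_space_def continuous_map_in_subtopology continuous_map_componentwise by auto

lemma continuous_map_config_proj:
  "i < n \<Longrightarrow> continuous_map (config_space n X) X (\<lambda>x. x i)"
  using continuous_map_config[of "config_space n X" n X "\<lambda>x. x"] by simp

lemma permute_config:
  assumes "\<pi> permutes {..<n}" "x \<in> topspace (config_space n X)"
  shows "x \<circ> \<pi> \<in> topspace (config_space n X)"
proof -
  have "inj_on x (\<pi> ` {..<n})" using assms permutes_image[OF assms(1)] by (simp add: topspace_config_space)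
  then have "inj_on (x \<circ> \<pi>) {..<n}" using permutes_inj_on[OF assms(1)] by (intro comp_inj_on) auto
  moreover have "x \<circ> \<pi> \<in> extensional {..<n}"
    using assms permutes_not_in[OF assms(1)] by (auto simp: topspace_config_space extensional_def)
  moreover have "x (\<pi> i) \<in> topspace X" if "i < n" for i
    using assms(2) permutes_in_image[OF assms(1), of i] that by (simp add: topspace_config_space)
  ultimately show ?thesis by (simp add: topspace_config_space)
qed

lemma continuous_map_permute:
  assumes "\<pi> permutes {..<n}"
  shows "continuous_map (config_space n X) (config_space n X) (\<lambda>x. x \<circ> \<pi>)"
  unfolding continuous_map_config
proof (intro conjI allI impI ballI)
  show "continuous_map (config_space n X) X (\<lambda>z. (z \<circ> \<pi>) i)" if "i < n" for i
    using continuous_map_config_proj[of "\<pi> i" n X] permutes_in_image[OF assms, of i] that by simp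
next
  fix z assume "z \<in> topspace (config_space n X)"
  from permute_config[OF assms this] show "z \<circ> \<pi> \<in> extensional {..<n}" "inj_on (z \<circ> \<pi>) {..<n}"
    by (simp_all only: topspace_config_space)
qed

lemma perm_orbit_eq_iff:
  "perm_orbit n x = perm_orbit n y \<longleftrightarrow> (\<exists>\<pi>. \<pi> permutes {..<n} \<and> y = x \<circ> \<pi>)"
proof
  have "y \<in> perm_orbit n y" unfolding perm_orbit_def by (auto intro!: exI[of _ id] simp: permutes_id)
  moreover assume "perm_orbit n x = perm_orbit n y"
  ultimately show "\<exists>\<pi>. \<pi> permutes {..<n} \<and> y = x \<circ> \<pi>" by (auto simp: perm_orbit_def)
next
  assume "\<exists>\<pi>. \<pi> permutes {..<n} \<and> y = x \<circ> \<pi>"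
  then obtain \<pi> where \<pi>: "\<pi> permutes {..<n}" "y = x \<circ> \<pi>" by blast
  then have x: "x = y \<circ> inv_into UNIV \<pi>" using permutes_inv_o(1)[OF \<pi>(1)] by (simp add: comp_assoc)
  show "perm_orbit n x = perm_orbit n y"
    unfolding perm_orbit_def
  proof (rule equalityI; rule subsetI)
    fix z assume "z \<in> {x \<circ> \<tau> |\<tau>. \<tau> permutes {..<n}}"
    then obtain \<tau> where "\<tau> permutes {..<n}" "z = x \<circ> \<tau>" by blast
    then have "z = y \<circ> (inv_into UNIV \<pi> \<circ> \<tau>)" "inv_into UNIV \<pi> \<circ> \<tau> permutes {..<n}"
      using permutes_compose[OF _ permutes_inv[OF \<pi>(1)]] x by (simp_all add: comp_assoc)
    then show "z \<in> {y \<circ> \<tau> |\<tau>. \<tau> permutes {..<n}}" by blast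
  next
    fix z assume "z \<in> {y \<circ> \<tau> |\<tau>. \<tau> permutes {..<n}}"
    then obtain \<tau> where "\<tau> permutes {..<n}" "z = y \<circ> \<tau>" by blast
    then have "z = x \<circ> (\<pi> \<circ> \<tau>)" "\<pi> \<circ> \<tau> permutes {..<n}"
      using permutes_compose[OF _ \<pi>(1)] \<pi>(2) by (simp_all add: comp_assoc)
    then show "z \<in> {x \<circ> \<tau> |\<tau>. \<tau> permutes {..<n}}" by blast
  qed
qed

lemma perm_orbit_permute: "\<pi> permutes {..<n} \<Longrightarrow> perm_orbit n (x \<circ> \<pi>) = perm_orbit n x"
  using perm_orbit_eq_iff by metis

lemma topspace_unordered_config_space:
  "topspace (unordered_config_space n X) = perm_orbit n ` topspace (config_space n X)"
  by (simp add: unordered_config_space_def)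

lemma continuous_map_perm_orbit:
  "continuous_map (config_space n X) (unordered_config_space n X) (perm_orbit n)"
  unfolding unordered_config_space_def
  by (rule quotient_imp_continuous_map[OF quotient_map_quotient_topology])

text \<open>The saturation of an open set is the union of its translates under the
  permutations.\<close>

lemma open_map_perm_orbit:
  "open_map (config_space n X) (unordered_config_space n X) (perm_orbit n)"
  unfolding open_map_def
proof (intro allI impI)
  fix W assume W: "openin (config_space n X) W"
  let ?F = "config_space n X"
  have sub: "W \<subseteq> topspace ?F" by (rule openin_subset[OF W])
  have "{x \<in> topspace ?F. perm_orbit n x \<in> perm_orbit n ` W} =
      (\<Union>\<pi>\<in>{\<pi>. \<pi> permutes {..<n}}. {x \<in> topspace ?F. x \<circ> \<pi> \<in> W})"
  proof (rule equalityI; rule subsetI)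
    fix x assume "x \<in> {x \<in> topspace ?F. perm_orbit n x \<in> perm_orbit n ` W}"
    then obtain w where "x \<in> topspace ?F" "w \<in> W" "perm_orbit n x = perm_orbit n w" by blast
    then show "x \<in> (\<Union>\<pi>\<in>{\<pi>. \<pi> permutes {..<n}}. {x \<in> topspace ?F. x \<circ> \<pi> \<in> W})"
      using perm_orbit_eq_iff by (metis (mono_tags, lifting) UN_I mem_Collect_eq)
  next
    fix x assume "x \<in> (\<Union>\<pi>\<in>{\<pi>. \<pi> permutes {..<n}}. {x \<in> topspace ?F. x \<circ> \<pi> \<in> W})"
    then obtain \<pi> where "\<pi> permutes {..<n}" "x \<in> topspace ?F" "x \<circ> \<pi> \<in> W" by blast
    then show "x \<in> {x \<in> topspace ?F. perm_orbit n x \<in> perm_orbit n ` W}"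
      using perm_orbit_permute by (metis (mono_tags, lifting) imageI mem_Collect_eq)
  qed
  moreover have "openin ?F \<dots>"
    using openin_continuous_map_preimage[OF continuous_map_permute W] by (intro openin_clauses(3)) auto
  ultimately show "openin (unordered_config_space n X) (perm_orbit n ` W)"
    unfolding unordered_config_space_def openin_quotient_topology using sub by auto
qed

lemma Hausdorff_config_space:
  assumes "Hausdorff_space X"
  shows "Hausdorff_space (config_space n X)"
  unfolding config_space_def using assms
  by (intro Hausdorff_space_subtopology) (simp add: Hausdorff_space_product_topology)

lemma config_box:
  assumes "Hausdorff_space X" "x \<in> topspace (config_space n X)"
  obtains B where "\<And>i. i < n \<Longrightarrow> openin X (B i)" "\<And>i. i < n \<Longrightarrow> x i \<in> B i"
    "\<And>i j. i < n \<Longrightarrow> j < n \<Longrightarrow> i \<noteq> j \<Longrightarrow> B i \<inter> B j = {}"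
proof -
  have "\<exists>U V. openin X U \<and> openin X V \<and> x i \<in> U \<and> x j \<in> V \<and> disjnt U V" if "i < n" "j < n" "i \<noteq> j" for i j
    using assms that unfolding Hausdorff_space_def topspace_config_space inj_on_def by (metis lessThan_iff)
  then obtain U V where UV: "\<And>i j. i < n \<Longrightarrow> j < n \<Longrightarrow> i \<noteq> j \<Longrightarrow>
      openin X (U i j) \<and> openin X (V i j) \<and> x i \<in> U i j \<and> x j \<in> V i j \<and> disjnt (U i j) (V i j)" by metis
  define B where "B i = (\<Inter>j\<in>{..<n} - {i}. U i j \<inter> V j i) \<inter> topspace X" for i
  show ?thesis
  proof
    show "openin X (B i)" if "i < n" for i
      unfolding B_def using UV that by (intro openin_INT) auto
    show "x i \<in> B i" if "i < n" for i
      unfolding B_def using UV that assms(2) by (auto simp: topspace_config_space)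
    show "B i \<inter> B j = {}" if ij: "i < n" "j < n" "i \<noteq> j" for i j
    proof -
      have "B i \<subseteq> U i j" "B j \<subseteq> V i j" using ij unfolding B_def by blast+
      then show ?thesis using UV[OF ij] unfolding disjnt_def by blast
    qed
  qed
qed

lemma openin_config_box:
  assumes "\<And>i. i < n \<Longrightarrow> openin X (B i)"
  shows "openin (config_space n X) {x \<in> topspace (config_space n X). \<forall>i<n. x i \<in> B i}"
proof -
  have "{x \<in> topspace (config_space n X). \<forall>i<n. x i \<in> B i} =
      (\<Inter>i\<in>{..<n}. {x \<in> topspace (config_space n X). x i \<in> B i}) \<inter> topspace (config_space n X)" by auto
  also have "openin (config_space n X) \<dots>"
    using openin_continuous_map_preimage[OF continuous_map_config_proj assms] by (intro openin_INT) auto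
  finally show ?thesis .
qed

lemma inj_on_config_box:
  assumes "\<And>i j. i < n \<Longrightarrow> j < n \<Longrightarrow> i \<noteq> j \<Longrightarrow> B i \<inter> B j = {}"
  shows "inj_on (perm_orbit n) {x \<in> topspace (config_space n X). \<forall>i<n. x i \<in> B i}"
proof (rule inj_onI; clarify)
  fix x y assume "perm_orbit n x = perm_orbit n y" and B: "\<forall>i<n. x i \<in> B i" "\<forall>i<n. y i \<in> B i"
  then obtain \<pi> where \<pi>: "\<pi> permutes {..<n}" "y = x \<circ> \<pi>" using perm_orbit_eq_iff by blast
  have "\<pi> i = i" for i
  proof (cases "i < n")
    case True
    then have "\<pi> i < n" using permutes_in_image[OF \<pi>(1), of i] by simp
    then show ?thesis using True B \<pi>(2) assms[of i "\<pi> i"] by fastforce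
  qed (use permutes_not_in[OF \<pi>(1)] in simp)
  then show "x = y" using \<pi>(2) by auto
qed

text \<open>Disjoint neighbourhoods of the points of \<open>x\<close> form a box on which the orbit
  map is injective and open, hence a homeomorphism onto its image. Following the inverse by
  permutations gives sections through the other points of a fibre.\<close>

theorem section_covering_config:
  assumes X: "Hausdorff_space X"
  shows "section_covering (config_space n X) (unordered_config_space n X) (perm_orbit n)"
  unfolding section_covering_def
proof (intro conjI ballI)
  let ?F = "config_space n X" and ?Y = "unordered_config_space n X"
  show "\<exists>W. openin ?F W \<and> e \<in> W \<and> inj_on (perm_orbit n) W" if e: "e \<in> topspace ?F" for e
  proof -
    obtain B where B: "\<And>i. i < n \<Longrightarrow> openin X (B i)" "\<And>i. i < n \<Longrightarrow> e i \<in> B i"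
      "\<And>i j. i < n \<Longrightarrow> j < n \<Longrightarrow> i \<noteq> j \<Longrightarrow> B i \<inter> B j = {}" using config_box[OF X e] by metis
    then show ?thesis using openin_config_box[OF B(1)] inj_on_config_box[where X = X, OF B(3)] e B(2)
      by (intro exI[of _ "{x \<in> topspace ?F. \<forall>i<n. x i \<in> B i}"]) auto
  qed
  fix y assume "y \<in> topspace ?Y"
  then obtain x where x: "x \<in> topspace ?F" "y = perm_orbit n x" by (auto simp: topspace_unordered_config_space)
  obtain B where B: "\<And>i. i < n \<Longrightarrow> openin X (B i)" "\<And>i. i < n \<Longrightarrow> x i \<in> B i"
      "\<And>i j. i < n \<Longrightarrow> j < n \<Longrightarrow> i \<noteq> j \<Longrightarrow> B i \<inter> B j = {}" using config_box[OF X x(1)] by metis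
  define O' where "O' = {x \<in> topspace ?F. \<forall>i<n. x i \<in> B i}"
  have O': "openin ?F O'" "inj_on (perm_orbit n) O'" "x \<in> O'" "O' \<subseteq> topspace ?F"
    using openin_config_box[OF B(1)] inj_on_config_box[where X = X, OF B(3)] x B(2) by (auto simp: O'_def)
  define V where "V = perm_orbit n ` O'"
  have V: "openin ?Y V" using open_map_perm_orbit O' unfolding open_map_def V_def by blast
  have "homeomorphic_map (subtopology ?F O') (subtopology ?Y V) (perm_orbit n)"
  proof (rule bijective_open_imp_homeomorphic_map)
    show "continuous_map (subtopology ?F O') (subtopology ?Y V) (perm_orbit n)"
      using continuous_map_from_subtopology[OF continuous_map_perm_orbit]
      by (auto simp: continuous_map_in_subtopology V_def)
    show "open_map (subtopology ?F O') (subtopology ?Y V) (perm_orbit n)"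
      unfolding open_map_def
    proof (intro allI impI)
      fix W assume "openin (subtopology ?F O') W"
      then have "openin ?F W" "W \<subseteq> O'" using O'(1) by (auto simp: openin_open_subtopology)
      then have "openin ?Y (perm_orbit n ` W)" "perm_orbit n ` W \<subseteq> V"
        using open_map_perm_orbit unfolding open_map_def V_def by blast+
      then show "openin (subtopology ?Y V) (perm_orbit n ` W)"
        using V by (simp add: openin_open_subtopology)
    qed
    show "perm_orbit n ` topspace (subtopology ?F O') = topspace (subtopology ?Y V)"
      using O' openin_subset[OF V] by (auto simp: V_def)
    show "inj_on (perm_orbit n) (topspace (subtopology ?F O'))"
      using O'(2) by (simp add: inj_on_def)
  qed
  then obtain s where s: "homeomorphic_maps (subtopology ?F O') (subtopology ?Y V) (perm_orbit n) s"
    using homeomorphic_map_maps by blast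
  have sV: "s v \<in> O'" "perm_orbit n (s v) = v" if "v \<in> V" for v
    using that s openin_subset[OF V] O'(4) unfolding homeomorphic_maps_def continuous_map_def by auto
  have "\<exists>\<sigma>. continuous_map (subtopology ?Y V) ?F \<sigma> \<and> (\<forall>v\<in>V. perm_orbit n (\<sigma> v) = v) \<and> \<sigma> (perm_orbit n e) = e"
    if e: "e \<in> topspace ?F" "perm_orbit n e \<in> V" for e
  proof -
    obtain \<pi> where \<pi>: "\<pi> permutes {..<n}" "e = s (perm_orbit n e) \<circ> \<pi>"
      using sV(2)[OF e(2)] perm_orbit_eq_iff by metis
    have "continuous_map (subtopology ?Y V) ?F s"
      using s by (auto simp: homeomorphic_maps_def continuous_map_in_subtopology)
    from continuous_map_compose[OF this continuous_map_permute[OF \<pi>(1)]]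
    have "continuous_map (subtopology ?Y V) ?F (\<lambda>v. s v \<circ> \<pi>)" by (simp add: o_def)
    moreover have "\<forall>v\<in>V. perm_orbit n (s v \<circ> \<pi>) = v" by (metis sV(2) perm_orbit_permute[OF \<pi>(1)])
    ultimately show ?thesis using \<pi>(2) by (intro exI[of _ "\<lambda>v. s v \<circ> \<pi>"]) auto
  qed
  then show "\<exists>V. openin ?Y V \<and> y \<in> V \<and> (\<forall>e\<in>topspace ?F. perm_orbit n e \<in> V \<longrightarrow>
      (\<exists>\<sigma>. continuous_map (subtopology ?Y V) ?F \<sigma> \<and> (\<forall>v\<in>V. perm_orbit n (\<sigma> v) = v) \<and> \<sigma> (perm_orbit n e) = e))"
    using V O'(3) x(2) by (intro exI[of _ V]) (auto simp: V_def)
qed (use Hausdorff_config_space[OF X] continuous_map_perm_orbit in auto)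

lemma path_connected_unordered_config_space:
  assumes "path_connected_space (config_space n X)"
  shows "path_connected_space (unordered_config_space n X)"
  using path_connectedin_continuous_map_image[OF continuous_map_perm_orbit, of n X "topspace (config_space n X)"] assms
  by (simp add: path_connectedin_topspace flip: topspace_unordered_config_space)

text \<open>If deleting finitely many points never disconnects \<open>X\<close>, the points of a configuration can be
  moved one at a time.\<close>

lemma path_connected_config_space:
  assumes pc: "\<And>S. finite S \<Longrightarrow> path_connected_space (subtopology X (- S))"
    and inf: "infinite (topspace X)"
  shows "path_connected_space (config_space n X)"
proof -
  let ?F = "config_space n X"
  define R where "R x y \<longleftrightarrow> (\<exists>p. pathin ?F p \<and> p 0 = x \<and> p 1 = y)" for x y
  have Rsym: "R y x" if "R x y" for x y
    using that pathin_rev path_rev_ends unfolding R_def by metis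
  have Rtrans: "R x z" if "R x y" "R y z" for x y z
    using that pathin_concat path_concat_ends unfolding R_def by metis
  have step: "R x (x(k := w))" if x: "x \<in> topspace ?F" and k: "k < n" and w: "w \<in> topspace X" "w \<notin> x ` ({..<n} - {k})" for x k w
  proof -
    let ?S = "x ` ({..<n} - {k})"
    have xk: "x k \<in> topspace X" "x k \<notin> ?S"
      using x k by (auto simp: topspace_config_space inj_on_def)
    then obtain p where p: "pathin (subtopology X (- ?S)) p" "p 0 = x k" "p 1 = w"
      using pc[of ?S] w unfolding path_connected_space_def by force
    have pX: "continuous_map (top_of_set {0..1}) X p" and pS: "\<And>t. t \<in> {0..1} \<Longrightarrow> p t \<notin> ?S"
    proof -
      have "pathin X p \<and> (\<forall>t\<in>{0..1}. p t \<in> - ?S)" by (rule pathin_subtopology[THEN iffD1, OF p(1)])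
      then show "continuous_map (top_of_set {0..1}) X p" "\<And>t. t \<in> {0..1} \<Longrightarrow> p t \<notin> ?S"
        unfolding pathin_def by blast+
    qed
    have "pathin ?F (\<lambda>t. x(k := p t))"
      unfolding pathin_def continuous_map_config
    proof (intro conjI ballI allI impI)
      fix i assume i: "i < n"
      show "continuous_map (top_of_set {0..1}) X (\<lambda>t. (x(k := p t)) i)"
        using pX x i by (cases "i = k") (auto simp: topspace_config_space)
    next
      fix t :: real assume "t \<in> topspace (top_of_set {0..1})"
      then have t: "p t \<notin> ?S" using pS by simp
      show "x(k := p t) \<in> extensional {..<n}" using x k by (auto simp: topspace_config_space extensional_def)
      have "inj_on x {..<n}" using x by (simp add: topspace_config_space)
      moreover have "x i \<noteq> p t" if "i < n" "i \<noteq> k" for i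
        using t that by (metis DiffI imageI lessThan_iff singletonD)
      ultimately show "inj_on (x(k := p t)) {..<n}"
        unfolding inj_on_def fun_upd_apply by (metis lessThan_iff)
    qed
    then show ?thesis unfolding R_def using p by (intro exI[of _ "\<lambda>t. x(k := p t)"]) auto
  qed
  have far: "R x w" if x: "x \<in> topspace ?F" and w: "w \<in> topspace ?F" and disj: "x ` {..<n} \<inter> w ` {..<n} = {}" for x w
  proof -
    define m where "m k = (\<lambda>i. if i < k then w i else x i)" for k :: nat
    have mF: "m k \<in> topspace ?F" if "k \<le> n" for k
    proof -
      have "inj_on (m k) {..<n}"
      proof (rule inj_onI)
        fix i j assume ij: "i \<in> {..<n}" "j \<in> {..<n}" "m k i = m k j"
        have "w i \<noteq> x j" "x i \<noteq> w j" using disj ij by blast+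
        then show "i = j" using ij x w by (auto simp: m_def topspace_config_space inj_on_def split: if_splits)
      qed
      then show ?thesis using x w that by (auto simp: topspace_config_space extensional_def m_def)
    qed
    have "R x (m k)" if "k \<le> n" for k using that
    proof (induction k)
      case 0
      have "m 0 = x" by (auto simp: m_def)
      moreover have "pathin ?F (\<lambda>_. x)" using x by simp
      ultimately show ?case unfolding R_def by (intro exI[of _ "\<lambda>_. x"]) simp
    next
      case (Suc k)
      have "m (Suc k) = (m k)(k := w k)" by (auto simp: m_def less_Suc_eq)
      moreover have "w k \<notin> m k ` ({..<n} - {k})"
      proof
        assume "w k \<in> m k ` ({..<n} - {k})"
        then obtain i where i: "i < n" "i \<noteq> k" "w k = m k i" by auto
        have "w k \<noteq> x i" using disj i Suc.prems by fastforce
        then show False using i w Suc.prems by (auto simp: m_def topspace_config_space inj_on_def split: if_splits)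
      qed
      ultimately have "R (m k) (m (Suc k))"
        using step[OF mF[of k], of k "w k"] Suc.prems w by (simp add: topspace_config_space)
      then show ?case using Rtrans Suc by simp
    qed
    moreover have "m n = w" using x w by (auto simp: m_def topspace_config_space extensional_def fun_eq_iff)
    ultimately show ?thesis by force
  qed
  have "R x y" if x: "x \<in> topspace ?F" and y: "y \<in> topspace ?F" for x y
  proof -
    \<comment> \<open>\<open>x\<close> and \<open>y\<close> may share points, so the moves go
      through a third configuration disjoint from both.\<close>
    have "infinite (topspace X - (x ` {..<n} \<union> y ` {..<n}))" using inf by simp
    then obtain f :: "nat \<Rightarrow> _" where f: "inj f" "range f \<subseteq> topspace X - (x ` {..<n} \<union> y ` {..<n})"
      using infinite_iff_countable_subset by metis
    define w where "w = restrict f {..<n}"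
    have "f i \<in> topspace X - (x ` {..<n} \<union> y ` {..<n})" for i using f(2) by blast
    then have "w \<in> topspace ?F" "x ` {..<n} \<inter> w ` {..<n} = {}" "y ` {..<n} \<inter> w ` {..<n} = {}"
      using f(1) by (force simp: w_def topspace_config_space inj_on_def inj_def)+
    then show ?thesis using far[OF x] far[OF y] Rsym Rtrans by metis
  qed
  then show ?thesis unfolding path_connected_space_def R_def by blast
qed

section \<open>Characters of the braid groupoid of a square\<close>

abbreviation nat_swap :: "nat \<Rightarrow> nat \<Rightarrow> nat \<Rightarrow> nat" where
  "nat_swap \<equiv> Transposition.transpose"

text \<open>A square instead of a disc: real parts can be exchanged between points without leaving
  it.\<close>

definition sq_box :: "complex set" where
  "sq_box = {z. \<bar>Re z\<bar> < 1/2 \<and> \<bar>Im z\<bar> < 1/2}"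

definition tcomb :: "nat \<Rightarrow> real \<Rightarrow> (nat \<Rightarrow> complex) \<Rightarrow> (nat \<Rightarrow> complex) \<Rightarrow> nat \<Rightarrow> complex" where
  "tcomb n t x y = restrict (\<lambda>i. (1 - t) *\<^sub>R x i + t *\<^sub>R y i) {..<n}"

abbreviation box_config :: "nat \<Rightarrow> (nat \<Rightarrow> complex) topology" where
  "box_config n \<equiv> config_space n (top_of_set sq_box)"

text \<open>Convexity for tuples, with \<open>tcomb\<close> in place of the affine structure because
  tuples are kept \<open>undefined\<close> outside \<open>{..<n}\<close>. Membership in the
  configuration space is part of the notion, so segments are free of collisions.\<close>

definition tconvex :: "nat \<Rightarrow> (nat \<Rightarrow> complex) set \<Rightarrow> bool" where
  "tconvex n C \<longleftrightarrow> C \<subseteq> topspace (box_config n) \<and> (\<forall>x\<in>C. \<forall>y\<in>C. \<forall>t\<in>{0..1}. tcomb n t x y \<in> C)"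

lemma topspace_box_config:
  "x \<in> topspace (box_config n) \<longleftrightarrow> x \<in> extensional {..<n} \<and> (\<forall>i<n. x i \<in> sq_box) \<and> inj_on x {..<n}"
  by (simp add: topspace_config_space)

lemma convex_box: "convex sq_box"
proof -
  have "sq_box = {z. Re z < 1/2} \<inter> {z. Re z > - (1/2)} \<inter> {z. Im z < 1/2} \<inter> {z. Im z > - (1/2)}"
    by (auto simp: sq_box_def abs_less_iff)
  then show ?thesis
    by (metis convex_Int convex_halfspace_Re_lt convex_halfspace_Re_gt convex_halfspace_Im_lt convex_halfspace_Im_gt)
qed

lemma tcomb_ends: "x \<in> extensional {..<n} \<Longrightarrow> tcomb n 0 x y = x" "y \<in> extensional {..<n} \<Longrightarrow> tcomb n 1 x y = y"
  by (auto simp: tcomb_def extensional_def)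

lemma tcomb_self: "x \<in> extensional {..<n} \<Longrightarrow> tcomb n t x x = x"
  by (auto simp: tcomb_def extensional_def fun_eq_iff simp flip: scaleR_left_distrib)

lemma continuous_box_coordinate:
  assumes "continuous_map (top_of_set A) (box_config n) f" "i < n"
  shows "continuous_on A (\<lambda>a. f a i)"
  using assms unfolding continuous_map_config by (auto simp: continuous_map_in_subtopology)

lemma continuous_map_box_config:
  assumes "\<And>i. i < n \<Longrightarrow> continuous_on A (\<lambda>a. f a i)" "\<And>a. a \<in> A \<Longrightarrow> f a \<in> topspace (box_config n)"
  shows "continuous_map (top_of_set A) (box_config n) f"
  using assms unfolding continuous_map_config topspace_box_config
  by (auto simp: continuous_map_in_subtopology)

lemma path_hom_tconvex:
  assumes C: "tconvex n C" and p: "pathin (box_config n) p" "p ` {0..1} \<subseteq> C"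
    and q: "pathin (box_config n) q" "q ` {0..1} \<subseteq> C" and "p 0 = q 0" "p 1 = q 1"
  shows "path_hom (box_config n) p q"
proof (rule path_homI)
  have *: "tcomb n t (p s) (q s) \<in> C" if "t \<in> {0..1}" "s \<in> {0..1}" for t s
    using C p q that unfolding tconvex_def by blast
  have ext: "x \<in> extensional {..<n}" if "x \<in> C" for x
    using C that by (auto simp: tconvex_def topspace_box_config)
  show "continuous_map (top_of_set unit_square) (box_config n) (\<lambda>z. tcomb n (fst z) (p (snd z)) (q (snd z)))"
  proof (rule continuous_map_box_config)
    fix i assume i: "i < n"
    have "continuous_on unit_square (\<lambda>z. p (snd z) i)" "continuous_on unit_square (\<lambda>z. q (snd z) i)"
      using continuous_on_compose2[OF continuous_box_coordinate[OF p(1)[unfolded pathin_def] i], of unit_square snd]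
        continuous_on_compose2[OF continuous_box_coordinate[OF q(1)[unfolded pathin_def] i], of unit_square snd]
      by (simp_all add: continuous_on_snd image_subset_iff)
    then show "continuous_on unit_square (\<lambda>z. tcomb n (fst z) (p (snd z)) (q (snd z)) i)"
      using i by (simp add: tcomb_def continuous_intros)
  next
    fix a assume "a \<in> unit_square"
    then show "tcomb n (fst a) (p (snd a)) (q (snd a)) \<in> topspace (box_config n)"
      using * C unfolding tconvex_def by auto
  qed
  show "tcomb n (fst (0, s)) (p (snd (0::real, s))) (q (snd (0::real, s))) = p s" if "s \<in> {0..1}" for s
    using ext[of "p s"] p that by (simp add: tcomb_ends image_subset_iff)
  show "tcomb n (fst (1, s)) (p (snd (1::real, s))) (q (snd (1::real, s))) = q s" if "s \<in> {0..1}" for s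
    using ext[of "q s"] q that by (simp add: tcomb_ends image_subset_iff)
  show "tcomb n (fst (t, 0)) (p (snd (t, 0::real))) (q (snd (t, 0::real))) = p 0" if "t \<in> {0..1}" for t
    using ext[of "p 0"] p(2) assms(6) by (metis atLeastAtMost_iff fst_conv image_subset_iff order_refl snd_conv tcomb_self zero_le_one)
  show "tcomb n (fst (t, 1)) (p (snd (t, 1::real))) (q (snd (t, 1::real))) = p 1" if "t \<in> {0..1}" for t
    using ext[of "p 1"] p(2) assms(7) by (metis atLeastAtMost_iff fst_conv image_subset_iff order_refl snd_conv tcomb_self zero_le_one)
qed

lemma pathin_tcomb:
  assumes C: "tconvex n C" and x: "x \<in> C" "y \<in> C"
  shows "pathin (box_config n) (\<lambda>t. tcomb n t x y)" "(\<lambda>t. tcomb n t x y) ` {0..1} \<subseteq> C"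
proof -
  show s: "(\<lambda>t. tcomb n t x y) ` {0..1} \<subseteq> C" using C x unfolding tconvex_def by blast
  show "pathin (box_config n) (\<lambda>t. tcomb n t x y)"
    unfolding pathin_def
  proof (rule continuous_map_box_config)
    show "continuous_on {0..1} (\<lambda>t. tcomb n t x y i)" if "i < n" for i
      using that by (simp add: tcomb_def continuous_intros)
    show "tcomb n a x y \<in> topspace (box_config n)" if "a \<in> {0..1}" for a
      using s C that unfolding tconvex_def by blast
  qed
qed

text \<open>\<open>R\<close> prescribes the horizontal and \<open>M\<close> the vertical order of pairs of points.\<close>

definition ordered_configs :: "nat \<Rightarrow> (nat \<times> nat) set \<Rightarrow> (nat \<times> nat) set \<Rightarrow> (nat \<Rightarrow> complex) set" where
  "ordered_configs n R M = {x \<in> topspace (box_config n).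
     (\<forall>(i,j)\<in>R. Re (x i) < Re (x j)) \<and> (\<forall>(i,j)\<in>M. Im (x i) < Im (x j))}"

text \<open>If every pair of points is ordered in some direction, the strict inequalities already
  exclude collisions, so they cut out a set that is convex and lies in the configuration
  space.\<close>

definition separates :: "nat \<Rightarrow> (nat \<times> nat) set \<Rightarrow> bool" where
  "separates n R \<longleftrightarrow> R \<subseteq> {..<n} \<times> {..<n} \<and> (\<forall>i<n. \<forall>j<n. i \<noteq> j \<longrightarrow> (i,j) \<in> R \<or> (j,i) \<in> R)"

lemma separates_finite:
  assumes "separates n (R \<union> M)"
  shows "finite R" "finite M"
proof -
  have "R \<union> M \<subseteq> {..<n} \<times> {..<n}" using assms by (simp add: separates_def)
  from finite_subset[OF this] show "finite R" "finite M" by simp_all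
qed

lemma ordered_configsI:
  assumes "separates n (R \<union> M)" "x \<in> extensional {..<n}" "\<And>i. i < n \<Longrightarrow> x i \<in> sq_box"
    "\<And>i j. (i,j) \<in> R \<Longrightarrow> Re (x i) < Re (x j)" "\<And>i j. (i,j) \<in> M \<Longrightarrow> Im (x i) < Im (x j)"
  shows "x \<in> ordered_configs n R M"
proof -
  have "inj_on x {..<n}"
  proof (rule inj_onI, rule ccontr)
    fix i j assume ij: "i \<in> {..<n}" "j \<in> {..<n}" "x i = x j" "i \<noteq> j"
    then have "(i,j) \<in> R \<union> M \<or> (j,i) \<in> R \<union> M" using assms(1) by (auto simp: separates_def)
    then show False using assms(4,5) ij(3) by (metis UnE less_irrefl)
  qed
  then show ?thesis using assms by (auto simp: ordered_configs_def topspace_box_config)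
qed

lemma convex_less:
  fixes a b c d t :: real
  assumes "a < b" "c < d" "0 \<le> t" "t \<le> 1"
  shows "(1 - t) * a + t * c < (1 - t) * b + t * d"
proof (cases "t = 0")
  case False
  then have "t * c < t * d" using assms by simp
  moreover have "(1 - t) * a \<le> (1 - t) * b" using assms by (simp add: mult_left_mono)
  ultimately show ?thesis by simp
qed (use assms in simp)

lemma tconvex_ordered_configs:
  assumes "separates n (R \<union> M)"
  shows "tconvex n (ordered_configs n R M)"
  unfolding tconvex_def
proof (intro conjI ballI)
  fix x y and t :: real assume x: "x \<in> ordered_configs n R M" and y: "y \<in> ordered_configs n R M" and t: "t \<in> {0..1}"
  show "tcomb n t x y \<in> ordered_configs n R M"
  proof (rule ordered_configsI[OF assms])
    show "tcomb n t x y \<in> extensional {..<n}" by (simp add: tcomb_def)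
    show "tcomb n t x y i \<in> sq_box" if "i < n" for i
      using that x y t convexD_alt[OF convex_box, of "x i" "y i" t]
      by (simp add: tcomb_def ordered_configs_def topspace_box_config)
    have lt: "i < n" "j < n" if "(i,j) \<in> R \<union> M" for i j
      using that assms by (auto simp: separates_def)
    show "Re (tcomb n t x y i) < Re (tcomb n t x y j)" if "(i,j) \<in> R" for i j
      using that x y t lt[of i j] by (auto simp: tcomb_def ordered_configs_def intro!: convex_less)
    show "Im (tcomb n t x y i) < Im (tcomb n t x y j)" if "(i,j) \<in> M" for i j
      using that x y t lt[of i j] by (auto simp: tcomb_def ordered_configs_def intro!: convex_less)
  qed
qed (auto simp: ordered_configs_def)

section \<open>Generic configurations and their horizontal order\<close>

definition generic :: "nat \<Rightarrow> (nat \<Rightarrow> complex) \<Rightarrow> bool" where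
  "generic n x \<longleftrightarrow> x \<in> topspace (box_config n) \<and> inj_on (\<lambda>i. Re (x i)) {..<n}"

definition re_rank :: "nat \<Rightarrow> (nat \<Rightarrow> complex) \<Rightarrow> nat \<Rightarrow> nat" where
  "re_rank n x i = card {j. j < n \<and> Re (x j) < Re (x i)}"

lemma re_rank_less_iff:
  assumes "i < n" "j < n"
  shows "re_rank n x i < re_rank n x j \<longleftrightarrow> Re (x i) < Re (x j)"
proof
  assume l: "Re (x i) < Re (x j)"
  then have "{k. k < n \<and> Re (x k) < Re (x i)} \<subset> {k. k < n \<and> Re (x k) < Re (x j)}" using assms by auto
  then show "re_rank n x i < re_rank n x j" unfolding re_rank_def by (intro psubset_card_mono) auto
next
  assume l: "re_rank n x i < re_rank n x j"
  show "Re (x i) < Re (x j)"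
  proof (rule ccontr)
    assume "\<not> Re (x i) < Re (x j)"
    then have "{k. k < n \<and> Re (x k) < Re (x j)} \<subseteq> {k. k < n \<and> Re (x k) < Re (x i)}" by auto
    then have "re_rank n x j \<le> re_rank n x i" unfolding re_rank_def by (intro card_mono) auto
    then show False using l by simp
  qed
qed

lemma re_rank_less: "i < n \<Longrightarrow> re_rank n x i < n"
proof -
  assume "i < n"
  then have "{k. k < n \<and> Re (x k) < Re (x i)} \<subset> {..<n}" by auto
  then have "re_rank n x i < card {..<n}" unfolding re_rank_def by (intro psubset_card_mono) auto
  then show ?thesis by simp
qed

lemma bij_re_rank:
  assumes "inj_on (\<lambda>i. Re (x i)) {..<n}"
  shows "bij_betw (re_rank n x) {..<n} {..<n}"
proof -
  have inj: "inj_on (re_rank n x) {..<n}"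
  proof (rule inj_onI)
    fix i j assume ij: "i \<in> {..<n}" "j \<in> {..<n}" "re_rank n x i = re_rank n x j"
    then have "Re (x i) = Re (x j)" using re_rank_less_iff[of i n j x] re_rank_less_iff[of j n i x] by auto
    then show "i = j" using assms ij by (auto simp: inj_on_def)
  qed
  moreover have "re_rank n x ` {..<n} = {..<n}"
    using re_rank_less by (intro endo_inj_surj inj) auto
  ultimately show ?thesis by (simp add: bij_betw_def)
qed

lemma re_rank_permute:
  assumes "\<tau> permutes {..<n}" "\<And>i. i < n \<Longrightarrow> Re (y i) = Re (x (\<tau> i))" "i < n"
  shows "re_rank n y i = re_rank n x (\<tau> i)"
proof -
  have "\<tau> ` {j. j < n \<and> Re (y j) < Re (y i)} = {j. j < n \<and> Re (x j) < Re (x (\<tau> i))}"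
  proof (intro equalityI subsetI)
    fix k assume "k \<in> \<tau> ` {j. j < n \<and> Re (y j) < Re (y i)}"
    then show "k \<in> {j. j < n \<and> Re (x j) < Re (x (\<tau> i))}"
      using assms permutes_in_image[OF assms(1)] by force
  next
    fix k assume k: "k \<in> {j. j < n \<and> Re (x j) < Re (x (\<tau> i))}"
    then have "k \<in> \<tau> ` {..<n}" using permutes_image[OF assms(1)] by simp
    then obtain j where "k = \<tau> j" "j < n" by auto
    then show "k \<in> \<tau> ` {j. j < n \<and> Re (y j) < Re (y i)}" using k assms by auto
  qed
  moreover have "card (\<tau> ` {j. j < n \<and> Re (y j) < Re (y i)}) = card {j. j < n \<and> Re (y j) < Re (y i)}"
    by (rule card_image[OF permutes_inj_on[OF assms(1)]])
  ultimately show ?thesis unfolding re_rank_def by simp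
qed

definition base_pt :: "nat \<Rightarrow> nat \<Rightarrow> complex" where
  "base_pt n k = Complex (real k / (2 * real n)) (real k / (2 * real n))"

text \<open>Heights increase with the index whatever \<open>f\<close> is, so these models of all
  horizontal orders can be joined by segments without collisions.\<close>

definition base_config :: "nat \<Rightarrow> (nat \<Rightarrow> nat) \<Rightarrow> nat \<Rightarrow> complex" where
  "base_config n f = restrict (\<lambda>i. Complex (Re (base_pt n (f i))) (Im (base_pt n i))) {..<n}"

text \<open>The points slide to standard positions in their horizontal order: all generic
  configurations get the same underlying set, labelled differently.\<close>

definition sorted_config :: "nat \<Rightarrow> (nat \<Rightarrow> complex) \<Rightarrow> nat \<Rightarrow> complex" where
  "sorted_config n x = restrict (\<lambda>i. base_pt n (re_rank n x i)) {..<n}"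

lemma base_pt_less: "n > 0 \<Longrightarrow> Re (base_pt n j) < Re (base_pt n k) \<longleftrightarrow> j < k"
  "n > 0 \<Longrightarrow> Im (base_pt n j) < Im (base_pt n k) \<longleftrightarrow> j < k"
  by (simp_all add: base_pt_def divide_less_cancel)

lemma base_pt_bound: "k < n \<Longrightarrow> 0 \<le> Re (base_pt n k) \<and> Re (base_pt n k) < 1/2 \<and> 0 \<le> Im (base_pt n k) \<and> Im (base_pt n k) < 1/2"
  by (auto simp: base_pt_def divide_simps)

lemma base_config_generic:
  assumes "f permutes {..<n}"
  shows "generic n (base_config n f)" "\<And>i. i < n \<Longrightarrow> re_rank n (base_config n f) i = f i"
proof -
  have fn: "f i < n" if "i < n" for i using permutes_in_image[OF assms, of i] that by simp
  have inj: "inj_on (\<lambda>i. Re (base_config n f i)) {..<n}"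
    using permutes_inj_on[OF assms, of "{..<n}"]
    by (auto simp: inj_on_def base_config_def base_pt_def divide_simps)
  moreover have "base_config n f i \<in> sq_box" if "i < n" for i
    using base_pt_bound[OF that] base_pt_bound[OF fn[OF that]] that by (simp add: base_config_def sq_box_def)
  moreover have "inj_on (base_config n f) {..<n}" using inj by (auto simp: inj_on_def)
  ultimately show "generic n (base_config n f)"
    by (auto simp: generic_def topspace_box_config base_config_def)
  show "re_rank n (base_config n f) i = f i" if i: "i < n" for i
  proof -
    have "n > 0" using i by simp
    have "f ` {j. j < n \<and> Re (base_config n f j) < Re (base_config n f i)} = {..<f i}"
    proof (intro equalityI subsetI)
      fix k assume "k \<in> {..<f i}"
      then have "k \<in> f ` {..<n}" using permutes_image[OF assms] fn[OF i] by auto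
      then show "k \<in> f ` {j. j < n \<and> Re (base_config n f j) < Re (base_config n f i)}"
        using \<open>k \<in> {..<f i}\<close> i base_pt_less(1)[OF \<open>n > 0\<close>] by (auto simp: base_config_def)
    qed (use i base_pt_less(1)[OF \<open>n > 0\<close>] in \<open>auto simp: base_config_def\<close>)
    moreover have "card (f ` {j. j < n \<and> Re (base_config n f j) < Re (base_config n f i)}) = re_rank n (base_config n f) i"
      unfolding re_rank_def by (rule card_image[OF permutes_inj_on[OF assms]])
    ultimately show ?thesis by simp
  qed
qed

definition order_of :: "nat \<Rightarrow> (nat \<Rightarrow> complex) \<Rightarrow> (nat \<times> nat) set" where
  "order_of n x = {(i,j). i < n \<and> j < n \<and> Re (x i) < Re (x j)}"

lemma separates_order_of: "generic n x \<Longrightarrow> separates n (order_of n x \<union> {})"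
  unfolding separates_def order_of_def generic_def inj_on_def
  by (auto; metis lessThan_iff linorder_less_linear)

lemma in_order_of: "generic n x \<Longrightarrow> x \<in> ordered_configs n (order_of n x) {}"
  by (auto simp: ordered_configs_def order_of_def generic_def)

lemma in_order_of_re_rank:
  assumes "generic n x" "generic n y" "\<And>i. i < n \<Longrightarrow> re_rank n x i = re_rank n y i"
  shows "x \<in> ordered_configs n (order_of n y) {}"
  using assms re_rank_less_iff[of _ n _ x] re_rank_less_iff[of _ n _ y]
  by (auto simp: ordered_configs_def order_of_def generic_def)

lemma sorted_config_in:
  assumes "generic n x"
  shows "generic n (sorted_config n x)" "sorted_config n x \<in> ordered_configs n (order_of n x) {}"
proof -
  show *: "sorted_config n x \<in> ordered_configs n (order_of n x) {}"
  proof (rule ordered_configsI[OF separates_order_of[OF assms]])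
    show "sorted_config n x i \<in> sq_box" if "i < n" for i
      using base_pt_bound[OF re_rank_less[OF that, of x]] that by (simp add: sorted_config_def sq_box_def)
    show "Re (sorted_config n x i) < Re (sorted_config n x j)" if "(i,j) \<in> order_of n x" for i j
    proof -
      have "i < n" "j < n" "Re (x i) < Re (x j)" using that by (auto simp: order_of_def)
      then show ?thesis using base_pt_less(1)[of n "re_rank n x i" "re_rank n x j"] re_rank_less_iff[of i n j x]
        by (simp add: sorted_config_def)
    qed
  qed (auto simp: sorted_config_def)
  have "Re (sorted_config n x i) \<noteq> Re (sorted_config n x j)" if "i < n" "j < n" "i \<noteq> j" for i j
  proof -
    have "(i,j) \<in> order_of n x \<or> (j,i) \<in> order_of n x"
      using separates_order_of[OF assms] that by (auto simp: separates_def)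
    then show ?thesis using * by (auto simp: ordered_configs_def)
  qed
  then show "generic n (sorted_config n x)"
    using * by (auto simp: generic_def ordered_configs_def inj_on_def)
qed

text \<open>\<open>sym\<close> expresses that \<open>\<Psi>\<close> does not see the labels, as is
  the case when it comes from unordered configurations.\<close>

locale box_char =
  fixes n :: nat and \<Psi> :: "(real \<Rightarrow> nat \<Rightarrow> complex) \<Rightarrow> complex"
  assumes pc: "path_char (box_config n) \<Psi>"
    and sym: "\<And>\<pi> p. \<pi> permutes {..<n} \<Longrightarrow> pathin (box_config n) p \<Longrightarrow> \<Psi> (\<lambda>t. p t \<circ> \<pi>) = \<Psi> p"
begin

text \<open>Meaningful when the straight segment avoids collisions, which a common
  \<open>tconvex\<close> set guarantees.\<close>

definition seg :: "(nat \<Rightarrow> complex) \<Rightarrow> (nat \<Rightarrow> complex) \<Rightarrow> complex" where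
  "seg x y = \<Psi> (\<lambda>t. tcomb n t x y)"

lemma seg_path:
  assumes "tconvex n C" "pathin (box_config n) p" "p ` {0..1} \<subseteq> C"
  shows "\<Psi> p = seg (p 0) (p 1)"
proof -
  have e: "p 0 \<in> C" "p 1 \<in> C" using assms(3) by auto
  then have "p 0 \<in> extensional {..<n}" "p 1 \<in> extensional {..<n}"
    using assms(1) by (auto simp: tconvex_def topspace_box_config)
  then show ?thesis unfolding seg_def
    using path_char_hom[OF pc path_hom_tconvex[OF assms pathin_tcomb[OF assms(1) e]]] by (simp add: tcomb_ends)
qed

lemma seg_nonzero: "tconvex n C \<Longrightarrow> x \<in> C \<Longrightarrow> y \<in> C \<Longrightarrow> seg x y \<noteq> 0"
  unfolding seg_def using path_char_nonzero[OF pc pathin_tcomb(1)] by blast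

lemma seg_triangle:
  assumes C: "tconvex n C" and x: "x \<in> C" "y \<in> C" "z \<in> C"
  shows "seg x y * seg y z = seg x z"
proof -
  let ?p = "\<lambda>t. tcomb n t x y" and ?q = "\<lambda>t. tcomb n t y z"
  have ext: "x \<in> extensional {..<n}" "y \<in> extensional {..<n}" "z \<in> extensional {..<n}"
    using C x by (auto simp: tconvex_def topspace_box_config)
  have eq: "?p 1 = ?q 0" using ext by (simp add: tcomb_ends)
  note p = pathin_tcomb[OF C x(1,2)] and q = pathin_tcomb[OF C x(2,3)]
  have "path_concat ?p ?q ` {0..1} \<subseteq> C"
  proof
    fix w assume "w \<in> path_concat ?p ?q ` {0..1}"
    then obtain t :: real where t: "t \<in> {0..1}" "w = path_concat ?p ?q t" by blast
    show "w \<in> C"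
    proof (cases "t \<le> 1/2")
      case True
      then show ?thesis using t p(2) by (auto simp: path_concat_def image_subset_iff)
    next
      case False
      then show ?thesis using t q(2) by (auto simp: path_concat_def image_subset_iff)
    qed
  qed
  from seg_path[OF C pathin_concat[OF p(1) q(1) eq] this]
  have "\<Psi> (path_concat ?p ?q) = seg x z" using ext by (simp add: tcomb_ends)
  then show ?thesis using path_char_concat[OF pc p(1) q(1) eq] by (simp add: seg_def)
qed

lemma seg_self:
  assumes "x \<in> topspace (box_config n)"
  shows "seg x x = 1"
  using assms path_char_const[OF pc assms] unfolding seg_def by (simp add: tcomb_self topspace_box_config)

lemma seg_permute:
  assumes "\<pi> permutes {..<n}" "tconvex n C" "x \<in> C" "y \<in> C"
  shows "seg (x \<circ> \<pi>) (y \<circ> \<pi>) = seg x y"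
proof -
  have "x \<in> extensional {..<n}" "y \<in> extensional {..<n}"
    using assms by (auto simp: tconvex_def topspace_box_config)
  then have "tcomb n t (x \<circ> \<pi>) (y \<circ> \<pi>) = tcomb n t x y \<circ> \<pi>" for t
    using permutes_in_image[OF assms(1)] permutes_not_in[OF assms(1)]
    by (auto simp: tcomb_def fun_eq_iff restrict_def)
  then show ?thesis unfolding seg_def using sym[OF assms(1) pathin_tcomb(1)[OF assms(2-4)]] by simp
qed

definition gauge :: "(nat \<Rightarrow> complex) \<Rightarrow> complex" where
  "gauge x = seg (sorted_config n x) x"

text \<open>The value of the path from the sorted model of \<open>x\<close> through \<open>x\<close>
  and \<open>y\<close> to the sorted model of \<open>y\<close>. The models differ only in labels, so
  this is the value of a closed braid, and positions within one horizontal order cease to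
  matter.\<close>

definition jump :: "(nat \<Rightarrow> complex) \<Rightarrow> (nat \<Rightarrow> complex) \<Rightarrow> complex" where
  "jump x y = gauge x * seg x y / gauge y"

lemma gauge_nonzero: "generic n x \<Longrightarrow> gauge x \<noteq> 0"
  unfolding gauge_def
  using seg_nonzero[OF tconvex_ordered_configs[OF separates_order_of] sorted_config_in(2) in_order_of] by blast

lemma jump_triangle:
  assumes "tconvex n C" "x \<in> C" "y \<in> C" "z \<in> C" "generic n x" "generic n y" "generic n z"
  shows "jump x y * jump y z = jump x z"
  unfolding jump_def using seg_triangle[OF assms(1-4)] gauge_nonzero[OF assms(6)] gauge_nonzero[OF assms(7)]
  by (simp add: field_simps)

lemma jump_same_order:
  assumes "generic n x" "generic n y" "\<And>i. i < n \<Longrightarrow> re_rank n x i = re_rank n y i"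
  shows "jump x y = 1"
proof -
  have e: "sorted_config n x = sorted_config n y" using assms(3) by (auto simp: sorted_config_def)
  have "gauge x * seg x y = gauge y"
    unfolding gauge_def e
    by (rule seg_triangle[OF tconvex_ordered_configs[OF separates_order_of[OF assms(2)]]])
      (use assms sorted_config_in(2)[OF assms(2)] in_order_of in_order_of_re_rank in auto)
  then show ?thesis unfolding jump_def using gauge_nonzero[OF assms(2)] by simp
qed

lemma generic_permute:
  assumes "\<pi> permutes {..<n}" "generic n x"
  shows "generic n (x \<circ> \<pi>)"
proof -
  have "inj_on ((\<lambda>i. Re (x i)) \<circ> \<pi>) {..<n}"
    using assms permutes_inj_on[OF assms(1)] permutes_image[OF assms(1)]
    by (intro comp_inj_on) (auto simp: generic_def)
  then show ?thesis using assms permute_config[OF assms(1)] by (auto simp: generic_def o_def)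
qed

lemma gauge_permute:
  assumes "\<pi> permutes {..<n}" "generic n x"
  shows "gauge (x \<circ> \<pi>) = gauge x"
proof -
  have "sorted_config n (x \<circ> \<pi>) i = (sorted_config n x \<circ> \<pi>) i" for i
  proof (cases "i < n")
    case True
    then have "re_rank n (x \<circ> \<pi>) i = re_rank n x (\<pi> i)" by (intro re_rank_permute[OF assms(1)]) auto
    then show ?thesis using True permutes_in_image[OF assms(1), of i] by (simp add: sorted_config_def)
  next
    case False
    then show ?thesis using permutes_not_in[OF assms(1), of i] by (simp add: sorted_config_def)
  qed
  then have "sorted_config n (x \<circ> \<pi>) = sorted_config n x \<circ> \<pi>" by blast
  then show ?thesis unfolding gauge_def
    using seg_permute[OF assms(1) tconvex_ordered_configs[OF separates_order_of[OF assms(2)]]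
        sorted_config_in(2)[OF assms(2)] in_order_of[OF assms(2)]] by simp
qed

text \<open>The value of the Artin generator that exchanges the points of ranks \<open>r\<close> and
  \<open>r + 1\<close>.\<close>

definition swap_value :: "nat \<Rightarrow> complex" where
  "swap_value r = jump (base_config n id) (base_config n (nat_swap r (Suc r)))"

text \<open>An elementary crossing of the points of horizontal ranks \<open>r\<close> and \<open>r + 1\<close>, the left one passing
  below, has a value depending on \<open>r\<close> only: after relabelling, all such crossings take place in one
  convex set.\<close>

lemma jump_swap:
  assumes r: "Suc r < n" and x: "generic n x" and y: "generic n y" and C: "tconvex n C" "x \<in> C" "y \<in> C"
    and rk: "\<And>i. i < n \<Longrightarrow> re_rank n y i = nat_swap r (Suc r) (re_rank n x i)"
    and jk: "j < n" "k < n" "re_rank n x j = r" "re_rank n x k = Suc r"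
    and im: "Im (x j) < Im (x k)" "Im (y j) < Im (y k)"
  shows "jump x y = swap_value r"
proof -
  \<comment> \<open>The case in which the labels are the horizontal ranks of
    \<open>x\<close>.\<close>
  have *: "jump x y = swap_value r"
    if x: "generic n x" and y: "generic n y"
      and rx: "\<And>i. i < n \<Longrightarrow> re_rank n x i = i" and ry: "\<And>i. i < n \<Longrightarrow> re_rank n y i = nat_swap r (Suc r) i"
      and im: "Im (x r) < Im (x (Suc r))" "Im (y r) < Im (y (Suc r))" for x y
  proof -
    \<comment> \<open>The crossing pair is the only one without a horizontal constraint; it is kept
      apart by its heights.\<close>
    define R where "R = {(i,j). i < j \<and> j < n \<and> (i,j) \<noteq> (r, Suc r)}"
    define W where "W = ordered_configs n R {(r, Suc r)}"
    have sep: "separates n (R \<union> {(r, Suc r)})" using r by (auto simp: separates_def R_def)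
    have W: "tconvex n W" unfolding W_def by (rule tconvex_ordered_configs[OF sep])
    have tr: "nat_swap r (Suc r) permutes {..<n}" using r by (intro permutes_swap_id) auto
    define B B' where "B = base_config n id" and "B' = base_config n (nat_swap r (Suc r))"
    have gB: "generic n B" "\<And>i. i < n \<Longrightarrow> re_rank n B i = i"
      unfolding B_def using base_config_generic[OF permutes_id] by simp_all
    note gB' = base_config_generic[OF tr, folded B'_def]
    have inW: "z \<in> W" if z: "generic n z" "Im (z r) < Im (z (Suc r))"
      and rz: "(\<forall>i<n. re_rank n z i = i) \<or> (\<forall>i<n. re_rank n z i = nat_swap r (Suc r) i)" for z
      unfolding W_def
    proof (rule ordered_configsI[OF sep])
      show "Re (z i) < Re (z j)" if "(i,j) \<in> R" for i j
      proof -
        have ij: "i < j" "j < n" "(i,j) \<noteq> (r, Suc r)" using that by (auto simp: R_def)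
        have "re_rank n z i < re_rank n z j"
          using rz
        proof
          assume "\<forall>i<n. re_rank n z i = nat_swap r (Suc r) i"
          then show ?thesis using ij by (auto simp: Transposition.transpose_def)
        qed (use ij in simp)
        then show ?thesis using re_rank_less_iff[of i n j z] ij by simp
      qed
    qed (use z in \<open>auto simp: generic_def topspace_box_config\<close>)
    have imB: "Im (B r) < Im (B (Suc r))" "Im (B' r) < Im (B' (Suc r))"
      using r by (auto simp: B_def B'_def base_config_def base_pt_less)
    have xW: "x \<in> W" "y \<in> W" "B \<in> W" "B' \<in> W"
      using inW x y rx ry im gB gB' imB by auto
    have sx: "sorted_config n x = B"
      using rx by (auto simp: sorted_config_def B_def base_config_def base_pt_def)
    have sB: "sorted_config n B = B"
      using gB(2) unfolding sorted_config_def by (auto simp: B_def base_config_def base_pt_def)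
    have sy: "sorted_config n y = sorted_config n B'" using ry gB'(2) by (auto simp: sorted_config_def)
    have yB': "jump B' y = 1" using jump_same_order[OF gB'(1) y] ry gB'(2) by simp
    have Bx: "jump B x = 1" using jump_same_order[OF gB(1) x] rx gB(2) by simp
    have "jump x y = jump B x * jump x y" using Bx by simp
    also have "\<dots> = jump B y" by (rule jump_triangle[OF W]) (use xW x y gB in auto)
    also have "\<dots> = jump B B' * jump B' y" by (rule jump_triangle[OF W, symmetric]) (use xW x y gB gB' in auto)
    finally show ?thesis using yB' by (simp add: swap_value_def B_def B'_def)
  qed
  have bij: "bij_betw (re_rank n x) {..<n} {..<n}" using x by (intro bij_re_rank) (simp add: generic_def)
  \<comment> \<open>Relabelling by ranks reduces to the case above; \<open>sym\<close> makes
    \<open>jump\<close> invariant under it.\<close>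
  define \<pi> where "\<pi> i = (if i < n then inv_into {..<n} (re_rank n x) i else i)" for i
  have "bij_betw \<pi> {..<n} {..<n}"
    using bij_betw_inv_into[OF bij] by (subst bij_betw_cong[of _ _ "inv_into {..<n} (re_rank n x)"]) (auto simp: \<pi>_def)
  then have \<pi>: "\<pi> permutes {..<n}" by (intro bij_imp_permutes) (auto simp: \<pi>_def)
  have r\<pi>: "re_rank n x (\<pi> i) = i" if "i < n" for i
    using bij_betw_inv_into_right[OF bij, of i] that by (simp add: \<pi>_def)
  have \<pi>n: "\<pi> i < n" if "i < n" for i using permutes_in_image[OF \<pi>, of i] that by simp
  have rx: "re_rank n (x \<circ> \<pi>) i = i" if "i < n" for i
    using re_rank_permute[OF \<pi>, of "x \<circ> \<pi>" x i] that r\<pi> by simp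
  have ry: "re_rank n (y \<circ> \<pi>) i = nat_swap r (Suc r) i" if "i < n" for i
    using re_rank_permute[OF \<pi>, of "y \<circ> \<pi>" y i] that r\<pi> rk[OF \<pi>n] by simp
  have "\<pi> r = j" "\<pi> (Suc r) = k"
    using r\<pi>[of r] r\<pi>[of "Suc r"] \<pi>n r jk bij by (auto simp: bij_betw_def inj_on_def)
  then have "jump (x \<circ> \<pi>) (y \<circ> \<pi>) = swap_value r"
    using * generic_permute[OF \<pi>] x y rx ry im by simp
  then show ?thesis
    using gauge_permute[OF \<pi>] x y seg_permute[OF \<pi> C] by (simp add: jump_def)
qed

lemma swap_value_nonzero: "Suc r < n \<Longrightarrow> swap_value r \<noteq> 0"
proof -
  assume r: "Suc r < n"
  define R where "R = {(i,j). i < j \<and> j < n \<and> (i,j) \<noteq> (r, Suc r)}"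
  have sep: "separates n (R \<union> {(r, Suc r)})" using r by (auto simp: separates_def R_def)
  have tr: "nat_swap r (Suc r) permutes {..<n}" using r by (intro permutes_swap_id) auto
  have "base_config n f \<in> ordered_configs n R {(r, Suc r)}" if "f = id \<or> f = nat_swap r (Suc r)" for f
  proof (rule ordered_configsI[OF sep])
    have f: "f permutes {..<n}" using that tr permutes_id by blast
    show "base_config n f i \<in> sq_box" if "i < n" for i
      using base_config_generic(1)[OF f] that by (auto simp: generic_def topspace_box_config)
    show "Re (base_config n f i) < Re (base_config n f j)" if "(i,j) \<in> R" for i j
    proof -
      have l: "i < j" "j < n" "(i,j) \<noteq> (r, Suc r)" using that by (auto simp: R_def)
      then have "f i < f j" using \<open>f = id \<or> f = _\<close> by (auto simp: Transposition.transpose_def)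
      then show ?thesis using base_pt_less(1)[of n "f i" "f j"] l by (simp add: base_config_def)
    qed
    show "Im (base_config n f i) < Im (base_config n f j)" if "(i,j) \<in> {(r, Suc r)}" for i j
      using that r base_pt_less(2)[of n i j] by (auto simp: base_config_def)
  qed (simp add: base_config_def)
  then have "seg (base_config n id) (base_config n (nat_swap r (Suc r))) \<noteq> 0"
    by (intro seg_nonzero[OF tconvex_ordered_configs[OF sep]]) auto
  then show ?thesis
    unfolding swap_value_def jump_def
    using gauge_nonzero base_config_generic(1)[OF permutes_id] base_config_generic(1)[OF tr] by simp
qed

text \<open>The braid relation at a triple point.\<close>

lemma swap_value_Suc:
  assumes r: "Suc (Suc r) < n"
  shows "swap_value r = swap_value (Suc r)"
proof -
  let ?a = "r" and ?b = "Suc r" and ?c = "Suc (Suc r)"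
  \<comment> \<open>The three points are kept apart by height alone, so all six of their horizontal
    orders lie in one convex set.\<close>
  define M where "M = {(?a, ?b), (?a, ?c), (?b, ?c)}"
  define R where "R = {(i,j). i < j \<and> j < n} - M"
  have sep: "separates n (R \<union> M)"
  proof -
    have RM: "R \<union> M = {(i,j). i < j \<and> j < n}" using r by (auto simp: R_def M_def)
    show ?thesis unfolding RM by (auto simp: separates_def)
  qed
  let ?C = "ordered_configs n R M"
  note C = tconvex_ordered_configs[OF sep]
  let ?s = "nat_swap ?a ?b" and ?t = "nat_swap ?b ?c"
  have st: "?s permutes {..<n}" "?t permutes {..<n}" using r by (auto intro!: permutes_swap_id)
  have moved: "base_config n f \<in> ?C" if f: "f permutes {..<n}" and fixd: "\<And>i. i \<notin> {?a,?b,?c} \<Longrightarrow> f i = i"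
      and tri: "\<And>i. i \<in> {?a,?b,?c} \<Longrightarrow> f i \<in> {?a,?b,?c}" for f
  proof (rule ordered_configsI[OF sep])
    show "base_config n f i \<in> sq_box" if "i < n" for i
      using base_config_generic(1)[OF f] that by (auto simp: generic_def topspace_box_config)
    show "Re (base_config n f i) < Re (base_config n f j)" if ij: "(i,j) \<in> R" for i j
    proof -
      have l: "i < j" "j < n" "(i,j) \<notin> M" using ij by (auto simp: R_def)
      have nb: "\<not> (i \<in> {?a,?b,?c} \<and> j \<in> {?a,?b,?c})" using l by (auto simp: M_def)
      have "f i < f j"
      proof (cases "i \<in> {?a,?b,?c}")
        case True
        then have "f j = j" "f i \<le> ?c" "j > ?c"
          using l(1) nb fixd[of j] tri[of i] by auto
        then show ?thesis by simp
      next
        case False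
        then have "f i = i" using fixd by simp
        show ?thesis
        proof (cases "j \<in> {?a,?b,?c}")
          case True
          then have "?a \<le> f j" "i < ?a" using l(1) False tri[of j] by auto
          then show ?thesis using \<open>f i = i\<close> by simp
        qed (use fixd[of j] \<open>f i = i\<close> l in simp)
      qed
      then show ?thesis using base_pt_less(1)[of n "f i" "f j"] l by (auto simp: base_config_def)
    qed
    show "Im (base_config n f i) < Im (base_config n f j)" if "(i,j) \<in> M" for i j
      using that r base_pt_less(2)[of n i j] by (auto simp: base_config_def M_def)
  qed (simp add: base_config_def)
  have step: "jump (base_config n f) (base_config n (nat_swap q (Suc q) \<circ> f)) = swap_value q"
    if f: "f permutes {..<n}" "base_config n f \<in> ?C" "base_config n (nat_swap q (Suc q) \<circ> f) \<in> ?C"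
      and q: "Suc q < n" and jk: "j < n" "k < n" "f j = q" "f k = Suc q" "j < k" for f q j k
  proof -
    have tq: "nat_swap q (Suc q) permutes {..<n}" using q by (intro permutes_swap_id) auto
    note g = base_config_generic[OF f(1)] base_config_generic[OF permutes_compose[OF f(1) tq]]
    show ?thesis
      by (rule jump_swap[OF q g(1,3) C f(2,3), where j = j and k = k])
        (use jk q g(2,4) base_pt_less(2)[of n j k] in \<open>auto simp: base_config_def\<close>)
  qed
  have perms: "?s \<circ> id permutes {..<n}" "?t \<circ> (?s \<circ> id) permutes {..<n}" "?s \<circ> (?t \<circ> (?s \<circ> id)) permutes {..<n}"
    "?t \<circ> id permutes {..<n}" "?s \<circ> (?t \<circ> id) permutes {..<n}" "?t \<circ> (?s \<circ> (?t \<circ> id)) permutes {..<n}"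
    using st by (auto intro!: permutes_compose permutes_id)
  have inC: "base_config n id \<in> ?C" "base_config n (?s \<circ> id) \<in> ?C" "base_config n (?t \<circ> (?s \<circ> id)) \<in> ?C"
    "base_config n (?s \<circ> (?t \<circ> (?s \<circ> id))) \<in> ?C"
    "base_config n (?t \<circ> id) \<in> ?C" "base_config n (?s \<circ> (?t \<circ> id)) \<in> ?C" "base_config n (?t \<circ> (?s \<circ> (?t \<circ> id))) \<in> ?C"
    by (rule moved; (rule perms permutes_id | (auto simp: Transposition.transpose_def)[1]))+
  have eq: "?s \<circ> (?t \<circ> (?s \<circ> id)) = ?t \<circ> (?s \<circ> (?t \<circ> id))"
    by (auto simp: fun_eq_iff Transposition.transpose_def)
  note gen = base_config_generic(1)[OF permutes_id] base_config_generic(1)[OF perms(1)] base_config_generic(1)[OF perms(2)]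
    base_config_generic(1)[OF perms(3)] base_config_generic(1)[OF perms(4)] base_config_generic(1)[OF perms(5)]
    base_config_generic(1)[OF perms(6)]
  have "jump (base_config n id) (base_config n (?s \<circ> (?t \<circ> (?s \<circ> id)))) =
      jump (base_config n id) (base_config n (?s \<circ> id)) *
      (jump (base_config n (?s \<circ> id)) (base_config n (?t \<circ> (?s \<circ> id))) *
       jump (base_config n (?t \<circ> (?s \<circ> id))) (base_config n (?s \<circ> (?t \<circ> (?s \<circ> id)))))"
    using jump_triangle[OF C] inC gen by metis
  also have "\<dots> = swap_value r * (swap_value (Suc r) * swap_value r)"
    using step[OF permutes_id inC(1,2), of ?a ?b] step[OF perms(1) inC(2,3), of ?a ?c] step[OF perms(2) inC(3,4), of ?b ?c] r
    by (simp add: Transposition.transpose_def)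
  finally have 1: "jump (base_config n id) (base_config n (?s \<circ> (?t \<circ> (?s \<circ> id)))) = swap_value r * (swap_value (Suc r) * swap_value r)" .
  have "jump (base_config n id) (base_config n (?t \<circ> (?s \<circ> (?t \<circ> id)))) =
      jump (base_config n id) (base_config n (?t \<circ> id)) *
      (jump (base_config n (?t \<circ> id)) (base_config n (?s \<circ> (?t \<circ> id))) *
       jump (base_config n (?s \<circ> (?t \<circ> id))) (base_config n (?t \<circ> (?s \<circ> (?t \<circ> id)))))"
    using jump_triangle[OF C] inC gen by metis
  also have "\<dots> = swap_value (Suc r) * (swap_value r * swap_value (Suc r))"
    using step[OF permutes_id inC(1,5), of ?b ?c] step[OF perms(4) inC(5,6), of ?a ?c] step[OF perms(5) inC(6,7), of ?a ?b] r
    by (simp add: Transposition.transpose_def)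
  \<comment> \<open>Both routes to the reversed order agree; since values commute, the relation s t
    s = t s t cancels to s = t.\<close>
  finally show ?thesis
    using 1 eq swap_value_nonzero[of r] swap_value_nonzero[of "Suc r"] r by simp
qed

lemma swap_value_eq:
  assumes "Suc r < n" "Suc q < n"
  shows "swap_value r = swap_value q"
proof -
  have "swap_value k = swap_value 0" if "Suc k < n" for k
    using that by (induction k) (use swap_value_Suc in force)+
  then show ?thesis using assms by metis
qed

definition inversions :: "(nat \<Rightarrow> complex) \<Rightarrow> nat" where
  "inversions x = card {(i,j). i < j \<and> j < n \<and> Re (x j) < Re (x i)}"

lemma finite_pairs: "finite {(i,j). i < j \<and> j < n \<and> P i j}"
  by (rule finite_subset[of _ "{..<n} \<times> {..<n}"]) auto

text \<open>Induction on the number of pairs whose horizontal orders at \<open>x\<close> and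
  \<open>y\<close> differ. Such a pair can be chosen adjacent, and exchanging its real parts is one
  elementary crossing inside the same convex set.\<close>

lemma jump_parity:
  assumes sv: "\<And>r. Suc r < n \<Longrightarrow> swap_value r = \<epsilon>" and eps: "\<epsilon>\<^sup>2 = 1" and sep: "separates n (R \<union> M)"
    and "generic n x" "x \<in> ordered_configs n R M" and y: "generic n y" "y \<in> ordered_configs n R M"
  shows "jump x y = \<epsilon> ^ (inversions x + inversions y)"
  using assms(4,5)
proof (induction "card {(i,j). i < n \<and> j < n \<and> Re (x i) < Re (x j) \<and> Re (y j) < Re (y i)}" arbitrary: x rule: less_induct)
  case (less x)
  note C = tconvex_ordered_configs[OF sep]
  have neq: "Re (z i) \<noteq> Re (z j)" if "generic n z" "i < n" "j < n" "i \<noteq> j" for z i j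
    using that by (auto simp: generic_def inj_on_def)
  let ?D = "\<lambda>x. {(i,j). i < n \<and> j < n \<and> Re (x i) < Re (x j) \<and> Re (y j) < Re (y i)}"
  have finD: "finite (?D z)" for z by (rule finite_subset[of _ "{..<n} \<times> {..<n}"]) auto
  show ?case
  proof (cases "?D x = {}")
    case True
    have same: "Re (x i) < Re (x j) \<longleftrightarrow> Re (y i) < Re (y j)" if "i < n" "j < n" for i j
    proof (cases "i = j")
      case False
      have "\<not> (Re (x i) < Re (x j) \<and> Re (y j) < Re (y i))" "\<not> (Re (x j) < Re (x i) \<and> Re (y i) < Re (y j))"
        using True that by auto
      then show ?thesis using neq[OF less.prems(1) that False] neq[OF y(1) that False] by linarith
    qed simp
    have "jump x y = 1"
      using same by (intro jump_same_order less.prems y) (auto simp: re_rank_def intro!: arg_cong[of _ _ card])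
    moreover have "inversions x = inversions y"
      unfolding inversions_def using same by (intro arg_cong[of _ _ card]) auto
    ultimately show ?thesis using eps by (simp flip: mult_2 add: power_mult)
  next
    case False
    \<comment> \<open>A discordant pair of least rank difference is adjacent: a point between the
      two would be discordant with one of them at smaller rank difference.\<close>
    define gap where "gap p = re_rank n x (snd p) - re_rank n x (fst p)" for p
    obtain p where p: "p \<in> ?D x" "\<And>p'. p' \<in> ?D x \<Longrightarrow> gap p \<le> gap p'"
      using ex_has_least_nat[of "\<lambda>p. p \<in> ?D x" _ gap] False by force
    obtain j k where jk: "p = (j,k)" by (cases p)
    have d: "j < n" "k < n" "Re (x j) < Re (x k)" "Re (y k) < Re (y j)" using p(1) jk by auto
    have rjk: "re_rank n x j < re_rank n x k" using re_rank_less_iff[of j n k x] d by simp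
    have bij: "bij_betw (re_rank n x) {..<n} {..<n}"
      using less.prems(1) by (intro bij_re_rank) (simp add: generic_def)
    define r where "r = re_rank n x j"
    have rk: "re_rank n x k = Suc r"
    proof (rule ccontr)
      assume "re_rank n x k \<noteq> Suc r"
      then have lt: "Suc r < re_rank n x k" using rjk by (simp add: r_def)
      have "Suc r \<in> re_rank n x ` {..<n}"
        using bij lt re_rank_less[OF d(2), of x] by (auto simp: bij_betw_def)
      then obtain l where l: "l < n" "re_rank n x l = Suc r" by auto
      have lx: "Re (x j) < Re (x l)" "Re (x l) < Re (x k)"
        using re_rank_less_iff[of j n l x] re_rank_less_iff[of l n k x] l lt d by (auto simp: r_def)
      have "l \<noteq> j" using l r_def by auto
      then have "Re (y l) \<noteq> Re (y j)" using neq[OF y(1) l(1) d(1)] by simp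
      then consider "Re (y l) < Re (y j)" | "Re (y j) < Re (y l)" by linarith
      then show False
      proof cases
        case 1
        then have "(j,l) \<in> ?D x" using d l lx by auto
        from p(2)[OF this] show False using l lt by (simp add: gap_def jk r_def)
      next
        case 2
        then have "(l,k) \<in> ?D x" using d l lx by auto
        from p(2)[OF this] show False using l lt rjk by (simp add: gap_def jk r_def)
      qed
    qed
    have r: "Suc r < n" using re_rank_less[OF d(2), of x] rk by simp
    have "j \<noteq> k" using d by auto
    \<comment> \<open>Only real parts move, so the vertical constraints are kept.\<close>
    define x' where "x' = x(j := Complex (Re (x k)) (Im (x j)), k := Complex (Re (x j)) (Im (x k)))"
    let ?\<tau> = "nat_swap j k"
    have \<tau>: "?\<tau> permutes {..<n}" using d by (intro permutes_swap_id) auto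
    have Rex': "Re (x' i) = Re (x (?\<tau> i))" for i
      using \<open>j \<noteq> k\<close> by (auto simp: x'_def Transposition.transpose_def)
    have Imx': "Im (x' i) = Im (x i)" for i by (auto simp: x'_def)
    have rkx': "re_rank n x' i = re_rank n x (?\<tau> i)" if "i < n" for i
      using re_rank_permute[OF \<tau>, of x' x i] Rex' that by simp
    have rinj: "re_rank n x i = re_rank n x l \<longleftrightarrow> i = l" if "i < n" "l < n" for i l
      using bij that by (auto simp: bij_betw_def inj_on_def)
    have rr: "re_rank n x i = r \<longleftrightarrow> i = j" "re_rank n x i = Suc r \<longleftrightarrow> i = k" if "i < n" for i
      using rinj[OF that d(1)] rinj[OF that d(2)] rk r_def by auto
    have rkx: "re_rank n x' i = nat_swap r (Suc r) (re_rank n x i)" if "i < n" for i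
      using rkx'[OF that] rk r_def rr[OF that] by (auto simp: Transposition.transpose_def)
    have keep: "Re (x' i) < Re (x' l) \<longleftrightarrow> Re (x i) < Re (x l)"
      if "i < n" "l < n" "(i,l) \<noteq> (j,k)" "(i,l) \<noteq> (k,j)" for i l
    proof -
      have "(re_rank n x i, re_rank n x l) \<noteq> (r, Suc r)" "(re_rank n x i, re_rank n x l) \<noteq> (Suc r, r)"
        using rr that by auto
      then have "re_rank n x' i < re_rank n x' l \<longleftrightarrow> re_rank n x i < re_rank n x l"
        using rkx that by (auto simp: Transposition.transpose_def)
      then show ?thesis using re_rank_less_iff that by simp
    qed
    have flip: "Re (x' k) < Re (x' j)" using d \<open>j \<noteq> k\<close> by (simp add: x'_def)
    have notR: "(j,k) \<notin> R" "(k,j) \<notin> R" using less.prems(2) y(2) d by (auto simp: ordered_configs_def)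
    have xbox: "x i \<in> sq_box" if "i < n" for i using less.prems(1) that by (simp add: generic_def topspace_box_config)
    have x'C: "x' \<in> ordered_configs n R M"
    proof (rule ordered_configsI[OF sep])
      show "x' \<in> extensional {..<n}"
        using less.prems(1) d by (auto simp: generic_def topspace_box_config x'_def extensional_def)
      show "x' i \<in> sq_box" if "i < n" for i
        using xbox[OF that] xbox[OF d(1)] xbox[OF d(2)] by (auto simp: x'_def sq_box_def)
      show "Re (x' i) < Re (x' l)" if "(i,l) \<in> R" for i l
      proof -
        have "i < n" "l < n" using that sep by (auto simp: separates_def)
        then show ?thesis using keep[of i l] that notR less.prems(2) by (auto simp: ordered_configs_def)
      qed
      show "Im (x' i) < Im (x' l)" if "(i,l) \<in> M" for i l
        using that less.prems(2) Imx' by (auto simp: ordered_configs_def)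
    qed
    have x'g: "generic n x'"
    proof -
      have "inj_on ((\<lambda>i. Re (x i)) \<circ> ?\<tau>) {..<n}"
        using less.prems(1) permutes_inj_on[OF \<tau>] permutes_image[OF \<tau>]
        by (intro comp_inj_on) (auto simp: generic_def)
      then show ?thesis using x'C Rex' by (simp add: generic_def ordered_configs_def o_def)
    qed
    have eps': "inverse \<epsilon> = \<epsilon>" using eps by (intro inverse_unique) (simp add: power2_eq_square)
    \<comment> \<open>A discordant pair cannot be constrained horizontally, so it is constrained
      vertically. If the right point is the lower one, the reversed crossing is elementary, and
      \<open>\<epsilon>\<close> is its own inverse.\<close>
    have "(j,k) \<in> M \<or> (k,j) \<in> M" using notR sep d \<open>j \<noteq> k\<close> by (auto simp: separates_def)
    then have step: "jump x x' = \<epsilon>"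
    proof
      assume "(j,k) \<in> M"
      then have "Im (x j) < Im (x k)" using less.prems(2) by (auto simp: ordered_configs_def)
      then show ?thesis
        using jump_swap[OF r less.prems(1) x'g C less.prems(2) x'C rkx d(1,2) _ rk] sv[OF r] Imx' r_def by simp
    next
      assume "(k,j) \<in> M"
      then have im: "Im (x k) < Im (x j)" using less.prems(2) by (auto simp: ordered_configs_def)
      have "re_rank n x i = nat_swap r (Suc r) (re_rank n x' i)" if "i < n" for i using rkx[OF that] by simp
      moreover have "re_rank n x' k = r" "re_rank n x' j = Suc r" using rkx d rk r_def by (auto simp: Transposition.transpose_def)
      ultimately have "jump x' x = \<epsilon>"
        using jump_swap[OF r x'g less.prems(1) C x'C less.prems(2) _ d(2,1)] sv[OF r] Imx' im by simp
      moreover have "jump x x' * jump x' x = jump x x"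
        by (rule jump_triangle[OF C]) (use less.prems x'C x'g in auto)
      moreover have "jump x x = 1" by (rule jump_same_order) (use less.prems in auto)
      ultimately show ?thesis using eps' by (metis inverse_unique mult.commute)
    qed
    have Deq: "?D x' = ?D x - {(j,k)}"
    proof (rule Set.set_eqI)
      fix q show "q \<in> ?D x' \<longleftrightarrow> q \<in> ?D x - {(j,k)}"
      proof (cases "q = (j,k) \<or> q = (k,j)")
        case True
        then show ?thesis using flip d by auto
      next
        case False
        then show ?thesis using keep[of "fst q" "snd q"] by (cases q) auto
      qed
    qed
    have mem: "(j,k) \<in> ?D x" using p(1) jk by simp
    have "card (?D x') < card (?D x)"
      unfolding Deq by (rule card_Diff1_less[OF finD mem])
    from less.hyps[OF this x'g x'C] have IH: "jump x' y = \<epsilon> ^ (inversions x' + inversions y)" .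
    \<comment> \<open>The exchange changes the order of this one pair, so the parity flips.\<close>
    have inv: "inversions x' = Suc (inversions x) \<or> inversions x = Suc (inversions x')"
    proof -
      let ?I = "\<lambda>x. {(i,l). i < l \<and> l < n \<and> Re (x l) < Re (x i)}"
      have other: "q \<in> ?I x' \<longleftrightarrow> q \<in> ?I x" if "q \<noteq> (j,k)" "q \<noteq> (k,j)" for q
        using keep[of "snd q" "fst q"] that by (cases q) auto
      have fin: "finite (?I z)" for z by (rule finite_pairs)
      show ?thesis
      proof (cases "j < k")
        case True
        have "?I x' = insert (j,k) (?I x)"
        proof (rule Set.set_eqI)
          fix q show "q \<in> ?I x' \<longleftrightarrow> q \<in> insert (j,k) (?I x)"
            using other[of q] True d flip by (cases "q = (j,k)"; cases "q = (k,j)") auto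
        qed
        moreover have "(j,k) \<notin> ?I x" using d by auto
        ultimately show ?thesis unfolding inversions_def using fin[of x] by (simp add: card_insert_disjoint)
      next
        case False
        then have "k < j" using \<open>j \<noteq> k\<close> by simp
        have "?I x = insert (k,j) (?I x')"
        proof (rule Set.set_eqI)
          fix q show "q \<in> ?I x \<longleftrightarrow> q \<in> insert (k,j) (?I x')"
            using other[of q] \<open>k < j\<close> d flip by (cases "q = (j,k)"; cases "q = (k,j)") auto
        qed
        moreover have "(k,j) \<notin> ?I x'" using flip by auto
        ultimately show ?thesis unfolding inversions_def using fin[of x'] by (simp add: card_insert_disjoint)
      qed
    qed
    have "jump x y = jump x x' * jump x' y"
      by (rule jump_triangle[OF C, symmetric]) (use less.prems x'C x'g y in auto)
    also have "\<dots> = \<epsilon> ^ Suc (inversions x' + inversions y)" using step IH by simp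
    also have "\<dots> = \<epsilon> ^ (inversions x + inversions y)"
      using inv eps by (auto simp: power2_eq_square)
    finally show ?thesis .
  qed
qed

text \<open>Membership is a finite set of strict inequalities, hence stable under small shifts; the
  shift \<open>\<epsilon> * real i\<close> in the real direction differs from point to point and
  breaks all ties.\<close>

lemma generic_nearby:
  assumes z: "z \<in> ordered_configs n R M" "z \<in> ordered_configs n R' M'" and sep: "separates n (R \<union> M)" "separates n (R' \<union> M')"
  obtains w where "generic n w" "w \<in> ordered_configs n R M" "w \<in> ordered_configs n R' M'"
proof -
  define w where "w \<epsilon> = restrict (\<lambda>i. z i + of_real (\<epsilon> * real i)) {..<n}" for \<epsilon> :: real
  have less: "\<forall>\<^sub>F \<epsilon> in at_right 0. a + \<epsilon> * c < b + \<epsilon> * d" if "a < b" for a b c d :: real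
  proof -
    have "((\<lambda>\<epsilon>. a + \<epsilon> * c) \<longlongrightarrow> a) (at_right 0)" "((\<lambda>\<epsilon>. b + \<epsilon> * d) \<longlongrightarrow> b) (at_right 0)"
      by (auto intro!: tendsto_eq_intros)
    from tendsto_diff[OF this] have "((\<lambda>\<epsilon>. (a + \<epsilon> * c) - (b + \<epsilon> * d)) \<longlongrightarrow> a - b) (at_right 0)" .
    from order_tendstoD(2)[OF this, of 0] have "\<forall>\<^sub>F \<epsilon> in at_right 0. (a + \<epsilon> * c) - (b + \<epsilon> * d) < 0" using that by simp
    then show ?thesis by (rule eventually_mono) simp
  qed
  have fin: "finite R" "finite R'"
    using separates_finite sep by blast+
  have zbox: "\<bar>Re (z i)\<bar> < 1/2" "\<bar>Im (z i)\<bar> < 1/2" if "i < n" for i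
  proof -
    have "z i \<in> sq_box" using z(1) that by (simp add: ordered_configs_def topspace_box_config)
    then show "\<bar>Re (z i)\<bar> < 1/2" "\<bar>Im (z i)\<bar> < 1/2" unfolding sq_box_def by auto
  qed
  have "\<forall>\<^sub>F \<epsilon> in at_right 0. \<forall>i\<in>{..<n}. Re (z i) + \<epsilon> * real i < 1/2 + \<epsilon> * 0 \<and> - (1/2) + \<epsilon> * 0 < Re (z i) + \<epsilon> * real i"
  proof (intro eventually_ball_finite ballI eventually_conj less)
    fix i assume "i \<in> {..<n}"
    then show "Re (z i) < 1/2" "- (1/2) < Re (z i)" using zbox(1)[of i] by auto
  qed simp
  moreover have "\<forall>\<^sub>F \<epsilon> in at_right 0. \<forall>p\<in>R. Re (z (fst p)) + \<epsilon> * real (fst p) < Re (z (snd p)) + \<epsilon> * real (snd p)"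
    using z(1) fin by (intro eventually_ball_finite ballI less) (auto simp: ordered_configs_def)
  moreover have "\<forall>\<^sub>F \<epsilon> in at_right 0. \<forall>p\<in>R'. Re (z (fst p)) + \<epsilon> * real (fst p) < Re (z (snd p)) + \<epsilon> * real (snd p)"
    using z(2) fin by (intro eventually_ball_finite ballI less) (auto simp: ordered_configs_def)
  moreover have "\<forall>\<^sub>F \<epsilon> in at_right 0. \<forall>p\<in>{..<n} \<times> {..<n}. fst p \<noteq> snd p \<longrightarrow>
      Re (z (fst p)) + \<epsilon> * real (fst p) \<noteq> Re (z (snd p)) + \<epsilon> * real (snd p)"
  proof (intro eventually_ball_finite ballI)
    fix p assume "p \<in> {..<n} \<times> {..<n}"
    consider "Re (z (fst p)) < Re (z (snd p))" | "Re (z (snd p)) < Re (z (fst p))" | "Re (z (fst p)) = Re (z (snd p))" by linarith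
    then show "\<forall>\<^sub>F \<epsilon> in at_right 0. fst p \<noteq> snd p \<longrightarrow>
        Re (z (fst p)) + \<epsilon> * real (fst p) \<noteq> Re (z (snd p)) + \<epsilon> * real (snd p)"
    proof cases
      case 1
      show ?thesis by (rule eventually_mono[OF less[OF 1, of "real (fst p)" "real (snd p)"]]) auto
    next
      case 2
      show ?thesis by (rule eventually_mono[OF less[OF 2, of "real (snd p)" "real (fst p)"]]) auto
    next
      case 3
      have "\<forall>\<^sub>F \<epsilon>::real in at_right 0. 0 < \<epsilon>" by (simp add: eventually_at_right_less)
      then show ?thesis by (rule eventually_mono) (use 3 in auto)
    qed
  qed simp
  ultimately have "\<forall>\<^sub>F \<epsilon>::real in at_right 0. generic n (w \<epsilon>) \<and> w \<epsilon> \<in> ordered_configs n R M \<and> w \<epsilon> \<in> ordered_configs n R' M'"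
  proof eventually_elim
    case (elim \<epsilon>)
    have lt: "i < n" "j < n" if "(i,j) \<in> R \<union> M \<union> (R' \<union> M')" for i j
      using that sep by (auto simp: separates_def)
    have wb: "w \<epsilon> i \<in> sq_box" if "i < n" for i
    proof -
      have "Re (z i) + \<epsilon> * real i < 1/2" "- (1/2) < Re (z i) + \<epsilon> * real i" using elim(1) that by auto
      then have "\<bar>Re (z i) + \<epsilon> * real i\<bar> < 1/2" unfolding abs_less_iff by linarith
      then show ?thesis using zbox(2)[OF that] that by (simp add: w_def sq_box_def)
    qed
    have wR: "Re (w \<epsilon> i) = Re (z i) + \<epsilon> * real i" "Im (w \<epsilon> i) = Im (z i)" if "i < n" for i
      using that by (simp_all add: w_def)
    have 1: "w \<epsilon> \<in> ordered_configs n R M"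
      by (rule ordered_configsI[OF sep(1)]) (use elim(2) wb wR lt z(1) in \<open>force simp: w_def ordered_configs_def\<close>)+
    moreover have "w \<epsilon> \<in> ordered_configs n R' M'"
      by (rule ordered_configsI[OF sep(2)]) (use elim(3) wb wR lt z(2) in \<open>force simp: w_def ordered_configs_def\<close>)+
    moreover have "inj_on (\<lambda>i. Re (w \<epsilon> i)) {..<n}"
      using elim(4) wR by (auto simp: inj_on_def)
    ultimately show ?case by (simp add: generic_def ordered_configs_def)
  qed
  then have "\<exists>\<epsilon>::real. generic n (w \<epsilon>) \<and> w \<epsilon> \<in> ordered_configs n R M \<and> w \<epsilon> \<in> ordered_configs n R' M'"
    by (rule eventually_happens'[rotated]) simp
  then show ?thesis using that by blast
qed

text \<open>Pairs with equal real part are ordered by height, all others horizontally. The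
  inequalities of \<open>Rof z\<close> and \<open>Mof z\<close> describe a convex open neighbourhood
  of \<open>z\<close>.\<close>

definition Rof where "Rof z = {(i,j). i < n \<and> j < n \<and> Re (z i) < Re (z j)}" for z :: "nat \<Rightarrow> complex"
definition Mof where "Mof z = {(i,j). i < n \<and> j < n \<and> Re (z i) = Re (z j) \<and> Im (z i) < Im (z j)}" for z :: "nat \<Rightarrow> complex"

lemma separates_of:
  assumes "z \<in> topspace (box_config n)"
  shows "separates n (Rof z \<union> Mof z)" "z \<in> ordered_configs n (Rof z) (Mof z)"
proof -
  have "Re (z i) \<noteq> Re (z j) \<or> Im (z i) \<noteq> Im (z j)" if "i < n" "j < n" "i \<noteq> j" for i j
    using assms that complex_eqI[of "z i" "z j"] by (auto simp: topspace_box_config inj_on_def)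
  then have "(i,j) \<in> Rof z \<union> Mof z \<or> (j,i) \<in> Rof z \<union> Mof z" if "i < n" "j < n" "i \<noteq> j" for i j
    unfolding Rof_def Mof_def using that by force
  then show "separates n (Rof z \<union> Mof z)"
    unfolding separates_def by (auto simp: Rof_def Mof_def)
  show "z \<in> ordered_configs n (Rof z) (Mof z)"
    using assms by (auto simp: ordered_configs_def Rof_def Mof_def)
qed

lemma openin_ordered_configs:
  assumes "separates n (R \<union> M)"
  shows "openin (box_config n) (ordered_configs n R M)"
proof -
  have fin: "finite R" "finite M"
    using separates_finite[OF assms] by blast+
  have lt: "fst p < n" "snd p < n" if "p \<in> R \<or> p \<in> M" for p
    using that assms by (auto simp: separates_def)
  have c: "continuous_map (box_config n) euclidean (\<lambda>x. x i)" if "i < n" for i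
    using continuous_map_config_proj[OF that, of "top_of_set sq_box"] by (simp add: continuous_map_in_subtopology)
  have o1: "openin (box_config n) {x \<in> topspace (box_config n). Re (x i) < Re (x j)}" if "i < n" "j < n" for i j
  proof -
    have "continuous_map (box_config n) euclideanreal ((\<lambda>z. Re z) \<circ> (\<lambda>x. x j - x i))"
      by (rule continuous_map_compose[OF continuous_map_diff[OF c c]]) (use that in \<open>auto intro: continuous_intros\<close>)
    from openin_continuous_map_preimage[OF this, of "{0<..}"] show ?thesis by simp
  qed
  have o2: "openin (box_config n) {x \<in> topspace (box_config n). Im (x i) < Im (x j)}" if "i < n" "j < n" for i j
  proof -
    have "continuous_map (box_config n) euclideanreal ((\<lambda>z. Im z) \<circ> (\<lambda>x. x j - x i))"
      by (rule continuous_map_compose[OF continuous_map_diff[OF c c]]) (use that in \<open>auto intro: continuous_intros\<close>)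
    from openin_continuous_map_preimage[OF this, of "{0<..}"] show ?thesis by simp
  qed
  have "ordered_configs n R M =
      ((\<Inter>p\<in>R. {x \<in> topspace (box_config n). Re (x (fst p)) < Re (x (snd p))}) \<inter> topspace (box_config n)) \<inter>
      ((\<Inter>p\<in>M. {x \<in> topspace (box_config n). Im (x (fst p)) < Im (x (snd p))}) \<inter> topspace (box_config n))"
    unfolding ordered_configs_def case_prod_beta by blast
  also have "openin (box_config n) \<dots>"
    by (intro openin_Int[OF openin_INT[OF fin(1)] openin_INT[OF fin(2)]] o1 o2) (use lt in auto)
  finally show ?thesis .
qed

text \<open>If all elementary crossings have the same value \<open>\<epsilon> = \<plusminus>1\<close>, then a path is evaluated by the
  parities of the horizontal orders of its endpoints.\<close>

theorem box_potential:
  assumes sv: "\<And>r. Suc r < n \<Longrightarrow> swap_value r = \<epsilon>" and eps: "\<epsilon>\<^sup>2 = 1"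
  obtains G where "\<And>z. z \<in> topspace (box_config n) \<Longrightarrow> G z \<noteq> 0"
    "\<And>p. pathin (box_config n) p \<Longrightarrow> \<Psi> p = G (p 1) / G (p 0)"
    "\<And>x. generic n x \<Longrightarrow> G x = gauge x * \<epsilon> ^ inversions x"
proof -
  \<comment> \<open>On generic configurations \<open>jump_parity\<close> becomes
    \<open>seg x y = g y / g x\<close>; it remains to extend \<open>g\<close> to configurations with
    coinciding real parts.\<close>
  define g where "g x = gauge x * \<epsilon> ^ inversions x" for x
  have eps0: "\<epsilon> \<noteq> 0" using eps by auto
  have g0: "g x \<noteq> 0" if "generic n x" for x using gauge_nonzero[OF that] eps0 by (simp add: g_def)
  have gseg: "seg x y = g y / g x"
    if "separates n (R \<union> M)" "generic n x" "generic n y" "x \<in> ordered_configs n R M" "y \<in> ordered_configs n R M" for x y R M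
  proof -
    have "jump x y = \<epsilon> ^ (inversions x + inversions y)"
      by (rule jump_parity[OF sv eps that(1,2,4,3,5)])
    then have "seg x y = gauge y / gauge x * (\<epsilon> ^ inversions x * \<epsilon> ^ inversions y)"
      unfolding jump_def using gauge_nonzero that(2,3) by (simp add: field_simps power_add)
    moreover have "inverse (\<epsilon> ^ inversions x) = \<epsilon> ^ inversions x"
    proof -
      have "\<epsilon> * \<epsilon> = 1" using eps by (simp add: power2_eq_square)
      then have "\<epsilon> ^ inversions x * \<epsilon> ^ inversions x = 1" by (metis power_mult_distrib power_one)
      then show ?thesis by (rule inverse_unique)
    qed
    moreover have "g y / g x = gauge y / gauge x * (inverse (\<epsilon> ^ inversions x) * \<epsilon> ^ inversions y)"
      by (simp add: g_def divide_simps)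
    ultimately show ?thesis by simp
  qed
  \<comment> \<open>Two generic starting points are compared through a generic \<open>w\<close> near
    \<open>z\<close> that lies in both convex sets.\<close>
  have transfer: "g x * seg x z = g y * seg y z"
    if C: "separates n (R \<union> M)" "separates n (R' \<union> M')" and z: "z \<in> ordered_configs n R M" "z \<in> ordered_configs n R' M'"
      and x: "generic n x" "x \<in> ordered_configs n R M" and y: "generic n y" "y \<in> ordered_configs n R' M'"
    for x y z R M R' M'
  proof -
    obtain w where w: "generic n w" "w \<in> ordered_configs n R M" "w \<in> ordered_configs n R' M'"
      using generic_nearby[OF z C] .
    have "g x * seg x z = g w * seg w z"
      using seg_triangle[OF tconvex_ordered_configs[OF C(1)] x(2) w(2) z(1)] gseg[OF C(1) x(1) w(1) x(2) w(2)] g0[OF x(1)]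
      by (simp add: field_simps)
    moreover have "g y * seg y z = g w * seg w z"
      using seg_triangle[OF tconvex_ordered_configs[OF C(2)] y(2) w(3) z(2)] gseg[OF C(2) y(1) w(1) y(2) w(3)] g0[OF y(1)]
      by (simp add: field_simps)
    ultimately show ?thesis by simp
  qed
  define near where "near z = (SOME x. generic n x \<and> x \<in> ordered_configs n (Rof z) (Mof z))" for z
  have near: "generic n (near z)" "near z \<in> ordered_configs n (Rof z) (Mof z)" if z: "z \<in> topspace (box_config n)" for z
  proof -
    have "\<exists>x. generic n x \<and> x \<in> ordered_configs n (Rof z) (Mof z)"
      using generic_nearby[OF separates_of(2)[OF z] separates_of(2)[OF z] separates_of(1)[OF z] separates_of(1)[OF z]] by blast
    from someI_ex[OF this] show "generic n (near z)" "near z \<in> ordered_configs n (Rof z) (Mof z)"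
      unfolding near_def by auto
  qed
  define G where "G z = g (near z) * seg (near z) z" for z
  have G: "G z = g x * seg x z"
    if "separates n (R \<union> M)" "z \<in> ordered_configs n R M" "generic n x" "x \<in> ordered_configs n R M" for x z R M
  proof -
    have z: "z \<in> topspace (box_config n)" using that(2) by (simp add: ordered_configs_def)
    show ?thesis unfolding G_def
      by (rule transfer[OF separates_of(1)[OF z] that(1) separates_of(2)[OF z] that(2) near[OF z] that(3,4)])
  qed
  have G0: "G z \<noteq> 0" if z: "z \<in> topspace (box_config n)" for z
    unfolding G_def using g0[OF near(1)[OF z]] near(2)[OF z]
      seg_nonzero[OF tconvex_ordered_configs[OF separates_of(1)[OF z]] _ separates_of(2)[OF z]] by simp
  have "\<Psi> p = G (p 1) / G (p 0)" if "pathin (box_config n) p" for p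
  proof (rule path_char_local_potential[OF pc G0 _ that])
    fix z assume z: "z \<in> topspace (box_config n)"
    let ?V = "ordered_configs n (Rof z) (Mof z)"
    note sep = separates_of(1)[OF z]
    have "\<Psi> p = G (p 1) / G (p 0)" if p: "pathin (box_config n) p" "p ` {0..1} \<subseteq> ?V" for p
    proof -
      have e: "p 0 \<in> ?V" "p 1 \<in> ?V" using p(2) by auto
      have "seg (near z) (p 0) * seg (p 0) (p 1) = seg (near z) (p 1)"
        by (rule seg_triangle[OF tconvex_ordered_configs[OF sep] near(2)[OF z] e])
      moreover have "\<Psi> p = seg (p 0) (p 1)" by (rule seg_path[OF tconvex_ordered_configs[OF sep] p])
      moreover have "seg (near z) (p 0) \<noteq> 0" by (rule seg_nonzero[OF tconvex_ordered_configs[OF sep] near(2)[OF z] e(1)])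
      ultimately show ?thesis
        using G[OF sep e(1) near[OF z]] G[OF sep e(2) near[OF z]] g0[OF near(1)[OF z]] by (simp add: field_simps)
    qed
    then show "\<exists>V. openin (box_config n) V \<and> z \<in> V \<and>
        (\<forall>p. pathin (box_config n) p \<longrightarrow> p ` {0..1} \<subseteq> V \<longrightarrow> \<Psi> p = G (p 1) / G (p 0))"
      using openin_ordered_configs[OF sep] separates_of(2)[OF z] by blast
  qed auto
  moreover have "G x = gauge x * \<epsilon> ^ inversions x" if x: "generic n x" for x
  proof -
    have z: "x \<in> topspace (box_config n)" using x by (simp add: generic_def)
    show ?thesis using G[OF separates_of[OF z] x separates_of(2)[OF z]] seg_self[OF z] by (simp add: g_def)
  qed
  ultimately show ?thesis using that G0 by blast
qed

end

section \<open>Polygonal surfaces\<close>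

lemma norm_edge_point [simp]: "norm (edge_point m i t) = 1"
  by (simp add: edge_point_def)

lemma edge_glued_norm: "edge_glued w z z' \<Longrightarrow> norm z = 1 \<and> norm z' = 1"
  by (auto simp: edge_glued_def)

lemma equivclp_edge_glued_norm:
  "equivclp (edge_glued w) z z' \<Longrightarrow> z = z' \<or> norm z = 1 \<and> norm z' = 1"
  by (induction rule: equivclp_induct) (use edge_glued_norm in fastforce)+

text \<open>The \<open>m\<close>-th power forgets the edge and keeps the parameter modulo 1. When
  all glued edges have the same direction, it is constant on the classes of the gluing.\<close>

lemma edge_point_power: "m > 0 \<Longrightarrow> edge_point m i t ^ m = cis (2 * pi * t)"
proof -
  assume m: "m > 0"
  have "real m * (2 * pi * (real i + t) / real m) = 2 * pi * t + 2 * pi * real i"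
    using m by (auto simp: field_simps)
  moreover have "edge_point m i t ^ m = cis (real m * (2 * pi * (real i + t) / real m))"
    unfolding edge_point_def by (rule Complex.DeMoivre)
  ultimately have "edge_point m i t ^ m = cis (2 * pi * t + 2 * pi * real i)" by presburger
  also have "\<dots> = cis (2 * pi * t) * cis (2 * pi * real i)" by (simp only: cis_mult)
  also have "cis (2 * pi * real i) = 1"
    by (intro cis_multiple_2pi) simp
  finally show ?thesis by simp
qed

lemma edge_point_Suc: "edge_point m i 1 = edge_point m (Suc i) 0"
  by (simp add: edge_point_def algebra_simps)

lemma edge_point_wrap: "m > 0 \<Longrightarrow> edge_point m m 0 = edge_point m 0 0"
  by (simp add: edge_point_def)

lemma cis_eq_iff: "cis a = cis b \<longleftrightarrow> (\<exists>k::int. a - b = 2 * pi * of_int k)"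
proof -
  have "cis a = cis b \<longleftrightarrow> exp (\<i> * of_real a) = exp (\<i> * of_real b)" by (simp add: cis_conv_exp)
  also have "\<dots> \<longleftrightarrow> (\<exists>k::int. a - b = 2 * pi * of_int k)"
    unfolding exp_eq by (auto simp: complex_eq_iff algebra_simps)
  finally show ?thesis .
qed

lemma abs_2pi: "\<bar>y\<bar> < 1 \<Longrightarrow> \<bar>2 * pi * y\<bar> < 2 * pi"
  by (simp add: abs_mult)

lemma cis_eq_small:
  assumes "cis a = cis b" "\<bar>a - b\<bar> < 2 * pi"
  shows "a = b"
proof -
  obtain k :: int where k: "a - b = 2 * pi * of_int k" using assms(1) cis_eq_iff by blast
  have "2 * pi * \<bar>of_int k\<bar> < 2 * pi * 1"
    using assms(2) unfolding k by (simp add: abs_mult)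
  then have "\<bar>real_of_int k\<bar> < 1" using mult_less_cancel_left_pos[of "2 * pi" "\<bar>real_of_int k\<bar>" 1] pi_gt_zero by linarith
  then have "k = 0" by linarith
  then show ?thesis using k by simp
qed

section \<open>The quotient map of a polygon\<close>

locale polygon =
  fixes w :: scheme and X :: "'a topology" and q :: "complex \<Rightarrow> 'a"
  assumes quot: "quotient_map (top_of_set (cball 0 1)) X q"
    and fib: "\<And>z z'. z \<in> cball 0 1 \<Longrightarrow> z' \<in> cball 0 1 \<Longrightarrow> q z = q z' \<longleftrightarrow> equivclp (edge_glued w) z z'"
begin

lemma q_cont: "continuous_map (top_of_set (cball 0 1)) X q"
  using quot by (rule quotient_imp_continuous_map)

lemma q_surj: "u \<in> topspace X \<Longrightarrow> \<exists>z\<in>cball 0 1. q z = u"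
  using quotient_imp_surjective_map[OF quot] by force

lemma q_glued: "edge_glued w z z' \<Longrightarrow> q z = q z'"
  using edge_glued_norm[of w z z'] by (subst fib) auto

lemma q_interior:
  assumes "z \<in> cball 0 1" "norm z' < 1" "q z = q z'"
  shows "z = z'"
  using assms fib[of z z'] equivclp_edge_glued_norm[of w z z'] by auto

lemma q_in: "z \<in> cball 0 1 \<Longrightarrow> q z \<in> topspace X"
  using q_cont by (auto simp: continuous_map_def)

lemma q_compose:
  assumes "continuous_on A f" "f ` A \<subseteq> cball 0 1"
  shows "continuous_map (top_of_set A) X (\<lambda>a. q (f a))"
proof -
  have "continuous_map (top_of_set A) (top_of_set (cball 0 1)) f"
    using assms by (auto simp: continuous_map_in_subtopology)
  from continuous_map_compose[OF this q_cont] show ?thesis by (simp add: o_def)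
qed

end

section \<open>The nonorientable polygon: fibres of the quotient map, separation, local
  contractions\<close>

locale crosscap_polygon = polygon "projective_planes_scheme g" U q
  for g :: nat and U :: "'a topology" and q +
  assumes g: "g \<ge> 1"
begin

abbreviation m :: nat where "m \<equiv> 2 * g"

abbreviation glued where "glued \<equiv> edge_glued (projective_planes_scheme g)"

lemma m_pos: "m > 0" using g by simp

lemma scheme_length: "length (projective_planes_scheme k) = 2 * k"
  by (induction k) (auto simp: projective_planes_scheme_def)

lemma scheme_nth: "i < 2 * k \<Longrightarrow> projective_planes_scheme k ! i = (i div 2, True)"
proof (induction k)
  case (Suc k)
  have s: "projective_planes_scheme (Suc k) = projective_planes_scheme k @ [(k, True), (k, True)]"
    by (simp add: projective_planes_scheme_def)
  show ?case
  proof (cases "i < 2 * k")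
    case True
    then show ?thesis using Suc.IH by (simp add: s nth_append scheme_length)
  next
    case False
    then have "i = 2 * k \<or> i = Suc (2 * k)" using Suc.prems by auto
    then show ?thesis by (auto simp: s nth_append scheme_length)
  qed
qed simp

lemma glued_iff:
  "glued z z' \<longleftrightarrow> (\<exists>a<m. \<exists>b<m. \<exists>t\<in>{0..1}. a div 2 = b div 2 \<and> z = edge_point m a t \<and> z' = edge_point m b t)"
  unfolding edge_glued_def scheme_length by (simp add: scheme_nth cong: conj_cong)

lemma glued_sym: "glued z z' \<Longrightarrow> glued z' z"
  unfolding glued_iff by metis

lemma glued_power: "glued z z' \<Longrightarrow> z ^ m = z' ^ m"
  unfolding glued_iff using edge_point_power[OF m_pos] by auto

lemma equiv_induct [consumes 1, case_names base step]:
  assumes "equivclp glued z z'" "P z" "\<And>y y'. P y \<Longrightarrow> glued y y' \<Longrightarrow> P y'"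
  shows "P z'"
  using assms(1,2) by (induction rule: equivclp_induct) (use assms(3) glued_sym in blast)+

lemma equiv_power: "equivclp glued z z' \<Longrightarrow> z' ^ m = z ^ m"
  by (induction rule: equiv_induct) (use glued_power in auto)

text \<open>Away from the vertices, where the \<open>m\<close>-th power is 1, the power recovers the
  parameter, and then the angle recovers the edge.\<close>

lemma edge_point_inj:
  assumes "a < m" "b < m" "t \<in> {0..1}" "s \<in> {0..1}" "edge_point m a t = edge_point m b s" "edge_point m a t ^ m \<noteq> 1"
  shows "a = b \<and> t = s"
proof -
  have "cis (2 * pi * t) = cis (2 * pi * s)" using assms(5) edge_point_power[OF m_pos] by metis
  moreover have "t \<noteq> 0" "t \<noteq> 1" "s \<noteq> 0" "s \<noteq> 1"
    using assms(5,6) edge_point_power[OF m_pos] by (metis cis_2pi cis_zero mult.right_neutral mult_zero_right)+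
  ultimately have ts: "t = s"
  proof -
    have "\<bar>t - s\<bar> < 1" using assms(3,4) \<open>t \<noteq> 0\<close> \<open>t \<noteq> 1\<close> \<open>s \<noteq> 0\<close> \<open>s \<noteq> 1\<close> by (auto simp: abs_if)
    then have "\<bar>2 * pi * t - 2 * pi * s\<bar> < 2 * pi" using abs_2pi[of "t - s"] by (simp add: algebra_simps)
    from cis_eq_small[OF \<open>cis _ = cis _\<close> this] show ?thesis by simp
  qed
  have "cis (2 * pi * (real a + t) / m) = cis (2 * pi * (real b + s) / m)" using assms(5) by (simp add: edge_point_def)
  moreover have "\<bar>2 * pi * (real a + t) / m - 2 * pi * (real b + s) / m\<bar> < 2 * pi"
  proof -
    have "2 * pi * (x + s) / M - 2 * pi * (y + s) / M = 2 * pi * ((x - y) / M)" for x y M :: real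
      by (simp add: add_divide_distrib diff_divide_distrib ring_distribs)
    then have "2 * pi * (real a + t) / m - 2 * pi * (real b + s) / m = 2 * pi * ((real a - real b) / m)"
      unfolding ts .
    moreover have "\<bar>(real a - real b) / m\<bar> < 1" using assms(1,2) by (auto simp: abs_if field_simps)
    ultimately show ?thesis using abs_2pi by presburger
  qed
  ultimately have "2 * pi * (real a + t) / m = 2 * pi * (real b + s) / m" by (rule cis_eq_small)
  then show ?thesis using ts m_pos by simp
qed

text \<open>Gluing edges \<open>2 * k\<close> and \<open>Suc (2 * k)\<close> in the same direction
  identifies the start of either edge with its own end; going around, all vertices become one
  point.\<close>

lemma corner_step: "j < m \<Longrightarrow> q (edge_point m j 0) = q (edge_point m j 1)"
proof -
  assume j: "j < m"
  define k where "k = j div 2"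
  have k: "2 * k < m" "Suc (2 * k) < m" unfolding k_def using j by presburger+
  have "glued (edge_point m (2*k) t) (edge_point m (Suc (2*k)) t)" if "t \<in> {0..1}" for t
    unfolding glued_iff by (rule exI[of _ "2*k"], intro conjI k exI[of _ "Suc (2*k)"] bexI[OF _ that]) auto
  then have e: "q (edge_point m (2*k) t) = q (edge_point m (Suc (2*k)) t)" if "t \<in> {0..1}" for t
    using that q_glued by blast
  have "j = 2 * k \<or> j = Suc (2 * k)" by (auto simp: k_def)
  then show ?thesis
  proof
    assume "j = 2 * k"
    then show ?thesis using e[of 0] edge_point_Suc[of m "2*k"] by simp
  next
    assume "j = Suc (2 * k)"
    then show ?thesis using e[of 1] edge_point_Suc[of m "2*k"] by simp
  qed
qed

lemma q_corner: "j \<le> m \<Longrightarrow> q (edge_point m j 0) = q 1"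
proof (induction j)
  case (Suc j)
  then show ?case using corner_step[of j] edge_point_Suc[of m j] by simp
qed (simp add: edge_point_def)

lemma q_vertex:
  assumes "z ^ m = 1"
  shows "q z = q 1"
proof -
  obtain j where "j < m" "z = cis (2 * pi * real j / real m)"
    using Complex.bij_betw_roots_unity[OF m_pos] assms by (auto simp: bij_betw_def)
  then show ?thesis using q_corner[of j] by (simp add: edge_point_def)
qed

text \<open>Off the vertices each edge has only one partner, so a chain of gluings collapses to a
  single one; chains through a vertex stay among the vertices.\<close>

lemma equiv_cases:
  assumes "equivclp glued z z'"
  shows "z = z' \<or> glued z z' \<or> z ^ m = 1 \<and> z' ^ m = 1"
  using assms
proof (induction rule: equiv_induct)
  case (step y y')
  show ?case
  proof (cases "y ^ m = 1")
    case True
    have "z ^ m = 1" using step(1) True glued_power by auto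
    then show ?thesis using True glued_power[OF step(2)] by simp
  next
    case False
    from step(1) False consider "z = y" | "glued z y" by auto
    then show ?thesis
    proof cases
      case 2
      then obtain a b t where ab: "a < m" "b < m" "t \<in> {0..1}" "a div 2 = b div 2" "z = edge_point m a t" "y = edge_point m b t"
        unfolding glued_iff by blast
      obtain c d s where cd: "c < m" "d < m" "s \<in> {0..1}" "c div 2 = d div 2" "y = edge_point m c s" "y' = edge_point m d s"
        using step(2) unfolding glued_iff by blast
      have "b = c \<and> t = s" using edge_point_inj[of b c t s] ab cd False by simp
      then have "glued z y'" unfolding glued_iff using ab cd by metis
      then show ?thesis by simp
    qed (use step(2) in simp)
  qed
qed simp

text \<open>The saturation of a compact set consists of the set itself, finitely many of its
  boundary pieces carried to partner edges, and possibly the finitely many vertices; so it is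
  compact.\<close>

lemma closed_map_q: "closed_map (top_of_set (cball 0 1)) U q"
  unfolding closed_map_def
proof (intro allI impI)
  fix C assume C: "closedin (top_of_set (cball (0::complex) 1)) C"
  then have comp: "compact C" "C \<subseteq> cball 0 1"
    using closedin_compact[OF compact_cball C] closedin_imp_subset by auto
  define V where "V = {z::complex. z ^ m = 1}"
  have finV: "finite V" unfolding V_def by (rule finite_nth_roots[OF m_pos])
  have cont: "continuous_on A (edge_point m a)" for A a
    unfolding edge_point_def by (intro continuous_intros) (use m_pos in auto)
  define S where "S a b = edge_point m b ` ({0..1} \<inter> edge_point m a -` C)" for a b
  have "compact (S a b)" for a b
  proof -
    have "closed ({0..1} \<inter> edge_point m a -` C)"
      using comp(1) compact_imp_closed by (intro continuous_closed_preimage cont) auto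
    then have "compact ({0..1} \<inter> edge_point m a -` C)"
      using compact_Int_closed[OF compact_Icc[of 0 "1::real"]] by (metis Int_absorb Int_assoc)
    then show ?thesis unfolding S_def by (intro compact_continuous_image cont)
  qed
  moreover have "{z \<in> cball 0 1. q z \<in> q ` C} =
      C \<union> (\<Union>(a,b)\<in>{(a,b). a < m \<and> b < m \<and> a div 2 = b div 2}. S a b) \<union> (if C \<inter> V = {} then {} else V)" (is "?L = ?R")
  proof (intro equalityI subsetI)
    fix z assume "z \<in> ?L"
    then obtain c where c: "z \<in> cball 0 1" "c \<in> C" "q z = q c" by blast
    then have "equivclp glued c z" using fib[of c z] comp(2) by auto
    from equiv_cases[OF this] consider "c = z" | "glued c z" | "c ^ m = 1" "z ^ m = 1" by blast
    then show "z \<in> ?R"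
    proof cases
      case 2
      then obtain a b t where "a < m" "b < m" "t \<in> {0..1}" "a div 2 = b div 2" "c = edge_point m a t" "z = edge_point m b t"
        unfolding glued_iff by blast
      then show ?thesis using c(2) unfolding S_def by blast
    next
      case 3
      then show ?thesis using c(2) unfolding V_def by auto
    qed (use c in simp)
  next
    fix z assume "z \<in> ?R"
    then consider "z \<in> C" | "z \<in> (\<Union>(a,b)\<in>{(a,b). a < m \<and> b < m \<and> a div 2 = b div 2}. S a b)" | "z \<in> V" "C \<inter> V \<noteq> {}"
      by (auto split: if_splits)
    then show "z \<in> ?L"
    proof cases
      case 2
      then obtain a b t where ab: "a < m" "b < m" "a div 2 = b div 2" "t \<in> {0..1}" "edge_point m a t \<in> C" "z = edge_point m b t"
        unfolding S_def by blast
      then have "glued (edge_point m a t) z" unfolding glued_iff by blast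
      from q_glued[OF this] ab(5,6) show ?thesis by (auto intro: rev_image_eqI)
    next
      case 3
      then obtain c where c: "c \<in> C" "c ^ m = 1" "z ^ m = 1" by (auto simp: V_def)
      have "q z = q c" by (metis q_vertex c(2,3))
      moreover have "norm z = 1" using power_eq_1_iff[OF c(3)] m_pos by auto
      ultimately show ?thesis using c(1) by (auto intro: rev_image_eqI)
    qed (use comp(2) in auto)
  qed
  moreover have "finite {(a,b). a < m \<and> b < m \<and> a div 2 = b div 2}"
    by (rule finite_subset[of _ "{..<m} \<times> {..<m}"]) auto
  ultimately have "compact {z \<in> cball 0 1. q z \<in> q ` C}"
    using comp(1) finV finite_imp_compact by (auto intro!: compact_Un compact_UN)
  then have "closedin (top_of_set (cball 0 1)) {z \<in> topspace (top_of_set (cball 0 1)). q z \<in> q ` C}"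
    by (intro closed_subset) (auto dest: compact_imp_closed)
  moreover have "q ` C \<subseteq> topspace U" using comp(2) q_in by blast
  ultimately show "closedin U (q ` C)"
    using quot unfolding quotient_map_closedin by blast
qed

text \<open>Normality of the disc passes to its image under the closed map \<open>q\<close>, and
  points of \<open>U\<close> are closed as images of points.\<close>

lemma Hausdorff_U: "Hausdorff_space U"
proof -
  have "normal_space (top_of_set (cball (0::complex) 1))"
    by (intro metrizable_imp_normal_space metrizable_space_subtopology metrizable_space_euclidean)
  from normal_space_continuous_closed_map_image[OF this q_cont closed_map_q]
  have "normal_space U" using quotient_imp_surjective_map[OF quot] by simp
  moreover have "t1_space U"
    unfolding t1_space_closedin_singleton
  proof
    fix u assume "u \<in> topspace U"
    then obtain z where "z \<in> cball 0 1" "q z = u" using q_surj by blast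
    moreover have "closedin (top_of_set (cball (0::complex) 1)) {z}" if "z \<in> cball 0 1"
      using that by (simp add: closed_subset)
    ultimately have "closedin U (q ` {z})" using closed_map_q unfolding closed_map_def by blast
    then show "closedin U {u}" using \<open>q z = u\<close> by simp
  qed
  ultimately show ?thesis by (rule normal_t1_imp_Hausdorff_space)
qed

lemma proper_map_q: "proper_map (top_of_set (cball 0 1)) U q"
proof (rule continuous_imp_proper_map[OF _ _ q_cont])
  show "compact_space (top_of_set (cball (0::complex) 1))" by (simp add: compact_space_subtopology)
  show "kc_space U" by (rule Hausdorff_imp_kc_space[OF Hausdorff_U])
qed

text \<open>A homotopy of a saturated open set \<open>N\<close> of the polygon that respects the gluing descends to \<open>U\<close>:
  multiplying the proper map \<open>q\<close> by an interval gives again a quotient map.\<close>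

definition contraction :: "'a set \<Rightarrow> 'a \<Rightarrow> (real \<times> 'a \<Rightarrow> 'a) \<Rightarrow> bool" where
  "contraction V u k \<longleftrightarrow> openin U V \<and> u \<in> V \<and>
     continuous_map (prod_topology (top_of_set {0..1}) (subtopology U V)) U k \<and>
     (\<forall>v\<in>V. k (0, v) = v \<and> k (1, v) = u \<and> (\<forall>t\<in>{0..1}. k (t, v) \<in> V)) \<and>
     (\<forall>z\<in>cball 0 1. q z \<in> V \<longrightarrow> (\<exists>p. continuous_on {0..1} p \<and> p ` {0..1} \<subseteq> cball 0 1 \<and> p 0 = z \<and>
        (\<forall>t\<in>{0..1}. q (p t) = k (t, q z))))"

lemma contraction_descends:
  assumes N: "openin (top_of_set (cball 0 1)) N" and sat: "\<And>z z'. z \<in> N \<Longrightarrow> z' \<in> cball 0 1 \<Longrightarrow> q z = q z' \<Longrightarrow> z' \<in> N"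
    and h: "continuous_on ({0..1::real} \<times> N) h" "\<And>t z. t \<in> {0..1} \<Longrightarrow> z \<in> N \<Longrightarrow> h (t, z) \<in> N"
    and h0: "\<And>z. z \<in> N \<Longrightarrow> h (0, z) = z" and h1: "\<And>z. z \<in> N \<Longrightarrow> q (h (1, z)) = u"
    and comp: "\<And>t z z'. t \<in> {0..1} \<Longrightarrow> z \<in> N \<Longrightarrow> z' \<in> N \<Longrightarrow> q z = q z' \<Longrightarrow> q (h (t, z)) = q (h (t, z'))"
    and u: "z0 \<in> N" "q z0 = u"
  shows "\<exists>k. contraction (q ` N) u k"
proof -
  have sub: "N \<subseteq> cball 0 1" using openin_imp_subset[OF N] .
  have pre: "{z \<in> topspace (top_of_set (cball 0 1)). q z \<in> q ` N} = N"
  proof (intro equalityI subsetI)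
    fix z assume "z \<in> {z \<in> topspace (top_of_set (cball 0 1)). q z \<in> q ` N}"
    then obtain y where "y \<in> N" "q y = q z" "z \<in> cball 0 1" by auto
    then show "z \<in> N" using sat by blast
  qed (use sub in auto)
  have V: "openin U (q ` N)"
  proof -
    have "q ` N \<subseteq> topspace U" using sub q_in by blast
    moreover have "openin (top_of_set (cball 0 1)) {z \<in> topspace (top_of_set (cball 0 1)). q z \<in> q ` N}"
      unfolding pre by (rule N)
    ultimately show ?thesis using quot unfolding quotient_map_def by blast
  qed
  \<comment> \<open>\<open>comp\<close> makes the choice of the representative irrelevant.\<close>
  define r where "r v = (SOME z. z \<in> N \<and> q z = v)" for v
  have r: "r v \<in> N" "q (r v) = v" if "v \<in> q ` N" for v
  proof -
    have "\<exists>z. z \<in> N \<and> q z = v" using that by blast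
    from someI_ex[OF this] show "r v \<in> N" "q (r v) = v" by (auto simp: r_def)
  qed
  define k where "k x = q (h (fst x, r (snd x)))" for x :: "real \<times> 'a"
  have kq: "k (t, q z) = q (h (t, z))" if "t \<in> {0..1}" "z \<in> N" for t z
    unfolding k_def using comp[OF that(1) r(1)[of "q z"] that(2)] r(2)[of "q z"] that(2) by auto
  have pm: "proper_map (subtopology (top_of_set (cball 0 1)) N) (subtopology U (q ` N)) q"
    by (rule proper_map_restriction[OF proper_map_q pre])
  have topN: "subtopology (top_of_set (cball 0 1)) N = top_of_set N"
    using sub by (simp add: subtopology_subtopology Int_absorb1)
  let ?I = "top_of_set {0..1::real}"
  \<comment> \<open>A proper map stays closed after multiplication with the interval, so the product
    is a quotient map, through which continuity of \<open>k\<close> is tested.\<close>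
  have "proper_map (prod_topology ?I (top_of_set N)) (prod_topology ?I (subtopology U (q ` N))) (\<lambda>(x,y). (id x, q y))"
    using pm topN by (subst proper_map_prod) auto
  then have cl: "closed_map (prod_topology ?I (top_of_set N)) (prod_topology ?I (subtopology U (q ` N))) (\<lambda>(x,y). (x, q y))"
    using proper_imp_closed_map by (simp add: id_def)
  have qm: "quotient_map (prod_topology ?I (top_of_set N)) (prod_topology ?I (subtopology U (q ` N))) (\<lambda>(x,y). (x, q y))"
  proof (rule continuous_closed_imp_quotient_map[OF _ cl])
    have "continuous_map (top_of_set N) (subtopology U (q ` N)) q"
      using continuous_map_from_subtopology[OF q_cont, of N] topN by (simp add: continuous_map_in_subtopology)
    then have "continuous_map (prod_topology ?I (top_of_set N)) (subtopology U (q ` N)) (q \<circ> snd)"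
      using continuous_map_compose[OF continuous_map_snd] by blast
    then show "continuous_map (prod_topology ?I (top_of_set N)) (prod_topology ?I (subtopology U (q ` N))) (\<lambda>(x, y). (x, q y))"
      unfolding continuous_map_pairwise case_prod_beta by (auto simp: o_def continuous_map_fst continuous_on_fst continuous_on_id)
    show "(\<lambda>(x, y). (x, q y)) ` topspace (prod_topology ?I (top_of_set N)) = topspace (prod_topology ?I (subtopology U (q ` N)))"
      using openin_subset[OF V] by (auto simp: image_iff)
  qed
  have kc: "continuous_map (prod_topology ?I (subtopology U (q ` N))) U k"
  proof (rule continuous_compose_quotient_map[OF qm])
    have "continuous_map (top_of_set ({0..1} \<times> N)) U (\<lambda>x. q (h x))"
      using h sub by (intro q_compose) auto
    then have "continuous_map (prod_topology ?I (top_of_set N)) U (\<lambda>x. q (h x))"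
      by (simp add: prod_topology_subtopology_eu)
    then show "continuous_map (prod_topology ?I (top_of_set N)) U (k \<circ> (\<lambda>(x, y). (x, q y)))"
      by (rule continuous_map_eq) (use kq in auto)
  qed
  \<comment> \<open>These lifts are recorded because paths of \<open>U\<close> in general have none,
    while the paths of the contraction do.\<close>
  have "\<exists>p. continuous_on {0..1} p \<and> p ` {0..1} \<subseteq> cball 0 1 \<and> p 0 = z \<and> (\<forall>t\<in>{0..1}. q (p t) = k (t, q z))"
    if z: "z \<in> cball 0 1" "q z \<in> q ` N" for z
  proof -
    have zN: "z \<in> N" using z pre by auto
    have "continuous_on {0..1} (\<lambda>t. h (t, z))"
      by (rule continuous_on_compose2[OF h(1)]) (use zN in \<open>auto intro!: continuous_intros\<close>)
    then show ?thesis using zN h(2) h0 kq sub by (intro exI[of _ "\<lambda>t. h (t, z)"]) auto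
  qed
  moreover have "k (0, v) = v \<and> k (1, v) = u \<and> (\<forall>t\<in>{0..1}. k (t, v) \<in> q ` N)" if "v \<in> q ` N" for v
  proof -
    obtain z where z: "z \<in> N" "v = q z" using \<open>v \<in> q ` N\<close> by blast
    show ?thesis unfolding z(2) using kq[OF _ z(1)] h0[OF z(1)] h1[OF z(1)] h(2)[OF _ z(1)] by auto
  qed
  ultimately show ?thesis unfolding contraction_def using V kc u by (intro exI[of _ k] conjI) auto
qed

text \<open>A small ball inside the open disc is saturated, since interior points are glued to
  nothing, and contracts linearly to its centre.\<close>

lemma contraction_interior:
  assumes W: "openin U W" "u \<in> W" and z0: "norm z0 < 1" "q z0 = u"
  shows "\<exists>V k. V \<subseteq> W \<and> contraction V u k"
proof -
  have "openin (top_of_set (cball 0 1)) {z \<in> cball 0 1. q z \<in> W}"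
    using openin_continuous_map_preimage[OF q_cont W(1)] by simp
  then obtain T where T: "open T" "{z \<in> cball 0 1. q z \<in> W} = cball 0 1 \<inter> T" unfolding openin_open by blast
  have "z0 \<in> cball 0 1 \<inter> T" unfolding T(2)[symmetric] using W z0 by simp
  then have "open (T \<inter> ball 0 1)" "z0 \<in> T \<inter> ball 0 1" using T(1) z0(1) by auto
  then obtain e where e: "e > 0" "ball z0 e \<subseteq> T \<inter> ball 0 1" by (rule openE)
  let ?N = "ball z0 e"
  have N1: "?N \<subseteq> ball 0 1" using e(2) by blast
  have NW: "q ` ?N \<subseteq> W"
  proof clarify
    fix z assume "z \<in> ?N"
    then have "z \<in> cball 0 1 \<inter> T" using e(2) ball_subset_cball[of "0::complex" 1] by blast
    then show "q z \<in> W" using T(2) by blast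
  qed
  have "\<exists>k. contraction (q ` ?N) u k"
  proof (rule contraction_descends[where h = "\<lambda>x. (1 - fst x) *\<^sub>R snd x + fst x *\<^sub>R z0" and ?z0.0 = z0])
    show "openin (top_of_set (cball 0 1)) ?N" using N1 by (intro open_subset) auto
    show "z' \<in> ?N" if "z \<in> ?N" "z' \<in> cball 0 1" "q z = q z'" for z z'
      using q_interior[of z' z] that N1 by auto
    show "continuous_on ({0..1} \<times> ?N) (\<lambda>x. (1 - fst x) *\<^sub>R snd x + fst x *\<^sub>R z0)"
      by (intro continuous_intros)
    show "(1 - fst (t, z)) *\<^sub>R snd (t, z) + fst (t, z) *\<^sub>R z0 \<in> ?N" if "t \<in> {0..1}" "z \<in> ?N" for t :: real and z
      using convexD_alt[OF convex_ball[of z0 e], of z z0 t] that e(1) by simp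
    show "q ((1 - fst (t, z)) *\<^sub>R snd (t, z) + fst (t, z) *\<^sub>R z0) = q ((1 - fst (t, z')) *\<^sub>R snd (t, z') + fst (t, z') *\<^sub>R z0)"
      if "t \<in> {0..1}" "z \<in> ?N" "z' \<in> ?N" "q z = q z'" for t :: real and z z'
      using q_interior[of z' z] that N1 by force
  qed (use z0 e in auto)
  then show ?thesis using NW by blast
qed

text \<open>No vertex lies strictly between \<open>y\<close> and \<open>y * cis \<xi>\<close>, so
  this arc lies on one edge, and the gluing carries it by a rotation to the partner edge. The bound
  \<open>pi / (2 * m)\<close> is a quarter of the angle of an edge.\<close>

lemma vertex_shift:
  assumes y: "norm y = 1" "y \<in> cball 0 1" and eps: "0 < \<epsilon>" "\<epsilon> \<le> pi / (2 * m)"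
    and far: "y ^ m \<noteq> 1 \<Longrightarrow> (\<And>\<xi>. \<bar>\<xi>\<bar> < \<epsilon> \<Longrightarrow> (y * cis \<xi>) ^ m \<noteq> 1)"
    and \<xi>: "\<bar>\<xi>\<bar> < \<epsilon>" and gl: "glued (y * cis \<xi>) z'"
  obtains y' where "z' = y' * cis \<xi>" "\<And>t. t \<in> {0..1} \<Longrightarrow> glued (y * cis (t * \<xi>)) (y' * cis (t * \<xi>))"
proof -
  define \<kappa> where "\<kappa> = 2 * pi / m"
  have \<kappa>: "\<kappa> > 0" using m_pos by (simp add: \<kappa>_def)
  have ep: "edge_point m a t = cis (\<kappa> * (a + t))" for a t by (simp add: edge_point_def \<kappa>_def)
  obtain a b t where ab: "a < m" "b < m" "t \<in> {0..1}" "a div 2 = b div 2"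
    "y * cis \<xi> = edge_point m a t" "z' = edge_point m b t" using gl unfolding glued_iff by blast
  have y_eq: "y * cis \<theta> = cis (\<kappa> * (a + t) - \<xi> + \<theta>)" for \<theta>
  proof -
    have "y * cis \<theta> = (y * cis \<xi>) * cis (\<theta> - \<xi>)" by (simp add: mult.assoc cis_mult)
    also have "\<dots> = cis (\<kappa> * (a + t) - \<xi> + \<theta>)" unfolding ab(5) ep by (simp add: cis_mult algebra_simps)
    finally show ?thesis .
  qed
  \<comment> \<open>The edge parameter of \<open>y\<close>, while \<open>t\<close> is that of
    \<open>y * cis \<xi>\<close>.\<close>
  define t' where "t' = t - \<xi> / \<kappa>"
  have \<xi>\<kappa>: "\<bar>\<xi> / \<kappa>\<bar> < 1/2"
  proof -
    have "pi / (2 * m) \<le> \<kappa> / 4" using m_pos by (simp add: \<kappa>_def field_simps)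
    then have "\<bar>\<xi>\<bar> < \<kappa> / 2" using \<xi> eps \<kappa> by linarith
    then show ?thesis using \<kappa> by (simp add: abs_div_pos[symmetric] field_simps)
  qed
  have t': "t' \<in> {0..1}"
  proof (rule ccontr)
    assume n: "t' \<notin> {0..1}"
    show False
    proof (cases "y ^ m = 1")
      case True
      have "y = cis (\<kappa> * (a + t'))" using y_eq[of 0] \<kappa> by (simp add: t'_def algebra_simps)
      then have "edge_point m a t' ^ m = 1" using True by (simp add: ep)
      then have "cis (2 * pi * t') = cis 0" using edge_point_power[OF m_pos] by simp
      then obtain k :: int where "2 * pi * t' - 0 = 2 * pi * of_int k" using cis_eq_iff by blast
      then have "t' = of_int k" by simp
      moreover have "-1/2 < t'" "t' < 3/2" using \<xi>\<kappa> ab(3) unfolding t'_def abs_less_iff atLeastAtMost_iff by linarith+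
      ultimately have "k = 0 \<or> k = 1" by linarith
      then show False using n \<open>t' = of_int k\<close> by auto
    next
      case False
      \<comment> \<open>The end of the edge at which the arc would leave it: a vertex within angle
        \<open>\<bar>\<xi>\<bar>\<close> of \<open>y\<close>, against \<open>far\<close>.\<close>
      define c where "c = (if t' < 0 then 0 else 1 :: real)"
      define \<theta> where "\<theta> = \<xi> + \<kappa> * (c - t)"
      have "\<bar>\<theta>\<bar> \<le> \<bar>\<xi>\<bar>"
      proof (cases "t' < 0")
        case True
        then have "\<kappa> * t < \<xi>" using \<kappa> by (simp add: t'_def field_simps)
        moreover have "0 \<le> \<kappa> * t" using \<kappa> ab(3) by simp
        ultimately show ?thesis using True by (simp add: \<theta>_def c_def)
      next
        case False
        then have "t' > 1" using n by auto
        then have "\<xi> < \<kappa> * (t - 1)" using \<kappa> by (simp add: t'_def field_simps)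
        moreover have "\<kappa> * (t - 1) \<le> 0" using \<kappa> ab(3) by (simp add: mult_nonneg_nonpos)
        ultimately show ?thesis using False by (simp add: \<theta>_def c_def algebra_simps)
      qed
      then have "(y * cis \<theta>) ^ m \<noteq> 1" using far[OF False] \<xi> by simp
      moreover have "y * cis \<theta> = edge_point m a c" unfolding y_eq ep by (simp add: \<theta>_def algebra_simps)
      ultimately show False using edge_point_power[OF m_pos, of a c] by (auto simp: c_def)
    qed
  qed
  define y' where "y' = cis (\<kappa> * (b + t) - \<xi>)"
  have "glued (y * cis (s * \<xi>)) (y' * cis (s * \<xi>))" if s: "s \<in> {0..1}" for s
  proof -
    let ?r = "(1 - s) * t' + s * t"
    have "?r \<in> {0..1}" using convexD_alt[of "{0..1::real}" t' t s] s t' ab(3) by simp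
    moreover have "\<kappa> * (real x + t) - \<xi> + s * \<xi> = \<kappa> * (real x + ?r)" for x
      using \<kappa> by (simp add: t'_def field_simps)
    then have "y * cis (s * \<xi>) = edge_point m a ?r" "y' * cis (s * \<xi>) = edge_point m b ?r"
      unfolding y_eq ep y'_def cis_mult by simp_all
    ultimately show ?thesis unfolding glued_iff using ab by metis
  qed
  moreover have "z' = y' * cis \<xi>" unfolding ab(6) ep y'_def cis_mult by simp
  ultimately show ?thesis using that by blast
qed

text \<open>Near a boundary point the contraction is radial in the coordinate \<open>log z\<close>, in which all
  identifications of boundary arcs are translations.\<close>

lemma contraction_boundary:
  assumes W: "openin U W" "u \<in> W" and z0: "norm z0 = 1" "q z0 = u"
  shows "\<exists>V k. V \<subseteq> W \<and> contraction V u k"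
proof -
  \<comment> \<open>The fibre over \<open>u\<close>; a neighbourhood of \<open>u\<close> has to be
    described around all its points at once.\<close>
  define Z where "Z = {y \<in> cball 0 1. q y = u}"
  have Zm: "y ^ m = z0 ^ m" "norm y = 1" "equivclp glued z0 y" if "y \<in> Z" for y
  proof -
    show e: "equivclp glued z0 y" using fib[of z0 y] that z0 by (auto simp: Z_def)
    show "y ^ m = z0 ^ m" using equiv_power[OF e] .
    show "norm y = 1" using equivclp_edge_glued_norm[OF e] z0(1) by auto
  qed
  have "finite Z" by (rule finite_subset[OF _ finite_nth_roots[OF m_pos, of "z0 ^ m"]]) (use Zm in auto)
  have "z0 \<in> Z" using z0 by (auto simp: Z_def)
  define Q where "Q \<epsilon> = {w. - \<epsilon> < Re w \<and> Re w < \<epsilon> \<and> - \<epsilon> < Im w \<and> Im w < \<epsilon>}" for \<epsilon> :: real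
  have Qmono: "Q a \<subseteq> Q b" if "a \<le> b" for a b using that by (auto simp: Q_def)
  have Qopen: "open (Q \<epsilon>)" for \<epsilon>
  proof -
    have "Q \<epsilon> = {w. - \<epsilon> < Re w} \<inter> {w. Re w < \<epsilon>} \<inter> {w. - \<epsilon> < Im w} \<inter> {w. Im w < \<epsilon>}" by (auto simp: Q_def)
    then show ?thesis by (simp add: open_Int open_halfspace_Re_gt open_halfspace_Re_lt open_halfspace_Im_gt open_halfspace_Im_lt)
  qed
  have "openin (top_of_set (cball 0 1)) {z \<in> cball 0 1. q z \<in> W}"
    using openin_continuous_map_preimage[OF q_cont W(1)] by simp
  then obtain T where T: "open T" "{z \<in> cball 0 1. q z \<in> W} = cball 0 1 \<inter> T" unfolding openin_open by blast
  have "\<exists>\<epsilon>>0. \<forall>w\<in>Q \<epsilon>. y * exp w \<in> T" if y: "y \<in> Z" for y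
  proof -
    have "y \<in> T" using T(2) W(2) y by (auto simp: Z_def)
    have "open ((\<lambda>w. y * exp w) -` T)" by (intro open_vimage T continuous_intros)
    moreover have "0 \<in> (\<lambda>w. y * exp w) -` T" using \<open>y \<in> T\<close> by simp
    ultimately obtain e where e: "e > 0" "ball 0 e \<subseteq> (\<lambda>w. y * exp w) -` T" by (rule openE)
    have "Q (e / 2) \<subseteq> ball 0 e"
    proof
      fix w assume "w \<in> Q (e / 2)"
      then have "\<bar>Re w\<bar> + \<bar>Im w\<bar> < e" by (auto simp: Q_def abs_if)
      then show "w \<in> ball 0 e" using cmod_le[of w] by simp
    qed
    then show ?thesis using e by (intro exI[of _ "e / 2"]) auto
  qed
  then obtain \<delta> where \<delta>: "\<And>y. y \<in> Z \<Longrightarrow> \<delta> y > 0" "\<And>y w. y \<in> Z \<Longrightarrow> w \<in> Q (\<delta> y) \<Longrightarrow> y * exp w \<in> T" by metis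
  obtain e1 where e1: "e1 > 0" "\<And>\<xi>. z0 ^ m \<noteq> 1 \<Longrightarrow> \<bar>\<xi>\<bar> < e1 \<Longrightarrow> (z0 * cis \<xi>) ^ m \<noteq> 1"
  proof (cases "z0 ^ m = 1")
    case False
    have "continuous_on UNIV (\<lambda>\<xi>. (z0 * cis \<xi>) ^ m)" by (intro continuous_intros)
    then have "open ((\<lambda>\<xi>. (z0 * cis \<xi>) ^ m) -` (- {1}))" by (intro open_vimage) (auto simp: open_Compl)
    moreover have "0 \<in> (\<lambda>\<xi>. (z0 * cis \<xi>) ^ m) -` (- {1})" using False by simp
    ultimately obtain e where "e > 0" "ball 0 e \<subseteq> (\<lambda>\<xi>. (z0 * cis \<xi>) ^ m) -` (- {1})" by (rule openE)
    then show ?thesis by (intro that[of e]) (auto simp: subset_iff)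
  qed (use that[of 1] in simp)
  \<comment> \<open>Small enough for three purposes: the neighbourhoods lie over \<open>W\<close>,
    no vertex comes close to a fibre point that is not a vertex, and distinct fibre points get
    disjoint neighbourhoods.\<close>
  define \<epsilon> where "\<epsilon> = Min (insert e1 (insert (pi / (2 * m)) (\<delta> ` Z)))"
  have \<epsilon>: "\<epsilon> > 0" "\<epsilon> \<le> e1" "\<epsilon> \<le> pi / (2 * m)" "\<And>y. y \<in> Z \<Longrightarrow> \<epsilon> \<le> \<delta> y"
  proof -
    let ?M = "insert e1 (insert (pi / (2 * m)) (\<delta> ` Z))"
    have fin: "finite ?M" using \<open>finite Z\<close> by simp
    show "\<epsilon> > 0" unfolding \<epsilon>_def using fin \<delta>(1) e1(1) m_pos by (subst Min_gr_iff) auto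
    show "\<epsilon> \<le> e1" "\<epsilon> \<le> pi / (2 * m)" "\<And>y. y \<in> Z \<Longrightarrow> \<epsilon> \<le> \<delta> y"
      unfolding \<epsilon>_def by (rule Min_le[OF fin]; simp)+
  qed
  have far: "(y * cis \<xi>) ^ m \<noteq> 1" if "y \<in> Z" "y ^ m \<noteq> 1" "\<bar>\<xi>\<bar> < \<epsilon>" for y \<xi>
    using e1(2)[of \<xi>] Zm(1)[OF that(1)] that \<epsilon>(2) by (simp add: power_mult_distrib)
  have \<epsilon>pi: "\<epsilon> < pi"
  proof -
    have "pi / (2 * m) \<le> pi / 2" using m_pos by (simp add: divide_simps)
    then show ?thesis using \<epsilon>(3) pi_gt_zero by linarith
  qed
  have QLn: "Ln (exp w) = w" if "w \<in> Q \<epsilon>" for w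
    using that \<epsilon>pi by (intro Ln_exp) (auto simp: Q_def)
  \<comment> \<open>The image of the square \<open>Q \<epsilon>\<close> under
    \<open>y * exp w\<close>, with the principal logarithm as coordinate.\<close>
  define S where "S y = {z. z / y \<notin> \<real>\<^sub>\<le>\<^sub>0 \<and> Ln (z / y) \<in> Q \<epsilon>}" for y
  have Sexp: "z = y * exp (Ln (z / y))" if "z \<in> S y" "y \<in> Z" for z y
  proof -
    have "z / y \<noteq> 0" using that(1) by (auto simp: S_def)
    moreover have "y \<noteq> 0" using Zm(2)[OF that(2)] by auto
    ultimately show ?thesis by simp
  qed
  have expS: "y * exp w \<in> S y" "Ln (y * exp w / y) = w" if "w \<in> Q \<epsilon>" "y \<in> Z" for y w
  proof -
    have "y \<noteq> 0" using Zm(2)[OF that(2)] by auto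
    then show L: "Ln (y * exp w / y) = w" using QLn[OF that(1)] by simp
    have "exp w \<notin> \<real>\<^sub>\<le>\<^sub>0"
    proof
      assume "exp w \<in> \<real>\<^sub>\<le>\<^sub>0"
      then have "exp w \<noteq> 0 \<and> Im (exp w) = 0 \<and> Re (exp w) < 0"
        by (metis complex_nonpos_Reals_iff exp_not_eq_zero complex_eqI less_eq_real_def zero_complex.simps)
      then have "Im (Ln (exp w)) = pi" using Im_Ln_eq_pi[of "exp w"] by simp
      then show False using QLn[OF that(1)] that(1) \<epsilon>pi by (simp add: Q_def)
    qed
    then show "y * exp w \<in> S y" using L \<open>y \<noteq> 0\<close> that(1) by (simp add: S_def)
  qed
  have Sopen: "open (S y)" if "y \<in> Z" for y
  proof -
    have "y \<noteq> 0" using Zm(2)[OF that] by auto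
    have "open ((\<lambda>z. z / y) -` (- \<real>\<^sub>\<le>\<^sub>0))" using \<open>y \<noteq> 0\<close> by (intro open_vimage continuous_intros) (auto simp: open_Compl)
    moreover have "continuous_on ((\<lambda>z. z / y) -` (- \<real>\<^sub>\<le>\<^sub>0)) (\<lambda>z. Ln (z / y))"
      using \<open>y \<noteq> 0\<close> by (intro continuous_intros) auto
    ultimately have "open ((\<lambda>z. Ln (z / y)) -` Q \<epsilon> \<inter> ((\<lambda>z. z / y) -` (- \<real>\<^sub>\<le>\<^sub>0)))"
      using Qopen continuous_on_open_vimage by blast
    moreover have "S y = (\<lambda>z. Ln (z / y)) -` Q \<epsilon> \<inter> ((\<lambda>z. z / y) -` (- \<real>\<^sub>\<le>\<^sub>0))" by (auto simp: S_def)
    ultimately show ?thesis by simp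
  qed
  \<comment> \<open>Fibre points have equal \<open>m\<close>-th powers, so distinct ones differ in
    angle by at least \<open>2 * pi / m\<close>, more than overlapping neighbourhoods would
    allow.\<close>
  have Sdisj: "y = y'" if y: "y \<in> Z" "y' \<in> Z" and z: "z \<in> S y" "z \<in> S y'" for y y' z
  proof -
    let ?w = "Ln (z / y)" and ?w' = "Ln (z / y')"
    have e: "y * exp ?w = y' * exp ?w'" using Sexp[OF z(1) y(1)] Sexp[OF z(2) y(2)] by simp
    have Q: "?w \<in> Q \<epsilon>" "?w' \<in> Q \<epsilon>" using z by (auto simp: S_def)
    have "norm (exp ?w) = norm (exp ?w')" using arg_cong[OF e, of norm] Zm(2)[OF y(1)] Zm(2)[OF y(2)] by (simp add: norm_mult)
    then have re: "Re ?w = Re ?w'" by simp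
    have "z0 ^ m \<noteq> 0" using z0(1) by auto
    then have "exp ?w ^ m = exp ?w' ^ m"
      using arg_cong[OF e, of "\<lambda>x. x ^ m"] Zm(1)[OF y(1)] Zm(1)[OF y(2)] by (auto simp: power_mult_distrib)
    moreover have "exp w ^ k = of_real (exp (k * Re w)) * cis (k * Im w)" for w :: complex and k :: nat
      by (simp add: exp_eq_polar power_mult_distrib Complex.DeMoivre exp_of_nat_mult)
    ultimately have "cis (m * Im ?w) = cis (m * Im ?w')" using re by simp
    moreover have "\<bar>m * Im ?w - m * Im ?w'\<bar> < 2 * pi"
    proof -
      have "\<bar>Im ?w - Im ?w'\<bar> < 2 * \<epsilon>" using Q by (auto simp: Q_def abs_if)
      then have "\<bar>Im ?w - Im ?w'\<bar> < pi / m" using \<epsilon>(3) by simp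
      then have "m * \<bar>Im ?w - Im ?w'\<bar> < pi" using m_pos by (simp add: field_simps)
      moreover have "\<bar>m * Im ?w - m * Im ?w'\<bar> = m * \<bar>Im ?w - Im ?w'\<bar>"
        by (simp add: abs_mult flip: right_diff_distrib)
      ultimately show ?thesis using pi_gt_zero by linarith
    qed
    ultimately have "m * Im ?w = m * Im ?w'" by (rule cis_eq_small)
    then have "?w = ?w'" using re m_pos by (intro complex_eqI) simp_all
    then show ?thesis using e by simp
  qed
  define N where "N = cball 0 1 \<inter> (\<Union>y\<in>Z. S y)"
  define c where "c z = (THE y. y \<in> Z \<and> z \<in> S y)" for z
  have c: "c z = y" if "y \<in> Z" "z \<in> S y" for z y
    unfolding c_def using that Sdisj by (intro the_equality) blast+
  \<comment> \<open>The logarithm is scaled to 0. Its real part stays nonpositive, so the disc is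
    not left.\<close>
  define h where "h x = c (snd x) * exp ((1 - fst x) *\<^sub>R Ln (snd x / c (snd x)))" for x :: "real \<times> complex"
  have hy: "h (t, z) = y * exp ((1 - t) *\<^sub>R Ln (z / y))" if "y \<in> Z" "z \<in> S y" for t z y
    using c[OF that] by (simp add: h_def)
  have Re_le: "Re (Ln (z / y)) \<le> 0" if "y \<in> Z" "z \<in> S y" "z \<in> cball 0 1" for z y
  proof -
    have "norm z = exp (Re (Ln (z / y)))"
      using arg_cong[OF Sexp[OF that(2,1)], of norm] Zm(2)[OF that(1)] by (simp add: norm_mult)
    then show ?thesis using that(3) by (metis dist_0_norm exp_le_one_iff mem_cball)
  qed
  have scaleQ: "(1 - t) *\<^sub>R w \<in> Q \<epsilon>" if "t \<in> {0..1}" "w \<in> Q \<epsilon>" for t :: real and w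
  proof -
    have "\<bar>(1 - t) * x\<bar> < \<epsilon>" if "\<bar>x\<bar> < \<epsilon>" for x
    proof -
      have "\<bar>(1 - t) * x\<bar> \<le> 1 * \<bar>x\<bar>" unfolding abs_mult using \<open>t \<in> {0..1}\<close> by (intro mult_right_mono) auto
      then show ?thesis using that by simp
    qed
    then have "\<bar>(1 - t) * Re w\<bar> < \<epsilon>" "\<bar>(1 - t) * Im w\<bar> < \<epsilon>" using that(2) by (auto simp: Q_def)
    then show ?thesis unfolding Q_def by (simp add: abs_less_iff)
  qed
  have hS: "h (t, z) \<in> S y" "h (t, z) \<in> cball 0 1" if t: "t \<in> {0..1}" and y: "y \<in> Z" "z \<in> S y" "z \<in> cball 0 1" for t z y
  proof -
    have "Ln (z / y) \<in> Q \<epsilon>" using y(2) by (simp add: S_def)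
    then show "h (t, z) \<in> S y" unfolding hy[OF y(1,2)] using expS(1) scaleQ[OF t] y(1) by blast
    have "(1 - t) * Re (Ln (z / y)) \<le> 0" using t Re_le[OF y] by (simp add: mult_nonneg_nonpos)
    then show "h (t, z) \<in> cball 0 1" unfolding hy[OF y(1,2)] using Zm(2)[OF y(1)] by (simp add: norm_mult)
  qed
  \<comment> \<open>Distinct glued points lie on the circle, where the logarithm is imaginary and
    the homotopy a rotation; \<open>vertex_shift\<close> keeps the pair glued throughout.\<close>
  have step: "z' \<in> N \<and> (\<forall>t\<in>{0..1}. q (h (t, z')) = q (h (t, z)))" if z: "z \<in> N" and gl: "glued z z'" for z z'
  proof -
    obtain y where y: "y \<in> Z" "z \<in> S y" "z \<in> cball 0 1" using z by (auto simp: N_def)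
    let ?w = "Ln (z / y)"
    have w: "?w \<in> Q \<epsilon>" using y(2) by (simp add: S_def)
    have nz: "norm z = 1" using edge_glued_norm[OF gl] by simp
    have "Re ?w = 0" using arg_cong[OF Sexp[OF y(2,1)], of norm] Zm(2)[OF y(1)] nz by (simp add: norm_mult)
    define \<xi> where "\<xi> = Im ?w"
    have w\<xi>: "?w = \<i> * \<xi>" using \<open>Re ?w = 0\<close> by (simp add: \<xi>_def complex_eq_iff)
    have zy: "z = y * cis \<xi>" using Sexp[OF y(2,1)] w\<xi> by (simp add: cis_conv_exp)
    have \<xi>: "\<bar>\<xi>\<bar> < \<epsilon>" using w by (auto simp: \<xi>_def Q_def abs_less_iff)
    have ycb: "y \<in> cball 0 1" using y(1) by (simp add: Z_def)
    obtain y' where y': "z' = y' * cis \<xi>" "\<And>t. t \<in> {0..1} \<Longrightarrow> glued (y * cis (t * \<xi>)) (y' * cis (t * \<xi>))"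
      using vertex_shift[OF Zm(2)[OF y(1)] ycb \<epsilon>(1,3) far[OF y(1)] \<xi>] gl zy by blast
    have gy: "glued y y'" using y'(2)[of 0] by simp
    have y'Z: "y' \<in> Z" using q_glued[OF gy] edge_glued_norm[OF gy] y(1) by (simp add: Z_def)
    have z'S: "z' \<in> S y'" "Ln (z' / y') = ?w"
      using expS[OF w y'Z] y'(1) w\<xi> by (simp_all add: cis_conv_exp)
    have "z' \<in> N" using z'S(1) y'Z edge_glued_norm[OF gl] by (auto simp: N_def)
    moreover have "q (h (t, z')) = q (h (t, z))" if t: "t \<in> {0..1}" for t
    proof -
      have "exp ((1 - t) *\<^sub>R ?w) = cis ((1 - t) * \<xi>)" unfolding w\<xi> by (simp add: cis_conv_exp scaleR_conv_of_real mult.left_commute)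
      then have "h (t, z) = y * cis ((1 - t) * \<xi>)" "h (t, z') = y' * cis ((1 - t) * \<xi>)"
        using hy[OF y(1,2)] hy[OF y'Z z'S(1)] z'S(2) by simp_all
      then show ?thesis using q_glued[OF y'(2)[of "1 - t"]] t by simp
    qed
    ultimately show ?thesis by blast
  qed
  have sat: "z' \<in> N \<and> (\<forall>t\<in>{0..1}. q (h (t, z')) = q (h (t, z)))" if z: "z \<in> N" "z' \<in> cball 0 1" "q z = q z'" for z z'
  proof -
    have "equivclp glued z z'" using fib[of z z'] z by (auto simp: N_def)
    then show ?thesis
    proof (induction rule: equiv_induct)
      case (step y y')
      then show ?case using \<open>\<And>z z'. z \<in> N \<Longrightarrow> glued z z' \<Longrightarrow> _\<close>[of y y'] by auto
    qed (use z in simp)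
  qed
  have NopenS: "openin (top_of_set (cball 0 1)) N"
    unfolding N_def by (intro openin_open_Int open_UN ballI Sopen)
  have "\<exists>k. contraction (q ` N) u k"
  proof (rule contraction_descends[OF NopenS _ _ _ _ _ _ _ z0(2), where h = h])
    show "z' \<in> N" if "z \<in> N" "z' \<in> cball 0 1" "q z = q z'" for z z' using sat[OF that] by blast
    show "q (h (t, z)) = q (h (t, z'))" if "t \<in> {0..1}" "z \<in> N" "z' \<in> N" "q z = q z'" for t z z'
      using sat[OF that(2) _ that(4)] that(1,3) by (auto simp: N_def)
    show "h (t, z) \<in> N" if "t \<in> {0..1}" "z \<in> N" for t z
      using that hS[OF that(1)] by (auto simp: N_def)
    show "h (0, z) = z" if "z \<in> N" for z
    proof -
      obtain y where y: "y \<in> Z" "z \<in> S y" using \<open>z \<in> N\<close> by (auto simp: N_def)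
      show ?thesis using hy[OF y, of 0] Sexp[OF y(2,1)] by simp
    qed
    show "q (h (1, z)) = u" if "z \<in> N" for z
    proof -
      obtain y where y: "y \<in> Z" "z \<in> S y" using \<open>z \<in> N\<close> by (auto simp: N_def)
      show ?thesis using hy[OF y, of 1] y(1) by (simp add: Z_def)
    qed
    have "0 \<in> Q \<epsilon>" using \<epsilon>(1) by (simp add: Q_def)
    then show "z0 \<in> N" using expS(1)[OF _ \<open>z0 \<in> Z\<close>, of 0] z0 \<open>z0 \<in> Z\<close> by (auto simp: N_def)
    show "continuous_on ({0..1::real} \<times> N) h"
      unfolding continuous_on_eq_continuous_within
    proof
      fix x :: "real \<times> complex" assume x: "x \<in> {0..1} \<times> N"
      then obtain y where y: "y \<in> Z" "snd x \<in> S y" by (auto simp: N_def)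
      have y0: "y \<noteq> 0" using Zm(2)[OF y(1)] by auto
      let ?f = "\<lambda>x. y * exp ((1 - fst x) *\<^sub>R Ln (snd x / y))"
      let ?A = "({0..1} \<times> N) \<inter> (UNIV \<times> S y)"
      show "continuous (at x within {0..1} \<times> N) h"
      proof (rule continuous_transform_within_openin[where f = ?f and S = ?A])
        have "snd x / y \<notin> \<real>\<^sub>\<le>\<^sub>0" using y(2) by (simp add: S_def)
        then have iL: "isCont Ln (snd x / y)" by (rule continuous_at_Ln)
        have "((\<lambda>x. snd x / y) \<longlongrightarrow> snd x / y) (at x within {0..1} \<times> N)"
          using y0 by (intro tendsto_intros) auto
        from isCont_tendsto_compose[OF iL this]
        have "continuous (at x within {0..1} \<times> N) (\<lambda>x. Ln (snd x / y))"
          unfolding continuous_within .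
        then show "continuous (at x within {0..1} \<times> N) ?f"
          by (intro continuous_intros)
        show "openin (top_of_set ({0..1} \<times> N)) ?A"
          by (intro openin_open_Int open_Times Sopen y) simp
      qed (use x y hy[OF y(1)] in auto)
    qed
  qed
  moreover have "q ` N \<subseteq> W"
  proof
    fix v assume "v \<in> q ` N"
    then obtain z y where z: "v = q z" "z \<in> cball 0 1" "y \<in> Z" "z \<in> S y" by (auto simp: N_def)
    have "Ln (z / y) \<in> Q (\<delta> y)" using z(4) Qmono[OF \<epsilon>(4)[OF z(3)]] by (auto simp: S_def)
    then have "z \<in> T" using \<delta>(2)[OF z(3)] Sexp[OF z(4,3)] by metis
    then show "v \<in> W" using T(2) z by blast
  qed
  ultimately show ?thesis by blast
qed

theorem contraction_exists:
  assumes W: "openin U W" "u \<in> W"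
  shows "\<exists>V k. V \<subseteq> W \<and> contraction V u k"
proof -
  have "u \<in> topspace U" using W openin_subset by blast
  then obtain z0 where "z0 \<in> cball 0 1" "q z0 = u" using q_surj by blast
  then show ?thesis using contraction_interior[OF W] contraction_boundary[OF W] by (cases "norm z0 < 1") auto
qed

end

lemma path_connected_space_top_of_set: "path_connected_space (top_of_set S) \<longleftrightarrow> path_connected S"
  unfolding path_connected_space_def path_connected_def pathin_canon_iff path_image_def pathstart_def pathfinish_def
  by (simp add: image_subset_iff_funcset conj_assoc)

lemma open_sq_box: "open sq_box"
proof -
  have "sq_box = {z. - (1/2) < Re z} \<inter> {z. Re z < 1/2} \<inter> {z. - (1/2) < Im z} \<inter> {z. Im z < 1/2}"
    by (auto simp: sq_box_def abs_less_iff)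
  then show ?thesis
    by (metis open_Int open_halfspace_Re_gt open_halfspace_Re_lt open_halfspace_Im_gt open_halfspace_Im_lt)
qed

lemma path_connected_box_config: "path_connected_space (box_config n)"
proof (rule path_connected_config_space)
  show "path_connected_space (subtopology (top_of_set sq_box) (- S))" if "finite S" for S
  proof -
    have "path_connected (sq_box - S)"
      using that open_sq_box convex_connected[OF convex_box] countable_finite
      by (intro path_connected_open_diff_countable) auto
    then show ?thesis by (simp add: subtopology_subtopology path_connected_space_top_of_set Diff_eq)
  qed
  have "0 \<in> sq_box" by (simp add: sq_box_def)
  then show "infinite (topspace (top_of_set sq_box))" using finite_imp_not_open[OF _ open_sq_box] by auto
qed

section \<open>Configurations represented in the disc\<close>

context polygon
begin

text \<open>Tuples of representatives in the disc: distinctness is required of the images, so two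
  glued boundary points may not occur together.\<close>

abbreviation lifted :: "nat \<Rightarrow> (nat \<Rightarrow> complex) topology" where
  "lifted n \<equiv> subtopology (product_topology (\<lambda>_. top_of_set (cball 0 1)) {..<n}) {z. inj_on (\<lambda>i. q (z i)) {..<n}}"

definition proj :: "nat \<Rightarrow> (nat \<Rightarrow> complex) \<Rightarrow> nat \<Rightarrow> 'a" where
  "proj n z = restrict (\<lambda>i. q (z i)) {..<n}"

lemma topspace_lifted:
  "z \<in> topspace (lifted n) \<longleftrightarrow> z \<in> extensional {..<n} \<and> (\<forall>i<n. z i \<in> cball 0 1) \<and> inj_on (\<lambda>i. q (z i)) {..<n}"
  by (auto simp: PiE_iff)

lemma continuous_map_liftedI:
  assumes "\<And>i. i < n \<Longrightarrow> continuous_on A (\<lambda>a. f a i)" "\<And>a. a \<in> A \<Longrightarrow> f a \<in> topspace (lifted n)"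
  shows "continuous_map (top_of_set A) (lifted n) f"
  unfolding continuous_map_in_subtopology continuous_map_componentwise
  using assms unfolding topspace_lifted by (auto simp: continuous_map_in_subtopology)

lemma continuous_lifted_coordinate:
  assumes "continuous_map (top_of_set A) (lifted n) f" "i < n"
  shows "continuous_on A (\<lambda>a. f a i)"
  using assms unfolding continuous_map_in_subtopology continuous_map_componentwise
  by (auto simp: continuous_map_in_subtopology)

lemma continuous_map_proj: "continuous_map (lifted n) (config_space n X) (proj n)"
  unfolding continuous_map_config
proof (intro conjI allI impI ballI)
  fix i assume i: "i < n"
  have "continuous_map (lifted n) (top_of_set (cball 0 1)) (\<lambda>z. z i)"
    using continuous_map_from_subtopology[OF continuous_map_product_projection[of i "{..<n}" "\<lambda>_. top_of_set (cball (0::complex) 1)"]] i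
    by simp
  from continuous_map_compose[OF this q_cont] show "continuous_map (lifted n) X (\<lambda>z. proj n z i)"
    using i by (simp add: proj_def o_def)
next
  fix z assume "z \<in> topspace (lifted n)"
  then show "proj n z \<in> extensional {..<n}" "inj_on (proj n z) {..<n}"
    unfolding topspace_lifted by (auto simp: proj_def inj_on_def)
qed

lemma proj_surj:
  assumes "x \<in> topspace (config_space n X)"
  obtains z where "z \<in> topspace (lifted n)" "proj n z = x"
proof -
  have "\<forall>i. \<exists>z. i < n \<longrightarrow> z \<in> cball 0 1 \<and> q z = x i"
  proof
    fix i show "\<exists>z. i < n \<longrightarrow> z \<in> cball 0 1 \<and> q z = x i"
    proof (cases "i < n")
      case True
      then have "x i \<in> topspace X" using assms by (simp add: topspace_config_space)
      then show ?thesis using q_surj by metis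
    qed simp
  qed
  then obtain f where f: "\<And>i. i < n \<Longrightarrow> f i \<in> cball 0 1 \<and> q (f i) = x i" by metis
  let ?z = "restrict f {..<n}"
  have "proj n ?z = x" using f assms by (auto simp: proj_def topspace_config_space extensional_def fun_eq_iff)
  moreover have "?z \<in> topspace (lifted n)"
    using f assms unfolding topspace_lifted by (auto simp: topspace_config_space inj_on_def)
  ultimately show ?thesis using that by blast
qed

lemma interior_lifted:
  assumes "z \<in> extensional {..<n}" "\<And>i. i < n \<Longrightarrow> norm (z i) < 1" "inj_on z {..<n}"
  shows "z \<in> topspace (lifted n)"
proof -
  have "i = j" if "i < n" "j < n" "q (z i) = q (z j)" for i j
  proof -
    have "z i = z j" using q_interior[of "z i" "z j"] assms(2) that less_imp_le by fastforce
    then show ?thesis using assms(3) that by (simp add: inj_on_def)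
  qed
  then show ?thesis using assms less_imp_le unfolding topspace_lifted by (fastforce simp: inj_on_def)
qed

lemma box_norm: "z \<in> sq_box \<Longrightarrow> norm z < 1"
  using cmod_le[of z] unfolding sq_box_def by auto

lemma box_lifted: "continuous_map (box_config n) (lifted n) id"
proof -
  have "x \<in> topspace (lifted n)" if "x \<in> topspace (box_config n)" for x
    using that box_norm unfolding topspace_box_config by (intro interior_lifted) auto
  moreover have "continuous_map (box_config n) (top_of_set (cball 0 1)) (\<lambda>x. x i)" if "i < n" for i
    using continuous_map_config_proj[OF that, of "top_of_set sq_box"] box_norm that less_imp_le
    by (auto simp: continuous_map_in_subtopology topspace_box_config) fastforce
  ultimately show ?thesis
    unfolding continuous_map_in_subtopology continuous_map_componentwise
    by (auto simp: topspace_box_config)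
qed

text \<open>Scaling by \<open>c < 1\<close> pulls all points into the open disc, where
  \<open>q\<close> is injective, so no collision arises. The ratio 1/3 reaches
  \<open>sq_box\<close>, which \<open>polygon_potential\<close> and the connectedness proof
  exploit.\<close>

definition shrink :: "nat \<Rightarrow> real \<Rightarrow> (nat \<Rightarrow> complex) \<Rightarrow> nat \<Rightarrow> complex" where
  "shrink n c z = restrict (\<lambda>i. c *\<^sub>R z i) {..<n}"

lemma shrink_one: "z \<in> extensional {..<n} \<Longrightarrow> shrink n 1 z = z"
  by (auto simp: shrink_def extensional_def)

lemma shrink_lifted:
  assumes z: "z \<in> topspace (lifted n)" and c: "0 < c" "c \<le> 1"
  shows "shrink n c z \<in> topspace (lifted n)"
proof (cases "c = 1")
  case True
  then show ?thesis using z unfolding topspace_lifted by (simp add: shrink_one)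
next
  case False
  show ?thesis
  proof (rule interior_lifted)
    fix i assume "i < n"
    then have "norm (z i) \<le> 1" using z unfolding topspace_lifted by simp
    then have "c * norm (z i) \<le> c * 1" using c by (intro mult_left_mono) auto
    then have "c * norm (z i) < 1" using c False by linarith
    then show "norm (shrink n c z i) < 1" using \<open>i < n\<close> c by (simp add: shrink_def)
  next
    have "inj_on z {..<n}" using z unfolding topspace_lifted by (auto simp: inj_on_def)
    then show "inj_on (shrink n c z) {..<n}" using c by (auto simp: shrink_def inj_on_def)
  qed (simp add: shrink_def)
qed

lemma shrink_box:
  assumes z: "z \<in> topspace (lifted n)"
  shows "shrink n (1/3) z \<in> topspace (box_config n)"
proof -
  have "inj_on z {..<n}" using z unfolding topspace_lifted by (auto simp: inj_on_def)
  then have "inj_on (shrink n (1/3) z) {..<n}" by (auto simp: shrink_def inj_on_def)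
  moreover have "shrink n (1/3) z i \<in> sq_box" if "i < n" for i
  proof -
    have "norm (z i) \<le> 1" using that z unfolding topspace_lifted by simp
    then have "\<bar>Re (z i)\<bar> \<le> 1" "\<bar>Im (z i)\<bar> \<le> 1" using abs_Re_le_cmod[of "z i"] abs_Im_le_cmod[of "z i"] by linarith+
    then show ?thesis using that by (simp add: shrink_def sq_box_def)
  qed
  ultimately show ?thesis by (simp add: topspace_box_config shrink_def)
qed

definition ray :: "nat \<Rightarrow> (nat \<Rightarrow> complex) \<Rightarrow> real \<Rightarrow> nat \<Rightarrow> complex" where
  "ray n z = (\<lambda>t. shrink n (1 - 2/3 * t) z)"

lemma pathin_ray:
  assumes "z \<in> topspace (lifted n)"
  shows "pathin (lifted n) (ray n z)"
  unfolding pathin_def ray_def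
  by (intro continuous_map_liftedI shrink_lifted[OF assms]) (auto simp: shrink_def intro!: continuous_intros)

lemma ray_ends: "z \<in> topspace (lifted n) \<Longrightarrow> ray n z 0 = z" "ray n z 1 = shrink n (1/3) z"
  unfolding topspace_lifted by (simp_all add: ray_def shrink_one)

lemma pathin_box_lifted: "pathin (box_config n) p \<Longrightarrow> pathin (lifted n) p"
  using pathin_compose[OF _ box_lifted] by fastforce

lemma path_connected_lifted: "path_connected_space (lifted n)"
  unfolding path_connected_space_def
proof (intro ballI)
  fix x y assume x: "x \<in> topspace (lifted n)" and y: "y \<in> topspace (lifted n)"
  obtain p where p: "pathin (box_config n) p" "p 0 = shrink n (1/3) x" "p 1 = shrink n (1/3) y"
    using path_connected_box_config[of n] shrink_box[OF x] shrink_box[OF y] unfolding path_connected_space_def by blast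
  let ?r = "path_concat (path_concat (ray n x) p) (path_rev (ray n y))"
  have "pathin (lifted n) ?r"
    using pathin_box_lifted[OF p(1)] pathin_ray[OF x] pathin_ray[OF y] p ray_ends(2)
    by (intro pathin_concat pathin_rev) simp_all
  then show "\<exists>g. pathin (lifted n) g \<and> g 0 = x \<and> g 1 = y"
    using ray_ends(1)[OF x] ray_ends(1)[OF y] by (intro exI[of _ ?r]) simp
qed

lemma path_connected_polygon_config: "path_connected_space (config_space n X)"
  unfolding path_connected_space_def
proof (intro ballI)
  fix x y assume "x \<in> topspace (config_space n X)" "y \<in> topspace (config_space n X)"
  then obtain z z' where z: "z \<in> topspace (lifted n)" "proj n z = x" "z' \<in> topspace (lifted n)" "proj n z' = y"
    using proj_surj by metis
  then obtain p where p: "pathin (lifted n) p" "p 0 = z" "p 1 = z'"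
    using path_connected_lifted[of n] unfolding path_connected_space_def by blast
  then show "\<exists>g. pathin (config_space n X) g \<and> g 0 = x \<and> g 1 = y"
    using pathin_compose[OF p(1) continuous_map_proj] z by (intro exI[of _ "proj n \<circ> p"]) simp
qed

lemma proj_permute: "\<pi> permutes {..<n} \<Longrightarrow> proj n (z \<circ> \<pi>) = proj n z \<circ> \<pi>"
  using permutes_in_image[of \<pi> "{..<n}"] permutes_not_in[of \<pi> "{..<n}"]
  by (auto simp: proj_def restrict_def fun_eq_iff)

lemma lifted_permute:
  assumes "\<pi> permutes {..<n}" "z \<in> topspace (lifted n)"
  shows "z \<circ> \<pi> \<in> topspace (lifted n)"
proof -
  have "inj_on (\<lambda>i. q (z i)) (\<pi> ` {..<n})" using assms permutes_image[OF assms(1)] unfolding topspace_lifted by simp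
  then have "inj_on ((\<lambda>i. q (z i)) \<circ> \<pi>) {..<n}" using permutes_inj_on[OF assms(1)] by (intro comp_inj_on) auto
  moreover have "z \<circ> \<pi> \<in> extensional {..<n}"
    using assms(2) permutes_not_in[OF assms(1)] unfolding topspace_lifted by (auto simp: extensional_def)
  moreover have "(z \<circ> \<pi>) i \<in> cball 0 1" if "i < n" for i
    using assms(2) permutes_in_image[OF assms(1), of i] that unfolding topspace_lifted by simp
  ultimately show ?thesis unfolding topspace_lifted by (simp add: o_def)
qed

end

section \<open>Braids crossing the edges of the polygon\<close>

locale crosscap_char = crosscap_polygon +
  fixes n :: nat and \<Phi> :: "(real \<Rightarrow> (nat \<Rightarrow> 'a) set) \<Rightarrow> complex"
  assumes pc\<Phi>: "path_char (unordered_config_space n U) \<Phi>"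
begin

definition \<Phi>o :: "(real \<Rightarrow> nat \<Rightarrow> 'a) \<Rightarrow> complex" where "\<Phi>o p = \<Phi> (perm_orbit n \<circ> p)"

definition \<Psi> :: "(real \<Rightarrow> nat \<Rightarrow> complex) \<Rightarrow> complex" where "\<Psi> p = \<Phi>o (proj n \<circ> p)"

lemma pc\<Phi>o: "path_char (config_space n U) \<Phi>o"
  unfolding \<Phi>o_def by (rule path_char_compose[OF pc\<Phi> continuous_map_perm_orbit])

lemma pc\<Psi>: "path_char (lifted n) \<Psi>"
  unfolding \<Psi>_def by (rule path_char_compose[OF pc\<Phi>o continuous_map_proj])

lemma \<Phi>o_permute: "\<pi> permutes {..<n} \<Longrightarrow> \<Phi>o (\<lambda>t. p t \<circ> \<pi>) = \<Phi>o p"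
  unfolding \<Phi>o_def o_def[of "perm_orbit n"] using perm_orbit_permute by (metis (no_types))

lemma \<Psi>_permute: "\<pi> permutes {..<n} \<Longrightarrow> \<Psi> (\<lambda>t. p t \<circ> \<pi>) = \<Psi> p"
  unfolding \<Psi>_def using \<Phi>o_permute[of \<pi> "proj n \<circ> p"] by (simp add: o_def[of "proj n"] proj_permute)

sublocale box_char n \<Psi>
proof
  show "path_char (box_config n) \<Psi>" using path_char_compose[OF pc\<Psi> box_lifted] by simp
qed (use \<Psi>_permute in blast)

text \<open>The angle of one of the \<open>2 * g\<close> edges.\<close>

definition \<kappa> :: real where "\<kappa> = pi / g"

lemma \<kappa>: "0 < \<kappa>" "\<kappa> \<le> pi" "2 * pi / m = \<kappa>"
  using g by (auto simp: \<kappa>_def field_simps)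

text \<open>The strip \<open>|a| \<le> \<kappa>/4\<close>, \<open>|b| \<le> 1\<close> glued from neighbourhoods of the first two edges, in polar
  coordinates: \<open>b\<close> is the signed distance from the common image of the edges.\<close>

definition strip_lift :: "real \<Rightarrow> real \<Rightarrow> complex" where
  "strip_lift a b = (if 0 \<le> b then of_real (1 - b) * cis (\<kappa> / 2 + a) else of_real (1 + b) * cis (3 * \<kappa> / 2 + a))"

lemma norm_strip_lift: "\<bar>b\<bar> \<le> 1 \<Longrightarrow> norm (strip_lift a b) = 1 - \<bar>b\<bar>"
  by (auto simp: strip_lift_def norm_mult simp del: of_real_add of_real_diff)

lemma strip_glue:
  assumes "\<bar>a\<bar> \<le> \<kappa> / 2"
  shows "q (cis (\<kappa> / 2 + a)) = q (cis (3 * \<kappa> / 2 + a))"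
proof -
  let ?t = "1/2 + a / \<kappa>"
  have t: "?t \<in> {0..1}" using assms \<kappa>(1) by (auto simp: abs_le_iff field_simps)
  have "edge_point m j ?t = cis (\<kappa> * (real j + ?t))" for j
    unfolding edge_point_def \<kappa>(3)[symmetric] by auto
  then have e: "edge_point m j ?t = cis (\<kappa> * real j + (\<kappa> / 2 + a))" for j
    using \<kappa>(1) by (simp add: algebra_simps)
  have "glued (edge_point m 0 ?t) (edge_point m 1 ?t)"
    unfolding glued_iff by (rule exI[of _ 0], intro conjI exI[of _ 1] bexI[OF _ t]) (use g in auto)
  from q_glued[OF this] show ?thesis unfolding e by (simp add: add_ac)
qed

lemma continuous_strip:
  fixes S :: "'z::topological_space set"
  assumes a: "continuous_on S a" "\<And>x. x \<in> S \<Longrightarrow> \<bar>a x\<bar> \<le> \<kappa> / 2"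
    and b: "continuous_on S b" "\<And>x. x \<in> S \<Longrightarrow> \<bar>b x\<bar> \<le> 1"
  shows "continuous_map (top_of_set S) U (\<lambda>x. q (strip_lift (a x) (b x)))"
proof -
  have "continuous_map (top_of_set S) U (\<lambda>x. if 0 \<le> b x then q (of_real (1 - b x) * cis (\<kappa> / 2 + a x))
      else q (of_real (1 + b x) * cis (3 * \<kappa> / 2 + a x)))"
  proof (rule continuous_map_cases_le)
    have s: "S \<inter> {x \<in> topspace (top_of_set S). 0 \<le> b x} \<subseteq> S" by blast
    show "continuous_map (subtopology (top_of_set S) {x \<in> topspace (top_of_set S). 0 \<le> b x}) U
        (\<lambda>x. q (of_real (1 - b x) * cis (\<kappa> / 2 + a x)))"
      unfolding subtopology_subtopology
    proof (rule q_compose)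
      show "continuous_on (S \<inter> {x \<in> topspace (top_of_set S). 0 \<le> b x}) (\<lambda>x. of_real (1 - b x) * cis (\<kappa> / 2 + a x))"
        by (intro continuous_intros continuous_on_subset[OF a(1) s] continuous_on_subset[OF b(1) s])
      show "(\<lambda>x. of_real (1 - b x) * cis (\<kappa> / 2 + a x)) ` (S \<inter> {x \<in> topspace (top_of_set S). 0 \<le> b x}) \<subseteq> cball 0 1"
        using b(2) by (force simp: norm_mult simp del: of_real_diff)
    qed
    have s: "S \<inter> {x \<in> topspace (top_of_set S). b x \<le> 0} \<subseteq> S" by blast
    show "continuous_map (subtopology (top_of_set S) {x \<in> topspace (top_of_set S). b x \<le> 0}) U
        (\<lambda>x. q (of_real (1 + b x) * cis (3 * \<kappa> / 2 + a x)))"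
      unfolding subtopology_subtopology
    proof (rule q_compose)
      show "continuous_on (S \<inter> {x \<in> topspace (top_of_set S). b x \<le> 0}) (\<lambda>x. of_real (1 + b x) * cis (3 * \<kappa> / 2 + a x))"
        by (intro continuous_intros continuous_on_subset[OF a(1) s] continuous_on_subset[OF b(1) s])
      show "(\<lambda>x. of_real (1 + b x) * cis (3 * \<kappa> / 2 + a x)) ` (S \<inter> {x \<in> topspace (top_of_set S). b x \<le> 0}) \<subseteq> cball 0 1"
        using b(2) by (force simp: norm_mult simp del: of_real_add)
    qed
    show "q (of_real (1 - b x) * cis (\<kappa> / 2 + a x)) = q (of_real (1 + b x) * cis (3 * \<kappa> / 2 + a x))"
      if "x \<in> topspace (top_of_set S)" "0 = b x" for x
      using strip_glue[OF a(2)] that by (simp flip: that(2))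
  qed (use b(1) in auto)
  then show ?thesis by (rule continuous_map_eq) (simp add: strip_lift_def)
qed

text \<open>Unless both points lie on the edge, one is interior and the two lifts must coincide; the
  sectors around \<open>\<kappa> / 2\<close> and \<open>3 * \<kappa> / 2\<close> are disjoint. On
  the edge, the \<open>m\<close>-th power separates points at angular distance at most
  \<open>\<kappa> / 2\<close>.\<close>

lemma strip_inj:
  assumes eq: "q (strip_lift a b) = q (strip_lift a' b')"
    and a: "\<bar>a\<bar> \<le> \<kappa> / 4" "\<bar>a'\<bar> \<le> \<kappa> / 4" and b: "\<bar>b\<bar> < 1" "\<bar>b'\<bar> < 1"
  shows "a = a' \<and> b = b'"
proof -
  have n: "norm (strip_lift a b) = 1 - \<bar>b\<bar>" "norm (strip_lift a' b') = 1 - \<bar>b'\<bar>"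
    using b norm_strip_lift by auto
  have small: "\<bar>a - a'\<bar> \<le> \<kappa> / 2" using a by linarith
  show ?thesis
  proof (cases "b = 0 \<and> b' = 0")
    case True
    then have s: "strip_lift a b = cis (\<kappa> / 2 + a)" "strip_lift a' b' = cis (\<kappa> / 2 + a')" by (auto simp: strip_lift_def)
    have "equivclp glued (cis (\<kappa> / 2 + a')) (cis (\<kappa> / 2 + a))" using fib[of "strip_lift a' b'" "strip_lift a b"] eq s by simp
    from equiv_power[OF this] have "cis (m * (\<kappa> / 2 + a)) = cis (m * (\<kappa> / 2 + a'))" by (simp only: Complex.DeMoivre)
    moreover have "\<bar>m * (\<kappa> / 2 + a) - m * (\<kappa> / 2 + a')\<bar> < 2 * pi"
    proof -
      have "m * \<kappa> = 2 * pi" using \<kappa>(3) m_pos by (simp add: field_simps)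
      moreover have "m * \<bar>a - a'\<bar> \<le> m * (\<kappa> / 2)" using small by (intro mult_left_mono) auto
      moreover have "\<bar>m * (\<kappa> / 2 + a) - m * (\<kappa> / 2 + a')\<bar> = m * \<bar>a - a'\<bar>"
        by (simp add: abs_mult flip: right_diff_distrib)
      ultimately show ?thesis using pi_gt_zero by linarith
    qed
    ultimately have "m * (\<kappa> / 2 + a) = m * (\<kappa> / 2 + a')" by (rule cis_eq_small)
    then show ?thesis using True m_pos by simp
  next
    case False
    then have "norm (strip_lift a b) < 1 \<or> norm (strip_lift a' b') < 1" using n by auto
    then have e: "strip_lift a b = strip_lift a' b'"
      using q_interior[of "strip_lift a b" "strip_lift a' b'"] q_interior[of "strip_lift a' b'" "strip_lift a b"] eq n b
      by (auto simp: mem_cball)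
    then have bb: "\<bar>b\<bar> = \<bar>b'\<bar>" using n by simp
    have cancel: "cis x = cis y" if "of_real r * cis x = of_real r * cis y" "r > 0" for r x y :: real
      using that by simp
    show ?thesis
    proof (cases "0 \<le> b \<longleftrightarrow> 0 \<le> b'")
      case True
      then have "b = b'" using bb by (auto simp: abs_if split: if_splits)
      moreover have "cis ((if 0 \<le> b then \<kappa> / 2 else 3 * \<kappa> / 2) + a) = cis ((if 0 \<le> b then \<kappa> / 2 else 3 * \<kappa> / 2) + a')"
        using e b \<open>b = b'\<close> cancel[of "1 - b"] cancel[of "1 + b"] by (auto simp: strip_lift_def abs_less_iff simp del: of_real_add of_real_diff)
      moreover have "\<bar>((if 0 \<le> b then \<kappa> / 2 else 3 * \<kappa> / 2) + a) - ((if 0 \<le> b then \<kappa> / 2 else 3 * \<kappa> / 2) + a')\<bar> < 2 * pi"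
        using small \<kappa> pi_gt_zero by simp
      ultimately show ?thesis using cis_eq_small by fastforce
    next
      case False
      have *: "cis (\<kappa> / 2 + x) \<noteq> cis (3 * \<kappa> / 2 + y)" if "\<bar>x - y\<bar> \<le> \<kappa> / 2" for x y
      proof
        assume c: "cis (\<kappa> / 2 + x) = cis (3 * \<kappa> / 2 + y)"
        have "\<bar>(\<kappa> / 2 + x) - (3 * \<kappa> / 2 + y)\<bar> < 2 * pi" using that \<kappa> by linarith
        from cis_eq_small[OF c this] have "x - y = \<kappa>" by simp
        then show False using that \<kappa> by simp
      qed
      have "cis (\<kappa> / 2 + a) = cis (3 * \<kappa> / 2 + a') \<or> cis (\<kappa> / 2 + a') = cis (3 * \<kappa> / 2 + a)"
      proof (cases "0 \<le> b")
        case True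
        then have "b' = - b" using False bb by auto
        then show ?thesis using e True False b cancel[of "1 - b"] by (auto simp: strip_lift_def simp del: of_real_diff of_real_add)
      next
        case nb: False
        then have "b = - b'" using False bb by auto
        then show ?thesis using e nb False b cancel[of "1 - b'"] by (auto simp: strip_lift_def simp del: of_real_diff of_real_add)
      qed
      then show ?thesis using * small by (auto simp: abs_minus_commute)
    qed
  qed
qed

text \<open>The points that take no part in a twist wait on the negative real axis within radius
  1/16 of the centre, in the order of their indices.\<close>

definition spectator :: "nat \<Rightarrow> complex" where
  "spectator i = of_real ((real i - real n) / (16 * real n))"

lemma spectator:
  assumes "i < n"
  shows "norm (spectator i) \<le> 1/16" "Re (spectator i) < 0" "Im (spectator i) = 0"
    "j < n \<Longrightarrow> i < j \<Longrightarrow> Re (spectator i) < Re (spectator j)"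
    "j < n \<Longrightarrow> spectator i = spectator j \<Longrightarrow> i = j"
proof -
  have n0: "real n > 0" using assms by simp
  have "(real i - real n) / (16 * real n) < 0" using assms by (simp add: divide_neg_pos)
  moreover have "- (1/16) \<le> (real i - real n) / (16 * real n)" using n0 by (simp add: field_simps)
  ultimately show "norm (spectator i) \<le> 1/16" "Re (spectator i) < 0" "Im (spectator i) = 0"
    unfolding spectator_def norm_of_real by auto
  show "j < n \<Longrightarrow> i < j \<Longrightarrow> Re (spectator i) < Re (spectator j)"
    using n0 unfolding spectator_def Re_complex_of_real by (intro divide_strict_right_mono) auto
  show "j < n \<Longrightarrow> spectator i = spectator j \<Longrightarrow> i = j"
    using n0 unfolding spectator_def of_real_eq_iff by simp
qed

text \<open>A half twist of the last two points around the point of radius 1/4 and angle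
  \<open>\<alpha>\<close>. The radii stay between 1/8 and 3/8, clear of the spectators, and the
  angular amplitude \<open>\<kappa> / 4\<close> fits the strip around an edge.\<close>

definition twist :: "real \<Rightarrow> real \<Rightarrow> nat \<Rightarrow> complex" where
  "twist \<alpha> t = restrict (\<lambda>i.
     if i = n - 2 then of_real (1/4 - cos (pi * t) / 8) * cis (\<alpha> - \<kappa> / 4 * sin (pi * t))
     else if i = n - 1 then of_real (1/4 + cos (pi * t) / 8) * cis (\<alpha> + \<kappa> / 4 * sin (pi * t))
     else spectator i) {..<n}"

lemma radius: "1/8 \<le> 1/4 - cos (x::real) / 8" "1/4 - cos x / 8 \<le> 3/8" "1/8 \<le> 1/4 + cos x / 8" "1/4 + cos x / 8 \<le> 3/8"
  using cos_le_one[of x] cos_ge_minus_one[of x] by linarith+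

lemma angle_bound: "\<bar>\<kappa> / 4 * sin x\<bar> \<le> \<kappa> / 4"
  using \<kappa>(1) abs_sin_le_one[of x] by (simp add: abs_mult mult_left_le)

context
  assumes n2: "n \<ge> 2"
begin

lemma n_less: "n - 2 < n" "n - 1 < n" "n - 2 \<noteq> n - 1" "Suc (n - 2) = n - 1"
  using n2 by auto

lemma swap_permutes: "nat_swap (n - 2) (n - 1) permutes {..<n}"
  using n_less by (intro permutes_swap_id) auto

lemma twist_norm: "norm (twist \<alpha> t (n - 2)) = 1/4 - cos (pi * t) / 8" "norm (twist \<alpha> t (n - 1)) = 1/4 + cos (pi * t) / 8"
proof -
  have r: "0 \<le> 1/4 - cos (pi * t) / 8" "0 \<le> 1/4 + cos (pi * t) / 8" using radius[of "pi * t"] by linarith+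
  have "twist \<alpha> t (n - 2) = of_real (1/4 - cos (pi * t) / 8) * cis (\<alpha> - \<kappa> / 4 * sin (pi * t))"
    "twist \<alpha> t (n - 1) = of_real (1/4 + cos (pi * t) / 8) * cis (\<alpha> + \<kappa> / 4 * sin (pi * t))"
    using n_less by (simp_all add: twist_def)
  then show "norm (twist \<alpha> t (n - 2)) = 1/4 - cos (pi * t) / 8" "norm (twist \<alpha> t (n - 1)) = 1/4 + cos (pi * t) / 8"
    using r by (simp_all only: norm_mult norm_of_real norm_cis mult_1_right abs_of_nonneg)
qed

lemma twist_spectator: "i < n \<Longrightarrow> i \<noteq> n - 2 \<Longrightarrow> i \<noteq> n - 1 \<Longrightarrow> twist \<alpha> t i = spectator i"
  by (simp add: twist_def)

lemma twist_inj: "inj_on (twist \<alpha> t) {..<n}"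
proof -
  have pair: "twist \<alpha> t (n - 2) \<noteq> twist \<alpha> t (n - 1)"
  proof
    assume e: "twist \<alpha> t (n - 2) = twist \<alpha> t (n - 1)"
    then have c0: "cos (pi * t) = 0" using twist_norm[of \<alpha> t] by simp
    then have "cis (\<alpha> - \<kappa> / 4 * sin (pi * t)) = cis (\<alpha> + \<kappa> / 4 * sin (pi * t))"
      using e n_less by (simp add: twist_def)
    moreover have "\<bar>(\<alpha> - \<kappa> / 4 * sin (pi * t)) - (\<alpha> + \<kappa> / 4 * sin (pi * t))\<bar> < 2 * pi"
      using angle_bound[of "pi * t"] \<kappa> pi_gt_zero by linarith
    ultimately have "\<kappa> / 4 * sin (pi * t) = 0" using cis_eq_small by fastforce
    then have "sin (pi * t) = 0" using \<kappa>(1) by simp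
    then show False using c0 sin_cos_squared_add[of "pi * t"] by simp
  qed
  have big: "1/8 \<le> norm (twist \<alpha> t i)" if "i = n - 2 \<or> i = n - 1" for i
    using that twist_norm[of \<alpha> t] radius[of "pi * t"] by auto
  have sp: "norm (twist \<alpha> t i) \<le> 1/16" if "i < n" "i \<noteq> n - 2" "i \<noteq> n - 1" for i
    using that twist_spectator spectator(1) by simp
  show ?thesis
  proof (rule inj_onI)
    fix i j assume ij: "i \<in> {..<n}" "j \<in> {..<n}" "twist \<alpha> t i = twist \<alpha> t j"
    have "(i = n - 2 \<or> i = n - 1) \<longleftrightarrow> (j = n - 2 \<or> j = n - 1)"
      using big[of i] big[of j] sp[of i] sp[of j] ij by force
    then consider "i = n - 2 \<or> i = n - 1" "j = n - 2 \<or> j = n - 1" | "i \<noteq> n - 2" "i \<noteq> n - 1" "j \<noteq> n - 2" "j \<noteq> n - 1" by blast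
    then show "i = j"
    proof cases
      case 1
      then show ?thesis using ij(3) pair by metis
    next
      case 2
      then have "spectator i = spectator j" using ij twist_spectator by simp
      then show ?thesis using ij spectator(5) by simp
    qed
  qed
qed

lemma twist_lifted: "twist \<alpha> t \<in> topspace (lifted n)"
proof (rule interior_lifted[OF _ _ twist_inj])
  fix i assume "i < n"
  consider "i = n - 2" | "i = n - 1" | "i \<noteq> n - 2" "i \<noteq> n - 1" by blast
  then show "norm (twist \<alpha> t i) < 1"
  proof cases
    case 3
    then show ?thesis using twist_spectator[OF \<open>i < n\<close>] spectator(1)[OF \<open>i < n\<close>] by simp
  qed (simp only: twist_norm, use radius[of "pi * t"] in linarith)+
qed (simp add: twist_def)

lemma twist_continuous:
  fixes A :: "'z::t2_space set"
  assumes "continuous_on A \<alpha>" "continuous_on A t"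
  shows "continuous_map (top_of_set A) (lifted n) (\<lambda>x. twist (\<alpha> x) (t x))"
proof (rule continuous_map_liftedI[OF _ twist_lifted])
  fix i assume "i < n"
  consider "i = n - 2" | "i = n - 1" | "i \<noteq> n - 2" "i \<noteq> n - 1" by blast
  then show "continuous_on A (\<lambda>a. twist (\<alpha> a) (t a) i)"
    by cases (use \<open>i < n\<close> n_less assms in \<open>auto simp: twist_def intro!: continuous_intros\<close>)
qed

lemma twist_swap: "twist \<alpha> 1 = twist \<alpha> 0 \<circ> nat_swap (n - 2) (n - 1)"
proof
  fix i
  consider "i = n - 2" | "i = n - 1" | "i \<noteq> n - 2" "i \<noteq> n - 1" by blast
  then show "twist \<alpha> 1 i = (twist \<alpha> 0 \<circ> nat_swap (n - 2) (n - 1)) i"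
    using n_less by cases (simp_all add: twist_def)
qed

lemma pathin_twist: "pathin (lifted n) (twist \<alpha>)"
  unfolding pathin_def using twist_continuous[of "{0..1}" "\<lambda>_. \<alpha>" "\<lambda>t. t"] by (simp add: continuous_intros)

text \<open>Turning \<open>\<alpha>\<close> carries the twist around the centre. The other two sides
  of this homotopy are the same motion up to relabelling, so their values cancel.\<close>

lemma \<Psi>_twist: "\<Psi> (twist \<alpha>) = \<Psi> (twist 0)"
proof -
  have c: "continuous_map (top_of_set unit_square) (lifted n) (\<lambda>x. twist (fst x * \<alpha>) (snd x))"
    by (intro twist_continuous continuous_intros)
  have p: "pathin (lifted n) (\<lambda>u. twist (u * \<alpha>) 0)"
    unfolding pathin_def by (intro twist_continuous continuous_intros)
  have "\<Psi> (\<lambda>u. twist (u * \<alpha>) 1) = \<Psi> (\<lambda>u. twist (u * \<alpha>) 0)"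
    unfolding twist_swap using \<Psi>_permute[OF swap_permutes, of "\<lambda>u. twist (u * \<alpha>) 0"] .
  then show ?thesis
    using path_char_square[OF pc\<Psi> c] path_char_nonzero[OF pc\<Psi> p] by simp
qed

text \<open>Carried across the edge, where the orientation is reversed, a half twist becomes its inverse.\<close>

lemma twist_reverse: "\<Psi> (twist (\<kappa> / 2)) = inverse (\<Psi> (twist (3 * \<kappa> / 2)))"
proof -
  \<comment> \<open>Strip coordinates of the pair: \<open>a\<close> carries the angular and
    \<open>b\<close> the radial part of the twist. At \<open>u = 0\<close> the radius is
    \<open>1 - b\<close>; lowering \<open>b\<close> by 3/2 takes the pair across the edge, always
    with \<open>\<bar>b\<bar> \<le> 7/8\<close>.\<close>
  define a where "a i t = (if i = n - 2 then - (\<kappa> / 4 * sin (pi * t)) else \<kappa> / 4 * sin (pi * t))" for i and t :: real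
  define b where "b i u t = (if i = n - 2 then 3/4 + cos (pi * t) / 8 else 3/4 - cos (pi * t) / 8) - 3/2 * u" for i and u t :: real
  define h where "h u t = restrict (\<lambda>i. if i = n - 2 \<or> i = n - 1 then q (strip_lift (a i t) (b i u t)) else q (spectator i)) {..<n}" for u t
  have a_bd: "\<bar>a i t\<bar> \<le> \<kappa> / 4" for i t using angle_bound[of "pi * t"] by (auto simp: a_def)
  have b_val: "b i u t = (if i = n - 2 then 3/4 + cos (pi * t) / 8 - 3/2 * u else 3/4 - cos (pi * t) / 8 - 3/2 * u)" for i u t
    by (simp add: b_def)
  have b_bd: "\<bar>b i u t\<bar> \<le> 7/8" if "u \<in> {0..1}" for i u t
  proof -
    have "0 \<le> u" "u \<le> 1" "-1 \<le> cos (pi * t)" "cos (pi * t) \<le> 1" using that by auto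
    moreover have "b i u t = 3/4 + cos (pi * t) / 8 - 3/2 * u \<or> b i u t = 3/4 - cos (pi * t) / 8 - 3/2 * u"
      by (simp add: b_val)
    ultimately show ?thesis by linarith
  qed
  have cont: "continuous_map (top_of_set unit_square) (config_space n U) (\<lambda>x. h (fst x) (snd x))"
    unfolding continuous_map_config
  proof (intro conjI allI impI ballI)
    fix i assume i: "i < n"
    show "continuous_map (top_of_set unit_square) U (\<lambda>x. h (fst x) (snd x) i)"
    proof (cases "i = n - 2 \<or> i = n - 1")
      case True
      have "continuous_map (top_of_set unit_square) U (\<lambda>x. q (strip_lift (a i (snd x)) (b i (fst x) (snd x))))"
      proof (rule continuous_strip)
        show "continuous_on unit_square (\<lambda>x. a i (snd x))"
          by (cases "i = n - 2") (auto simp: a_def intro!: continuous_intros)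
        show "continuous_on unit_square (\<lambda>x. b i (fst x) (snd x))"
          by (cases "i = n - 2") (auto simp: b_def intro!: continuous_intros)
        show "\<bar>a i (snd x)\<bar> \<le> \<kappa> / 2" for x :: "real \<times> real" using a_bd[of i "snd x"] \<kappa>(1) by linarith
        show "\<bar>b i (fst x) (snd x)\<bar> \<le> 1" if "x \<in> unit_square" for x :: "real \<times> real"
          using b_bd[of "fst x" i "snd x"] that by auto
      qed
      then show ?thesis using True i by (simp add: h_def)
    next
      case False
      then show ?thesis using i q_in[of "spectator i"] spectator(1)[OF i] by (simp add: h_def)
    qed
  next
    fix x :: "real \<times> real" assume "x \<in> topspace (top_of_set unit_square)"
    then obtain u t where x: "x = (u, t)" "u \<in> {0..1}" "t \<in> {0..1}" by auto
    show "h (fst x) (snd x) \<in> extensional {..<n}" by (simp add: h_def)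
    have norm_s: "1/8 \<le> norm (strip_lift (a i t) (b i u t))" "strip_lift (a i t) (b i u t) \<in> cball 0 1" for i
      using norm_strip_lift[of "b i u t" "a i t"] b_bd[OF x(2), of i t] by auto
    have mixed: "q (strip_lift (a i t) (b i u t)) \<noteq> q (spectator j)" if "j < n" for i j
    proof
      assume "q (strip_lift (a i t) (b i u t)) = q (spectator j)"
      then have "strip_lift (a i t) (b i u t) = spectator j"
        using q_interior[OF norm_s(2)] spectator(1)[OF that] by simp
      then show False using norm_s(1)[of i] spectator(1)[OF that] by simp
    qed
    have pair: "q (strip_lift (a (n - 2) t) (b (n - 2) u t)) \<noteq> q (strip_lift (a (n - 1) t) (b (n - 1) u t))"
    proof
      assume e: "q (strip_lift (a (n - 2) t) (b (n - 2) u t)) = q (strip_lift (a (n - 1) t) (b (n - 1) u t))"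
      have "\<bar>b i u t\<bar> < 1" for i using b_bd[OF x(2), of i t] by linarith
      from strip_inj[OF e a_bd a_bd this this] have "cos (pi * t) = 0" "\<kappa> / 4 * sin (pi * t) = 0"
        using n_less by (auto simp: a_def b_def)
      then show False using \<kappa>(1) sin_cos_squared_add[of "pi * t"] by simp
    qed
    have specs: "i = j" if "i < n" "j < n" "q (spectator i) = q (spectator j)" for i j
    proof -
      have "spectator i = spectator j"
        using q_interior[of "spectator i" "spectator j"] that spectator(1)[of i] spectator(1)[of j] by simp
      then show ?thesis using spectator(5) that by blast
    qed
    show "inj_on (h (fst x) (snd x)) {..<n}"
    proof (rule inj_onI)
      fix i j assume "i \<in> {..<n}" "j \<in> {..<n}" "h (fst x) (snd x) i = h (fst x) (snd x) j"
      then show "i = j"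
        using mixed[of i j] mixed[of j i] pair specs[of i j] x(1) unfolding h_def
        by (auto split: if_splits)
    qed
  qed
  have h0: "h 0 t = proj n (twist (\<kappa> / 2) t)" for t
  proof -
    have "0 \<le> b i 0 t" for i
    proof -
      have "-1 \<le> cos (pi * t)" "cos (pi * t) \<le> 1" by auto
      moreover have "b i 0 t = 3/4 + cos (pi * t) / 8 \<or> b i 0 t = 3/4 - cos (pi * t) / 8" by (simp add: b_val)
      ultimately show ?thesis by linarith
    qed
    then have "strip_lift (a i t) (b i 0 t) = of_real (1 - b i 0 t) * cis (\<kappa> / 2 + a i t)" for i
      by (simp add: strip_lift_def)
    moreover have "1 - b i 0 t = (if i = n - 2 then 1/4 - cos (pi * t) / 8 else 1/4 + cos (pi * t) / 8)" for i
      by (simp add: b_def)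
    ultimately have "strip_lift (a i t) (b i 0 t) = twist (\<kappa> / 2) t i" if "i = n - 2 \<or> i = n - 1" for i
      using that n_less by (auto simp: twist_def a_def)
    then show ?thesis by (auto simp: fun_eq_iff h_def proj_def twist_spectator)
  qed
  \<comment> \<open>Beyond the edge the radius is \<open>1 + b\<close> instead of
    \<open>1 - b\<close>: the radial motion is mirrored and the angular one kept, which is the twist
    run backwards.\<close>
  have h1: "h 1 t = proj n (path_rev (twist (3 * \<kappa> / 2)) t)" for t
  proof -
    have "\<not> 0 \<le> b i 1 t" for i
    proof -
      have "-1 \<le> cos (pi * t)" "cos (pi * t) \<le> 1" by auto
      moreover have "b i 1 t = cos (pi * t) / 8 - 3/4 \<or> b i 1 t = - (cos (pi * t) / 8) - 3/4" by (simp add: b_val)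
      ultimately show ?thesis by linarith
    qed
    then have "strip_lift (a i t) (b i 1 t) = of_real (1 + b i 1 t) * cis (3 * \<kappa> / 2 + a i t)" for i
      by (simp add: strip_lift_def)
    moreover have "1 + b i 1 t = (if i = n - 2 then 1/4 + cos (pi * t) / 8 else 1/4 - cos (pi * t) / 8)" for i
      by (simp add: b_def)
    moreover have "sin (pi * (1 - t)) = sin (pi * t)" "cos (pi * (1 - t)) = - cos (pi * t)"
      by (simp_all add: algebra_simps sin_diff cos_diff)
    ultimately have "strip_lift (a i t) (b i 1 t) = path_rev (twist (3 * \<kappa> / 2)) t i" if "i = n - 2 \<or> i = n - 1" for i
      using that n_less by (auto simp: twist_def a_def path_rev_def)
    then show ?thesis by (auto simp: fun_eq_iff h_def proj_def twist_spectator path_rev_def)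
  qed
  \<comment> \<open>A half twist ends where it began with the labels of the pair exchanged, so the
    sides of the homotopy at times 0 and 1 have equal values.\<close>
  have hs: "h u 1 = h u 0 \<circ> nat_swap (n - 2) (n - 1)" for u
    using n_less by (auto simp: fun_eq_iff h_def a_def b_def Transposition.transpose_def)
  have "pathin (config_space n U) (\<lambda>u. h u 0)"
  proof -
    have "continuous_map (top_of_set {0..1}) (top_of_set unit_square) (\<lambda>u::real. (u, 0::real))"
      by (auto simp: continuous_map_in_subtopology intro!: continuous_intros)
    from continuous_map_compose[OF this cont] show ?thesis by (simp add: pathin_def o_def)
  qed
  moreover have "\<Phi>o (\<lambda>u. h u 1) = \<Phi>o (\<lambda>u. h u 0)"
    unfolding hs using \<Phi>o_permute[OF swap_permutes, of "\<lambda>u. h u 0"] .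
  ultimately have "\<Phi>o (h 0) = \<Phi>o (h 1)"
    using path_char_square[OF pc\<Phi>o cont] path_char_nonzero[OF pc\<Phi>o] by simp
  moreover have "\<Phi>o (h 0) = \<Psi> (twist (\<kappa> / 2))" unfolding \<Psi>_def o_def h0[symmetric] ..
  moreover have "\<Phi>o (h 1) = \<Psi> (path_rev (twist (3 * \<kappa> / 2)))" unfolding \<Psi>_def o_def h1[symmetric] ..
  ultimately show ?thesis using path_char_rev[OF pc\<Psi> pathin_twist] by simp
qed

lemma twist_box: "t \<in> {0..1} \<Longrightarrow> twist 0 t \<in> topspace (box_config n)"
proof -
  have "twist 0 t i \<in> sq_box" if "i < n" for i
  proof -
    have "norm (twist 0 t i) \<le> 3/8"
      using that twist_norm[of 0 t] radius[of "pi * t"] twist_spectator[of i 0 t] spectator(1)[of i]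
      by (cases "i = n - 2"; cases "i = n - 1") auto
    then show ?thesis using abs_Re_le_cmod[of "twist 0 t i"] abs_Im_le_cmod[of "twist 0 t i"] by (simp add: sq_box_def)
  qed
  then show ?thesis using twist_inj by (simp add: topspace_box_config twist_def)
qed

lemma pathin_twist_box: "pathin (box_config n) (twist 0)"
  unfolding pathin_def
  by (rule continuous_map_box_config[OF continuous_lifted_coordinate[OF pathin_twist[unfolded pathin_def]] twist_box])

lemma re_rank_sorted:
  assumes "\<And>i j. i < j \<Longrightarrow> j < n \<Longrightarrow> Re (x i) < Re (x j)" "i < n"
  shows "re_rank n x i = i"
proof -
  have "{j. j < n \<and> Re (x j) < Re (x i)} = {..<i}"
  proof (intro equalityI subsetI)
    fix j assume j: "j \<in> {j. j < n \<and> Re (x j) < Re (x i)}"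
    show "j \<in> {..<i}"
    proof (rule ccontr)
      assume "j \<notin> {..<i}"
      then have "i = j \<or> i < j" by auto
      then show False using assms(1)[of i j] j by auto
    qed
  next
    fix j assume "j \<in> {..<i}"
    then show "j \<in> {j. j < n \<and> Re (x j) < Re (x i)}" using assms(1)[of j i] assms(2) by auto
  qed
  then show ?thesis by (simp add: re_rank_def)
qed

lemma twist_Re_Im:
  assumes "t \<in> {0..1}"
  shows "cos (pi * t) > 0 \<Longrightarrow> Re (twist 0 t (n - 2)) < Re (twist 0 t (n - 1))"
    "cos (pi * t) < 0 \<Longrightarrow> Re (twist 0 t (n - 1)) < Re (twist 0 t (n - 2))"
    "t \<in> {0<..<1} \<Longrightarrow> Im (twist 0 t (n - 2)) < Im (twist 0 t (n - 1))"
    "0 < Re (twist 0 t (n - 2))" "0 < Re (twist 0 t (n - 1))"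
proof -
  let ?\<theta> = "\<kappa> / 4 * sin (pi * t)"
  have "\<bar>?\<theta>\<bar> < pi / 2" using angle_bound[of "pi * t"] \<kappa> pi_gt_zero by linarith
  then have c: "cos ?\<theta> > 0" by (intro cos_gt_zero_pi) auto
  have e: "Re (twist 0 t (n - 2)) = (1/4 - cos (pi * t) / 8) * cos ?\<theta>" "Re (twist 0 t (n - 1)) = (1/4 + cos (pi * t) / 8) * cos ?\<theta>"
    "Im (twist 0 t (n - 2)) = - ((1/4 - cos (pi * t) / 8) * sin ?\<theta>)" "Im (twist 0 t (n - 1)) = (1/4 + cos (pi * t) / 8) * sin ?\<theta>"
    using n_less by (simp_all add: twist_def)
  show "cos (pi * t) > 0 \<Longrightarrow> Re (twist 0 t (n - 2)) < Re (twist 0 t (n - 1))"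
    "cos (pi * t) < 0 \<Longrightarrow> Re (twist 0 t (n - 1)) < Re (twist 0 t (n - 2))"
    unfolding e by (rule mult_strict_right_mono[OF _ c], linarith)+
  have r: "0 < 1/4 - cos (pi * t) / 8" "0 < 1/4 + cos (pi * t) / 8" using radius[of "pi * t"] by linarith+
  show "0 < Re (twist 0 t (n - 2))" "0 < Re (twist 0 t (n - 1))"
    unfolding e by (rule mult_pos_pos[OF _ c], rule r)+
  assume t: "t \<in> {0<..<1}"
  have "sin (pi * t) > 0" using t pi_gt_zero by (intro sin_gt_zero) auto
  then have "0 < ?\<theta>" using \<kappa>(1) by simp
  then have "sin ?\<theta> > 0" using \<open>\<bar>?\<theta>\<bar> < pi / 2\<close> pi_gt_zero by (intro sin_gt_zero) linarith+
  then have "- ((1/4 - cos (pi * t) / 8) * sin ?\<theta>) < 0" "0 < (1/4 + cos (pi * t) / 8) * sin ?\<theta>"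
    using mult_pos_pos[OF r(1)] mult_pos_pos[OF r(2)] by simp_all
  then show "Im (twist 0 t (n - 2)) < Im (twist 0 t (n - 1))" unfolding e by linarith
qed

lemma twist_order:
  assumes "t \<in> {0..1}" "i < j" "j < n" "(i, j) \<noteq> (n - 2, n - 1)"
  shows "Re (twist 0 t i) < Re (twist 0 t j)"
proof -
  have i: "i \<noteq> n - 2" "i \<noteq> n - 1" "i < n" using assms by auto
  show ?thesis
  proof (cases "j = n - 2 \<or> j = n - 1")
    case True
    then show ?thesis using twist_Re_Im(4,5)[OF assms(1)] twist_spectator[OF i(3,1,2)] spectator(2)[OF i(3)] by force
  next
    case False
    then show ?thesis using twist_spectator[OF i(3,1,2)] twist_spectator[of j] spectator(4)[OF i(3)] assms by simp
  qed
qed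

text \<open>The horizontal order is constant for \<open>t\<close> up to 1/4 and from 3/4 on, and the
  vertical order of the pair is constant in between. So the path splits into three segments in
  convex sets, the middle one an elementary crossing.\<close>

lemma twist_value: "\<Psi> (twist 0) = swap_value (n - 2)"
proof -
  let ?\<tau> = "nat_swap (n - 2) (n - 1)"
  define O1 where "O1 = ordered_configs n {(i,j). i < j \<and> j < n} {}"
  define O2 where "O2 = ordered_configs n ({(i,j). i < j \<and> j < n \<and> (i,j) \<noteq> (n - 2, n - 1)}) {(n - 2, n - 1)}"
  define O3 where "O3 = ordered_configs n ({(i,j). i < j \<and> j < n \<and> (i,j) \<noteq> (n - 2, n - 1)} \<union> {(n - 1, n - 2)}) {}"
  have C: "tconvex n O1" "tconvex n O2" "tconvex n O3"
    unfolding O1_def O2_def O3_def using n_less by (auto intro!: tconvex_ordered_configs simp: separates_def)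
  have cpos: "cos (pi * t) > 0" if "t \<in> {0..1/4}" for t
  proof -
    have "pi * t \<le> pi * (1/4)" using that pi_gt_zero by (intro mult_left_mono) auto
    moreover have "0 \<le> pi * t" using that pi_gt_zero by simp
    ultimately show ?thesis using pi_gt_zero by (intro cos_gt_zero_pi) linarith+
  qed
  have cneg: "cos (pi * t) < 0" if "t \<in> {3/4..1}" for t
  proof -
    have "cos (pi * t) = - cos (pi * (1 - t))" by (simp add: algebra_simps cos_diff)
    then show ?thesis using cpos[of "1 - t"] that by simp
  qed
  have in1: "twist 0 t \<in> O1" if "t \<in> {0..1/4}" for t
    using that twist_box[of t] twist_order[of t] twist_Re_Im(1)[of t] cpos[of t] unfolding O1_def ordered_configs_def by force
  have in2: "twist 0 t \<in> O2" if "t \<in> {1/4..3/4}" for t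
    using that twist_box[of t] twist_order[of t] twist_Re_Im(3)[of t] unfolding O2_def ordered_configs_def by force
  have in3: "twist 0 t \<in> O3" if "t \<in> {3/4..1}" for t
    using that twist_box[of t] twist_order[of t] twist_Re_Im(2)[of t] cneg[of t] unfolding O3_def ordered_configs_def by force
  have r1: "re_rank n x i = i" if "x \<in> O1" "i < n" for x i
    using that by (intro re_rank_sorted) (auto simp: O1_def ordered_configs_def)
  have r3: "re_rank n x i = ?\<tau> i" if x: "x \<in> O3" and i: "i < n" for x i
  proof -
    have lt: "Re ((x \<circ> ?\<tau>) i) < Re ((x \<circ> ?\<tau>) j)" if "i < j" "j < n" for i j
    proof -
      have "(?\<tau> i, ?\<tau> j) \<in> {(i,j). i < j \<and> j < n \<and> (i,j) \<noteq> (n - 2, n - 1)} \<union> {(n - 1, n - 2)}"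
        using that n_less by (auto simp: Transposition.transpose_def)
      then show ?thesis using x unfolding O3_def ordered_configs_def by auto
    qed
    have ti: "?\<tau> i < n" using permutes_in_image[OF swap_permutes, of i] i by simp
    have "re_rank n (x \<circ> ?\<tau>) (?\<tau> i) = ?\<tau> i" by (rule re_rank_sorted[OF lt ti])
    moreover have "re_rank n (x \<circ> ?\<tau>) (?\<tau> i) = re_rank n x (?\<tau> (?\<tau> i))"
      by (rule re_rank_permute[OF swap_permutes _ ti]) simp
    ultimately show ?thesis by simp
  qed
  have gen: "generic n x" if "x \<in> O1 \<or> x \<in> O3" for x
  proof -
    have "Re (x i) \<noteq> Re (x j)" if "i < n" "j < n" "i \<noteq> j" for i j
    proof -
      have "re_rank n x i \<noteq> re_rank n x j"
        using r1[of x i] r1[of x j] r3[of x i] r3[of x j] that \<open>x \<in> O1 \<or> x \<in> O3\<close>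
          inj_eq[OF permutes_inj[OF swap_permutes], of i j] by auto
      then show ?thesis unfolding re_rank_def by auto
    qed
    then show ?thesis using that by (auto simp: generic_def inj_on_def O1_def O3_def ordered_configs_def)
  qed
  have sub: "\<Psi> (twist 0 \<circ> linepath a b) = seg (twist 0 a) (twist 0 b)"
    if "tconvex n D" "\<And>t. t \<in> {a..b} \<Longrightarrow> twist 0 t \<in> D" "0 \<le> a" "a \<le> b" "b \<le> 1" for D a b
  proof -
    have l: "linepath a b ` {0..1} = {a..b}"
      using that(4) by (simp add: linepath_image_01 closed_segment_eq_real_ivl)
    have "pathin (box_config n) (twist 0 \<circ> linepath a b)"
      using l that by (intro pathin_reparam[OF pathin_twist_box]) (auto simp: continuous_on_linepath)
    moreover have "(twist 0 \<circ> linepath a b) ` {0..1} \<subseteq> D"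
      unfolding image_comp[symmetric] l using that(2) by blast
    ultimately show ?thesis using seg_path[OF that(1)] by (fastforce simp: linepath_0' linepath_1')
  qed
  have I: "continuous_map (top_of_set {0..1::real}) (box_config n) (twist 0)" using pathin_twist_box by (simp add: pathin_def)
  have "\<Psi> (twist 0) = \<Psi> (twist 0 \<circ> linepath 0 1)" by (simp add: linepath_def o_def)
  also have "\<dots> = \<Psi> (twist 0 \<circ> linepath 0 (1/4)) * (\<Psi> (twist 0 \<circ> linepath (1/4) (3/4)) * \<Psi> (twist 0 \<circ> linepath (3/4) 1))"
    using path_char_triangle[OF pc _ I, of 0 "1/4" 1] path_char_triangle[OF pc _ I, of "1/4" "3/4" 1] by simp
  also have "\<dots> = seg (twist 0 0) (twist 0 (1/4)) * (seg (twist 0 (1/4)) (twist 0 (3/4)) * seg (twist 0 (3/4)) (twist 0 1))"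
    using sub[OF C(1) in1] sub[OF C(2) in2] sub[OF C(3) in3] by simp
  finally have val: "\<Psi> (twist 0) = \<dots>" .
  let ?x0 = "twist 0 0" and ?x1 = "twist 0 (1/4)" and ?x2 = "twist 0 (3/4)" and ?x3 = "twist 0 1"
  have mem: "?x0 \<in> O1" "?x1 \<in> O1" "?x1 \<in> O2" "?x2 \<in> O2" "?x2 \<in> O3" "?x3 \<in> O3"
    using in1[of 0] in1[of "1/4"] in2[of "1/4"] in2[of "3/4"] in3[of "3/4"] in3[of 1] by auto
  have g: "generic n ?x0" "generic n ?x1" "generic n ?x2" "generic n ?x3" using gen mem by auto
  have j1: "jump ?x0 ?x1 = 1" by (rule jump_same_order) (use g r1 mem in auto)
  have j3: "jump ?x2 ?x3 = 1" by (rule jump_same_order) (use g r3 mem in auto)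
  have j2: "jump ?x1 ?x2 = swap_value (n - 2)"
  proof (rule jump_swap[where j = "n - 2" and k = "n - 1"])
    show "re_rank n ?x2 i = nat_swap (n - 2) (Suc (n - 2)) (re_rank n ?x1 i)" if "i < n" for i
      using r3[OF mem(5) that] r1[OF mem(2) that] n_less by simp
    show "Im (?x1 (n - 2)) < Im (?x1 (n - 1))" "Im (?x2 (n - 2)) < Im (?x2 (n - 1))"
      using twist_Re_Im(3)[of "1/4"] twist_Re_Im(3)[of "3/4"] by auto
  qed (use g C(2) mem r1[OF mem(2)] n_less in auto)
  have "gauge ?x3 = gauge ?x0" unfolding twist_swap by (rule gauge_permute[OF swap_permutes g(1)])
  moreover have "gauge ?x0 * (seg ?x0 ?x1 * (seg ?x1 ?x2 * seg ?x2 ?x3)) = jump ?x0 ?x1 * jump ?x1 ?x2 * jump ?x2 ?x3 * gauge ?x3"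
    using gauge_nonzero[OF g(2)] gauge_nonzero[OF g(3)] gauge_nonzero[OF g(4)] by (simp add: jump_def)
  ultimately show ?thesis using val j1 j2 j3 gauge_nonzero[OF g(1)] by simp
qed

text \<open>The twists at 0, \<open>\<kappa> / 2\<close> and \<open>3 * \<kappa> / 2\<close> have
  equal values by rotation, while crossing the edge makes the last two inverse to each
  other.\<close>

lemma swap_value_sq: "Suc r < n \<Longrightarrow> (swap_value r)\<^sup>2 = 1"
proof -
  assume r: "Suc r < n"
  have "\<Psi> (twist 0) * \<Psi> (twist 0) = 1"
    using twist_reverse \<Psi>_twist path_char_nonzero[OF pc\<Psi> pathin_twist] by (metis right_inverse)
  then have "(swap_value (n - 2))\<^sup>2 = 1" unfolding twist_value by (simp add: power2_eq_square)
  then show ?thesis using swap_value_eq[OF r, of "n - 2"] n_less by simp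
qed

end

lemma swap_value_sign: "\<exists>\<epsilon>. \<epsilon>\<^sup>2 = 1 \<and> (\<forall>r. Suc r < n \<longrightarrow> swap_value r = \<epsilon>)"
proof (cases "n \<ge> 2")
  case True
  then have "Suc 0 < n" by simp
  then show ?thesis using swap_value_sq[OF True, of 0] swap_value_eq[of _ 0] by blast
qed (auto intro!: exI[of _ 1])

end

section \<open>Potentials on configurations in the disc\<close>

context crosscap_char
begin

text \<open>Radial shrinking deforms every path of the disc into the square, where
  \<open>box_potential\<close> applies; the values of the rays account for the endpoints.\<close>

lemma polygon_potential:
  obtains H where "\<And>z. z \<in> topspace (lifted n) \<Longrightarrow> H z \<noteq> 0"
    "\<And>p. pathin (lifted n) p \<Longrightarrow> \<Psi> p = H (p 1) / H (p 0)"
proof -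
  obtain \<epsilon> where \<epsilon>: "\<epsilon>\<^sup>2 = 1" "\<And>r. Suc r < n \<Longrightarrow> swap_value r = \<epsilon>" using swap_value_sign by blast
  obtain G where G: "\<And>z. z \<in> topspace (box_config n) \<Longrightarrow> G z \<noteq> 0"
    "\<And>p. pathin (box_config n) p \<Longrightarrow> \<Psi> p = G (p 1) / G (p 0)"
    using box_potential[OF \<epsilon>(2,1)] by metis
  define H where "H z = G (shrink n (1/3) z) / \<Psi> (ray n z)" for z
  have r0: "\<Psi> (ray n z) \<noteq> 0" if "z \<in> topspace (lifted n)" for z
    using path_char_nonzero[OF pc\<Psi> pathin_ray[OF that]] .
  have "\<Psi> p = H (p 1) / H (p 0)" if p: "pathin (lifted n) p" for p
  proof -
    have pz: "p s \<in> topspace (lifted n)" if "s \<in> {0..1}" for s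
      using p that path_image_subset_topspace by fastforce
    let ?h = "\<lambda>x. shrink n (1 - 2/3 * fst x) (p (snd x))"
    have "continuous_map (top_of_set unit_square) (lifted n) ?h"
    proof (rule continuous_map_liftedI)
      fix i assume i: "i < n"
      have "continuous_on unit_square (\<lambda>x. p (snd x) i)"
        using continuous_on_compose2[OF continuous_lifted_coordinate[OF p[unfolded pathin_def] i], of unit_square snd]
        by (simp add: continuous_on_snd image_subset_iff)
      then show "continuous_on unit_square (\<lambda>x. ?h x i)"
        using i by (auto simp: shrink_def intro!: continuous_intros)
    next
      fix x assume "x \<in> unit_square"
      then show "?h x \<in> topspace (lifted n)" by (intro shrink_lifted pz) auto
    qed
    from path_char_square[OF pc\<Psi> this]
    have "\<Psi> (\<lambda>s. shrink n 1 (p s)) * \<Psi> (ray n (p 1)) = \<Psi> (ray n (p 0)) * \<Psi> (\<lambda>s. shrink n (1/3) (p s))"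
      by (simp add: ray_def)
    moreover have "\<Psi> (\<lambda>s. shrink n 1 (p s)) = \<Psi> p"
      using shrink_one pz unfolding topspace_lifted by (intro path_char_cong[OF pc\<Psi> p]) auto
    moreover have "pathin (box_config n) (\<lambda>s. shrink n (1/3) (p s))"
      unfolding pathin_def
    proof (rule continuous_map_box_config)
      fix i assume i: "i < n"
      show "continuous_on {0..1} (\<lambda>s. shrink n (1/3) (p s) i)"
        using continuous_lifted_coordinate[OF p[unfolded pathin_def] i] i by (simp add: shrink_def continuous_intros)
    qed (use shrink_box pz in blast)
    ultimately show ?thesis
      using G(2)[of "\<lambda>s. shrink n (1/3) (p s)"] r0[OF pz[of 0]] r0[OF pz[of 1]] G(1)[OF shrink_box[OF pz[of 0]]] G(1)[OF shrink_box[OF pz[of 1]]]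
      by (simp add: H_def field_simps)
  qed
  moreover have "H z \<noteq> 0" if "z \<in> topspace (lifted n)" for z
    unfolding H_def using G(1)[OF shrink_box[OF that]] r0[OF that] by simp
  ultimately show ?thesis using that by blast
qed

end

section \<open>Moving one point along an edge\<close>

definition inner_pt :: "nat \<Rightarrow> nat \<Rightarrow> complex" where
  "inner_pt n i = of_real (real i / (4 * real n))"

definition edge_config :: "nat \<Rightarrow> nat \<Rightarrow> nat \<Rightarrow> real \<Rightarrow> nat \<Rightarrow> complex" where
  "edge_config m n a t = restrict (\<lambda>i. if i = 0 then edge_point m a t else inner_pt n i) {..<n}"

lemma inner_pt:
  assumes "i < n"
  shows "norm (inner_pt n i) < 1" "j < n \<Longrightarrow> inner_pt n i = inner_pt n j \<Longrightarrow> i = j" "inner_pt n i \<in> sq_box"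
proof -
  have "real i / (4 * real n) < 1/4" "0 \<le> real i / (4 * real n)" using assms by (auto simp: field_simps)
  then have b: "\<bar>real i / (4 * real n)\<bar> < 1/4" by simp
  then show "norm (inner_pt n i) < 1" unfolding inner_pt_def norm_of_real by linarith
  show "inner_pt n i \<in> sq_box" using b unfolding inner_pt_def sq_box_def by simp
  show "j < n \<Longrightarrow> inner_pt n i = inner_pt n j \<Longrightarrow> i = j"
    using assms unfolding inner_pt_def of_real_eq_iff by simp
qed

context polygon
begin

text \<open>An interior point is glued to nothing, so a single boundary point cannot collide with
  the others.\<close>

lemma boundary_lifted:
  assumes z: "norm z0 = 1" and x: "x \<in> extensional {..<n}" "x 0 = z0" "\<And>i. 0 < i \<Longrightarrow> i < n \<Longrightarrow> norm (x i) < 1" "inj_on x {..<n}"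
  shows "x \<in> topspace (lifted n)"
proof -
  have nx: "norm (x i) \<le> 1" if "i < n" for i using x(2,3) z that by (cases "i = 0") (auto simp: less_imp_le)
  have "i = j" if ij: "i < n" "j < n" "q (x i) = q (x j)" for i j
  proof -
    have "x i = x j"
    proof (cases "i = 0 \<and> j = 0")
      case False
      then have "norm (x i) < 1 \<or> norm (x j) < 1" using x(3) ij by auto
      then show ?thesis using q_interior[of "x i" "x j"] q_interior[of "x j" "x i"] nx ij by fastforce
    qed simp
    then show ?thesis using x(4) ij by (simp add: inj_on_def)
  qed
  then show ?thesis using x(1) nx unfolding topspace_lifted by (auto simp: inj_on_def)
qed

lemma edge_config_lifted: "n \<ge> 1 \<Longrightarrow> edge_config m n a t \<in> topspace (lifted n)"
proof (rule boundary_lifted[where ?z0.0 = "edge_point m a t"])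
  assume n: "n \<ge> 1"
  show "norm (edge_config m n a t i) < 1" if "0 < i" "i < n" for i using that inner_pt(1) by (simp add: edge_config_def)
  have ne: "edge_point m a t \<noteq> inner_pt n j" if "j < n" for j
    using inner_pt(1)[OF that] norm_edge_point[of m a t] by force
  show "inj_on (edge_config m n a t) {..<n}"
  proof (rule inj_onI)
    fix i j assume "i \<in> {..<n}" "j \<in> {..<n}" "edge_config m n a t i = edge_config m n a t j"
    then show "i = j" using ne[of i] ne[of j] inner_pt(2)[of i n j] by (auto simp: edge_config_def split: if_splits)
  qed
qed (auto simp: edge_config_def)

lemma pathin_edge_config: "m > 0 \<Longrightarrow> n \<ge> 1 \<Longrightarrow> pathin (lifted n) (edge_config m n a)"
  unfolding pathin_def
proof (rule continuous_map_liftedI[OF _ edge_config_lifted])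
  fix i assume "i < n" "m > 0"
  then show "continuous_on {0..1} (\<lambda>t. edge_config m n a t i)"
    by (cases "i = 0") (auto simp: edge_config_def edge_point_def intro!: continuous_intros)
qed

end

context crosscap_polygon
begin

text \<open>This is \<open>\<alpha>\<^sub>k\<close> of the overview. It closes up because the gluing
  identifies the two ends of the edge.\<close>

definition edge_loop :: "nat \<Rightarrow> nat \<Rightarrow> real \<Rightarrow> (nat \<Rightarrow> 'a) set" where
  "edge_loop n k = perm_orbit n \<circ> (proj n \<circ> edge_config m n (2 * k))"

lemma edge_config_next: "edge_config m n a 1 = edge_config m n (Suc a) 0"
  by (auto simp: edge_config_def edge_point_Suc fun_eq_iff)

lemma edge_config_wrap: "edge_config m n m 0 = edge_config m n 0 0"
  using edge_point_wrap[OF m_pos] by (auto simp: edge_config_def fun_eq_iff)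

lemma glued_pair: "k < g \<Longrightarrow> t \<in> {0..1} \<Longrightarrow> glued (edge_point m (2*k) t) (edge_point m (Suc (2*k)) t)"
  unfolding glued_iff by (rule exI[of _ "2*k"], intro conjI exI[of _ "Suc (2*k)"] bexI[of _ t]) auto

lemma proj_edge_pair:
  assumes "k < g" "t \<in> {0..1}"
  shows "proj n (edge_config m n (2 * k) t) = proj n (edge_config m n (Suc (2 * k)) t)"
  using q_glued[OF glued_pair[OF assms]] by (auto simp: proj_def edge_config_def)

lemma edge_loop_in:
  assumes "n \<ge> 1"
  shows "pathin (unordered_config_space n U) (edge_loop n k)"
  unfolding edge_loop_def
  by (intro pathin_compose[OF pathin_compose[OF pathin_edge_config[OF m_pos assms] continuous_map_proj] continuous_map_perm_orbit])

lemma edge_loop_closed: "k < g \<Longrightarrow> edge_loop n k 1 = edge_loop n k 0"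
  using proj_edge_pair[of k 0 n] by (simp add: edge_loop_def edge_config_next)

end

context crosscap_char
begin

lemma \<Psi>_edge: "\<Psi> (edge_config m n (2 * k)) = \<Phi> (edge_loop n k)"
  by (simp add: \<Psi>_def \<Phi>o_def edge_loop_def)

lemma \<Psi>_edge': "k < g \<Longrightarrow> n \<ge> 1 \<Longrightarrow> \<Psi> (edge_config m n (Suc (2 * k))) = \<Phi> (edge_loop n k)"
proof -
  assume k: "k < g" "n \<ge> 1"
  have "\<Phi>o (proj n \<circ> edge_config m n (Suc (2 * k))) = \<Phi>o (proj n \<circ> edge_config m n (2 * k))"
    using proj_edge_pair[OF k(1)]
    by (intro path_char_cong[OF pc\<Phi>o pathin_compose[OF pathin_edge_config[OF m_pos k(2)] continuous_map_proj]]) simp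
  then show ?thesis using \<Psi>_edge by (simp add: \<Psi>_def)
qed

text \<open>Going once around the boundary of the polygon.\<close>

lemma edge_loop_relation:
  assumes n: "n \<ge> 1"
  shows "(\<Prod>k<g. (\<Phi> (edge_loop n k))\<^sup>2) = 1"
proof -
  obtain H where H: "\<And>z. z \<in> topspace (lifted n) \<Longrightarrow> H z \<noteq> 0"
    "\<And>p. pathin (lifted n) p \<Longrightarrow> \<Psi> p = H (p 1) / H (p 0)" using polygon_potential by blast
  \<comment> \<open>The potential at the successive vertices: edge \<open>a\<close> contributes
    \<open>e (Suc a) / e a\<close>, the product telescopes, and the last vertex is the first one
    again.\<close>
  define e where "e a = H (edge_config m n a 0)" for a
  have e0: "e a \<noteq> 0" for a unfolding e_def by (rule H(1)[OF edge_config_lifted[OF n]])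
  have \<Psi>e: "\<Psi> (edge_config m n a) = e (Suc a) / e a" for a
    using H(2)[OF pathin_edge_config[OF m_pos n]] by (simp add: e_def edge_config_next)
  have "(\<Prod>k<j. (\<Phi> (edge_loop n k))\<^sup>2) = e (2 * j) / e 0" if "j \<le> g" for j
    using that
  proof (induction j)
    case (Suc j)
    have "(\<Phi> (edge_loop n j))\<^sup>2 = \<Psi> (edge_config m n (2 * j)) * \<Psi> (edge_config m n (Suc (2 * j)))"
      using \<Psi>_edge[of j] \<Psi>_edge'[of j] n Suc.prems by (simp add: power2_eq_square)
    then show ?case using Suc e0 by (simp add: \<Psi>e)
  qed (use e0 in simp)
  moreover have "e m = e 0" by (simp add: e_def edge_config_wrap)
  ultimately show ?thesis using e0 by simp
qed

end

text \<open>\<open>H\<close> is a potential in the disc. With crossings and edge loops of value 1 it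
  descends to ordered and then to unordered configurations of \<open>U\<close>, which forces
  \<open>\<Phi>\<close> to be 1 on loops.\<close>

locale trivial_crosscap_char = crosscap_char +
  fixes H
  assumes n1: "n \<ge> 1" and triv_swap: "\<And>r. Suc r < n \<Longrightarrow> swap_value r = 1" and triv: "\<And>k. k < g \<Longrightarrow> \<Phi> (edge_loop n k) = 1"
    and H0: "\<And>z. z \<in> topspace (lifted n) \<Longrightarrow> H z \<noteq> 0"
    and H: "\<And>p. pathin (lifted n) p \<Longrightarrow> \<Psi> p = H (p 1) / H (p 0)"
begin

lemma ratio_path:
  assumes p: "pathin (lifted n) p" "pathin (lifted n) p'" and eq: "\<And>t. t \<in> {0..1} \<Longrightarrow> proj n (p t) = proj n (p' t)"
  shows "H (p 1) / H (p 0) = H (p' 1) / H (p' 0)"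
proof -
  have "\<Psi> p = \<Psi> p'" unfolding \<Psi>_def
    by (rule path_char_cong[OF pc\<Phi>o pathin_compose[OF p(2) continuous_map_proj]]) (use eq in simp)
  then show ?thesis using H p by simp
qed

text \<open>A path from \<open>y\<close> to \<open>x\<close> and its relabelling have the same value
  under \<open>\<Psi>\<close>.\<close>

lemma ratio_permute:
  assumes "\<pi> permutes {..<n}" "x \<in> topspace (lifted n)" "y \<in> topspace (lifted n)"
  shows "H (x \<circ> \<pi>) / H (y \<circ> \<pi>) = H x / H y"
proof -
  obtain p where p: "pathin (lifted n) p" "p 0 = y" "p 1 = x"
    using path_connected_lifted[of n] assms unfolding path_connected_space_def by blast
  have "pathin (lifted n) (\<lambda>t. p t \<circ> \<pi>)"
    unfolding pathin_def
  proof (rule continuous_map_liftedI)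
    fix i assume "i < n"
    then have "\<pi> i < n" using permutes_in_image[OF assms(1), of i] by simp
    then show "continuous_on {0..1} (\<lambda>t. (p t \<circ> \<pi>) i)"
      using continuous_lifted_coordinate[OF p(1)[unfolded pathin_def]] by simp
  next
    fix t :: real assume "t \<in> {0..1}"
    then have "p t \<in> topspace (lifted n)" using p(1) path_image_subset_topspace by fastforce
    then show "p t \<circ> \<pi> \<in> topspace (lifted n)" by (rule lifted_permute[OF assms(1)])
  qed
  from H[OF this] have "H (x \<circ> \<pi>) / H (y \<circ> \<pi>) = \<Psi> p" using \<Psi>_permute[OF assms(1), of p] p by simp
  then show ?thesis using H[OF p(1)] p by simp
qed

text \<open>Both configurations have the same projection. A motion performed on both at once with
  equal projections keeps \<open>H x / H y\<close>, so both can be brought to standard form.\<close>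

lemma update_path_ratio:
  assumes n: "x \<in> topspace (lifted n)" "x 0 = edge_point m a t"
    and y: "y \<in> topspace (lifted n)" "y 0 = edge_point m b t" "\<And>i. i \<noteq> 0 \<Longrightarrow> y i = x i"
    and gl: "glued (edge_point m a t) (edge_point m b t)" "t \<in> {0..1}"
      "\<And>s. s \<in> {0..1} \<Longrightarrow> glued (edge_point m a s) (edge_point m b s)"
  shows "H x / H y = H (edge_config m n a 0) / H (edge_config m n b 0)"
proof -
  have qab: "q (edge_point m a s) = q (edge_point m b s)" if "s \<in> {0..1}" for s using q_glued[OF gl(3)[OF that]] .
  \<comment> \<open>first shrink the other points, then move them to the standard position, then slide along the edge\<close>
  define w where "w c s = (\<lambda>i. if i = 0 then c else shrink n (1 - 2/3 * s) x i)" for c :: complex and s :: real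
  have wl: "w c s \<in> topspace (lifted n)" if "c = x 0 \<or> c = y 0" "s \<in> {0..1}" for c s
  proof (cases "s = 0")
    case True
    have "w c 0 = x \<or> w c 0 = y"
      using that(1) y(3) n(1) y(1) unfolding topspace_lifted by (auto simp: w_def shrink_def fun_eq_iff extensional_def)
    then show ?thesis using True n(1) y(1) by auto
  next
    case False
    have s: "0 < 1 - 2/3 * s" "1 - 2/3 * s < 1" using that(2) False by auto
    have nw: "norm (w c s i) < 1" if "0 < i" "i < n" for i
    proof -
      have "norm (x i) \<le> 1" using n(1) that unfolding topspace_lifted by simp
      then have "(1 - 2/3 * s) * norm (x i) \<le> (1 - 2/3 * s) * 1" using s by (intro mult_left_mono) auto
      then have "(1 - 2/3 * s) * norm (x i) < 1" using s by (smt (verit))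
      then show ?thesis using that s by (simp add: w_def shrink_def)
    qed
    have nc: "norm c = 1" using that(1) n(2) y(2) by auto
    show ?thesis
    proof (rule boundary_lifted[where ?z0.0 = c])
      show "inj_on (w c s) {..<n}"
      proof (rule inj_onI)
        fix i j assume ij: "i \<in> {..<n}" "j \<in> {..<n}" "w c s i = w c s j"
        have "w c s 0 = c" by (simp add: w_def)
        then have "i = 0 \<longleftrightarrow> j = 0" using ij nw[of i] nw[of j] nc by (metis gr0I lessThan_iff less_irrefl)
        moreover have "x i = x j \<Longrightarrow> i = j" using n(1) ij unfolding topspace_lifted inj_on_def by auto
        ultimately show "i = j" using ij s by (auto simp: w_def shrink_def split: if_splits)
      qed
    qed (use nc nw n1 in \<open>auto simp: w_def shrink_def extensional_def\<close>)
  qed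
  have wp: "pathin (lifted n) (w c)" if "c = x 0 \<or> c = y 0" for c
    unfolding pathin_def
  proof (rule continuous_map_liftedI[OF _ wl[OF that]])
    fix i assume "i < n"
    then show "continuous_on {0..1} (\<lambda>s. w c s i)"
      by (cases "i = 0") (auto simp: w_def shrink_def intro!: continuous_intros)
  qed
  have w0: "w (x 0) 0 = x" "w (y 0) 0 = y"
    using y(3) n(1) y(1) unfolding topspace_lifted by (auto simp: w_def shrink_def fun_eq_iff extensional_def)
  have pw: "proj n (w (x 0) s) = proj n (w (y 0) s)" for s
    using qab[OF gl(2)] n(2) y(2) by (auto simp: proj_def w_def)
  have 1: "H (w (x 0) 1) / H x = H (w (y 0) 1) / H y"
    using ratio_path[OF wp[of "x 0"] wp[of "y 0"] pw] w0 by simp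
  \<comment> \<open>A free place for point 0 inside the square, so that connectedness of
    \<open>box_config n\<close> applies to all \<open>n\<close> points; coordinate 0 of the
    resulting path is then overwritten.\<close>
  obtain d where d: "d \<in> sq_box" "d \<notin> w (x 0) 1 ` {0<..<n}"
  proof -
    have "0 \<in> sq_box" by (simp add: sq_box_def)
    then have "infinite sq_box" using finite_imp_not_open open_sq_box by blast
    then have "\<not> sq_box \<subseteq> w (x 0) 1 ` {0<..<n}" using finite_subset by blast
    then show ?thesis using that by blast
  qed
  define z1 where "z1 = restrict (\<lambda>i. if i = 0 then d else w (x 0) 1 i) {..<n}"
  define z2 where "z2 = restrict (inner_pt n) {..<n}"
  have z1: "z1 \<in> topspace (box_config n)"
  proof -
    have "shrink n (1/3) x \<in> topspace (box_config n)" by (rule shrink_box[OF n(1)])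
    then have s: "inj_on (shrink n (1/3) x) {..<n}" "\<And>i. i < n \<Longrightarrow> shrink n (1/3) x i \<in> sq_box"
      by (auto simp: topspace_box_config)
    have e: "w (x 0) 1 i = shrink n (1/3) x i" if "i \<noteq> 0" for i using that by (simp add: w_def)
    have dd: "d \<noteq> w (x 0) 1 i" if "0 < i" "i < n" for i using d(2) that by auto
    have "inj_on z1 {..<n}"
    proof (rule inj_onI)
      fix i j assume "i \<in> {..<n}" "j \<in> {..<n}" "z1 i = z1 j"
      then show "i = j" using dd[of i] dd[of j] s(1) e by (auto simp: z1_def inj_on_def split: if_splits)
    qed
    then show ?thesis using d(1) s(2) e by (auto simp: topspace_box_config z1_def)
  qed
  have z2: "z2 \<in> topspace (box_config n)"
    using inner_pt(2,3) by (auto simp: z2_def topspace_box_config inj_on_def)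
  obtain p where p: "pathin (box_config n) p" "p 0 = z1" "p 1 = z2"
    using path_connected_box_config[of n] z1 z2 unfolding path_connected_space_def by blast
  have pb: "p s \<in> topspace (box_config n)" if "s \<in> {0..1}" for s
    using p(1) that path_image_subset_topspace by fastforce
  define v where "v c s = (\<lambda>i. if i = 0 then c else p s i)" for c s
  have vl: "v c s \<in> topspace (lifted n)" if c: "norm c = 1" and s: "s \<in> {0..1}" for c s
  proof (rule boundary_lifted[where ?z0.0 = c])
    have bx: "norm (p s i) < 1" if "i < n" for i using pb[OF s] box_norm that by (auto simp: topspace_box_config)
    then show "norm (v c s i) < 1" if "0 < i" "i < n" for i using that by (simp add: v_def)
    show "inj_on (v c s) {..<n}"
    proof (rule inj_onI)
      fix i j assume ij: "i \<in> {..<n}" "j \<in> {..<n}" "v c s i = v c s j"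
      have "i = 0 \<longleftrightarrow> j = 0" using ij bx[of i] bx[of j] c by (auto simp: v_def split: if_splits)
      then show "i = j" using ij pb[OF s] by (auto simp: v_def topspace_box_config inj_on_def split: if_splits)
    qed
    show "v c s \<in> extensional {..<n}" using pb[OF s] n1 by (auto simp: v_def topspace_box_config extensional_def)
  qed (use c in \<open>auto simp: v_def\<close>)
  have vp: "pathin (lifted n) (v c)" if c: "norm c = 1" for c
    unfolding pathin_def
  proof (rule continuous_map_liftedI[OF _ vl[OF c]])
    fix i assume "i < n"
    then show "continuous_on {0..1} (\<lambda>s. v c s i)"
      using continuous_box_coordinate[OF p(1)[unfolded pathin_def], of i] by (cases "i = 0") (auto simp: v_def)
  qed
  have nxy: "norm (x 0) = 1" "norm (y 0) = 1" using n(2) y(2) by auto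
  have v0: "v c 0 = w c 1" for c
    using n1 by (auto simp: v_def w_def p(2) z1_def fun_eq_iff shrink_def)
  have v1: "v (x 0) 1 = edge_config m n a t" "v (y 0) 1 = edge_config m n b t"
    using n1 n(2) y(2) by (auto simp: v_def p(3) z2_def edge_config_def fun_eq_iff)
  have 2: "H (edge_config m n a t) / H (w (x 0) 1) = H (edge_config m n b t) / H (w (y 0) 1)"
  proof -
    have "proj n (v (x 0) s) = proj n (v (y 0) s)" for s
      using qab[OF gl(2)] n(2) y(2) by (auto simp: proj_def v_def)
    from ratio_path[OF vp[OF nxy(1)] vp[OF nxy(2)] this] show ?thesis using v0 v1 by simp
  qed
  \<comment> \<open>Reparametrised so that the point runs from the start of its edge to parameter
    \<open>t\<close>.\<close>
  have slide: "pathin (lifted n) (edge_config m n j \<circ> (\<lambda>s. s * t))" for j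
    using gl(2) by (intro pathin_reparam[OF pathin_edge_config[OF m_pos n1]]) (auto intro!: continuous_intros mult_le_one)
  have 3: "H (edge_config m n a t) / H (edge_config m n a 0) = H (edge_config m n b t) / H (edge_config m n b 0)"
  proof -
    have "proj n ((edge_config m n a \<circ> (\<lambda>s. s * t)) s) = proj n ((edge_config m n b \<circ> (\<lambda>s. s * t)) s)" if "s \<in> {0..1}" for s
      using qab[of "s * t"] that gl(2) by (auto simp: proj_def edge_config_def mult_le_one)
    from ratio_path[OF slide slide this] show ?thesis by simp
  qed
  have nz: "H x \<noteq> 0" "H y \<noteq> 0" "H (w (x 0) 1) \<noteq> 0" "H (w (y 0) 1) \<noteq> 0"
    "H (edge_config m n a t) \<noteq> 0" "H (edge_config m n b t) \<noteq> 0" "H (edge_config m n a 0) \<noteq> 0" "H (edge_config m n b 0) \<noteq> 0"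
    using H0 n(1) y(1) wl[of "x 0" 1] wl[of "y 0" 1] edge_config_lifted[OF n1] by auto
  have "H x / H y = H (w (x 0) 1) / H (w (y 0) 1)" using 1 nz by (simp add: field_simps)
  also have "\<dots> = H (edge_config m n a t) / H (edge_config m n b t)" using 2 nz by (simp add: field_simps)
  also have "\<dots> = H (edge_config m n a 0) / H (edge_config m n b 0)" using 3 nz by (simp add: field_simps)
  finally show ?thesis .
qed

text \<open>The ratio reduces to that of the starting points of two glued edges, which is 1 or the
  value of an edge loop or its inverse; these are all 1 by \<open>triv\<close>.\<close>

lemma glued_update_first:
  assumes x: "x \<in> topspace (lifted n)" and y: "y \<in> topspace (lifted n)" "glued (x 0) (y 0)" "\<And>i. i \<noteq> 0 \<Longrightarrow> y i = x i"
  shows "H x = H y"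
proof -
  obtain a b t where ab: "a < m" "b < m" "t \<in> {0..1}" "a div 2 = b div 2" "x 0 = edge_point m a t" "y 0 = edge_point m b t"
    using y(2) unfolding glued_iff by blast
  have gl: "glued (edge_point m a s) (edge_point m b s)" if "s \<in> {0..1}" for s
    unfolding glued_iff using ab that by blast
  have r: "H x / H y = H (edge_config m n a 0) / H (edge_config m n b 0)"
    by (rule update_path_ratio[OF x ab(5) y(1) ab(6) y(3) gl[OF ab(3)] ab(3) gl])
  define k where "k = a div 2"
  have k: "k < g" using ab(1) by (simp add: k_def)
  have pair: "H (edge_config m n (Suc (2 * k)) 0) = H (edge_config m n (2 * k) 0)"
    using H[OF pathin_edge_config[OF m_pos n1], of "2 * k"] triv[OF k] \<Psi>_edge[of k] H0[OF edge_config_lifted[OF n1, of m "2*k" 0]]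
    by (simp add: edge_config_next)
  have "a = 2 * k \<or> a = Suc (2 * k)" "b = 2 * k \<or> b = Suc (2 * k)" using ab(4) unfolding k_def by presburger+
  then have "H (edge_config m n a 0) = H (edge_config m n b 0)" using pair by auto
  then show ?thesis using r H0[OF edge_config_lifted[OF n1, of m b 0]] H0[OF y(1)] by simp
qed

lemma glued_update:
  assumes x: "x \<in> topspace (lifted n)" and k: "k < n" and gl: "glued (x k) c"
  shows "x(k := c) \<in> topspace (lifted n)" "H (x(k := c)) = H x"
proof -
  have qc: "q (x k) = q c" by (rule q_glued[OF gl])
  have nc: "norm c = 1" using edge_glued_norm[OF gl] by simp
  have "(\<lambda>i. q ((x(k := c)) i)) = (\<lambda>i. q (x i))" using qc by auto
  then show y: "x(k := c) \<in> topspace (lifted n)"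
    using x k nc unfolding topspace_lifted by (auto simp: extensional_def)
  let ?\<pi> = "nat_swap 0 k"
  have \<pi>: "?\<pi> permutes {..<n}" using k n1 by (intro permutes_swap_id) auto
  have "H (x \<circ> ?\<pi>) = H (x(k := c) \<circ> ?\<pi>)"
  proof (rule glued_update_first[OF lifted_permute[OF \<pi> x] lifted_permute[OF \<pi> y]])
    show "glued ((x \<circ> ?\<pi>) 0) ((x(k := c) \<circ> ?\<pi>) 0)" using gl by simp
    show "(x(k := c) \<circ> ?\<pi>) i = (x \<circ> ?\<pi>) i" if "i \<noteq> 0" for i
      using that by (auto simp: Transposition.transpose_def)
  qed
  then show "H (x(k := c)) = H x"
    using ratio_permute[OF \<pi> x y] H0[OF y] H0[OF lifted_permute[OF \<pi> y]] by simp
qed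

lemma equiv_update:
  assumes x: "x \<in> topspace (lifted n)" and k: "k < n" and c: "c \<in> cball 0 1" "q (x k) = q c"
  shows "x(k := c) \<in> topspace (lifted n) \<and> H (x(k := c)) = H x"
proof -
  have "equivclp glued (x k) c" using fib[of "x k" c] c x k unfolding topspace_lifted by auto
  then show ?thesis
  proof (induction rule: equiv_induct)
    case (step y y')
    from glued_update[of "x(k := y)" k y'] step k show ?case by (metis fun_upd_upd fun_upd_same)
  qed (use x in simp)
qed

text \<open>Representatives are exchanged one point at a time, and each exchange is a chain of
  gluings.\<close>

lemma H_proj:
  assumes x: "x \<in> topspace (lifted n)" and y: "y \<in> topspace (lifted n)" and eq: "proj n x = proj n y"
  shows "H x = H y"
proof -
  have q: "q (x i) = q (y i)" if "i < n" for i using eq that by (metis lessThan_iff proj_def restrict_apply')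
  define z where "z k = (\<lambda>i. if i < k then y i else x i)" for k
  have "z k \<in> topspace (lifted n) \<and> H (z k) = H x" if "k \<le> n" for k
    using that
  proof (induction k)
    case 0
    have "z 0 = x" by (auto simp: z_def)
    then show ?case using x by simp
  next
    case (Suc k)
    have "z (Suc k) = (z k)(k := y k)" by (auto simp: z_def less_Suc_eq)
    moreover have "z k k = x k" by (simp add: z_def)
    moreover have "y k \<in> cball 0 1" using y Suc.prems unfolding topspace_lifted by simp
    ultimately show ?case using equiv_update[of "z k" k "y k"] Suc q[of k] by (metis Suc_le_lessD less_imp_le)
  qed
  moreover have "z n = y" using x y unfolding topspace_lifted by (auto simp: z_def extensional_def)
  ultimately show ?thesis by force
qed

definition h :: "(nat \<Rightarrow> 'a) \<Rightarrow> complex" where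
  "h x = H (SOME z. z \<in> topspace (lifted n) \<and> proj n z = x)"

lemma h_proj: "z \<in> topspace (lifted n) \<Longrightarrow> h (proj n z) = H z"
proof -
  assume z: "z \<in> topspace (lifted n)"
  let ?z = "SOME y. y \<in> topspace (lifted n) \<and> proj n y = proj n z"
  have "?z \<in> topspace (lifted n) \<and> proj n ?z = proj n z" by (rule someI[of _ z]) (use z in simp)
  then show ?thesis unfolding h_def using H_proj z by blast
qed

text \<open>Paths of \<open>U\<close> need not lift to the disc, but near \<open>x\<close> every
  configuration contracts to \<open>x\<close> along a ray that does. For a short path, the square
  swept out by these rays compares both ends with \<open>x\<close>.\<close>

lemma \<Phi>o_potential:
  assumes "pathin (config_space n U) p"
  shows "\<Phi>o p = h (p 1) / h (p 0)"
proof (rule path_char_local_potential[OF pc\<Phi>o _ _ assms])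
  show "h x \<noteq> 0" if "x \<in> topspace (config_space n U)" for x
    using proj_surj[OF that] h_proj H0 by metis
next
  fix x assume x: "x \<in> topspace (config_space n U)"
  obtain B where B: "\<And>i. i < n \<Longrightarrow> openin U (B i)" "\<And>i. i < n \<Longrightarrow> x i \<in> B i"
    "\<And>i j. i < n \<Longrightarrow> j < n \<Longrightarrow> i \<noteq> j \<Longrightarrow> B i \<inter> B j = {}" using config_box[OF Hausdorff_U x] by metis
  have "\<forall>i. \<exists>V c. i < n \<longrightarrow> V \<subseteq> B i \<and> contraction V (x i) c" using contraction_exists[OF B(1) B(2)] by blast
  then obtain V c where Vc: "\<And>i. i < n \<Longrightarrow> V i \<subseteq> B i" "\<And>i. i < n \<Longrightarrow> contraction (V i) (x i) (c i)" by metis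
  have Vdisj: "V i \<inter> V j = {}" if "i < n" "j < n" "i \<noteq> j" for i j using Vc(1) B(3) that by blast
  have c: "openin U (V i)" "x i \<in> V i" "continuous_map (prod_topology (top_of_set {0..1}) (subtopology U (V i))) U (c i)"
    "\<And>v. v \<in> V i \<Longrightarrow> c i (0, v) = v" "\<And>v. v \<in> V i \<Longrightarrow> c i (1, v) = x i"
    "\<And>v t. v \<in> V i \<Longrightarrow> t \<in> {0..1} \<Longrightarrow> c i (t, v) \<in> V i"
    "\<And>z. z \<in> cball 0 1 \<Longrightarrow> q z \<in> V i \<Longrightarrow> \<exists>p. continuous_on {0..1} p \<and> p ` {0..1} \<subseteq> cball 0 1 \<and> p 0 = z \<and>
        (\<forall>t\<in>{0..1}. q (p t) = c i (t, q z))" if "i < n" for i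
    using Vc(2)[OF that] unfolding contraction_def by auto
  let ?W = "{y \<in> topspace (config_space n U). \<forall>i<n. y i \<in> V i}"
  define C where "C t y = restrict (\<lambda>i. c i (t, y i)) {..<n}" for t y
  have CF: "C t y \<in> extensional {..<n}" "inj_on (C t y) {..<n}" "\<And>i. i < n \<Longrightarrow> C t y i \<in> V i" if "y \<in> ?W" "t \<in> {0..1}" for t y
  proof -
    show v: "C t y i \<in> V i" if "i < n" for i using c(6)[OF that] \<open>y \<in> ?W\<close> \<open>t \<in> {0..1}\<close> that by (simp add: C_def)
    show "inj_on (C t y) {..<n}"
    proof (rule inj_onI, rule ccontr)
      fix i j assume ij: "i \<in> {..<n}" "j \<in> {..<n}" "C t y i = C t y j" "i \<noteq> j"
      then show False using v[of i] v[of j] Vdisj[of i j] by auto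
    qed
  qed (simp add: C_def)
  \<comment> \<open>The ray lifts from any representative \<open>z\<close> of \<open>y\<close>, so
    its value is read off from \<open>H\<close>.\<close>
  have ray: "\<Phi>o (\<lambda>t. C t y) = h x / h y" if y: "y \<in> ?W" for y
  proof -
    obtain z where z: "z \<in> topspace (lifted n)" "proj n z = y" using proj_surj y by blast
    have qz: "q (z i) = y i" "z i \<in> cball 0 1" if "i < n" for i
      using z that unfolding topspace_lifted by (auto simp: proj_def)
    have "\<forall>i. \<exists>p. i < n \<longrightarrow> continuous_on {0..1} p \<and> p ` {0..1} \<subseteq> cball 0 1 \<and> p 0 = z i \<and> (\<forall>t\<in>{0..1}. q (p t) = c i (t, y i))"
    proof
      fix i show "\<exists>p. i < n \<longrightarrow> continuous_on {0..1} p \<and> p ` {0..1} \<subseteq> cball 0 1 \<and> p 0 = z i \<and> (\<forall>t\<in>{0..1}. q (p t) = c i (t, y i))"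
      proof (cases "i < n")
        case True
        then show ?thesis using c(7)[OF True qz(2)[OF True]] qz(1)[OF True] y by auto
      qed simp
    qed
    then obtain p where p: "\<And>i. i < n \<Longrightarrow> continuous_on {0..1} (p i)" "\<And>i. i < n \<Longrightarrow> p i ` {0..1} \<subseteq> cball 0 1"
      "\<And>i. i < n \<Longrightarrow> p i 0 = z i" "\<And>i t. i < n \<Longrightarrow> t \<in> {0..1} \<Longrightarrow> q (p i t) = c i (t, y i)" by metis
    define P where "P t = restrict (\<lambda>i. p i t) {..<n}" for t
    have projP: "proj n (P t) = C t y" if "t \<in> {0..1}" for t
      using p(4) that by (auto simp: proj_def P_def C_def)
    have Pl: "P t \<in> topspace (lifted n)" if "t \<in> {0..1}" for t
    proof -
      have "inj_on (\<lambda>i. q (P t i)) {..<n}"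
        using CF(2)[OF y that] unfolding projP[OF that, symmetric] by (simp add: proj_def inj_on_def)
      moreover have "P t i \<in> cball 0 1" if "i < n" for i
        using p(2)[OF that] imageI[OF \<open>t \<in> {0..1}\<close>, of "p i"] that by (auto simp: P_def)
      ultimately show ?thesis unfolding topspace_lifted by (simp add: P_def)
    qed
    have Pp: "pathin (lifted n) P"
      unfolding pathin_def by (rule continuous_map_liftedI[OF _ Pl]) (use p(1) in \<open>auto simp: P_def\<close>)
    have P0: "P 0 = z" using p(3) z(1) unfolding topspace_lifted by (auto simp: P_def extensional_def)
    have P1: "proj n (P 1) = x"
      using projP[of 1] c(5) y x by (auto simp: C_def topspace_config_space extensional_def fun_eq_iff)
    have "\<Phi>o (\<lambda>t. C t y) = \<Phi>o (proj n \<circ> P)"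
      by (rule path_char_cong[OF pc\<Phi>o pathin_compose[OF Pp continuous_map_proj]]) (use projP in simp)
    also have "\<dots> = H (P 1) / H (P 0)" using H[OF Pp] by (simp add: \<Psi>_def)
    finally show ?thesis using h_proj[OF Pl[of 0]] h_proj[OF Pl[of 1]] P0 P1 z(2) by simp
  qed
  have "\<Phi>o p = h (p 1) / h (p 0)" if p: "pathin (config_space n U) p" "p ` {0..1} \<subseteq> ?W" for p
  proof -
    have pW: "p s \<in> ?W" if "s \<in> {0..1}" for s using p(2) that by blast
    have cont: "continuous_map (top_of_set unit_square) (config_space n U) (\<lambda>a. C (fst a) (p (snd a)))"
      unfolding continuous_map_config
    proof (intro conjI allI impI ballI)
      fix i assume i: "i < n"
      have "continuous_map (top_of_set {0..1}) U (\<lambda>s. p s i)"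
        using p(1) i unfolding pathin_def continuous_map_config by blast
      then have "continuous_map (top_of_set {0..1}) (subtopology U (V i)) (\<lambda>s. p s i)"
        using pW i by (auto simp: continuous_map_in_subtopology)
      moreover have "continuous_map (top_of_set unit_square) (top_of_set {0..1}) (snd :: real \<times> real \<Rightarrow> real)"
        by (auto simp: continuous_map_in_subtopology intro!: continuous_intros)
      ultimately have s: "continuous_map (top_of_set unit_square) (subtopology U (V i)) ((\<lambda>s. p s i) \<circ> (snd :: real \<times> real \<Rightarrow> real))"
        using continuous_map_compose by blast
      have f: "continuous_map (top_of_set unit_square) (top_of_set {0..1}) (fst :: real \<times> real \<Rightarrow> real)"
        by (auto simp: continuous_map_in_subtopology intro!: continuous_intros)
      have "continuous_map (top_of_set unit_square) (prod_topology (top_of_set {0..1}) (subtopology U (V i))) (\<lambda>a. (fst a, p (snd a) i))"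
        using f s by (simp add: continuous_map_pairwise o_def)
      from continuous_map_compose[OF this c(3)[OF i]]
      show "continuous_map (top_of_set unit_square) U (\<lambda>a. C (fst a) (p (snd a)) i)"
        using i by (simp add: C_def o_def)
    next
      fix a :: "real \<times> real" assume "a \<in> topspace (top_of_set unit_square)"
      then show "C (fst a) (p (snd a)) \<in> extensional {..<n}" "inj_on (C (fst a) (p (snd a))) {..<n}"
        using CF(1,2)[OF pW] by auto
    qed
    have C0: "C 0 (p s) = p s" if "s \<in> {0..1}" for s
      using pW[OF that] c(4) by (auto simp: C_def topspace_config_space extensional_def fun_eq_iff)
    have C1: "C 1 (p s) = x" if "s \<in> {0..1}" for s
      using pW[OF that] c(5) x by (auto simp: C_def topspace_config_space extensional_def fun_eq_iff)
    have "\<Phi>o (\<lambda>s. C 0 (p s)) = \<Phi>o p" by (rule path_char_cong[OF pc\<Phi>o p(1)]) (use C0 in simp)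
    moreover have "\<Phi>o (\<lambda>s. C 1 (p s)) = \<Phi>o (\<lambda>_. x)" by (rule path_char_cong[OF pc\<Phi>o]) (use C1 x in auto)
    moreover have "\<Phi>o (\<lambda>_. x) = 1" by (rule path_char_const[OF pc\<Phi>o x])
    ultimately have "\<Phi>o p * (h x / h (p 1)) = h x / h (p 0)"
      using path_char_square[OF pc\<Phi>o cont] ray[OF pW[of 0]] ray[OF pW[of 1]] by simp
    moreover have "h x \<noteq> 0" "h (p 1) \<noteq> 0" "h (p 0) \<noteq> 0"
      using proj_surj h_proj H0 x pW[of 0] pW[of 1] by (metis (no_types, lifting) atLeastAtMost_iff mem_Collect_eq order_refl zero_le_one)+
    ultimately show ?thesis by (simp add: field_simps)
  qed
  then show "\<exists>W. openin (config_space n U) W \<and> x \<in> W \<and>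
      (\<forall>p. pathin (config_space n U) p \<longrightarrow> p ` {0..1} \<subseteq> W \<longrightarrow> \<Phi>o p = h (p 1) / h (p 0))"
    using openin_config_box[OF c(1)] x c(2) by (intro exI[of _ ?W]) auto
qed

text \<open>By \<open>ratio_permute\<close> the effect of a relabelling on \<open>H\<close> is the
  same factor for all configurations. One example decides: a generic one in the square, where the
  potential is invariant because crossings have value 1.\<close>

lemma h_permute:
  assumes \<pi>: "\<pi> permutes {..<n}" and x: "x \<in> topspace (config_space n U)"
  shows "h (x \<circ> \<pi>) = h x"
proof -
  obtain z where z: "z \<in> topspace (lifted n)" "proj n z = x" using proj_surj[OF x] .
  have z\<pi>: "z \<circ> \<pi> \<in> topspace (lifted n)" "proj n (z \<circ> \<pi>) = x \<circ> \<pi>"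
    using lifted_permute[OF \<pi> z(1)] proj_permute[OF \<pi>, of z] z(2) by simp_all
  let ?B = "base_config n id"
  have g: "generic n ?B" by (rule base_config_generic(1)[OF permutes_id])
  have g\<pi>: "generic n (?B \<circ> \<pi>)" by (rule generic_permute[OF \<pi> g])
  have B: "?B \<in> topspace (box_config n)" "?B \<circ> \<pi> \<in> topspace (box_config n)"
    using g g\<pi> unfolding generic_def by blast+
  obtain G where G: "\<And>z. z \<in> topspace (box_config n) \<Longrightarrow> G z \<noteq> 0"
    "\<And>p. pathin (box_config n) p \<Longrightarrow> \<Psi> p = G (p 1) / G (p 0)"
    "\<And>x. generic n x \<Longrightarrow> G x = gauge x * 1 ^ inversions x"
    using box_potential[of 1] triv_swap by auto
  obtain p where p: "pathin (box_config n) p" "p 0 = ?B" "p 1 = ?B \<circ> \<pi>"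
    using path_connected_box_config[of n] B unfolding path_connected_space_def by blast
  have "G (?B \<circ> \<pi>) = G ?B" using G(3)[OF g] G(3)[OF g\<pi>] gauge_permute[OF \<pi> g] by simp
  then have "\<Psi> p = 1" using G(1)[OF B(1)] G(2)[OF p(1)] p(2,3) by simp
  then have "H (?B \<circ> \<pi>) / H ?B = 1" using H[OF pathin_box_lifted[OF p(1)]] p(2,3) by simp
  moreover have Bl: "?B \<in> topspace (lifted n)" "?B \<circ> \<pi> \<in> topspace (lifted n)"
    using funcset_mem[OF path_image_subset_topspace[OF pathin_box_lifted[OF p(1)]], of 0]
      funcset_mem[OF path_image_subset_topspace[OF pathin_box_lifted[OF p(1)]], of 1] p(2,3) by auto
  moreover have "H (z \<circ> \<pi>) / H (?B \<circ> \<pi>) = H z / H ?B" by (rule ratio_permute[OF \<pi> z(1) Bl(1)])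
  ultimately have "H (z \<circ> \<pi>) = H z" using H0[OF Bl(1)] by simp
  then show ?thesis using h_proj[OF z(1)] h_proj[OF z\<pi>(1)] z(2) z\<pi>(2) by simp
qed

lemma \<Phi>_trivial:
  assumes p: "pathin (unordered_config_space n U) p" "p 1 = p 0"
  shows "\<Phi> p = 1"
proof -
  have "p 0 \<in> topspace (unordered_config_space n U)" using path_image_subset_topspace[OF p(1)] by force
  then obtain x0 where x0: "x0 \<in> topspace (config_space n U)" "perm_orbit n x0 = p 0"
    unfolding topspace_unordered_config_space by force
  obtain x where x: "continuous_map (top_of_set {0..1}) (config_space n U) x"
    "\<And>t. t \<in> {0..1} \<Longrightarrow> perm_orbit n (x t) = p t" "x 0 = x0"
    by (rule lift_exists[OF section_covering_config[OF Hausdorff_U], of "{0..1::real}" 0 n p x0])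
      (use p x0 in \<open>auto simp: pathin_def\<close>)
  have "perm_orbit n (x 0) = perm_orbit n (x 1)" using x(2)[of 0] x(2)[of 1] p(2) by simp
  then obtain \<pi> where \<pi>: "\<pi> permutes {..<n}" "x 1 = x 0 \<circ> \<pi>" unfolding perm_orbit_eq_iff by blast
  have "\<Phi> p = \<Phi> (perm_orbit n \<circ> x)" by (rule path_char_cong[OF pc\<Phi> p(1), symmetric]) (use x(2) in simp)
  also have "\<dots> = h (x 1) / h (x 0)" using \<Phi>o_potential[of x] x(1) by (simp add: \<Phi>o_def pathin_def)
  also have "\<dots> = 1"
  proof -
    obtain z where "z \<in> topspace (lifted n)" "proj n z = x0" using proj_surj[OF x0(1)] .
    then have "h x0 \<noteq> 0" using h_proj H0 by metis
    then show ?thesis using h_permute[OF \<pi>(1) x0(1)] x(3) \<pi>(2) by simp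
  qed
  finally show ?thesis .
qed

end

lemma (in box_char) swap_value_square: "box_char.swap_value n (\<lambda>p. (\<Psi> p)\<^sup>2) r = (swap_value r)\<^sup>2"
proof -
  interpret sq: box_char n "\<lambda>p. (\<Psi> p)\<^sup>2"
    by unfold_locales (use path_char_power[OF pc] sym in auto)
  show ?thesis
    unfolding sq.swap_value_def sq.jump_def sq.gauge_def sq.seg_def swap_value_def jump_def gauge_def seg_def
    by (simp add: power_mult_distrib power_divide)
qed

text \<open>Squaring turns the values \<plusminus>1 of exchanges into 1, so
  \<open>trivial_crosscap_char\<close> applies to the square.\<close>

theorem (in crosscap_char) square_trivial:
  assumes n: "n \<ge> 1" and triv: "\<And>k. k < g \<Longrightarrow> (\<Phi> (edge_loop n k))\<^sup>2 = 1"
    and p: "pathin (unordered_config_space n U) p" "p 1 = p 0"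
  shows "(\<Phi> p)\<^sup>2 = 1"
proof -
  interpret sq: crosscap_char g U q n "\<lambda>p. (\<Phi> p)\<^sup>2"
    by unfold_locales (rule path_char_power[OF pc\<Phi>])
  have \<Psi>: "sq.\<Psi> = (\<lambda>p. (\<Psi> p)\<^sup>2)" by (simp add: fun_eq_iff sq.\<Psi>_def sq.\<Phi>o_def \<Psi>_def \<Phi>o_def)
  obtain H where "\<And>z. z \<in> topspace (lifted n) \<Longrightarrow> H z \<noteq> 0"
    "\<And>p. pathin (lifted n) p \<Longrightarrow> sq.\<Psi> p = H (p 1) / H (p 0)" using sq.polygon_potential by blast
  then interpret trivial_crosscap_char g U q n "\<lambda>p. (\<Phi> p)\<^sup>2" H
    using n triv swap_value_square swap_value_sq by unfold_locales (simp_all add: \<Psi>)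
  show ?thesis by (rule \<Phi>_trivial[OF p])
qed

section \<open>Characters through surjective homomorphisms\<close>

lemma path_char_conj:
  assumes pc: "path_char X \<Phi>" and k: "pathin X k" and p: "pathin X p" "k 1 = p 0" "p 1 = p 0"
  shows "\<Phi> (path_concat (path_concat k p) (path_rev k)) = \<Phi> p"
proof -
  have "\<Phi> (path_concat (path_concat k p) (path_rev k)) = \<Phi> k * \<Phi> p * inverse (\<Phi> k)"
    using path_char_concat[OF pc pathin_concat[OF k p(1,2)] pathin_rev[OF k]] path_char_concat[OF pc k p(1,2)]
      path_char_rev[OF pc k] p by simp
  then show ?thesis using path_char_nonzero[OF pc k] by simp
qed

lemma loopin_conj:
  "pathin X k \<Longrightarrow> k 0 = c \<Longrightarrow> pathin X p \<Longrightarrow> k 1 = p 0 \<Longrightarrow> p 1 = p 0 \<Longrightarrow>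
    loopin X c (path_concat (path_concat k p) (path_rev k))"
  by (simp add: loopin_def pathin_concat pathin_rev)

text \<open>\<open>T\<close> sends a loop, joined to the base point, to a representative of the
  image of its class. One \<open>T\<close> serves all characters at once, and surjectivity survives
  in the form that characters cannot tell a loop \<open>r\<close> from a suitable
  \<open>T p\<close>.\<close>

lemma epi_path_char:
  assumes Y: "path_connected_space Y" "c \<in> topspace Y" and Z: "path_connected_space Z" "d \<in> topspace Z"
    and f: "f \<in> epi (fundamental_group Y c) (fundamental_group Z d)"
  obtains T where "\<And>p. pathin Y p \<Longrightarrow> p 1 = p 0 \<Longrightarrow> pathin Z (T p) \<and> T p 1 = T p 0"
    "\<And>\<psi>. path_char Z \<psi> \<Longrightarrow> \<exists>\<Phi>. path_char Y \<Phi> \<and> (\<forall>p. pathin Y p \<longrightarrow> p 1 = p 0 \<longrightarrow> \<Phi> p = \<psi> (T p))"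
    "\<And>r. pathin Z r \<Longrightarrow> r 1 = r 0 \<Longrightarrow> \<exists>p. pathin Y p \<and> p 1 = p 0 \<and> (\<forall>\<psi>. path_char Z \<psi> \<longrightarrow> \<psi> (T p) = \<psi> r)"
proof -
  have hom: "f \<in> hom (fundamental_group Y c) (fundamental_group Z d)"
    and surj: "f ` carrier (fundamental_group Y c) = carrier (fundamental_group Z d)"
    using f by (auto simp: epi_def)
  obtain k where k: "\<And>y. y \<in> topspace Y \<Longrightarrow> pathin Y (k y) \<and> k y 0 = c \<and> k y 1 = y"
    using Y unfolding path_connected_space_def by metis
  define L where "L p = path_concat (path_concat (k (p 0)) p) (path_rev (k (p 0)))" for p
  have L: "loopin Y c (L p)" if "pathin Y p" "p 1 = p 0" for p
    unfolding L_def using k[OF path_start_in_topspace[OF that(1)]] that by (intro loopin_conj) auto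
  define T where "T p = (SOME r. loopin Z d r \<and> f (loop_class Y c (L p)) = loop_class Z d r)" for p
  have T: "loopin Z d (T p)" "f (loop_class Y c (L p)) = loop_class Z d (T p)" if "pathin Y p" "p 1 = p 0" for p
  proof -
    have "loop_class Y c (L p) \<in> carrier (fundamental_group Y c)"
      using L[OF that] unfolding fundamental_group_carrier by blast
    then have "f (loop_class Y c (L p)) \<in> carrier (fundamental_group Z d)" using surj by blast
    then have "\<exists>r. loopin Z d r \<and> f (loop_class Y c (L p)) = loop_class Z d r"
      unfolding fundamental_group_carrier by blast
    from someI_ex[OF this] show "loopin Z d (T p)" "f (loop_class Y c (L p)) = loop_class Z d (T p)"
      unfolding T_def by blast+
  qed
  show ?thesis
  proof (rule that)
    show "pathin Z (T p) \<and> T p 1 = T p 0" if "pathin Y p" "p 1 = p 0" for p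
      using T(1)[OF that] by (auto simp: loopin_def)
  next
    fix \<psi> assume \<psi>: "path_char Z \<psi>"
    obtain \<Phi> where \<Phi>: "path_char Y \<Phi>"
      "\<And>p r. loopin Y c p \<Longrightarrow> loopin Z d r \<Longrightarrow> f (loop_class Y c p) = loop_class Z d r \<Longrightarrow> \<Phi> p = \<psi> r"
      using path_char_extend[OF Y hom \<psi>] by blast
    have "\<Phi> p = \<psi> (T p)" if p: "pathin Y p" "p 1 = p 0" for p
    proof -
      have "\<Phi> (L p) = \<Phi> p"
        unfolding L_def using k[OF path_start_in_topspace[OF p(1)]] p by (intro path_char_conj[OF \<Phi>(1)]) auto
      then show ?thesis using \<Phi>(2)[OF L[OF p] T[OF p]] by simp
    qed
    then show "\<exists>\<Phi>. path_char Y \<Phi> \<and> (\<forall>p. pathin Y p \<longrightarrow> p 1 = p 0 \<longrightarrow> \<Phi> p = \<psi> (T p))" using \<Phi>(1) by blast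
  next
    fix r assume r: "pathin Z r" "r 1 = r 0"
    obtain j where j: "pathin Z j" "j 0 = d" "j 1 = r 0"
      using Z path_start_in_topspace[OF r(1)] unfolding path_connected_space_def by blast
    let ?r = "path_concat (path_concat j r) (path_rev j)"
    have r': "loopin Z d ?r" using j r by (intro loopin_conj) auto
    then have "loop_class Z d ?r \<in> carrier (fundamental_group Z d)"
      unfolding fundamental_group_carrier by blast
    then have "loop_class Z d ?r \<in> f ` carrier (fundamental_group Y c)" by (simp only: surj)
    then obtain p where p: "loopin Y c p" "f (loop_class Y c p) = loop_class Z d ?r"
      unfolding fundamental_group_carrier by auto
    have pp: "pathin Y p" "p 1 = p 0" using p(1) by (auto simp: loopin_def)
    have "\<psi> (T p) = \<psi> r" if \<psi>: "path_char Z \<psi>" for \<psi>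
    proof -
      obtain \<Phi> where \<Phi>: "path_char Y \<Phi>"
        "\<And>p r. loopin Y c p \<Longrightarrow> loopin Z d r \<Longrightarrow> f (loop_class Y c p) = loop_class Z d r \<Longrightarrow> \<Phi> p = \<psi> r"
        using path_char_extend[OF Y hom \<psi>] by blast
      have "\<Phi> (L p) = \<Phi> p"
        unfolding L_def using k[OF path_start_in_topspace[OF pp(1)]] pp by (intro path_char_conj[OF \<Phi>(1)]) auto
      then have "\<psi> (T p) = \<psi> ?r" using \<Phi>(2)[OF L[OF pp] T[OF pp]] \<Phi>(2)[OF p(1) r' p(2)] by simp
      also have "\<dots> = \<psi> r" using j r by (intro path_char_conj[OF \<psi>]) auto
      finally show ?thesis .
    qed
    then show "\<exists>p. pathin Y p \<and> p 1 = p 0 \<and> (\<forall>\<psi>. path_char Z \<psi> \<longrightarrow> \<psi> (T p) = \<psi> r)" using pp by blast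
  qed
qed

section \<open>Roots of nonvanishing functions along paths\<close>

text \<open>Two logarithms of one function differ by integer multiples of
  \<open>2 * pi * \<i>\<close>, a discrete set, hence by a constant on a connected set.\<close>

lemma continuous_log_increment_unique:
  fixes L L' :: "'a::topological_space \<Rightarrow> complex"
  assumes A: "connected A" "a \<in> A" "b \<in> A" and c: "continuous_on A L" "continuous_on A L'"
    and e: "\<And>x. x \<in> A \<Longrightarrow> exp (L x) = exp (L' x)"
  shows "L b - L a = L' b - L' a"
proof -
  define D where "D x = L x - L' x" for x
  have D1: "exp (D x) = 1" if "x \<in> A" for x using e[OF that] by (simp add: D_def exp_diff)
  have "D constant_on A"
  proof (rule continuous_discrete_range_constant[OF A(1)])
    show "continuous_on A D" unfolding D_def by (intro continuous_intros c)
    fix x assume x: "x \<in> A"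
    show "\<exists>e>0. \<forall>y. y \<in> A \<and> D y \<noteq> D x \<longrightarrow> e \<le> norm (D y - D x)"
    proof (intro exI[of _ "2 * pi"] conjI allI impI)
      fix y assume y: "y \<in> A \<and> D y \<noteq> D x"
      have "exp (D y - D x) = 1" using D1[OF x] D1[of y] y by (simp add: exp_diff)
      then obtain k :: int where k: "Re (D y - D x) = 0" "Im (D y - D x) = of_int (2 * k) * pi" unfolding exp_eq_1 by blast
      have "k \<noteq> 0"
      proof
        assume "k = 0"
        then have "D y - D x = 0" using k by (simp add: complex_eq_iff)
        then show False using y by simp
      qed
      then have "1 \<le> \<bar>k\<bar>" by linarith
      then have "1 \<le> \<bar>real_of_int k\<bar>" by linarith
      then have "2 * pi * 1 \<le> 2 * pi * \<bar>real_of_int k\<bar>" by (intro mult_left_mono) auto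
      also have "\<dots> = \<bar>Im (D y - D x)\<bar>" unfolding k(2) by (simp add: abs_mult)
      also have "\<dots> \<le> norm (D y - D x)" by (rule abs_Im_le_cmod)
      finally show "2 * pi \<le> norm (D y - D x)" by simp
    qed simp
  qed
  then have "D a = D b" using A unfolding constant_on_def by metis
  then show ?thesis by (simp add: D_def algebra_simps)
qed

text \<open>The factor by which a continuous \<open>N\<close>-th root of \<open>F\<close> changes
  along \<open>p\<close>. On a loop it is the root of unity
  \<open>exp (2 * pi * \<i> * w / N)\<close> with \<open>w\<close> the winding number of
  \<open>F\<close> around 0.\<close>

definition root_char :: "nat \<Rightarrow> ('a \<Rightarrow> complex) \<Rightarrow> (real \<Rightarrow> 'a) \<Rightarrow> complex" where
  "root_char N F p = (THE c. \<exists>L. continuous_on {0..1} L \<and> (\<forall>t\<in>{0..1}. exp (L t) = F (p t)) \<and>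
     c = exp ((L 1 - L 0) / of_nat N))"

lemma root_charI:
  assumes "continuous_on {0..1} L" "\<And>t. t \<in> {0..1} \<Longrightarrow> exp (L t) = F (p t)"
  shows "root_char N F p = exp ((L 1 - L 0) / of_nat N)"
  unfolding root_char_def
proof (rule the_equality)
  show "\<exists>L'. continuous_on {0..1} L' \<and> (\<forall>t\<in>{0..1}. exp (L' t) = F (p t)) \<and>
     exp ((L 1 - L 0) / of_nat N) = exp ((L' 1 - L' 0) / of_nat N)" using assms by blast
  fix c assume "\<exists>L'. continuous_on {0..1} L' \<and> (\<forall>t\<in>{0..1}. exp (L' t) = F (p t)) \<and> c = exp ((L' 1 - L' 0) / of_nat N)"
  then obtain L' where L': "continuous_on {0..1} L'" "\<forall>t\<in>{0..1}. exp (L' t) = F (p t)" "c = exp ((L' 1 - L' 0) / of_nat N)"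
    by blast
  have "L' 1 - L' 0 = L 1 - L 0"
    by (rule continuous_log_increment_unique[of "{0..1::real}"]) (use assms L' in auto)
  then show "c = exp ((L 1 - L 0) / of_nat N)" using L'(3) by simp
qed

lemma continuous_log_exists:
  fixes K :: "'b::real_normed_vector set"
  assumes "continuous_map X euclidean F" "\<And>x. x \<in> topspace X \<Longrightarrow> F x \<noteq> (0::complex)"
    and "convex K" "continuous_map (top_of_set K) X h"
  obtains L where "continuous_on K L" "\<And>x. x \<in> K \<Longrightarrow> exp (L x) = F (h x)"
proof -
  have "continuous_on K (F \<circ> h)" using continuous_map_compose[OF assms(4,1)] by simp
  moreover have "(F \<circ> h) x \<noteq> 0" if "x \<in> K" for x
    using assms(2) assms(4) that by (auto simp: continuous_map_def)
  ultimately obtain L where "continuous_on K L" "\<And>x. x \<in> K \<Longrightarrow> (F \<circ> h) x = exp (L x)"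
    using continuous_logarithm_on_contractible[OF _ convex_imp_contractible[OF assms(3)]] by metis
  then show ?thesis using that by simp
qed

lemma path_concat_second_half:
  assumes "t \<in> {0..1}" "p 1 = r 0"
  shows "path_concat p r ((t + 1) / 2) = r t"
proof (cases "t = 0")
  case False
  have "path_concat p r ((t + 1) / 2) = r (2 * ((t + 1) / 2) - 1)"
    using False assms(1) by (simp add: path_concat_def)
  also have "2 * ((t + 1) / 2) - 1 = t" by (simp add: field_simps)
  finally show ?thesis .
qed (use assms(2) in \<open>simp add: path_concat_def\<close>)

text \<open>For homotopy invariance the logarithm is taken on the whole square; on the sides where
  the homotopy is constant it has no increment.\<close>

lemma root_char_path_char:
  assumes F: "continuous_map X euclidean F" "\<And>x. x \<in> topspace X \<Longrightarrow> F x \<noteq> 0"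
  shows "path_char X (root_char N F)"
  unfolding path_char_def
proof (intro conjI allI impI)
  fix p assume "pathin X p"
  then obtain L where "continuous_on {0..1} L" "\<And>t. t \<in> {0..1} \<Longrightarrow> exp (L t) = F (p t)"
    using continuous_log_exists[OF F, of "{0..1}" p] by (auto simp: pathin_def)
  from root_charI[where F = F, OF this] show "root_char N F p \<noteq> 0" by simp
next
  fix p r assume pr: "pathin X p" "pathin X r" "p 1 = r 0"
  obtain L where L: "continuous_on {0..1} L" "\<And>t. t \<in> {0..1} \<Longrightarrow> exp (L t) = F (path_concat p r t)"
    using continuous_log_exists[OF F, of "{0..1}" "path_concat p r"] pathin_concat[OF pr] by (auto simp: pathin_def)
  have 1: "root_char N F p = exp ((L (1/2) - L 0) / of_nat N)"
    using root_charI[of "\<lambda>t. L (t / 2)" F p N] L(2)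
    by (force simp: path_concat_def intro!: continuous_on_compose2[OF L(1)] continuous_intros)
  have "exp (L ((t + 1) / 2)) = F (r t)" if "t \<in> {0..1}" for t
    using L(2)[of "(t + 1) / 2"] path_concat_second_half[of t p r] pr(3) that by auto
  then have 2: "root_char N F r = exp ((L 1 - L (1/2)) / of_nat N)"
    using root_charI[of "\<lambda>t. L ((t + 1) / 2)" F r N]
    by (force intro!: continuous_on_compose2[OF L(1)] continuous_intros)
  have "root_char N F (path_concat p r) = exp ((L 1 - L 0) / of_nat N)" by (rule root_charI[where F = F and p = "path_concat p r", OF L])
  then show "root_char N F (path_concat p r) = root_char N F p * root_char N F r"
    unfolding 1 2 by (simp flip: exp_add add_divide_distrib)
next
  fix p r assume "path_hom X p r"
  then obtain h where h: "continuous_map (top_of_set unit_square) X h"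
    "\<And>s. h (0, s) = p s" "\<And>s. h (1, s) = r s"
    "\<And>t. t \<in> {0..1} \<Longrightarrow> h (t, 0) = p 0" "\<And>t. t \<in> {0..1} \<Longrightarrow> h (t, 1) = p 1" using path_homD by blast
  obtain L where L: "continuous_on unit_square L" "\<And>x. x \<in> unit_square \<Longrightarrow> exp (L x) = F (h x)"
    using continuous_log_exists[OF F convex_Times[OF convex_real_interval(5) convex_real_interval(5)] h(1)] by blast
  have side: "continuous_on {0..1} (\<lambda>s. L (t, s))" "continuous_on {0..1} (\<lambda>s. L (s, t))" if "t \<in> {0..1}" for t
    using that by (auto intro!: continuous_on_compose2[OF L(1)] continuous_intros)
  have 1: "root_char N F p = exp ((L (0, 1) - L (0, 0)) / of_nat N)" "root_char N F r = exp ((L (1, 1) - L (1, 0)) / of_nat N)"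
    using root_charI[OF side(1)[of 0], of F p N] root_charI[OF side(1)[of 1], of F r N] L(2) h(2,3) by auto
  have "L (1, s) - L (0, s) = 0" if "s = 0 \<or> s = 1" for s
  proof -
    have "(\<lambda>t. L (t, s)) 1 - (\<lambda>t. L (t, s)) 0 = (\<lambda>t. L (0, s)) (1::real) - (\<lambda>t. L (0, s)) (0::real)"
      by (rule continuous_log_increment_unique[of "{0..1::real}"]) (use side(2)[of s] L(2) h(2,4,5) that in auto)
    then show ?thesis by simp
  qed
  then have "L (0, 1) - L (0, 0) = L (1, 1) - L (1, 0)" by (metis eq_iff_diff_eq_0)
  then show "root_char N F p = root_char N F r" unfolding 1 by simp
qed

lemma root_char_power:
  assumes F: "continuous_map X euclidean F" "\<And>x. x \<in> topspace X \<Longrightarrow> F x \<noteq> 0" and p: "pathin X p" and N: "N > 0"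
  shows "root_char N F p ^ N = F (p 1) / F (p 0)"
proof -
  obtain L where L: "continuous_on {0..1} L" "\<And>t. t \<in> {0..1} \<Longrightarrow> exp (L t) = F (p t)"
    using continuous_log_exists[OF F, of "{0..1}" p] p by (auto simp: pathin_def)
  have "root_char N F p ^ N = exp (of_nat N * ((L 1 - L 0) / of_nat N))"
    by (simp only: root_charI[where F = F, OF L] exp_of_nat_mult)
  also have "\<dots> = F (p 1) / F (p 0)" using N L(2)[of 0] L(2)[of 1] by (simp add: exp_diff)
  finally show ?thesis .
qed

text \<open>A symmetric product as a function on orbits; the ordering picked by \<open>SOME\<close>
  does not affect it.\<close>

definition conf_prod :: "nat \<Rightarrow> ('a \<Rightarrow> complex) \<Rightarrow> (nat \<Rightarrow> 'a) set \<Rightarrow> complex" where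
  "conf_prod n f c = (\<Prod>i<n. f ((SOME x. c = perm_orbit n x) i))"

lemma conf_prod_perm_orbit: "conf_prod n f (perm_orbit n x) = (\<Prod>i<n. f (x i))"
proof -
  have "perm_orbit n x = perm_orbit n (SOME y. perm_orbit n x = perm_orbit n y)" by (rule someI[of _ x]) simp
  then obtain \<pi> where "\<pi> permutes {..<n}" "(SOME y. perm_orbit n x = perm_orbit n y) = x \<circ> \<pi>"
    unfolding perm_orbit_eq_iff by blast
  then show ?thesis
    unfolding conf_prod_def using prod.permute[of \<pi> "{..<n}" "\<lambda>i. f (x i)"] by (simp add: o_def)
qed

lemma continuous_map_conf_prod:
  assumes "continuous_map X euclidean f"
  shows "continuous_map (unordered_config_space n X) euclidean (conf_prod n f)"
  unfolding unordered_config_space_def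
proof (rule continuous_compose_quotient_map[OF quotient_map_quotient_topology])
  have "continuous_map (config_space n X) euclidean (\<lambda>x. f (x i))" if "i < n" for i
    using continuous_map_compose[OF continuous_map_config_proj[OF that] assms] by (simp add: o_def)
  then have "continuous_map (config_space n X) euclidean (\<lambda>x. \<Prod>i<n. f (x i))"
    by (auto simp: continuous_map_atin intro!: tendsto_prod)
  then show "continuous_map (config_space n X) euclidean (conf_prod n f \<circ> perm_orbit n)"
    by (simp add: o_def conf_prod_perm_orbit)
qed

lemma conf_prod_nonzero:
  assumes "\<And>x. x \<in> topspace X \<Longrightarrow> f x \<noteq> 0" "c \<in> topspace (unordered_config_space n X)"
  shows "conf_prod n f c \<noteq> 0"
  using assms unfolding topspace_unordered_config_space by (auto simp: conf_prod_perm_orbit topspace_config_space)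

section \<open>Cubic characters of the surface braid groups of positive genus\<close>

lemma block_arith:
  assumes "r < 4"
  shows "(4 * b + r) div 4 = b" "(4 * b + r) mod 4 = r" "(4 * b + r) mod 2 = r mod (2::nat)"
proof -
  show "(4 * b + r) div 4 = b" "(4 * b + r) mod 4 = r" using assms by simp_all
  have "(4 * b + r) mod 2 = (2 * (2 * b) + r) mod 2" by simp
  also have "\<dots> = r mod 2" by (rule mod_mult_self4)
  finally show "(4 * b + r) mod 2 = r mod 2" .
qed

text \<open>In a block \<open>a b a^-1 b^-1\<close> the two occurrences of a letter are two places
  apart, the earlier one with direction \<open>True\<close>.\<close>

lemma block_cases:
  assumes "i div 4 = j div 4" "i mod 2 = j mod (2::nat)"
  obtains "i = j" | "j = i + 2" "i mod 4 < 2" "\<not> j mod 4 < 2" | "i = j + 2" "j mod 4 < 2" "\<not> i mod 4 < 2"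
proof -
  define b r s where "b = i div 4" and "r = i mod 4" and "s = j mod 4"
  have i: "i = 4 * b + r" and j: "j = 4 * b + s" using assms(1) unfolding b_def r_def s_def by (metis mult_div_mod_eq)+
  have rs: "r < 4" "s < 4" unfolding r_def s_def by simp_all
  have "r mod 2 = s mod 2" using assms(2) block_arith(3)[OF rs(1), of b] block_arith(3)[OF rs(2), of b] unfolding i j by simp
  moreover have "r = 0 \<or> r = 1 \<or> r = 2 \<or> r = 3" "s = 0 \<or> s = 1 \<or> s = 2 \<or> s = 3" using rs by linarith+
  ultimately have "r = s \<or> s = r + 2 \<and> r < 2 \<or> r = s + 2 \<and> s < 2" by auto
  then show ?thesis using that i j unfolding r_def[symmetric] s_def[symmetric] by auto
qed

lemma digit_eq: "p < 2 \<Longrightarrow> r < 2 \<Longrightarrow> 2 * A + p = 2 * B + r \<longleftrightarrow> A = B \<and> p = (r::nat)"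
  by presburger

section \<open>The orientable polygon and its dual angle functions\<close>

locale tori_polygon = polygon "tori_scheme h" X q
  for h :: nat and X :: "'a topology" and q +
  assumes h: "h \<ge> 1"
begin

lemma scheme_length: "length (tori_scheme k) = 4 * k"
  by (induction k) (auto simp: tori_scheme_def)

lemma scheme_nth: "i < 4 * k \<Longrightarrow> tori_scheme k ! i = (2 * (i div 4) + i mod 2, i mod 4 < 2)"
proof (induction k)
  case (Suc k)
  have s: "tori_scheme (Suc k) = tori_scheme k @ [(2*k, True), (2*k + 1, True), (2*k, False), (2*k + 1, False)]"
    by (simp add: tori_scheme_def)
  show ?case
  proof (cases "i < 4 * k")
    case True
    then show ?thesis using Suc.IH by (simp add: s nth_append scheme_length)
  next
    case False
    then obtain r where r: "i = 4 * k + r" "r < 4" using Suc.prems by (metis add_diff_inverse_nat add_less_cancel_left mult_Suc_right add.commute)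
    then have "r = 0 \<or> r = 1 \<or> r = 2 \<or> r = 3" by auto
    moreover note block_arith[OF r(2), of k]
    ultimately show ?thesis unfolding r(1) by (auto simp: s nth_append scheme_length)
  qed
qed simp

lemma glued_iff:
  "edge_glued (tori_scheme h) z z' \<longleftrightarrow> (\<exists>i<4*h. \<exists>j<4*h. \<exists>t\<in>{0..1}. i div 4 = j div 4 \<and> i mod 2 = j mod 2 \<and>
     z = edge_point (4*h) i t \<and> z' = edge_point (4*h) j (if (i mod 4 < 2) = (j mod 4 < 2) then t else 1 - t))"
proof -
  have "2 * (i div 4) + i mod 2 = 2 * (j div 4) + j mod 2 \<longleftrightarrow> i div 4 = j div 4 \<and> i mod 2 = j mod 2" for i j :: nat
    by (rule digit_eq) simp_all
  then show ?thesis unfolding edge_glued_def scheme_length by (simp add: scheme_nth conj_assoc cong: conj_cong)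
qed

text \<open>The edge on which label \<open>l\<close> occurs in positive direction: labels
  \<open>2 * b\<close> and \<open>2 * b + 1\<close> belong to block \<open>b\<close>.\<close>

definition start :: "nat \<Rightarrow> nat" where "start l = 4 * (l div 2) + l mod 2"

text \<open>A trapezoid along the boundary: it climbs from 0 to \<open>2 * pi\<close> on edge
  \<open>a\<close>, stays there on edge \<open>a + 1\<close> and descends on edge
  \<open>a + 2\<close>. For \<open>a = start l\<close> the last is the partner of the first, and
  modulo \<open>2 * pi\<close> this is the angle of a circle-valued function dual to edge
  \<open>a\<close>.\<close>

definition height :: "nat \<Rightarrow> real \<Rightarrow> real" where
  "height a x = 2 * pi * max 0 (min 1 (min (x - real a) (real a + 3 - x)))"

lemma start_mod: "start l mod 4 < 2" "\<not> (start l + 2) mod 4 < 2"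
proof -
  have l: "l mod 2 < 2" by simp
  then have "l mod 2 < 4" "l mod 2 + 2 < 4" by linarith+
  from block_arith(2)[OF this(1), of "l div 2"] block_arith(2)[OF this(2), of "l div 2"]
  show "start l mod 4 < 2" "\<not> (start l + 2) mod 4 < 2" using l unfolding start_def by (simp_all add: add.assoc)
qed

lemma start_inj: "start k = start l \<Longrightarrow> k = l"
proof -
  assume s: "start k = start l"
  have "k mod 2 < 4" "l mod 2 < 4" using mod_less_divisor[of 2 k] mod_less_divisor[of 2 l] by linarith+
  then have "k div 2 = l div 2" "k mod 2 = l mod 2"
    using s block_arith(1,2)[of "k mod 2" "k div 2"] block_arith(1,2)[of "l mod 2" "l div 2"] unfolding start_def by metis+
  then show "k = l" by (metis div_mult_mod_eq)
qed

lemma start_less: "l < 2 * h \<Longrightarrow> start l + 3 \<le> 4 * h"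
proof -
  assume "l < 2 * h"
  then have "l div 2 < h" by auto
  moreover have "l mod 2 \<le> 1" by auto
  ultimately show ?thesis unfolding start_def by linarith
qed

lemma cis_height:
  assumes "t \<in> {0..1}"
  shows "cis (height a (real i + t)) = (if i = a then cis (2 * pi * t) else if i = a + 2 then cis (2 * pi * (1 - t)) else 1)"
proof -
  consider "i < a" | "i = a" | "i = a + 1" | "i = a + 2" | "i \<ge> a + 3" by linarith
  then show ?thesis
  proof cases
    case 1
    then have "real i + 1 \<le> real a" by linarith
    then have "min (real i + t - real a) (real a + 3 - (real i + t)) \<le> 0" using assms by auto
    then show ?thesis using 1 by (simp add: height_def)
  next
    case 5
    then have "real a + 3 \<le> real i" by linarith
    then have "min (real i + t - real a) (real a + 3 - (real i + t)) \<le> 0" using assms by auto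
    then show ?thesis using 5 by (simp add: height_def)
  qed (use assms in \<open>auto simp: height_def min_def max_def\<close>)
qed

text \<open>Edges \<open>start l\<close> and \<open>start l + 2\<close> are glued in opposite
  directions, which matches climb and descent; on all other edges the angle is a multiple of
  \<open>2 * pi\<close>.\<close>

lemma cis_height_glued:
  assumes l: "l < 2 * h" and t: "t \<in> {0..1}" and ij: "i div 4 = j div 4" "i mod 2 = j mod 2"
  shows "cis (height (start l) (real i + t)) =
    cis (height (start l) (real j + (if (i mod 4 < 2) = (j mod 4 < 2) then t else 1 - t)))"
proof -
  have t': "1 - t \<in> {0..1}" using t by auto
  note s = start_mod[of l]
  show ?thesis
  proof (rule block_cases[OF ij])
    assume 2: "j = i + 2" "i mod 4 < 2" "\<not> j mod 4 < 2"
    then have "i \<noteq> start l + 2" "j \<noteq> start l" using s by auto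
    moreover have "(if (i mod 4 < 2) = (j mod 4 < 2) then t else 1 - t) = 1 - t" using 2 by simp
    ultimately show ?thesis using 2(1) by (simp only: cis_height[OF t] cis_height[OF t']) auto
  next
    assume 3: "i = j + 2" "j mod 4 < 2" "\<not> i mod 4 < 2"
    then have "j \<noteq> start l + 2" "i \<noteq> start l" using s by auto
    moreover have "(if (i mod 4 < 2) = (j mod 4 < 2) then t else 1 - t) = 1 - t" using 3 by simp
    ultimately show ?thesis using 3(1) by (simp only: cis_height[OF t] cis_height[OF t']) auto
  qed simp
qed

text \<open>The duality of angles and edges: edge \<open>start k\<close> gains \<open>2 * pi\<close>
  for \<open>k = l\<close> only. The descending edge \<open>start l + 2\<close> is never of the form
  \<open>start k\<close>.\<close>

lemma height_step:
  assumes "l < 2 * h" "k < 2 * h"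
  shows "height (start l) (real (start k) + 1) - height (start l) (real (start k)) = (if l = k then 2 * pi else 0)"
proof (cases "l = k")
  case True
  then show ?thesis by (simp add: height_def)
next
  case False
  then have "start k \<noteq> start l" using start_inj by blast
  moreover have "start k \<noteq> start l + 2" using start_mod by metis
  ultimately consider "start k + 1 \<le> start l" | "start k = start l + 1" | "start k \<ge> start l + 3" by linarith
  then show ?thesis
  proof cases
    case 1
    then have "real (start k) + 1 \<le> real (start l)" by linarith
    then show ?thesis using False by (simp add: height_def max_def min_def)
  next
    case 3
    then have "real (start k) \<ge> real (start l) + 3" by linarith
    then show ?thesis using False by (simp add: height_def max_def min_def)
  qed (use False in \<open>simp add: height_def\<close>)
qed

text \<open>The parameter interval wraps onto the circle and identifies only its two ends, where the
  trapezoid is 0 because \<open>a + 3 \<le> 4 * h\<close>. \<open>Tietze\<close> then extends the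
  function over the disc.\<close>

lemma height_on_disc:
  assumes a: "a + 3 \<le> 4 * h"
  obtains \<theta> where "continuous_on (cball 0 1) \<theta>" "\<And>i t. i < 4 * h \<Longrightarrow> t \<in> {0..1} \<Longrightarrow> \<theta> (edge_point (4*h) i t) = height a (real i + t)"
proof -
  define M where "M = real (4 * h)"
  have M: "M > 0" "real a + 3 \<le> M" using h a unfolding M_def by linarith+
  define e where "e x = cis (2 * pi * x / M)" for x
  have ce: "continuous_on A e" for A unfolding e_def by (intro continuous_intros) (use M in auto)
  have im: "e ` {0..M} = sphere 0 1"
  proof (intro equalityI subsetI)
    fix z :: complex assume z: "z \<in> sphere 0 1"
    let ?x = "Arg2pi z * M / (2 * pi)"
    have "z = e ?x" using z Arg2pi_eq[of z] M by (simp add: e_def cis_conv_exp)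
    moreover have "?x \<in> {0..M}" using Arg2pi_ge_0[of z] Arg2pi_lt_2pi[of z] M by (auto simp: field_simps)
    ultimately show "z \<in> e ` {0..M}" by blast
  qed (auto simp: e_def)
  have q1: "quotient_map (top_of_set {0..M}) (top_of_set (sphere 0 1)) e"
    using im ce[of "{0..M}"] by (intro T1_Spaces.continuous_imp_quotient_map)
      (auto simp: continuous_map_in_subtopology compact_space_subtopology Hausdorff_space_subtopology)
  have q2: "continuous_map (top_of_set {0..M}) euclideanreal (height a)"
    unfolding height_def by (simp, intro continuous_intros)
  have q3: "height a x = height a y" if xy: "x \<in> topspace (top_of_set {0..M})" "y \<in> topspace (top_of_set {0..M})" "e x = e y" for x y
  proof -
    obtain k :: int where "2 * pi * x / M - 2 * pi * y / M = 2 * pi * of_int k"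
      using xy(3) unfolding e_def cis_eq_iff by blast
    then have "2 * pi * (x - y) = 2 * pi * (of_int k * M)" using M by (simp add: field_simps)
    then have k: "x - y = of_int k * M" by simp
    have b: "0 \<le> x" "x \<le> M" "0 \<le> y" "y \<le> M" using xy by auto
    have "\<bar>of_int k\<bar> * M \<le> 1 * M" using k b M(1) by (metis abs_le_iff abs_mult abs_of_pos diff_ge_0_iff_ge diff_mono mult_1 diff_zero minus_diff_eq)
    then have "\<bar>real_of_int k\<bar> \<le> 1" using M(1) by simp
    then have "k = -1 \<or> k = 0 \<or> k = 1" by linarith
    then consider "x = y" | "x = M" "y = 0" | "x = 0" "y = M" using k b by force
    then show ?thesis using M(2) by cases (simp_all add: height_def max_def min_def)
  qed
  obtain f where f: "continuous_map (top_of_set (sphere 0 1)) euclideanreal f"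
    "\<And>x. x \<in> topspace (top_of_set {0..M}) \<Longrightarrow> f (e x) = height a x"
    using quotient_map_lift_exists[OF q1 q2 q3] by (smt (verit))
  have fb: "norm (f z) \<le> 2 * pi" if z: "z \<in> sphere 0 1" for z
  proof -
    obtain x where x: "z = e x" "x \<in> {0..M}" using z unfolding im[symmetric] by blast
    have m: "0 \<le> max 0 (min 1 (min (x - real a) (real a + 3 - x)))" "max 0 (min 1 (min (x - real a) (real a + 3 - x))) \<le> 1" by simp_all
    have "0 \<le> height a x" unfolding height_def using m(1) by simp
    moreover have "height a x \<le> 2 * pi * 1" unfolding height_def by (rule mult_left_mono[OF m(2)]) simp
    ultimately show ?thesis using f(2)[of x] x by simp
  qed
  have fc: "continuous_on (sphere 0 1) f" using f(1) by simp
  have cl: "closedin (top_of_set (cball (0::complex) 1)) (sphere 0 1)" by (simp add: closed_subset)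
  have "0 \<le> 2 * pi" by simp
  then obtain \<theta> where \<theta>: "continuous_on (cball (0::complex) 1) \<theta>" "\<And>x. x \<in> sphere 0 1 \<Longrightarrow> \<theta> x = f x"
    using Tietze[OF fc cl _ fb] by metis
  have "\<theta> (edge_point (4*h) i t) = height a (real i + t)" if "i < 4 * h" "t \<in> {0..1}" for i t
  proof -
    have "real i + 1 \<le> M" using that(1) unfolding M_def by linarith
    then have "real i + t \<in> {0..M}" using that(2) by auto
    moreover have "edge_point (4*h) i t = e (real i + t)" by (simp add: edge_point_def e_def M_def)
    moreover have "edge_point (4*h) i t \<in> sphere 0 1" by simp
    ultimately show ?thesis using \<theta>(2)[of "edge_point (4*h) i t"] f(2)[of "real i + t"] by (metis topspace_euclidean_subtopology)
  qed
  then show ?thesis using that \<theta>(1) by blast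
qed

text \<open>The gluing respects the angle only modulo \<open>2 * pi\<close>, so it is
  \<open>cis\<close> of the angle that descends to \<open>X\<close>.\<close>

lemma circle_function:
  assumes l: "l < 2 * h"
  obtains f \<theta> where "continuous_map X euclidean f" "continuous_on (cball 0 1) \<theta>" "\<And>z. z \<in> cball 0 1 \<Longrightarrow> f (q z) = cis (\<theta> z)"
    "\<And>i t. i < 4 * h \<Longrightarrow> t \<in> {0..1} \<Longrightarrow> \<theta> (edge_point (4*h) i t) = height (start l) (real i + t)"
proof -
  obtain \<theta> where \<theta>: "continuous_on (cball 0 1) \<theta>"
    "\<And>i t. i < 4 * h \<Longrightarrow> t \<in> {0..1} \<Longrightarrow> \<theta> (edge_point (4*h) i t) = height (start l) (real i + t)"
    using height_on_disc[OF start_less[OF l]] by blast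
  have glued: "cis (\<theta> z) = cis (\<theta> z')" if glued: "edge_glued (tori_scheme h) z z'" for z z'
  proof -
    obtain i j t where e: "i < 4*h" "j < 4*h" "t \<in> {0..1}" "i div 4 = j div 4" "i mod 2 = j mod 2"
      "z = edge_point (4*h) i t" "z' = edge_point (4*h) j (if (i mod 4 < 2) = (j mod 4 < 2) then t else 1 - t)"
      using glued[unfolded glued_iff] by (elim exE bexE conjE) blast
    have "(if (i mod 4 < 2) = (j mod 4 < 2) then t else 1 - t) \<in> {0..1}" using e(3) by auto
    then show ?thesis unfolding e(6,7) using \<theta>(2) e(1-3) cis_height_glued[OF l e(3-5)] by simp
  qed
  have "cis (\<theta> z) = cis (\<theta> z')" if "equivclp (edge_glued (tori_scheme h)) z z'" for z z'
    using that by (induction rule: equivclp_induct) (use glued in metis)+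
  then have q2: "cis (\<theta> z) = cis (\<theta> z')"
    if "z \<in> topspace (top_of_set (cball 0 1))" "z' \<in> topspace (top_of_set (cball 0 1))" "q z = q z'" for z z'
    using that fib by simp
  have q1: "continuous_map (top_of_set (cball 0 1)) euclidean (\<lambda>z. cis (\<theta> z))"
    using \<theta>(1) by (simp add: continuous_on_cis)
  obtain f where "continuous_map X euclidean f" "\<And>z. z \<in> topspace (top_of_set (cball 0 1)) \<Longrightarrow> f (q z) = cis (\<theta> z)"
    using quotient_map_lift_exists[OF quot q1 q2] by (smt (verit))
  then show ?thesis using that[of f \<theta>] \<theta> by simp
qed

text \<open>The two gluings of the block link its corners 0, 3, 2, 1 in a chain. This closes the
  handle loops.\<close>

lemma vertex_identified:
  assumes "b < h" "r < 4"
  shows "q (edge_point (4*h) (4*b + r) 0) = q (edge_point (4*h) (4*b + 1) 0)"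
proof -
  let ?v = "\<lambda>r. q (edge_point (4*h) (4*b + r) 0)"
  have g: "edge_glued (tori_scheme h) (edge_point (4*h) (4*b + r) t) (edge_point (4*h) (4*b + (r + 2)) (1 - t))"
    if "r < 2" "t \<in> {0..1}" for r t
  proof -
    have "4*b + r < 4*h" "4*b + (r + 2) < 4*h" using assms that(1) by linarith+
    moreover have "(4*b + r) div 4 = (4*b + (r + 2)) div 4" "(4*b + r) mod 2 = (4*b + (r + 2)) mod 2"
      "(4*b + r) mod 4 < 2" "\<not> (4*b + (r + 2)) mod 4 < 2"
      using block_arith[of r b] block_arith[of "r + 2" b] that(1) by simp_all
    ultimately show ?thesis unfolding glued_iff using that(2) by (smt (verit))
  qed
  have "?v r = ?v (Suc (r + 2))" "?v (Suc r) = ?v (r + 2)" if "r < 2" for r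
    using q_glued[OF g[OF that, of 0]] q_glued[OF g[OF that, of 1]] by (simp_all add: edge_point_Suc)
  from this[of 0] this[of 1] have "?v 0 = ?v 3" "?v 1 = ?v 2" "?v 2 = ?v 3" by (simp_all add: eval_nat_numeral)
  moreover have "r = 0 \<or> r = 1 \<or> r = 2 \<or> r = 3" using assms(2) by auto
  ultimately show ?thesis by metis
qed

lemma edge_closed:
  assumes "l < 2 * h"
  shows "q (edge_point (4*h) (start l) 1) = q (edge_point (4*h) (start l) 0)"
proof -
  have "l div 2 < h" using assms by auto
  moreover have "l mod 2 < 4" "Suc (l mod 2) < 4" using mod_less_divisor[of 2 l] by linarith+
  ultimately show ?thesis
    using vertex_identified[of "l div 2" "l mod 2"] vertex_identified[of "l div 2" "Suc (l mod 2)"]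
    by (simp add: start_def edge_point_Suc)
qed

definition handle_loop :: "nat \<Rightarrow> nat \<Rightarrow> real \<Rightarrow> (nat \<Rightarrow> 'a) set" where
  "handle_loop n l = perm_orbit n \<circ> (proj n \<circ> edge_config (4*h) n (start l))"

lemma handle_loop:
  assumes "n \<ge> 1" "l < 2 * h"
  shows "pathin (unordered_config_space n X) (handle_loop n l)" "handle_loop n l 1 = handle_loop n l 0"
proof -
  show "pathin (unordered_config_space n X) (handle_loop n l)"
    unfolding handle_loop_def using h assms(1)
    by (intro pathin_compose[OF pathin_compose[OF pathin_edge_config continuous_map_proj] continuous_map_perm_orbit]) auto
  have "proj n (edge_config (4*h) n (start l) 1) = proj n (edge_config (4*h) n (start l) 0)"
    using edge_closed[OF assms(2)] by (auto simp: proj_def edge_config_def fun_eq_iff)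
  then show "handle_loop n l 1 = handle_loop n l 0" by (simp add: handle_loop_def)
qed

text \<open>The character continues a cube root of the product of \<open>f\<close> over all points.
  Along \<open>handle_loop n k\<close> only the moving point changes its angle, by the amount in
  \<open>height_step\<close>.\<close>

lemma cubic_character:
  assumes n: "n \<ge> 1" and l: "l < 2 * h"
  shows "\<exists>\<Omega>. path_char (unordered_config_space n X) \<Omega> \<and>
    (\<forall>p. pathin (unordered_config_space n X) p \<longrightarrow> p 1 = p 0 \<longrightarrow> \<Omega> p ^ 3 = 1) \<and>
    (\<forall>k<2*h. \<Omega> (handle_loop n k) = (if k = l then cis (2 * pi / 3) else 1))"
proof -
  obtain f \<theta> where f: "continuous_map X euclidean f" "continuous_on (cball 0 1) \<theta>" "\<And>z. z \<in> cball 0 1 \<Longrightarrow> f (q z) = cis (\<theta> z)"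
    "\<And>i t. i < 4 * h \<Longrightarrow> t \<in> {0..1} \<Longrightarrow> \<theta> (edge_point (4*h) i t) = height (start l) (real i + t)"
    using circle_function[OF l] by blast
  have nz: "f x \<noteq> 0" if "x \<in> topspace X" for x using q_surj[OF that] f(3) by auto
  have F: "continuous_map (unordered_config_space n X) euclidean (conf_prod n f)"
    "\<And>c. c \<in> topspace (unordered_config_space n X) \<Longrightarrow> conf_prod n f c \<noteq> 0"
    by (rule continuous_map_conf_prod[OF f(1)], rule conf_prod_nonzero[of X f], rule nz)
  let ?\<Omega> = "root_char 3 (conf_prod n f)"
  have "?\<Omega> p ^ 3 = 1" if p: "pathin (unordered_config_space n X) p" "p 1 = p 0" for p
    using root_char_power[OF F p(1), where N = 3] p(2) F(2)[OF path_start_in_topspace[OF p(1)]] by simp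
  moreover have "?\<Omega> (handle_loop n k) = (if k = l then cis (2 * pi / 3) else 1)" if k: "k < 2 * h" for k
  proof -
    let ?e = "edge_config (4*h) n (start k)"
    define L where "L t = \<i> * of_real (\<Sum>i<n. \<theta> (?e t i))" for t
    have el: "?e t \<in> topspace (lifted n)" for t by (rule edge_config_lifted[OF n])
    then have eb: "?e t i \<in> cball 0 1" if "i < n" for i t using that unfolding topspace_lifted by blast
    have "continuous_on {0..1} (\<lambda>t. ?e t i)" if "i < n" for i
      using continuous_lifted_coordinate[OF pathin_edge_config[unfolded pathin_def] that] h n by simp
    then have "continuous_on {0..1} (\<lambda>t. \<theta> (?e t i))" if "i < n" for i
      using that eb by (intro continuous_on_compose2[OF f(2)]) auto
    then have cL: "continuous_on {0..1} L" unfolding L_def by (intro continuous_intros) auto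
    have eL: "exp (L t) = conf_prod n f (handle_loop n k t)" for t
    proof -
      have "exp (L t) = (\<Prod>i<n. cis (\<theta> (?e t i)))"
        by (simp add: L_def cis_conv_exp exp_sum sum_distrib_left)
      also have "\<dots> = (\<Prod>i<n. f (proj n (?e t) i))" using f(3) eb by (intro prod.cong) (auto simp: proj_def)
      finally show ?thesis by (simp add: handle_loop_def conf_prod_perm_orbit)
    qed
    have "start k < 4 * h" using start_less[OF k] by simp
    then have "\<theta> (?e 1 i) - \<theta> (?e 0 i) = (if i = 0 then if l = k then 2 * pi else 0 else 0)" if "i < n" for i
      using f(4)[of "start k" 0] f(4)[of "start k" 1] height_step[OF l k] that by (auto simp: edge_config_def)
    then have "(\<Sum>i<n. \<theta> (?e 1 i) - \<theta> (?e 0 i)) = (\<Sum>i<n. if i = 0 then if l = k then 2 * pi else 0 else 0)"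
      by (intro sum.cong) auto
    also have "\<dots> = (if l = k then 2 * pi else 0)" using n by simp
    finally have "L 1 - L 0 = \<i> * of_real (if l = k then 2 * pi else 0)"
      unfolding L_def by (simp only: right_diff_distrib[symmetric] of_real_diff[symmetric] sum_subtractf)
    then show ?thesis
      unfolding root_charI[where F = "conf_prod n f", OF cL eL] by (simp add: cis_conv_exp)
  qed
  ultimately show ?thesis using root_char_path_char[OF F] by blast
qed

end

text \<open>There are \<open>3\<^sup>2\<^sup>h\<close> products of cubic characters; pulled back to the nonorientable side, they
  are determined up to squares by their values on \<open>h\<close> loops.\<close>

theorem no_epi_to_positive_genus:
  assumes n: "n \<ge> 1" and U: "crosscap_polygon (Suc h) U qU" and X: "tori_polygon h X qX"
    and c: "c \<in> topspace (unordered_config_space n U)" and d: "d \<in> topspace (unordered_config_space n X)"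
  shows "f \<notin> epi (braid_group n U c) (braid_group n X d)"
proof
  assume f: "f \<in> epi (braid_group n U c) (braid_group n X d)"
  interpret U: crosscap_polygon "Suc h" U qU by (rule U)
  interpret X: tori_polygon h X qX by (rule X)
  let ?Y = "unordered_config_space n U" and ?Z = "unordered_config_space n X"
  obtain T where T: "\<And>p. pathin ?Y p \<Longrightarrow> p 1 = p 0 \<Longrightarrow> pathin ?Z (T p) \<and> T p 1 = T p 0"
    "\<And>\<psi>. path_char ?Z \<psi> \<Longrightarrow> \<exists>\<Phi>. path_char ?Y \<Phi> \<and> (\<forall>p. pathin ?Y p \<longrightarrow> p 1 = p 0 \<longrightarrow> \<Phi> p = \<psi> (T p))"
    "\<And>r. pathin ?Z r \<Longrightarrow> r 1 = r 0 \<Longrightarrow> \<exists>p. pathin ?Y p \<and> p 1 = p 0 \<and> (\<forall>\<psi>. path_char ?Z \<psi> \<longrightarrow> \<psi> (T p) = \<psi> r)"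
    using epi_path_char[OF path_connected_unordered_config_space[OF U.path_connected_polygon_config] c
        path_connected_unordered_config_space[OF X.path_connected_polygon_config] d f[unfolded braid_group_def]] by blast
  have "\<forall>l. \<exists>\<Omega>. l < 2 * h \<longrightarrow> path_char ?Z \<Omega> \<and> (\<forall>p. pathin ?Z p \<longrightarrow> p 1 = p 0 \<longrightarrow> \<Omega> p ^ 3 = 1) \<and>
      (\<forall>k<2*h. \<Omega> (X.handle_loop n k) = (if k = l then cis (2 * pi / 3) else 1))"
    using X.cubic_character[OF n] by blast
  from choice[OF this] obtain \<Omega> where \<Omega>: "\<And>l. l < 2 * h \<Longrightarrow> path_char ?Z (\<Omega> l)"
    "\<And>l p. l < 2 * h \<Longrightarrow> pathin ?Z p \<Longrightarrow> p 1 = p 0 \<Longrightarrow> \<Omega> l p ^ 3 = 1"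
    "\<And>l k. l < 2 * h \<Longrightarrow> k < 2 * h \<Longrightarrow> \<Omega> l (X.handle_loop n k) = (if k = l then cis (2 * pi / 3) else 1)" by blast
  define \<omega> where "\<omega> = cis (2 * pi / 3)"
  define ch where "ch v p = (\<Prod>l<2*h. \<Omega> l p ^ v l)" for v :: "nat \<Rightarrow> nat" and p
  have pcch: "path_char ?Z (ch v)" for v
    unfolding ch_def by (intro path_char_prod path_char_power \<Omega>(1)) auto
  have ch3: "ch v p ^ 3 = 1" if "pathin ?Z p" "p 1 = p 0" for v p
  proof -
    have "(\<Omega> l p ^ v l) ^ 3 = 1" if "l < 2 * h" for l
      using \<Omega>(2)[OF that \<open>pathin ?Z p\<close> \<open>p 1 = p 0\<close>] by (metis power_commutes power_mult mult.commute power_one)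
    then show ?thesis unfolding ch_def prod_power_distrib by simp
  qed
  have chv: "ch v (X.handle_loop n k) = \<omega> ^ v k" if k: "k < 2 * h" for v k
  proof -
    have "ch v (X.handle_loop n k) = (\<Prod>l<2*h. if l = k then \<omega> ^ v k else 1)"
      unfolding ch_def using \<Omega>(3)[OF _ k] by (intro prod.cong) (auto simp: \<omega>_def)
    then show ?thesis using k by simp
  qed
  define \<mu> where "\<mu> = {z::complex. z ^ 3 = 1}"
  have \<mu>: "finite \<mu>" "card \<mu> = 3" using card_roots_unity_eq[of 3] finite_nth_roots[of 3 1] by (auto simp: \<mu>_def)
  define V where "V = PiE {..<2*h} (\<lambda>_. {..<3::nat})"
  \<comment> \<open>Only the first \<open>h\<close> of the \<open>Suc h\<close> edge loops are
    recorded, since \<open>edge_loop_relation\<close> fixes the square of the value on the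
    last.\<close>
  define J where "J v = restrict (\<lambda>k. ch v (T (U.edge_loop n k))) {..<h}" for v
  have loop: "pathin ?Y (U.edge_loop n k)" "U.edge_loop n k 1 = U.edge_loop n k 0" if "k < Suc h" for k
    using U.edge_loop_in[OF n] U.edge_loop_closed[OF that] by auto
  have "J v \<in> PiE {..<h} (\<lambda>_. \<mu>)" for v
    using ch3 T(1) loop by (auto simp: J_def \<mu>_def)
  then have "card (J ` V) \<le> card (PiE {..<h} (\<lambda>_. \<mu>))" using \<mu>(1) by (intro card_mono finite_PiE) auto
  also have "\<dots> = 3 ^ h" by (simp add: card_PiE \<mu>(2))
  also have "\<dots> < (3::nat) ^ (2 * h)" using X.h by (intro power_strict_increasing) auto
  also have "\<dots> = card V" by (simp add: V_def card_PiE)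
  finally have "card (J ` V) < card V" .
  then have "\<not> inj_on J V" by (rule pigeonhole)
  then obtain v u where vu: "v \<in> V" "u \<in> V" "J v = J u" "v \<noteq> u" unfolding inj_on_def by blast
  \<comment> \<open>The quotient of two different products with the same record is 1 on the recorded
    loops.\<close>
  define \<psi> where "\<psi> p = ch v p * inverse (ch u p)" for p
  have pc\<psi>: "path_char ?Z \<psi>" unfolding \<psi>_def by (intro path_char_mult path_char_inverse pcch)
  obtain \<Phi> where \<Phi>: "path_char ?Y \<Phi>" "\<And>p. pathin ?Y p \<Longrightarrow> p 1 = p 0 \<Longrightarrow> \<Phi> p = \<psi> (T p)" using T(2)[OF pc\<psi>] by blast
  interpret crosscap_char "Suc h" U qU n \<Phi> by unfold_locales (rule \<Phi>(1))
  have triv: "\<Phi> (U.edge_loop n k) = 1" if "k < h" for k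
  proof -
    have "ch v (T (U.edge_loop n k)) = ch u (T (U.edge_loop n k))"
      using fun_cong[OF vu(3), of k] that by (simp add: J_def)
    moreover have "ch u (T (U.edge_loop n k)) \<noteq> 0" using path_char_nonzero[OF pcch] T(1)[OF loop[of k]] that by simp
    ultimately show ?thesis using \<Phi>(2)[OF loop[of k]] that by (simp add: \<psi>_def)
  qed
  have sq: "(\<Phi> (U.edge_loop n k))\<^sup>2 = 1" if "k < Suc h" for k
    using that triv edge_loop_relation[OF n] by (cases "k < h") (auto simp: less_Suc_eq)
  have "v k = u k" for k
  proof (cases "k < 2 * h")
    case True
    obtain p where p: "pathin ?Y p" "p 1 = p 0" "\<And>\<psi>. path_char ?Z \<psi> \<Longrightarrow> \<psi> (T p) = \<psi> (X.handle_loop n k)"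
      using T(3)[OF X.handle_loop[OF n True]] by blast
    have "(\<psi> (X.handle_loop n k))\<^sup>2 = 1" using square_trivial[OF n sq p(1,2)] \<Phi>(2)[OF p(1,2)] p(3)[OF pc\<psi>] by simp
    moreover have "\<omega> ^ u k \<noteq> 0" by (simp add: \<omega>_def)
    ultimately have "\<omega> ^ (2 * v k) = \<omega> ^ (2 * u k)"
      unfolding \<psi>_def chv[OF True] by (simp add: field_simps power_mult_distrib power_inverse flip: power_mult)
    then have "cis (2 * pi * (2 * v k) / 3) = cis (2 * pi * (2 * u k) / 3)"
      unfolding \<omega>_def Complex.DeMoivre by (simp add: algebra_simps)
    then obtain j :: int where "2 * pi * (2 * v k) / 3 - 2 * pi * (2 * u k) / 3 = 2 * pi * of_int j" unfolding cis_eq_iff by blast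
    then have "2 * pi * (2 * real (v k) - 2 * real (u k)) = 2 * pi * (3 * of_int j)" by (simp add: field_simps)
    then have "2 * real (v k) - 2 * real (u k) = 3 * of_int j" by simp
    then have "2 * int (v k) - 2 * int (u k) = 3 * j" by linarith
    moreover have "v k < 3" "u k < 3" using vu(1,2) True by (auto simp: V_def PiE_iff)
    \<comment> \<open>2 is invertible modulo 3, and both exponents are below 3.\<close>
    ultimately show ?thesis by presburger
  next
    case False
    then show ?thesis using vu(1,2) by (simp add: V_def PiE_iff extensional_def)
  qed
  then show False using vu(4) by auto
qed

section \<open>Spinors\<close>

text \<open>\<open>spin p v\<close> says that \<open>v\<close> lies in the line of \<open>\<complex>\<^sup>2\<close> that corresponds to the point \<open>p\<close> of the sphere, i.e.\ in
  the image of the projection \<open>spin_proj p\<close>.\<close>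

definition dt :: "complex \<times> complex \<Rightarrow> complex \<times> complex \<Rightarrow> complex" where
  "dt v w = fst v * snd w - snd v * fst w"

definition sm :: "complex \<Rightarrow> complex \<times> complex \<Rightarrow> complex \<times> complex" where
  "sm c v = (c * fst v, c * snd v)"

definition xy :: "real^3 \<Rightarrow> complex" where "xy p = Complex (p $ 1) (p $ 2)"

definition spin :: "real^3 \<Rightarrow> complex \<times> complex \<Rightarrow> bool" where
  "spin p v \<longleftrightarrow> (1 - of_real (p $ 3)) * fst v = cnj (xy p) * snd v \<and> (1 + of_real (p $ 3)) * snd v = xy p * fst v"

text \<open>Half the sum of the identity and the Pauli matrix of \<open>p\<close>: the Hermitian
  projection onto the line of \<open>p\<close>, whose kernel is the line of
  \<open>- p\<close>.\<close>

definition spin_proj :: "real^3 \<Rightarrow> complex \<times> complex \<Rightarrow> complex \<times> complex" where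
  "spin_proj p v = (((1 + of_real (p $ 3)) * fst v + cnj (xy p) * snd v) / 2,
                    (xy p * fst v + (1 - of_real (p $ 3)) * snd v) / 2)"

text \<open>The Hopf map, normalised by the squared length \<open>N\<close>.\<close>

definition spin_pt :: "complex \<times> complex \<Rightarrow> real^3" where
  "spin_pt v = (let N = (norm (fst v))\<^sup>2 + (norm (snd v))\<^sup>2 in
     vector [2 * Re (cnj (fst v) * snd v) / N, 2 * Im (cnj (fst v) * snd v) / N, ((norm (fst v))\<^sup>2 - (norm (snd v))\<^sup>2) / N])"

text \<open>The factor between parallel vectors, written through the Hermitian inner product so that
  it is continuous in both arguments.\<close>

definition coef :: "complex \<times> complex \<Rightarrow> complex \<times> complex \<Rightarrow> complex" where
  "coef v w = (cnj (fst v) * fst w + cnj (snd v) * snd w) / (cnj (fst v) * fst v + cnj (snd v) * snd v)"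

lemma norm_pair_sq: "cnj (fst v) * fst v + cnj (snd v) * snd v = of_real ((norm (fst v))\<^sup>2 + (norm (snd v))\<^sup>2)"
  unfolding of_real_add complex_norm_square by (simp add: mult.commute)

lemma norm_pair_pos: "v \<noteq> 0 \<Longrightarrow> 0 < (norm (fst v))\<^sup>2 + (norm (snd v))\<^sup>2"
  by (auto simp: prod_eq_iff sum_power2_gt_zero_iff)

lemma norm_pair_nz: "v \<noteq> 0 \<Longrightarrow> cnj (fst v) * fst v + cnj (snd v) * snd v \<noteq> 0"
  unfolding norm_pair_sq of_real_eq_0_iff using norm_pair_pos by fastforce

lemma sphere3_iff: "p \<in> sphere 0 1 \<longleftrightarrow> (p $ 1)\<^sup>2 + (p $ 2)\<^sup>2 + (p $ 3)\<^sup>2 = 1" for p :: "real^3"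
  by (simp add: norm_eq_1 inner_vec_def sum_3 power2_eq_square)

lemma xy_norm:
  assumes "p \<in> sphere 0 1"
  shows "xy p * cnj (xy p) = (1 - of_real (p $ 3)) * (1 + of_real (p $ 3))"
proof -
  have "xy p * cnj (xy p) = of_real ((p $ 1)\<^sup>2 + (p $ 2)\<^sup>2)"
    by (simp add: xy_def complex_eq_iff power2_eq_square)
  also have "(p $ 1)\<^sup>2 + (p $ 2)\<^sup>2 = (1 - p $ 3) * (1 + p $ 3)"
    using assms unfolding sphere3_iff by (simp add: algebra_simps power2_eq_square)
  finally show ?thesis by simp
qed

lemma spin_spin_proj: "p \<in> sphere 0 1 \<Longrightarrow> spin p (spin_proj p v)"
proof -
  assume "p \<in> sphere 0 1"
  note e = xy_norm[OF this]
  have "(1 - of_real (p $ 3)) * ((1 + of_real (p $ 3)) * fst v + cnj (xy p) * snd v) =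
      cnj (xy p) * (xy p * fst v + (1 - of_real (p $ 3)) * snd v)"
    "(1 + of_real (p $ 3)) * (xy p * fst v + (1 - of_real (p $ 3)) * snd v) =
      xy p * ((1 + of_real (p $ 3)) * fst v + cnj (xy p) * snd v)"
    using e by algebra+
  then show ?thesis unfolding spin_def spin_proj_def by simp
qed

lemma spin_proj_zero: "spin_proj p v = 0 \<Longrightarrow> spin (- p) v"
proof -
  have "xy (- p) = - xy p" by (simp add: xy_def complex_eq_iff)
  moreover assume "spin_proj p v = 0"
  ultimately show ?thesis unfolding spin_def spin_proj_def
    by (simp add: prod_eq_iff add_eq_0_iff)
qed

text \<open>The Hopf formulas recover the coordinates of the point from the vector.\<close>

lemma spin_inj:
  assumes "spin p v" "spin p' v" "v \<noteq> 0"
  shows "p = p'"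
proof -
  let ?N = "cnj (fst v) * fst v + cnj (snd v) * snd v"
  have c: "of_real (p $ 3) * ?N = cnj (fst v) * fst v - cnj (snd v) * snd v"
    "xy p * ?N = 2 * cnj (fst v) * snd v" if "spin p v" for p
  proof -
    have 1: "(1 - of_real (p $ 3)) * fst v = cnj (xy p) * snd v" "(1 + of_real (p $ 3)) * snd v = xy p * fst v"
      using that by (auto simp: spin_def)
    have 2: "(1 - of_real (p $ 3)) * cnj (fst v) = xy p * cnj (snd v)"
      using arg_cong[OF 1(1), of cnj] by simp
    show "of_real (p $ 3) * ?N = cnj (fst v) * fst v - cnj (snd v) * snd v" using 1(2) 2 by algebra
    show "xy p * ?N = 2 * cnj (fst v) * snd v" using 1(2) 2 by algebra
  qed
  have "complex_of_real (p $ 3) = of_real (p' $ 3)" "xy p = xy p'"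
    using c[OF assms(1)] c[OF assms(2)] norm_pair_nz[OF assms(3)] by (metis mult_right_cancel)+
  then show ?thesis by (simp add: vec_eq_iff forall_3 xy_def)
qed

lemma spin_parallel: "spin p v \<Longrightarrow> spin p w \<Longrightarrow> dt v w = 0"
proof -
  assume "spin p v" "spin p w"
  then have "2 * dt v w = 0" unfolding spin_def dt_def by algebra
  then show ?thesis by simp
qed

lemma coef:
  assumes "dt v w = 0" "v \<noteq> 0"
  shows "w = sm (coef v w) v"
proof -
  have "(cnj (fst v) * fst w + cnj (snd v) * snd w) * fst v = fst w * (cnj (fst v) * fst v + cnj (snd v) * snd v)"
    "(cnj (fst v) * fst w + cnj (snd v) * snd w) * snd v = snd w * (cnj (fst v) * fst v + cnj (snd v) * snd v)"
    using assms(1) unfolding dt_def by algebra+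
  then show ?thesis
    using norm_pair_nz[OF assms(2)] by (simp add: sm_def coef_def prod_eq_iff)
qed

lemma coef_nonzero: "dt v w = 0 \<Longrightarrow> v \<noteq> 0 \<Longrightarrow> w \<noteq> 0 \<Longrightarrow> coef v w \<noteq> 0"
  using coef[of v w] by (auto simp: sm_def zero_prod_def)

lemma spin_sm: "c \<noteq> 0 \<Longrightarrow> spin p (sm c v) \<longleftrightarrow> spin p v"
proof -
  assume c: "c \<noteq> 0"
  have "x * (c * y) = x' * (c * y') \<longleftrightarrow> x * y = x' * y'" for x y x' y'
    using c by (metis mult.left_commute mult_left_cancel)
  then show ?thesis by (simp add: spin_def sm_def)
qed

lemma dt_nonzero:
  assumes "spin p v" "spin p' v'" "v \<noteq> 0" "v' \<noteq> 0" "p \<noteq> p'"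
  shows "dt v v' \<noteq> 0"
proof
  assume d: "dt v v' = 0"
  let ?c = "coef v v'"
  have "v' = sm ?c v" "?c \<noteq> 0" using coef[OF d assms(3)] coef_nonzero[OF d assms(3,4)] .
  then have "spin p' v" using assms(2) spin_sm by metis
  then show False using spin_inj[OF assms(1) _ assms(3)] assms(5) by blast
qed

lemma spin_pt:
  assumes "v \<noteq> 0"
  shows "spin (spin_pt v) v" "spin_pt v \<in> sphere 0 1"
proof -
  define N where "N = (norm (fst v))\<^sup>2 + (norm (snd v))\<^sup>2"
  have N: "N > 0" unfolding N_def by (rule norm_pair_pos[OF assms])
  have c: "spin_pt v $ 1 = 2 * Re (cnj (fst v) * snd v) / N" "spin_pt v $ 2 = 2 * Im (cnj (fst v) * snd v) / N"
    "spin_pt v $ 3 = ((norm (fst v))\<^sup>2 - (norm (snd v))\<^sup>2) / N"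
    unfolding spin_pt_def Let_def N_def by (simp_all add: vector_def)
  have x: "xy (spin_pt v) * of_real N = 2 * (cnj (fst v) * snd v)"
    using N by (simp add: xy_def c complex_eq_iff field_simps)
  have x': "cnj (xy (spin_pt v)) * of_real N = 2 * (fst v * cnj (snd v))"
    using arg_cong[OF x, of cnj] by simp
  have z: "of_real (spin_pt v $ 3) * complex_of_real N = cnj (fst v) * fst v - cnj (snd v) * snd v"
  proof -
    have "of_real (spin_pt v $ 3) * complex_of_real N = of_real ((norm (fst v))\<^sup>2 - (norm (snd v))\<^sup>2)"
      unfolding of_real_mult[symmetric] c(3) using N by simp
    then show ?thesis unfolding of_real_diff complex_norm_square by (simp add: mult.commute)
  qed
  have N': "complex_of_real N = cnj (fst v) * fst v + cnj (snd v) * snd v" unfolding N_def norm_pair_sq ..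
  have "((1 - of_real (spin_pt v $ 3)) * fst v) * of_real N = (cnj (xy (spin_pt v)) * snd v) * of_real N"
    using x' z N' by algebra
  moreover have "((1 + of_real (spin_pt v $ 3)) * snd v) * of_real N = (xy (spin_pt v) * fst v) * of_real N"
    using x z N' by algebra
  ultimately show "spin (spin_pt v) v" unfolding spin_def using N by simp
  have "(xy (spin_pt v) * cnj (xy (spin_pt v)) + (of_real (spin_pt v $ 3))\<^sup>2) * (of_real N)\<^sup>2 = 1 * (complex_of_real N)\<^sup>2"
    using x x' z N' by algebra
  then have "xy (spin_pt v) * cnj (xy (spin_pt v)) + (of_real (spin_pt v $ 3))\<^sup>2 = 1" using N by simp
  moreover have "xy (spin_pt v) * cnj (xy (spin_pt v)) = of_real ((spin_pt v $ 1)\<^sup>2 + (spin_pt v $ 2)\<^sup>2)"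
    by (simp add: xy_def complex_eq_iff power2_eq_square)
  ultimately have "complex_of_real ((spin_pt v $ 1)\<^sup>2 + (spin_pt v $ 2)\<^sup>2 + (spin_pt v $ 3)\<^sup>2) = of_real 1" by simp
  then show "spin_pt v \<in> sphere 0 1" unfolding sphere3_iff of_real_eq_iff .
qed

lemma spin_exists:
  assumes "p \<in> sphere 0 1"
  obtains v where "v \<noteq> 0" "spin p v"
proof -
  have "spin_proj p (1, 0) \<noteq> 0 \<or> spin_proj p (0, 1) \<noteq> 0"
  proof (rule ccontr)
    assume "\<not> ?thesis"
    then have "1 + complex_of_real (p $ 3) = 0" "1 - complex_of_real (p $ 3) = 0"
      by (auto simp: spin_proj_def zero_prod_def)
    then show False by (simp add: complex_eq_iff)
  qed
  then show ?thesis using that spin_spin_proj[OF assms] by blast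
qed

text \<open>Continuous families of points lift to spinors by projecting successively along a fine radial
  subdivision.\<close>

lemma spin_lift:
  fixes K :: "'k::real_normed_vector set" and A :: "'k \<Rightarrow> real^3"
  assumes K: "convex K" "compact K" "k0 \<in> K" and A: "continuous_on K A" "A ` K \<subseteq> sphere 0 1"
    and v0: "v0 \<noteq> 0" "spin (A k0) v0"
  obtains l where "continuous_on K l" "\<And>k. k \<in> K \<Longrightarrow> l k \<noteq> 0 \<and> spin (A k) (l k)"
proof -
  \<comment> \<open>At distance below 2, the diameter of the sphere, consecutive points are never
    antipodal, so the projection does not kill the previous spinor.\<close>
  obtain \<delta> where \<delta>: "\<delta> > 0" "\<And>k k'. k \<in> K \<Longrightarrow> k' \<in> K \<Longrightarrow> dist k' k < \<delta> \<Longrightarrow> dist (A k') (A k) < 2"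
    using compact_uniformly_continuous[OF A(1) K(2)] unfolding uniformly_continuous_on_def by (metis zero_less_numeral)
  obtain B where B: "\<And>k. k \<in> K \<Longrightarrow> norm k \<le> B" using compact_imp_bounded[OF K(2)] unfolding bounded_iff by blast
  obtain N :: nat where N: "2 * B / \<delta> < real N" using reals_Archimedean2 by blast
  have N0: "N > 0"
  proof -
    have "0 \<le> B" using B[OF K(3)] norm_ge_zero[of k0] by linarith
    then have "0 \<le> 2 * B / \<delta>" using \<delta>(1) by simp
    then show ?thesis using N by (cases "N = 0") auto
  qed
  define r where "r j k = k0 + (real j / real N) *\<^sub>R (k - k0)" for j k
  have rK: "r j k \<in> K" if "j \<le> N" "k \<in> K" for j k
  proof -
    have "0 \<le> real j / real N" "real j / real N \<le> 1" using that N0 by auto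
    then have "(1 - real j / real N) *\<^sub>R k0 + (real j / real N) *\<^sub>R k \<in> K" using K that by (intro convexD_alt) auto
    then show ?thesis by (simp add: r_def algebra_simps)
  qed
  have near: "dist (A (r (Suc j) k)) (A (r j k)) < 2" if "Suc j \<le> N" "k \<in> K" for j k
  proof (rule \<delta>(2))
    have "r (Suc j) k - r j k = (1 / real N) *\<^sub>R (k - k0)"
      by (simp add: r_def add_divide_distrib algebra_simps)
    then have "dist (r (Suc j) k) (r j k) = norm (k - k0) / real N" by (simp add: dist_norm)
    also have "\<dots> \<le> 2 * B / real N" using norm_triangle_ineq4[of k k0] B[OF that(2)] B[OF K(3)] by (intro divide_right_mono) auto
    also have "\<dots> < \<delta>" using N N0 \<delta>(1) by (simp add: field_simps)
    finally show "dist (r (Suc j) k) (r j k) < \<delta>" .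
  qed (use rK that in auto)
  define l where "l j = rec_nat (\<lambda>k. v0) (\<lambda>j f k. spin_proj (A (r (Suc j) k)) (f k)) j" for j
  have lS: "l (Suc j) = (\<lambda>k. spin_proj (A (r (Suc j) k)) (l j k))" and l0: "l 0 = (\<lambda>_. v0)" for j by (simp_all add: l_def)
  have "continuous_on K (l j) \<and> (\<forall>k\<in>K. l j k \<noteq> 0 \<and> spin (A (r j k)) (l j k))" if "j \<le> N" for j
    using that
  proof (induction j)
    case 0
    then show ?case using v0 by (simp add: l0 r_def)
  next
    case (Suc j)
    have IH: "continuous_on K (l j)" "\<And>k. k \<in> K \<Longrightarrow> l j k \<noteq> 0 \<and> spin (A (r j k)) (l j k)" using Suc by auto
    have "continuous_on K (r (Suc j))" unfolding r_def by (intro continuous_intros)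
    then have "continuous_on K (\<lambda>k. A (r (Suc j) k))"
      using rK[OF Suc.prems] by (intro continuous_on_compose2[OF A(1)]) auto
    then have cA: "continuous_on K (\<lambda>k. A (r (Suc j) k) $ i)" for i by (rule continuous_on_component)
    have "continuous_on K (\<lambda>k. xy (A (r (Suc j) k)))"
      unfolding xy_def Complex_eq by (intro continuous_intros cA)
    then have "continuous_on K (l (Suc j))"
      unfolding lS spin_proj_def by (intro continuous_intros cA IH(1)) auto
    moreover have "l (Suc j) k \<noteq> 0 \<and> spin (A (r (Suc j) k)) (l (Suc j) k)" if k: "k \<in> K" for k
    proof
      have S: "A (r (Suc j) k) \<in> sphere 0 1" using A(2) rK[OF Suc.prems k] by blast
      show "spin (A (r (Suc j) k)) (l (Suc j) k)" unfolding lS by (rule spin_spin_proj[OF S])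
      show "l (Suc j) k \<noteq> 0"
      proof
        assume "l (Suc j) k = 0"
        then have "spin (- A (r (Suc j) k)) (l j k)" unfolding lS by (rule spin_proj_zero)
        then have "A (r j k) = - A (r (Suc j) k)" using spin_inj IH(2)[OF k] by blast
        then have "dist (A (r (Suc j) k)) (A (r j k)) = norm (2 *\<^sub>R A (r (Suc j) k))" by (simp add: dist_norm scaleR_2)
        then show False using near[OF Suc.prems k] S by simp
      qed
    qed
    ultimately show ?case by blast
  qed
  from this[of N] show ?thesis using that[of "l N"] N0 by (simp add: r_def)
qed

section \<open>A character of the sphere braid groups\<close>

text \<open>Up to sign the discriminant of the binary form \<open>pw n l\<close>. It has degree
  \<open>2 * (n - 1)\<close> in each spinor, while \<open>pw\<close> has degree 1; the character
  comes from comparing the two.\<close>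

definition disc :: "nat \<Rightarrow> (nat \<Rightarrow> complex \<times> complex) \<Rightarrow> complex" where
  "disc n l = (\<Prod>i<n. \<Prod>j\<in>{..<n}-{i}. dt (l i) (l j))"

definition pw :: "nat \<Rightarrow> (nat \<Rightarrow> complex \<times> complex) \<Rightarrow> complex \<times> complex \<Rightarrow> complex" where
  "pw n l v = (\<Prod>i<n. dt (l i) v)"

lemma dt_sm [simp]: "dt (sm c v) w = c * dt v w" "dt v (sm c w) = c * dt v w"
  by (simp_all add: dt_def sm_def algebra_simps)

lemma pw_permute: "\<pi> permutes {..<n} \<Longrightarrow> pw n (l \<circ> \<pi>) v = pw n l v"
  unfolding pw_def using prod.permute[of \<pi> "{..<n}" "\<lambda>i. dt (l i) v"] by (simp add: o_def)

lemma pw_scale: "(\<And>i. i < n \<Longrightarrow> l' i = sm (c i) (l i)) \<Longrightarrow> pw n l' v = (\<Prod>i<n. c i) * pw n l v"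
  unfolding pw_def prod.distrib[symmetric] by (intro prod.cong) auto

lemma disc_permute:
  assumes "\<pi> permutes {..<n}"
  shows "disc n (l \<circ> \<pi>) = disc n l"
proof -
  have "(\<Prod>j\<in>{..<n}-{i}. dt (l (\<pi> i)) (l (\<pi> j))) = (\<Prod>j\<in>{..<n}-{\<pi> i}. dt (l (\<pi> i)) (l j))" for i
  proof (rule prod.reindex_bij_betw)
    have "bij_betw \<pi> ({..<n} - {i}) (\<pi> ` ({..<n} - {i}))"
      using permutes_inj_on[OF assms] by (intro inj_on_imp_bij_betw) auto
    moreover have "\<pi> ` ({..<n} - {i}) = {..<n} - {\<pi> i}"
      using permutes_image[OF assms] permutes_inj[OF assms] by (simp add: image_set_diff)
    ultimately show "bij_betw \<pi> ({..<n} - {i}) ({..<n} - {\<pi> i})" by simp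
  qed
  then show ?thesis
    unfolding disc_def using prod.permute[OF assms, of "\<lambda>k. \<Prod>j\<in>{..<n}-{k}. dt (l k) (l j)"] by (simp add: o_def)
qed

text \<open>Each index occurs in \<open>n - 1\<close> factors as the first and in
  \<open>n - 1\<close> factors as the second argument of \<open>dt\<close>.\<close>

lemma disc_scale:
  assumes "\<And>i. i < n \<Longrightarrow> l' i = sm (c i) (l i)" "\<And>i. i < n \<Longrightarrow> c i \<noteq> 0"
  shows "disc n l' = (\<Prod>i<n. c i) ^ (2 * (n - 1)) * disc n l"
proof (cases n)
  case (Suc k)
  let ?C = "\<Prod>i<n. c i"
  have C: "?C \<noteq> 0" using assms(2) by simp
  have "disc n l' = (\<Prod>i<n. (c i ^ k * (?C / c i)) * (\<Prod>j\<in>{..<n}-{i}. dt (l i) (l j)))"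
    unfolding disc_def
  proof (intro prod.cong refl)
    fix i assume i: "i \<in> {..<n}"
    have "(\<Prod>j\<in>{..<n}-{i}. dt (l' i) (l' j)) = (\<Prod>j\<in>{..<n}-{i}. c i * (c j * dt (l i) (l j)))"
      using i assms(1) by (intro prod.cong) auto
    also have "\<dots> = c i ^ k * ((\<Prod>j\<in>{..<n}-{i}. c j) * (\<Prod>j\<in>{..<n}-{i}. dt (l i) (l j)))"
      using i Suc by (simp add: prod.distrib)
    also have "(\<Prod>j\<in>{..<n}-{i}. c j) = ?C / c i"
      using i assms(2) prod.remove[of "{..<n}" i c] by simp
    finally show "(\<Prod>j\<in>{..<n}-{i}. dt (l' i) (l' j)) = c i ^ k * (?C / c i) * (\<Prod>j\<in>{..<n}-{i}. dt (l i) (l j))"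
      by simp
  qed
  also have "\<dots> = (\<Prod>i<n. c i) ^ k * (?C ^ n / ?C) * disc n l"
    by (simp add: prod.distrib prod_dividef prod_power_distrib disc_def)
  also have "?C ^ n / ?C = ?C ^ k" using C Suc by simp
  finally show ?thesis using Suc by (simp add: mult_2 power_add)
qed (simp add: disc_def)

lemma continuous_on_disc:
  assumes "\<And>i. i < n \<Longrightarrow> continuous_on A (\<lambda>t. l t i)"
  shows "continuous_on A (\<lambda>t. disc n (l t))"
  unfolding disc_def dt_def by (intro continuous_intros assms) auto

lemma continuous_on_coef:
  assumes "continuous_on A v" "continuous_on A w" "\<And>t. t \<in> A \<Longrightarrow> v t \<noteq> 0"
  shows "continuous_on A (\<lambda>t. coef (v t) (w t))"
  unfolding coef_def using norm_pair_nz[OF assms(3)] by (intro continuous_intros assms) auto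

text \<open>Stereographic projection from a removed point turns the set into a plane without
  finitely many points.\<close>

lemma path_connected_sphere_diff_finite:
  assumes T: "finite T"
  shows "path_connected (sphere (0::real^3) 1 - T)"
proof (cases "T \<inter> sphere 0 1 = {}")
  case True
  then have "sphere (0::real^3) 1 - T = sphere 0 1" by blast
  then show ?thesis by (simp add: path_connected_sphere)
next
  case False
  then obtain b where b: "b \<in> T" "b \<in> sphere 0 1" by blast
  let ?H = "{x::real^3. axis 1 1 \<bullet> x = 0}"
  have ax: "axis 1 1 \<noteq> (0 :: real^3)" by (simp add: axis_eq_0_iff)
  have "(sphere 0 1 - {b}) homeomorphic ?H"
    using homeomorphic_punctured_sphere_hyperplane[OF _ b(2) ax] by simp
  then obtain f k where fk: "homeomorphism (sphere 0 1 - {b}) ?H f k" unfolding homeomorphic_def by blast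
  have "aff_dim ?H = 2" using aff_dim_hyperplane[OF ax, of 0] by simp
  then have "\<not> collinear ?H" by (simp add: collinear_aff_dim)
  then have "path_connected (?H - f ` (T \<inter> (sphere 0 1 - {b})))"
    using T by (intro path_connected_convex_diff_countable convex_hyperplane) (auto simp: countable_finite)
  moreover have "continuous_on (?H - f ` (T \<inter> (sphere 0 1 - {b}))) k"
    by (rule continuous_on_subset[OF homeomorphism_cont2[OF fk]]) blast
  moreover have "k ` (?H - f ` (T \<inter> (sphere 0 1 - {b}))) = sphere 0 1 - T"
  proof (intro equalityI subsetI)
    fix x assume "x \<in> k ` (?H - f ` (T \<inter> (sphere 0 1 - {b})))"
    then obtain y where y: "y \<in> ?H" "y \<notin> f ` (T \<inter> (sphere 0 1 - {b}))" "x = k y" by blast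
    have "x \<in> sphere 0 1 - {b}" "f x = y" using fk y(1,3) unfolding homeomorphism_def by blast+
    then show "x \<in> sphere 0 1 - T" using y(2) by blast
  next
    fix x assume x: "x \<in> sphere 0 1 - T"
    then have xb: "x \<in> sphere 0 1 - {b}" using b by blast
    then have fx: "f x \<in> ?H" "k (f x) = x" using fk unfolding homeomorphism_def by blast+
    have "f x \<notin> f ` (T \<inter> (sphere 0 1 - {b}))"
    proof
      assume "f x \<in> f ` (T \<inter> (sphere 0 1 - {b}))"
      then obtain z where z: "f x = f z" "z \<in> T" "z \<in> sphere 0 1 - {b}" by blast
      then have "k (f z) = z" using fk unfolding homeomorphism_def by blast
      then have "x = z" using z(1) fx(2) by metis
      then show False using z(2) x by blast
    qed
    then show "x \<in> k ` (?H - f ` (T \<inter> (sphere 0 1 - {b})))" using fx by (metis DiffI imageI)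
  qed
  ultimately show ?thesis using path_connected_continuous_image by metis
qed

section \<open>The normalised root of the discriminant along a braid\<close>

locale sphere_homeo =
  fixes X :: "'a topology" and a :: "'a \<Rightarrow> real^3"
  assumes homeo: "homeomorphic_map X (top_of_set (sphere 0 1)) a"
begin

lemma a_cont: "continuous_map X euclidean a"
  and a_in: "x \<in> topspace X \<Longrightarrow> a x \<in> sphere 0 1"
  and a_inj: "inj_on a (topspace X)"
  using homeomorphic_imp_continuous_map[OF homeo] homeomorphic_imp_injective_map[OF homeo]
  by (auto simp: continuous_map_in_subtopology)

lemma Hausdorff_X: "Hausdorff_space X"
  using homeomorphic_Hausdorff_space[OF homeomorphic_map_imp_homeomorphic_space[OF homeo]]
  by (simp add: Hausdorff_space_subtopology)

definition spinors :: "nat \<Rightarrow> (nat \<Rightarrow> 'a) \<Rightarrow> (nat \<Rightarrow> complex \<times> complex) \<Rightarrow> bool" where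
  "spinors n x l \<longleftrightarrow> (\<forall>i<n. l i \<noteq> 0 \<and> spin (a (x i)) (l i))"

lemma spinors_dt:
  assumes "x \<in> topspace (config_space n X)" "spinors n x l" "i < n" "j < n" "i \<noteq> j"
  shows "dt (l i) (l j) \<noteq> 0"
proof (rule dt_nonzero)
  show "a (x i) \<noteq> a (x j)"
    using assms a_inj unfolding topspace_config_space inj_on_def by blast
qed (use assms in \<open>auto simp: spinors_def\<close>)

lemma disc_nonzero: "x \<in> topspace (config_space n X) \<Longrightarrow> spinors n x l \<Longrightarrow> disc n l \<noteq> 0"
  unfolding disc_def using spinors_dt by auto

lemma spinors_compare:
  assumes "\<pi> permutes {..<n}" "spinors n x l" "spinors n (x \<circ> \<pi>) l'" "i < n"
  shows "l' i = sm (coef (l (\<pi> i)) (l' i)) (l (\<pi> i))" "coef (l (\<pi> i)) (l' i) \<noteq> 0"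
proof -
  have "\<pi> i < n" using permutes_in_image[OF assms(1), of i] assms(4) by simp
  then have "dt (l (\<pi> i)) (l' i) = 0" "l (\<pi> i) \<noteq> 0" "l' i \<noteq> 0"
    using assms spin_parallel[of "a (x (\<pi> i))"] unfolding spinors_def by auto
  then show "l' i = sm (coef (l (\<pi> i)) (l' i)) (l (\<pi> i))" "coef (l (\<pi> i)) (l' i) \<noteq> 0"
    using coef coef_nonzero by blast+
qed

text \<open>A vector on none of the lines of the configuration \<open>y\<close>. It depends on the
  orbit alone and varies without continuity: it is used only at the ends of a path, and these agree
  for a loop.\<close>

definition ref :: "nat \<Rightarrow> (nat \<Rightarrow> 'a) set \<Rightarrow> complex \<times> complex" where
  "ref n y = (SOME v. \<forall>x l. perm_orbit n x = y \<longrightarrow> spinors n x l \<longrightarrow> pw n l v \<noteq> 0)"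

lemma ref:
  assumes "x \<in> topspace (config_space n X)" "spinors n x l"
  shows "pw n l (ref n (perm_orbit n x)) \<noteq> 0"
proof -
  obtain s where s: "s \<notin> (\<lambda>i. snd (l i) / fst (l i)) ` {..<n}"
    using ex_new_if_finite[OF infinite_UNIV_char_0, of "(\<lambda>i. snd (l i) / fst (l i)) ` {..<n}"] by blast
  have v: "dt (l i) (1, s) \<noteq> 0" if "i < n" for i
  proof
    assume d: "dt (l i) (1, s) = 0"
    have "l i \<noteq> 0" using assms(2) that by (simp add: spinors_def)
    then have "fst (l i) \<noteq> 0" using d by (auto simp: dt_def prod_eq_iff)
    then have "s = snd (l i) / fst (l i)" using d by (simp add: dt_def field_simps)
    then show False using s that by blast
  qed
  have "\<forall>x' l'. perm_orbit n x' = perm_orbit n x \<longrightarrow> spinors n x' l' \<longrightarrow> pw n l' (1, s) \<noteq> 0"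
  proof (intro allI impI)
    fix x' l' assume x': "perm_orbit n x' = perm_orbit n x" and l': "spinors n x' l'"
    obtain \<pi> where \<pi>: "\<pi> permutes {..<n}" "x' = x \<circ> \<pi>" using x'[symmetric] unfolding perm_orbit_eq_iff by blast
    have "dt (l' i) (1, s) \<noteq> 0" if "i < n" for i
    proof -
      have "\<pi> i < n" using permutes_in_image[OF \<pi>(1), of i] that by simp
      then have "dt (sm (coef (l (\<pi> i)) (l' i)) (l (\<pi> i))) (1, s) \<noteq> 0"
        using spinors_compare(2)[OF \<pi>(1) assms(2) l'[unfolded \<pi>(2)] that] v by simp
      then show ?thesis using spinors_compare(1)[OF \<pi>(1) assms(2) l'[unfolded \<pi>(2)] that] by metis
    qed
    then show "pw n l' (1, s) \<noteq> 0" by (simp add: pw_def)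
  qed
  then have "\<exists>v. \<forall>x' l'. perm_orbit n x' = perm_orbit n x \<longrightarrow> spinors n x' l' \<longrightarrow> pw n l' v \<noteq> 0" by blast
  from someI_ex[OF this] show ?thesis unfolding ref_def using assms(2) by blast
qed

definition spinor_lift :: "nat \<Rightarrow> 'k::topological_space set \<Rightarrow> ('k \<Rightarrow> (nat \<Rightarrow> 'a) set) \<Rightarrow> ('k \<Rightarrow> nat \<Rightarrow> 'a) \<Rightarrow> ('k \<Rightarrow> nat \<Rightarrow> complex \<times> complex) \<Rightarrow> bool" where
  "spinor_lift n K y x l \<longleftrightarrow> continuous_map (top_of_set K) (config_space n X) x \<and> (\<forall>k\<in>K. perm_orbit n (x k) = y k) \<and>
     (\<forall>i<n. continuous_on K (\<lambda>k. l k i)) \<and> (\<forall>k\<in>K. spinors n (x k) (l k))"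

lemma spinor_lift_in: "spinor_lift n K y x l \<Longrightarrow> k \<in> K \<Longrightarrow> x k \<in> topspace (config_space n X)"
  unfolding spinor_lift_def by (auto simp: continuous_map_def)

lemma spinor_lift_exists:
  fixes K :: "'k::real_normed_vector set"
  assumes K: "convex K" "compact K" "K \<noteq> {}" and y: "continuous_map (top_of_set K) (unordered_config_space n X) y"
  obtains x l where "spinor_lift n K y x l"
proof -
  obtain k0 where k0: "k0 \<in> K" using K(3) by blast
  then have "y k0 \<in> topspace (unordered_config_space n X)" using y by (auto simp: continuous_map_def)
  then obtain x0 where x0: "x0 \<in> topspace (config_space n X)" "perm_orbit n x0 = y k0"
    unfolding topspace_unordered_config_space by force
  obtain x where x: "continuous_map (top_of_set K) (config_space n X) x" "\<And>k. k \<in> K \<Longrightarrow> perm_orbit n (x k) = y k"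
    by (rule lift_exists[OF section_covering_config[OF Hausdorff_X] K(1,2) k0, of n y x0])
      (use y x0 in auto)
  have xK: "x k \<in> topspace (config_space n X)" if "k \<in> K" for k using x(1) that by (auto simp: continuous_map_def)
  have "\<exists>l. i < n \<longrightarrow> continuous_on K l \<and> (\<forall>k\<in>K. l k \<noteq> 0 \<and> spin (a (x k i)) (l k))" for i
  proof (cases "i < n")
    case True
    have "continuous_map (top_of_set K) X (\<lambda>k. x k i)" using x(1) True unfolding continuous_map_config by blast
    from continuous_map_compose[OF this a_cont] have c: "continuous_on K (\<lambda>k. a (x k i))" by (simp add: o_def)
    have im: "(\<lambda>k. a (x k i)) ` K \<subseteq> sphere 0 1"
      using xK True a_in unfolding topspace_config_space by blast
    obtain v0 where v0: "v0 \<noteq> 0" "spin (a (x k0 i)) v0" using spin_exists[of "a (x k0 i)"] im k0 by blast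
    show ?thesis using spin_lift[OF K(1,2) k0 c im v0] by metis
  qed simp
  then obtain l where l: "\<And>i. i < n \<Longrightarrow> continuous_on K (l i)" "\<And>i k. i < n \<Longrightarrow> k \<in> K \<Longrightarrow> l i k \<noteq> 0 \<and> spin (a (x k i)) (l i k)"
    by metis
  have "spinor_lift n K y x (\<lambda>k i. l i k)" unfolding spinor_lift_def spinors_def using x l by auto
  then show ?thesis using that by blast
qed

text \<open>The change of the root of \<open>disc\<close> of order \<open>2 * (n - 1)\<close>,
  divided by the change of \<open>pw\<close>. Rescaling the spinors affects both alike, and on a
  loop the result is a root of unity whose order divides \<open>2 * (n - 1)\<close>.\<close>

definition weight :: "nat \<Rightarrow> (real \<Rightarrow> (nat \<Rightarrow> 'a) set) \<Rightarrow> (real \<Rightarrow> nat \<Rightarrow> complex \<times> complex) \<Rightarrow> complex" where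
  "weight n y l = root_char (2 * (n - 1)) (disc n) l * pw n (l 0) (ref n (y 0)) / pw n (l 1) (ref n (y 1))"

lemma disc_log:
  fixes K :: "'k::real_normed_vector set"
  assumes "spinor_lift n K y x l" "convex K"
  obtains L where "continuous_on K L" "\<And>k. k \<in> K \<Longrightarrow> exp (L k) = disc n (l k)"
proof -
  have "continuous_on K (\<lambda>k. disc n (l k))" using assms(1) by (intro continuous_on_disc) (auto simp: spinor_lift_def)
  moreover have "disc n (l k) \<noteq> 0" if "k \<in> K" for k
    using assms(1) that by (intro disc_nonzero[OF spinor_lift_in]) (auto simp: spinor_lift_def)
  ultimately show ?thesis using continuous_logarithm_on_contractible[OF _ convex_imp_contractible[OF assms(2)]] that by metis
qed

lemma ref_lift: "spinor_lift n K y x l \<Longrightarrow> k \<in> K \<Longrightarrow> pw n (l k) (ref n (y k)) \<noteq> 0"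
proof -
  assume l: "spinor_lift n K y x l" and k: "k \<in> K"
  then have "perm_orbit n (x k) = y k" "spinors n (x k) (l k)" unfolding spinor_lift_def by blast+
  then show ?thesis using ref[OF spinor_lift_in[OF l k]] by metis
qed

text \<open>Another lift differs by a fixed permutation and continuous scalars with product
  \<open>C\<close>. As \<open>C\<close> enters \<open>disc\<close> with exponent
  \<open>2 * (n - 1)\<close>, the root of \<open>disc\<close> gains \<open>C 1 / C 0\<close>, and so
  does \<open>pw\<close>.\<close>

lemma weight_unique:
  assumes n: "n \<ge> 2" and l: "spinor_lift n {0..1} y x l" and l': "spinor_lift n {0..1} y x' l'"
  shows "weight n y l' = weight n y l"
proof -
  have "perm_orbit n (x 0) = perm_orbit n (x' 0)" using l l' unfolding spinor_lift_def by simp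
  then obtain \<pi> where \<pi>: "\<pi> permutes {..<n}" "x' 0 = x 0 \<circ> \<pi>" unfolding perm_orbit_eq_iff by blast
  have x: "x' t = x t \<circ> \<pi>" if "t \<in> {0..1}" for t
  proof (rule lift_unique[OF section_covering_config[OF Hausdorff_X], of "{0..1::real}" 0])
    show "continuous_map (top_of_set {0..1}) (config_space n X) x'" using l' by (simp add: spinor_lift_def)
    have "continuous_map (top_of_set {0..1}) (config_space n X) ((\<lambda>x. x \<circ> \<pi>) \<circ> x)"
      using l continuous_map_permute[OF \<pi>(1)] continuous_map_compose unfolding spinor_lift_def by blast
    then show "continuous_map (top_of_set {0..1}) (config_space n X) (\<lambda>t. x t \<circ> \<pi>)" by (simp add: o_def)
    show "perm_orbit n (x' s) = perm_orbit n (x s \<circ> \<pi>)" if "s \<in> {0..1}" for s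
      using l l' that perm_orbit_permute[OF \<pi>(1)] unfolding spinor_lift_def by metis
  qed (use \<pi>(2) that in auto)
  define c where "c t i = coef (l t (\<pi> i)) (l' t i)" for t i
  have s: "spinors n (x t) (l t)" "spinors n (x t \<circ> \<pi>) (l' t)" if "t \<in> {0..1}" for t
    using l l' x that unfolding spinor_lift_def by force+
  have c: "l' t i = sm (c t i) ((l t \<circ> \<pi>) i)" "c t i \<noteq> 0" if "t \<in> {0..1}" "i < n" for t i
    using spinors_compare[OF \<pi>(1) s[OF that(1)] that(2)] by (simp_all add: c_def)
  have \<pi>n: "\<pi> i < n" if "i < n" for i using permutes_in_image[OF \<pi>(1), of i] that by simp
  define C where "C t = (\<Prod>i<n. c t i)" for t
  have C0: "C t \<noteq> 0" if "t \<in> {0..1}" for t using c(2)[OF that] by (simp add: C_def)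
  have "continuous_on {0..1} (\<lambda>t. c t i)" if "i < n" for i
    unfolding c_def using l l' \<pi>n[OF that] that
    by (intro continuous_on_coef) (auto simp: spinor_lift_def spinors_def)
  then have "continuous_on {0..1} C" unfolding C_def by (intro continuous_intros) auto
  then obtain \<Lambda> where \<Lambda>: "continuous_on {0..1} \<Lambda>" "\<And>t. t \<in> {0..1} \<Longrightarrow> C t = exp (\<Lambda> t)"
    using continuous_logarithm_on_contractible[OF _ convex_imp_contractible[OF convex_real_interval(5)]] C0 by metis
  obtain L where L: "continuous_on {0..1} L" "\<And>t. t \<in> {0..1} \<Longrightarrow> exp (L t) = disc n (l t)"
    using disc_log[OF l] by auto
  let ?N = "2 * (n - 1)"
  have N: "of_nat ?N \<noteq> (0::complex)" using n by auto
  have "continuous_on {0..1} (\<lambda>t. of_nat ?N * \<Lambda> t + L t)" by (intro continuous_intros \<Lambda> L)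
  moreover have "exp (of_nat ?N * \<Lambda> t + L t) = disc n (l' t)" if "t \<in> {0..1}" for t
  proof -
    have "disc n (l' t) = C t ^ ?N * disc n (l t \<circ> \<pi>)"
      unfolding C_def using c[OF that] by (intro disc_scale) auto
    moreover have "exp (of_nat ?N * \<Lambda> t) = C t ^ ?N" unfolding exp_of_nat_mult using \<Lambda>(2)[OF that] by simp
    ultimately show ?thesis by (simp only: exp_add disc_permute[OF \<pi>(1)] L(2)[OF that])
  qed
  ultimately have "root_char ?N (disc n) l' = exp ((of_nat ?N * \<Lambda> 1 + L 1 - (of_nat ?N * \<Lambda> 0 + L 0)) / of_nat ?N)"
    by (rule root_charI[where F = "disc n" and p = l'])
  also have "(of_nat ?N * \<Lambda> 1 + L 1 - (of_nat ?N * \<Lambda> 0 + L 0)) / of_nat ?N = (L 1 - L 0) / of_nat ?N + (\<Lambda> 1 - \<Lambda> 0)"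
    using N by (simp add: field_simps del: of_nat_mult)
  also have "exp \<dots> = root_char ?N (disc n) l * (C 1 / C 0)"
  proof -
    have "exp (\<Lambda> 1 - \<Lambda> 0) = C 1 / C 0" using \<Lambda>(2)[of 0] \<Lambda>(2)[of 1] by (simp add: exp_diff)
    then show ?thesis by (simp only: exp_add root_charI[where F = "disc n" and p = l, OF L])
  qed
  finally have "root_char ?N (disc n) l' = root_char ?N (disc n) l * (C 1 / C 0)" .
  moreover have "pw n (l' t) v = C t * pw n (l t) v" if "t \<in> {0..1}" for t v
    using pw_scale[of n "l' t" "c t" "l t \<circ> \<pi>" v] c(1)[OF that] pw_permute[OF \<pi>(1)] by (simp add: C_def)
  ultimately show ?thesis using C0[of 0] C0[of 1] by (simp add: weight_def)
qed

definition \<Theta> :: "nat \<Rightarrow> (real \<Rightarrow> (nat \<Rightarrow> 'a) set) \<Rightarrow> complex" where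
  "\<Theta> n y = (THE w. \<exists>x l. spinor_lift n {0..1} y x l \<and> w = weight n y l)"

lemma \<Theta>_eq: "n \<ge> 2 \<Longrightarrow> spinor_lift n {0..1} y x l \<Longrightarrow> \<Theta> n y = weight n y l"
  unfolding \<Theta>_def using weight_unique by (intro the_equality) blast+

lemma spinor_lift_compose:
  assumes "spinor_lift n K y x l" "continuous_on J f" "f ` J \<subseteq> K" "\<And>j. j \<in> J \<Longrightarrow> y' j = y (f j)"
  shows "spinor_lift n J y' (\<lambda>j. x (f j)) (\<lambda>j. l (f j))"
  unfolding spinor_lift_def
proof (intro conjI ballI allI impI)
  have "continuous_map (top_of_set J) (top_of_set K) f" using assms(2,3) by (auto simp: continuous_map_in_subtopology)
  then have "continuous_map (top_of_set J) (config_space n X) (x \<circ> f)"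
    using assms(1) continuous_map_compose unfolding spinor_lift_def by blast
  then show "continuous_map (top_of_set J) (config_space n X) (\<lambda>j. x (f j))" by (simp add: o_def)
  show "continuous_on J (\<lambda>j. l (f j) i)" if "i < n" for i
    using assms(1) that continuous_on_compose2[OF _ assms(2,3), of "\<lambda>k. l k i"] unfolding spinor_lift_def by blast
qed (use assms in \<open>auto simp: spinor_lift_def image_subset_iff\<close>)

text \<open>With one lift and one logarithm on a larger domain, such as the square of a homotopy,
  all paths inside it can be evaluated.\<close>

lemma \<Theta>_log:
  assumes n: "n \<ge> 2" and l: "spinor_lift n K y x l"
    and L: "continuous_on K L" "\<And>k. k \<in> K \<Longrightarrow> exp (L k) = disc n (l k)"
    and f: "continuous_on {0..1} f" "f ` {0..1} \<subseteq> K" and y': "\<And>t. t \<in> {0..1} \<Longrightarrow> y' t = y (f t)"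
  shows "\<Theta> n y' = exp ((L (f 1) - L (f 0)) / of_nat (2 * (n - 1))) *
    pw n (l (f 0)) (ref n (y' 0)) / pw n (l (f 1)) (ref n (y' 1))"
proof -
  have lf: "spinor_lift n {0..1} y' (\<lambda>t. x (f t)) (\<lambda>t. l (f t))" by (rule spinor_lift_compose[OF l f y'])
  have "root_char (2 * (n - 1)) (disc n) (\<lambda>t. l (f t)) = exp ((L (f 1) - L (f 0)) / of_nat (2 * (n - 1)))"
    by (rule root_charI[where F = "disc n" and p = "\<lambda>t. l (f t)" and L = "\<lambda>t. L (f t)"])
      (use f(2) L(2) in \<open>auto simp: image_subset_iff intro: continuous_on_compose2[OF L(1) f]\<close>)
  then show ?thesis by (simp only: \<Theta>_eq[OF n lf] weight_def)
qed

lemma exp_increments: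
  "exp ((v - u) / N) * exp ((w - v) / N) = exp ((w - u) / N :: complex)"
  by (simp flip: exp_add add_divide_distrib)

lemma \<Theta>_path_char:
  assumes n: "n \<ge> 2"
  shows "path_char (unordered_config_space n X) (\<Theta> n)"
  unfolding path_char_def
proof (intro conjI allI impI)
  let ?N = "of_nat (2 * (n - 1)) :: complex" and ?I = "{0..1} :: real set"
  have lift: "\<exists>x l. spinor_lift n ?I p x l" if p: "pathin (unordered_config_space n X) p" for p
    using spinor_lift_exists[OF convex_real_interval(5) compact_Icc _ p[unfolded pathin_def]] by (metis atLeastatMost_empty_iff zero_le_one)
  have half: "(0::real) / 2 = 0" "(1 + 1) / 2 = (1::real)" "(0 + 1) / 2 = (1 / 2 :: real)" by simp_all
  show "\<Theta> n p \<noteq> 0" if p: "pathin (unordered_config_space n X) p" for p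
  proof -
    obtain x l where l: "spinor_lift n ?I p x l" using lift[OF p] by blast
    obtain L where L: "continuous_on ?I L" "\<And>t. t \<in> ?I \<Longrightarrow> exp (L t) = disc n (l t)" using disc_log[OF l] by auto
    have "\<Theta> n p = exp ((L 1 - L 0) / ?N) * pw n (l 0) (ref n (p 0)) / pw n (l 1) (ref n (p 1))"
      by (rule \<Theta>_log[OF n l L, of "\<lambda>t. t"]) auto
    then show ?thesis using ref_lift[OF l, of 0] ref_lift[OF l, of 1] by simp
  qed
  show "\<Theta> n (path_concat p r) = \<Theta> n p * \<Theta> n r"
    if pr: "pathin (unordered_config_space n X) p" "pathin (unordered_config_space n X) r" "p 1 = r 0" for p r
  proof -
    obtain x l where l: "spinor_lift n ?I (path_concat p r) x l" using lift[OF pathin_concat[OF pr]] by blast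
    obtain L where L: "continuous_on ?I L" "\<And>t. t \<in> ?I \<Longrightarrow> exp (L t) = disc n (l t)" using disc_log[OF l] by auto
    have 1: "\<Theta> n p = exp ((L (1 / 2) - L (0 / 2)) / ?N) * pw n (l (0 / 2)) (ref n (p 0)) / pw n (l (1 / 2)) (ref n (p 1))"
      by (rule \<Theta>_log[OF n l L, of "\<lambda>t. t / 2"]) (auto simp: path_concat_def intro!: continuous_intros)
    have 2: "\<Theta> n r = exp ((L ((1 + 1) / 2) - L ((0 + 1) / 2)) / ?N) *
        pw n (l ((0 + 1) / 2)) (ref n (r 0)) / pw n (l ((1 + 1) / 2)) (ref n (r 1))"
      by (rule \<Theta>_log[OF n l L, of "\<lambda>t. (t + 1) / 2"])
        (use path_concat_second_half[of _ p r] pr(3) in \<open>auto intro!: continuous_intros\<close>)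
    have 3: "\<Theta> n (path_concat p r) = exp ((L 1 - L 0) / ?N) *
        pw n (l 0) (ref n (path_concat p r 0)) / pw n (l 1) (ref n (path_concat p r 1))"
      by (rule \<Theta>_log[OF n l L, of "\<lambda>t. t"]) auto
    have e: "path_concat p r 0 = p 0" "path_concat p r 1 = r 1" "path_concat p r (1 / 2) = r 0" using pr(3) by (simp_all add: path_concat_def)
    have "pw n (l (1 / 2)) (ref n (r 0)) \<noteq> 0" using ref_lift[OF l, of "1 / 2"] e by simp
    then show ?thesis
      unfolding 1 2 3 half pr(3) e exp_increments[of "L (1 / 2)" "L 0" ?N "L 1", symmetric] by simp
  qed
  show "\<Theta> n p = \<Theta> n r" if hom: "path_hom (unordered_config_space n X) p r" for p r
  proof -
    obtain h where h: "continuous_map (top_of_set unit_square) (unordered_config_space n X) h"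
      "\<And>s. h (0, s) = p s" "\<And>s. h (1, s) = r s"
      "\<And>t. t \<in> ?I \<Longrightarrow> h (t, 0) = p 0" "\<And>t. t \<in> ?I \<Longrightarrow> h (t, 1) = p 1" using path_homD[OF hom] by blast
    obtain x l where l: "spinor_lift n unit_square h x l"
      using spinor_lift_exists[OF convex_Times[OF convex_real_interval(5) convex_real_interval(5)] compact_Times[OF compact_Icc compact_Icc] _ h(1)] by auto
    obtain L where L: "continuous_on unit_square L" "\<And>k. k \<in> unit_square \<Longrightarrow> exp (L k) = disc n (l k)"
      using disc_log[OF l convex_Times[OF convex_real_interval(5) convex_real_interval(5)]] by blast
    have rp: "r 0 = p 0" "r 1 = p 1" using path_hom_imp[OF hom] by auto
    have P: "\<Theta> n p = exp ((L (0, 1) - L (0, 0)) / ?N) * pw n (l (0, 0)) (ref n (p 0)) / pw n (l (0, 1)) (ref n (p 1))"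
      by (rule \<Theta>_log[OF n l L, of "\<lambda>s. (0, s)"]) (auto simp: h intro!: continuous_intros)
    have R: "\<Theta> n r = exp ((L (1, 1) - L (1, 0)) / ?N) * pw n (l (1, 0)) (ref n (r 0)) / pw n (l (1, 1)) (ref n (r 1))"
      by (rule \<Theta>_log[OF n l L, of "\<lambda>s. (1, s)"]) (auto simp: h intro!: continuous_intros)
    have nz: "pw n (l (t, s)) (ref n (p s)) \<noteq> 0" if ts: "t = 0 \<or> t = 1" "s = 0 \<or> s = 1" for t s
      using ref_lift[OF l, of "(t, s)"] ts h(2,3) rp by auto
    \<comment> \<open>The sides of the square lie over constant paths, whose value is 1; this
      expresses the increments of \<open>L\<close> through \<open>pw\<close> at the corners.\<close>
    have side: "exp ((L (1, s) - L (0, s)) / ?N) = pw n (l (1, s)) (ref n (p s)) / pw n (l (0, s)) (ref n (p s))"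
      if s: "s = 0 \<or> s = 1" for s
    proof -
      have S: "\<Theta> n (\<lambda>_. p s) = exp ((L (1, s) - L (0, s)) / ?N) * pw n (l (0, s)) (ref n (p s)) / pw n (l (1, s)) (ref n (p s))"
        by (rule \<Theta>_log[OF n l L, of "\<lambda>t. (t, s)" "\<lambda>_. p s"]) (use s h(4,5) in \<open>auto intro!: continuous_intros\<close>)
      have "\<Theta> n (\<lambda>_. p s) = exp ((L (0, s) - L (0, s)) / ?N) * pw n (l (0, s)) (ref n (p s)) / pw n (l (0, s)) (ref n (p s))"
        by (rule \<Theta>_log[OF n l L, of "\<lambda>_. (0, s)" "\<lambda>_. p s"]) (use s h(2) in auto)
      then have "\<Theta> n (\<lambda>_. p s) = 1" using nz[of 0 s] s by simp
      moreover have "E * u / v = 1 \<Longrightarrow> u \<noteq> 0 \<Longrightarrow> v \<noteq> 0 \<Longrightarrow> E = v / u" for E u v :: complex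
        by (simp add: field_simps)
      ultimately show ?thesis using nz[of 0 s] nz[of 1 s] s unfolding S by blast
    qed
    have alg: "A * p00 / p01 = B * p10 / p11"
      if "S0 * B = A * S1" "S0 = p10 / p00" "S1 = p11 / p01" "p00 \<noteq> 0" "p01 \<noteq> 0" "p10 \<noteq> 0" "p11 \<noteq> 0"
      for A B S0 S1 p00 p01 p10 p11 :: complex
      using that by (simp add: field_simps)
    show ?thesis unfolding P R rp
      by (rule alg[OF _ side[of 0] side[of 1]]) (use nz in \<open>simp_all add: exp_increments\<close>)
  qed
qed

text \<open>Rotate \<open>n - 1\<close> points through \<open>1/(n - 1)\<close> of a full turn about an axis through the remaining one.\<close>

lemma rotation_loop:
  assumes n: "n \<ge> 3"
  obtains y where "pathin (unordered_config_space n X) y" "y 1 = y 0" "(\<Theta> n y)\<^sup>2 \<noteq> 1"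
proof -
  define N where "N = n - 1"
  have N: "N \<ge> 2" "n = Suc N" using n by (auto simp: N_def)
  define \<omega> where "\<omega> k = cis (2 * pi * real k / real N)" for k
  \<comment> \<open>The slopes are the \<open>N\<close>-th roots of unity, giving \<open>N\<close>
    points on the equator, and the last spinor is a pole on the axis.\<close>
  define w :: "nat \<Rightarrow> complex \<times> complex" where "w i = (if i < N then (\<omega> i, 1) else (0, 1))" for i
  \<comment> \<open>The determinant is 1, so \<open>disc\<close> is constant along the path. Slopes
    turn by twice the angle \<open>pi * t / real N\<close>, hence end at the next root of
    unity.\<close>
  define rot where "rot t v = (cis (pi * t / real N) * fst v, cis (- (pi * t / real N)) * snd v)" for t :: real and v :: "complex \<times> complex"
  define l where "l t i = rot t (w i)" for t i
  have dt_rot: "dt (rot t v) (rot t v') = dt v v'" for t v v'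
    by (simp add: dt_def rot_def algebra_simps cis_mult)
  have \<omega>_inj: "i = j" if "i < N" "j < N" "\<omega> i = \<omega> j" for i j
  proof -
    have "\<bar>2 * pi * ((real i - real j) / real N)\<bar> < 2 * pi" using that by (intro abs_2pi) (auto simp: abs_less_iff field_simps)
    moreover have "2 * pi * real i / real N - 2 * pi * real j / real N = 2 * pi * ((real i - real j) / real N)"
      by (simp add: diff_divide_distrib algebra_simps)
    ultimately have "2 * pi * real i / real N = 2 * pi * real j / real N"
      using that(3) unfolding \<omega>_def by (intro cis_eq_small) auto
    then show ?thesis using N by simp
  qed
  have w: "dt (w i) (w j) \<noteq> 0" if "i < n" "j < n" "i \<noteq> j" for i j
    using that \<omega>_inj[of i j] N(2) by (auto simp: w_def dt_def \<omega>_def)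
  have l0: "l t i \<noteq> 0" for t i by (auto simp: l_def rot_def w_def zero_prod_def)
  obtain b where b: "homeomorphic_maps X (top_of_set (sphere 0 1)) a b" using homeo homeomorphic_map_maps by blast
  have cb: "continuous_map (top_of_set (sphere 0 1)) X b" and ab: "\<And>p. p \<in> sphere 0 1 \<Longrightarrow> a (b p) = p"
    using b by (auto simp: homeomorphic_maps_def)
  define x where "x t = restrict (\<lambda>i. b (spin_pt (l t i))) {..<n}" for t
  have ax: "a (x t i) = spin_pt (l t i)" if "i < n" for t i using that ab spin_pt(2)[OF l0] by (simp add: x_def)
  have cl: "continuous_on A (\<lambda>t. l t i)" for A i
    unfolding l_def rot_def by (intro continuous_intros) (use N(1) in auto)
  have xc: "continuous_map (top_of_set {0..1}) (config_space n X) x"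
    unfolding continuous_map_config
  proof (intro conjI allI impI ballI)
    fix i assume i: "i < n"
    let ?D = "\<lambda>t. (norm (fst (l t i)))\<^sup>2 + (norm (snd (l t i)))\<^sup>2"
    have D: "?D t \<noteq> 0" for t using norm_pair_pos[OF l0, of t i] by auto
    have "continuous_on {0..1} (\<lambda>t. spin_pt (l t i) $ k)" for k
    proof -
      have "k = 1 \<or> k = 2 \<or> k = 3" using exhaust_3 by blast
      then show ?thesis
        by (elim disjE) (simp_all add: spin_pt_def Let_def vector_def, (intro continuous_intros cl; use D in simp)+)
    qed
    then have "continuous_on {0..1} (\<lambda>t. \<chi> k. spin_pt (l t i) $ k)" by (rule continuous_on_vec_lambda)
    then have "continuous_map (top_of_set {0..1}) (top_of_set (sphere 0 1)) (\<lambda>t. spin_pt (l t i))"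
      using spin_pt(2)[OF l0] by (auto simp: continuous_map_in_subtopology)
    from continuous_map_compose[OF this cb] show "continuous_map (top_of_set {0..1}) X (\<lambda>t. x t i)"
      using i by (simp add: x_def o_def)
  next
    fix t
    show "inj_on (x t) {..<n}"
    proof (rule inj_onI, rule ccontr)
      fix i j assume ij: "i \<in> {..<n}" "j \<in> {..<n}" "x t i = x t j" "i \<noteq> j"
      then have "spin_pt (l t i) = spin_pt (l t j)" using ax[of i t] ax[of j t] by simp
      then have "dt (l t i) (l t j) = 0" using spin_pt(1)[OF l0, of t i] spin_pt(1)[OF l0, of t j] spin_parallel by metis
      then show False using w[of i j] ij by (simp add: l_def dt_rot)
    qed
  qed (simp add: x_def)
  define y where "y t = perm_orbit n (x t)" for t
  have yp: "pathin (unordered_config_space n X) y"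
    using continuous_map_compose[OF xc continuous_map_perm_orbit] by (simp add: y_def[abs_def] pathin_def o_def)
  have sl: "spinor_lift n {0..1} y x l"
    unfolding spinor_lift_def spinors_def using xc cl l0 spin_pt(1)[OF l0] ax by (auto simp: y_def)
  define \<pi> where "\<pi> i = (if i < N then (if Suc i = N then 0 else Suc i) else i)" for i
  have \<pi>: "\<pi> permutes {..<n}"
  proof (rule bij_imp_permutes)
    have "inj_on \<pi> {..<n}" by (auto simp: inj_on_def \<pi>_def split: if_splits)
    moreover have "\<pi> ` {..<n} \<subseteq> {..<n}" using N by (auto simp: \<pi>_def)
    ultimately show "bij_betw \<pi> {..<n} {..<n}" by (simp add: bij_betw_def endo_inj_surj)
  qed (use N in \<open>auto simp: \<pi>_def\<close>)
  define c where "c = cis (- (pi / real N))"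
  have turn: "cis (pi / real N) * \<omega> i = c * \<omega> (\<pi> i)" if "i < N" for i
  proof -
    have "\<omega> (\<pi> i) = \<omega> (Suc i)"
    proof (cases "Suc i = N")
      case True
      then show ?thesis using N(1) by (simp add: \<pi>_def \<omega>_def flip: True)
    qed (use that in \<open>simp add: \<pi>_def\<close>)
    moreover have "pi / real N + 2 * pi * real i / real N = - (pi / real N) + 2 * pi * real (Suc i) / real N"
      by (simp add: add_divide_distrib distrib_left)
    ultimately show ?thesis by (simp only: c_def \<omega>_def cis_mult)
  qed
  have l1: "l 1 i = sm c ((l 0 \<circ> \<pi>) i)" if "i < n" for i
    using that turn[of i] N by (cases "i < N") (auto simp: l_def rot_def w_def sm_def c_def \<pi>_def)
  have y10: "y 1 = y 0"
  proof -
    have "x 1 i = x 0 (\<pi> i)" if "i < n" for i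
    proof -
      have \<pi>i: "\<pi> i < n" using permutes_in_image[OF \<pi>, of i] that by simp
      have "spin (spin_pt (l 0 (\<pi> i))) (l 1 i)"
        using l1[OF that] spin_pt(1)[OF l0, of 0 "\<pi> i"] spin_sm[of c] by (simp add: c_def)
      then have "spin_pt (l 1 i) = spin_pt (l 0 (\<pi> i))" using spin_inj spin_pt(1)[OF l0] l0 by blast
      then show ?thesis using that \<pi>i by (simp add: x_def)
    qed
    moreover have "x 1 i = x 0 (\<pi> i)" if "\<not> i < n" for i
      using that permutes_not_in[OF \<pi>, of i] by (simp add: x_def)
    ultimately have "x 1 = x 0 \<circ> \<pi>" by (metis comp_apply ext)
    then show ?thesis using perm_orbit_permute[OF \<pi>] by (simp add: y_def)
  qed
  have "disc n (l t) = disc n w" for t by (simp add: disc_def l_def dt_rot)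
  moreover have "disc n w \<noteq> 0" unfolding disc_def using w by auto
  ultimately have "root_char (2 * (n - 1)) (disc n) l = exp ((ln (disc n w) - ln (disc n w)) / of_nat (2 * (n - 1)))"
    by (intro root_charI[of "\<lambda>_. ln (disc n w)"]) auto
  then have r: "root_char (2 * (n - 1)) (disc n) l = 1" by simp
  have "pw n (l 1) v = c ^ n * pw n (l 0) v" for v
    using pw_scale[of n "l 1" "\<lambda>_. c" "l 0 \<circ> \<pi>" v] l1 pw_permute[OF \<pi>] by simp
  \<comment> \<open>Every spinor, the pole included, ends as \<open>c\<close> times that of the
    successor, while the root of \<open>disc\<close> has not moved.\<close>
  then have "\<Theta> n y = 1 / c ^ n"
    using \<Theta>_eq[OF _ sl] n r ref_lift[OF sl, of 0] y10 by (simp add: weight_def)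
  \<comment> \<open>\<open>c ^ (2 * n)\<close> is 1 only if \<open>N\<close> divides
    \<open>n = N + 1\<close>, which \<open>N \<ge> 2\<close> excludes.\<close>
  moreover have "(c ^ n)\<^sup>2 \<noteq> 1"
  proof
    assume "(c ^ n)\<^sup>2 = 1"
    then have "cis (- (2 * pi * real n / real N)) = cis 0"
      unfolding c_def power_mult[symmetric] Complex.DeMoivre by (simp add: algebra_simps)
    then obtain k :: int where "- (2 * pi * real n / real N) - 0 = 2 * pi * of_int k" unfolding cis_eq_iff by blast
    then have "2 * pi * (- real n) = 2 * pi * (of_int k * real N)" using N by (simp add: field_simps)
    moreover have "2 * pi \<noteq> 0" by simp
    ultimately have "- real n = of_int k * real N" using mult_left_cancel by blast
    then have "real_of_int (- int n) = real_of_int (k * int N)" by simp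
    then have "int N dvd int n" unfolding of_int_eq_iff by (metis dvd_minus_iff dvd_triv_right)
    then have "N dvd n" by simp
    then have "N dvd 1" unfolding N(2) by (metis Suc_eq_plus1 dvd_add_right_iff dvd_refl)
    then show False using N(1) by simp
  qed
  ultimately have "(\<Theta> n y)\<^sup>2 \<noteq> 1" by (simp add: power_one_over)
  then show ?thesis using that yp y10 by blast
qed

lemma path_connected_sphere_config: "path_connected_space (config_space n X)"
proof (rule path_connected_config_space)
  have inf: "infinite (sphere (0::real^3) 1)" 
  proof
    assume "finite (sphere (0::real^3) 1)"
    moreover have "connected (sphere (0::real^3) 1)" by (simp add: connected_sphere_eq)
    ultimately obtain p where "sphere (0::real^3) 1 \<subseteq> {p}" using connected_finite_iff_sing by (metis empty_subsetI subset_refl)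
    moreover have "axis 1 1 \<in> sphere (0::real^3) 1" "axis 2 1 \<in> sphere (0::real^3) 1" by auto
    ultimately have "axis 1 1 = (axis 2 1 :: real^3)" by blast
    then show False by (simp add: axis_eq_axis)
  qed
  have im: "a ` topspace X = sphere 0 1" using homeomorphic_imp_surjective_map[OF homeo] by simp
  then show "infinite (topspace X)" using inf by (metis finite_imageI)
  fix S :: "'a set" assume S: "finite S"
  have "homeomorphic_map (subtopology X (- S)) (subtopology (top_of_set (sphere 0 1)) (sphere 0 1 - a ` (S \<inter> topspace X))) a"
  proof (rule homeomorphic_map_subtopologies[OF homeo])
    show "a ` (topspace X \<inter> - S) = topspace (top_of_set (sphere 0 1)) \<inter> (sphere 0 1 - a ` (S \<inter> topspace X))"
      using a_inj unfolding im[symmetric] by (auto simp: inj_on_def)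
  qed
  moreover have "path_connected (sphere (0::real^3) 1 - a ` (S \<inter> topspace X))"
    using S by (intro path_connected_sphere_diff_finite) auto
  ultimately show "path_connected_space (subtopology X (- S))"
    using homeomorphic_path_connected_space homeomorphic_map_imp_homeomorphic_space
    by (metis Diff_subset Int_absorb1 path_connected_space_top_of_set subtopology_subtopology)
qed

text \<open>For \<open>g = 1\<close> the boundary relation alone gives the single edge loop a value
  of square 1. So the squares of all characters of the source are trivial on loops, against
  \<open>rotation_loop\<close>.\<close>

theorem no_epi_to_sphere:
  assumes n: "n \<ge> 3" and U: "crosscap_polygon 1 U qU"
    and c: "c \<in> topspace (unordered_config_space n U)" and d: "d \<in> topspace (unordered_config_space n X)"
  shows "f \<notin> epi (braid_group n U c) (braid_group n X d)"
proof
  assume f: "f \<in> epi (braid_group n U c) (braid_group n X d)"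
  interpret U: crosscap_polygon 1 U qU by (rule U)
  let ?Y = "unordered_config_space n U" and ?Z = "unordered_config_space n X"
  obtain T where T: "\<And>\<psi>. path_char ?Z \<psi> \<Longrightarrow> \<exists>\<Phi>. path_char ?Y \<Phi> \<and> (\<forall>p. pathin ?Y p \<longrightarrow> p 1 = p 0 \<longrightarrow> \<Phi> p = \<psi> (T p))"
    "\<And>r. pathin ?Z r \<Longrightarrow> r 1 = r 0 \<Longrightarrow> \<exists>p. pathin ?Y p \<and> p 1 = p 0 \<and> (\<forall>\<psi>. path_char ?Z \<psi> \<longrightarrow> \<psi> (T p) = \<psi> r)"
    using epi_path_char[OF path_connected_unordered_config_space[OF U.path_connected_polygon_config] c
        path_connected_unordered_config_space[OF path_connected_sphere_config] d f[unfolded braid_group_def]] by (smt (verit))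
  have pc\<Theta>: "path_char ?Z (\<Theta> n)" using n by (intro \<Theta>_path_char) simp
  obtain \<Phi> where \<Phi>: "path_char ?Y \<Phi>" "\<And>p. pathin ?Y p \<Longrightarrow> p 1 = p 0 \<Longrightarrow> \<Phi> p = \<Theta> n (T p)" using T(1)[OF pc\<Theta>] by blast
  interpret crosscap_char 1 U qU n \<Phi> by unfold_locales (rule \<Phi>(1))
  obtain y where y: "pathin ?Z y" "y 1 = y 0" "(\<Theta> n y)\<^sup>2 \<noteq> 1" using rotation_loop[OF n] by blast
  obtain p where p: "pathin ?Y p" "p 1 = p 0" "\<Theta> n (T p) = \<Theta> n y" using T(2)[OF y(1,2)] pc\<Theta> by blast
  have "(\<Phi> (U.edge_loop n k))\<^sup>2 = 1" if "k < 1" for k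
    using that edge_loop_relation n by simp
  then have "(\<Phi> p)\<^sup>2 = 1" using square_trivial[OF _ _ p(1,2)] n by simp
  then show False using \<Phi>(2)[OF p(1,2)] p(3) y(3) by simp
qed

end

section \<open>The sphere braid groups on at most two strings\<close>

text \<open>The braid has trivial permutation; by \<open>pure_loop_iff\<close> it does not matter
  which lift is tested.\<close>

definition pure_loop :: "nat \<Rightarrow> 'a topology \<Rightarrow> (real \<Rightarrow> (nat \<Rightarrow> 'a) set) \<Rightarrow> bool" where
  "pure_loop n X p \<longleftrightarrow>
     (\<exists>x. pathin (config_space n X) x \<and> (\<forall>t\<in>{0..1}. perm_orbit n (x t) = p t) \<and> x 1 = x 0)"

lemma config_lift_unique:
  fixes x x' :: "real \<Rightarrow> nat \<Rightarrow> 'a"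
  assumes X: "Hausdorff_space X" and x: "pathin (config_space n X) x" "pathin (config_space n X) x'"
    and eq: "\<And>t. t \<in> {0..1} \<Longrightarrow> perm_orbit n (x t) = perm_orbit n (x' t)" and s: "s \<in> {0..1}" "x s = x' s"
    and t: "t \<in> {0..1}"
  shows "x t = x' t"
  by (rule lift_unique[OF section_covering_config[OF X], of "{0..1::real}" s t n])
    (use x eq s t in \<open>auto simp: pathin_def\<close>)

lemma config_lift_exists:
  assumes X: "Hausdorff_space X" and p: "pathin (unordered_config_space n X) p"
    and x0: "x0 \<in> topspace (config_space n X)" "perm_orbit n x0 = p 0"
  obtains x where "pathin (config_space n X) x" "\<And>t. t \<in> {0..1} \<Longrightarrow> perm_orbit n (x t) = p t" "x 0 = x0"
  by (rule lift_exists[OF section_covering_config[OF X], of "{0..1::real}" 0 n p x0])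
    (use p x0 in \<open>auto simp: pathin_def\<close>)

lemma pathin_permute:
  assumes "\<pi> permutes {..<n}" "pathin (config_space n X) x"
  shows "pathin (config_space n X) (\<lambda>t. x t \<circ> \<pi>)"
  using pathin_compose[OF assms(2) continuous_map_permute[OF assms(1)]] by (simp add: o_def)

lemma pure_loop_iff:
  assumes X: "Hausdorff_space X" and x: "pathin (config_space n X) x" "\<And>t. t \<in> {0..1} \<Longrightarrow> perm_orbit n (x t) = p t"
  shows "pure_loop n X p \<longleftrightarrow> x 1 = x 0"
proof
  assume "pure_loop n X p"
  then obtain x' where x': "pathin (config_space n X) x'" "\<And>t. t \<in> {0..1} \<Longrightarrow> perm_orbit n (x' t) = p t" "x' 1 = x' 0"
    unfolding pure_loop_def by blast
  have "perm_orbit n (x' 0) = perm_orbit n (x 0)" using x x' by simp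
  then obtain \<pi> where \<pi>: "\<pi> permutes {..<n}" "x 0 = x' 0 \<circ> \<pi>" unfolding perm_orbit_eq_iff by blast
  have "x 1 = x' 1 \<circ> \<pi>"
    by (rule config_lift_unique[OF X x(1) pathin_permute[OF \<pi>(1) x'(1)], of 0])
      (use x(2) x'(2) \<pi> in \<open>auto simp: perm_orbit_permute[OF \<pi>(1)]\<close>)
  then show "x 1 = x 0" using \<pi>(2) x'(3) by simp
qed (use x in \<open>auto simp: pure_loop_def\<close>)

text \<open>The homotopy lifts over the whole square, and the lifts of its constant sides are
  constant.\<close>

lemma pure_loop_hom:
  assumes X: "Hausdorff_space X" and p: "path_hom (unordered_config_space n X) p r"
  shows "pure_loop n X p \<longleftrightarrow> pure_loop n X r"
proof -
  obtain h where h: "continuous_map (top_of_set unit_square) (unordered_config_space n X) h"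
    "\<And>s. h (0, s) = p s" "\<And>s. h (1, s) = r s"
    "\<And>t. t \<in> {0..1} \<Longrightarrow> h (t, 0) = p 0" "\<And>t. t \<in> {0..1} \<Longrightarrow> h (t, 1) = p 1" using path_homD[OF p] by blast
  have "p 0 \<in> topspace (unordered_config_space n X)" using path_start_in_topspace[OF path_hom_imp(1)[OF p]] .
  then obtain x0 where x0: "x0 \<in> topspace (config_space n X)" "perm_orbit n x0 = p 0"
    unfolding topspace_unordered_config_space by force
  obtain k where k: "continuous_map (top_of_set unit_square) (config_space n X) k"
    "\<And>z. z \<in> unit_square \<Longrightarrow> perm_orbit n (k z) = h z"
    by (rule lift_exists[OF section_covering_config[OF X], of unit_square "(0,0)" n h x0])
      (use h x0 in \<open>auto simp: convex_Times compact_Times\<close>)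
  have sub: "pathin (config_space n X) (\<lambda>s. k (u s))" if "continuous_on {0..1} u" "u ` {0..1} \<subseteq> unit_square" for u
  proof -
    have "continuous_map (top_of_set {0..1}) (top_of_set unit_square) u"
      using that by (auto simp: continuous_map_in_subtopology)
    from continuous_map_compose[OF this k(1)] show ?thesis by (simp add: pathin_def o_def)
  qed
  have v: "pathin (config_space n X) (\<lambda>s. k (t, s))" "pathin (config_space n X) (\<lambda>s. k (s, t))" if "t \<in> {0..1}" for t
    using that by (auto intro!: sub continuous_intros)
  have "k (1, s) = k (0, s)" if s: "s = 0 \<or> s = 1" for s
  proof (rule config_lift_unique[OF X v(2), where x' = "\<lambda>_. k (0, s)" and s = 0 and t = 1])
    have "k (0, s) \<in> topspace (config_space n X)" using k(1) s by (auto simp: continuous_map_def)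
    then show "pathin (config_space n X) (\<lambda>_. k (0, s))" by simp
  qed (use s k(2) h in auto)
  then have "k (0, 1) = k (0, 0) \<longleftrightarrow> k (1, 1) = k (1, 0)" by metis
  moreover have "pure_loop n X p \<longleftrightarrow> k (0, 1) = k (0, 0)"
    by (rule pure_loop_iff[OF X v(1)]) (use k(2) h in auto)
  moreover have "pure_loop n X r \<longleftrightarrow> k (1, 1) = k (1, 0)"
    by (rule pure_loop_iff[OF X v(1)]) (use k(2) h in auto)
  ultimately show ?thesis by simp
qed

lemma permutes_le_2:
  assumes "\<pi> permutes {..<n}" "n \<le> 2" "\<pi> \<noteq> id"
  shows "n = 2 \<and> \<pi> = nat_swap 0 1"
proof -
  have o: "\<pi> i = i" if "i \<ge> 2" for i using permutes_not_in[OF assms(1), of i] assms(2) that by simp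
  have inj: "\<pi> 0 \<noteq> \<pi> 1" using permutes_inj[OF assms(1)] by (simp add: inj_eq)
  obtain i where i: "\<pi> i \<noteq> i" using assms(3) by fastforce
  then have "i < n" using permutes_not_in[OF assms(1), of i] by auto
  then have n: "n = 2"
  proof (rule_tac ccontr)
    assume "n \<noteq> 2"
    then have "n = 1" "i = 0" using \<open>i < n\<close> assms(2) by auto
    then show False using i permutes_in_image[OF assms(1), of 0] by auto
  qed
  then have "\<pi> 0 < 2" "\<pi> 1 < 2" using permutes_in_image[OF assms(1), of 0] permutes_in_image[OF assms(1), of 1] by auto
  moreover have "i = 0 \<or> i = 1" using \<open>i < n\<close> n by auto
  ultimately have "\<pi> 0 = 1" "\<pi> 1 = 0" using inj i by auto
  then have "\<pi> j = nat_swap 0 1 j" for j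
    using o[of j] by (cases "j = 0 \<or> j = 1") (auto simp: Transposition.transpose_def)
  then show ?thesis using n by blast
qed

lemma orbit_le_2:
  assumes "n \<le> 2" "perm_orbit n u = perm_orbit n v" "perm_orbit n u = perm_orbit n w" "v \<noteq> u" "w \<noteq> u"
  shows "v = w"
proof -
  obtain \<pi> \<rho> where \<pi>: "\<pi> permutes {..<n}" "v = u \<circ> \<pi>" and \<rho>: "\<rho> permutes {..<n}" "w = u \<circ> \<rho>"
    using assms(2,3) unfolding perm_orbit_eq_iff by blast
  have "\<pi> \<noteq> id" "\<rho> \<noteq> id" using \<pi>(2) \<rho>(2) assms(4,5) by auto
  then show ?thesis using permutes_le_2[OF \<pi>(1) assms(1)] permutes_le_2[OF \<rho>(1) assms(1)] \<pi>(2) \<rho>(2) by simp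
qed

text \<open>With at most two strings an orbit has at most two orderings, so being pure or not
  multiplies like a sign.\<close>

lemma pure_loop_concat:
  assumes X: "Hausdorff_space X" and n: "n \<le> 2"
    and p: "loopin (unordered_config_space n X) c p" "loopin (unordered_config_space n X) c r"
  shows "pure_loop n X (path_concat p r) \<longleftrightarrow> (pure_loop n X p \<longleftrightarrow> pure_loop n X r)"
proof -
  have pr: "pathin (unordered_config_space n X) (path_concat p r)" and e: "p 0 = c" "p 1 = c" "r 0 = c" "r 1 = c"
    using loopin_concat[OF p] p by (auto simp: loopin_def)
  have e': "path_concat p r 0 = c" "path_concat p r (1/2) = c" "path_concat p r 1 = c" using e by (simp_all add: path_concat_def)
  obtain x0 where x0: "x0 \<in> topspace (config_space n X)" "perm_orbit n x0 = path_concat p r 0"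
    using path_start_in_topspace[OF pr] unfolding topspace_unordered_config_space by force
  obtain x where x: "pathin (config_space n X) x" "\<And>t. t \<in> {0..1} \<Longrightarrow> perm_orbit n (x t) = path_concat p r t"
    by (rule config_lift_exists[OF X pr x0]) blast
  have half: "pathin (config_space n X) (x \<circ> (\<lambda>t. t / 2))" "pathin (config_space n X) (x \<circ> (\<lambda>t. (t + 1) / 2))"
    by (rule pathin_reparam[OF x(1)]; force intro!: continuous_intros)+
  have "pure_loop n X p \<longleftrightarrow> (x \<circ> (\<lambda>t. t / 2)) 1 = (x \<circ> (\<lambda>t. t / 2)) 0"
    by (rule pure_loop_iff[OF X half(1)]) (use x(2) in \<open>simp add: path_concat_def\<close>)
  moreover have "pure_loop n X r \<longleftrightarrow> (x \<circ> (\<lambda>t. (t + 1) / 2)) 1 = (x \<circ> (\<lambda>t. (t + 1) / 2)) 0"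
    by (rule pure_loop_iff[OF X half(2)]) (use x(2) path_concat_second_half[of _ p r] e in simp)
  moreover have "pure_loop n X (path_concat p r) \<longleftrightarrow> x 1 = x 0" by (rule pure_loop_iff[OF X x])
  moreover have "perm_orbit n (x 0) = c" "perm_orbit n (x (1/2)) = c" "perm_orbit n (x 1) = c" using x(2) e' by simp_all
  then have "x 1 = x 0 \<longleftrightarrow> (x (1/2) = x 0 \<longleftrightarrow> x 1 = x (1/2))" using orbit_le_2[OF n, of "x (1/2)" "x 0" "x 1"] by metis
  ultimately show ?thesis by simp
qed

lemma not_pure_loop:
  assumes X: "Hausdorff_space X" and n: "n \<le> 2" and p: "loopin (unordered_config_space n X) c p" "\<not> pure_loop n X p"
  shows "n = 2"
proof -
  have pp: "pathin (unordered_config_space n X) p" "p 1 = p 0" using p(1) by (auto simp: loopin_def)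
  obtain x0 where x0: "x0 \<in> topspace (config_space n X)" "perm_orbit n x0 = p 0"
    using path_start_in_topspace[OF pp(1)] unfolding topspace_unordered_config_space by force
  obtain x where x: "pathin (config_space n X) x" "\<And>t. t \<in> {0..1} \<Longrightarrow> perm_orbit n (x t) = p t"
    by (rule config_lift_exists[OF X pp(1) x0]) blast
  have "perm_orbit n (x 0) = perm_orbit n (x 1)" using x(2) pp(2) by simp
  then obtain \<pi> where \<pi>: "\<pi> permutes {..<n}" "x 1 = x 0 \<circ> \<pi>" unfolding perm_orbit_eq_iff by blast
  have "x 1 \<noteq> x 0" using p(2) pure_loop_iff[OF X x] by simp
  then have "\<pi> \<noteq> id" using \<pi>(2) by auto
  then show ?thesis using permutes_le_2[OF \<pi>(1) n] by simp
qed

lemma pure_status_exists: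
  assumes X: "Hausdorff_space X" and pc: "path_connected_space (config_space n X)"
    and c: "c \<in> topspace (unordered_config_space n X)" and b: "b \<or> n = 2"
  obtains r where "loopin (unordered_config_space n X) c r" "pure_loop n X r \<longleftrightarrow> b"
proof -
  obtain z where z: "z \<in> topspace (config_space n X)" "perm_orbit n z = c"
    using c unfolding topspace_unordered_config_space by force
  define \<pi> where "\<pi> = (if b then id else nat_swap 0 (1::nat))"
  have \<pi>: "\<pi> permutes {..<n}" using b by (auto simp: \<pi>_def permutes_id intro!: permutes_swap_id)
  have "z \<circ> \<pi> \<in> topspace (config_space n X)" by (rule permute_config[OF \<pi> z(1)])
  then obtain x where x: "pathin (config_space n X) x" "x 0 = z" "x 1 = z \<circ> \<pi>"
    using pc z(1) unfolding path_connected_space_def by blast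
  have "pathin (unordered_config_space n X) (perm_orbit n \<circ> x)" by (rule pathin_compose[OF x(1) continuous_map_perm_orbit])
  then have "loopin (unordered_config_space n X) c (perm_orbit n \<circ> x)"
    using x(2,3) z(2) by (simp add: loopin_def perm_orbit_permute[OF \<pi>])
  moreover have "pure_loop n X (perm_orbit n \<circ> x) \<longleftrightarrow> x 1 = x 0" by (rule pure_loop_iff[OF X x(1)]) simp
  moreover have "x 1 = x 0 \<longleftrightarrow> b"
  proof (cases b)
    case False
    then have "n = 2" using b by simp
    then have "z 1 \<noteq> z 0" using z(1) unfolding topspace_config_space inj_on_def by force
    then have "(z \<circ> \<pi>) 0 \<noteq> z 0" using False by (simp add: \<pi>_def)
    then show ?thesis using x(2,3) False by metis
  qed (use x in \<open>simp add: \<pi>_def\<close>)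
  ultimately show ?thesis using that by blast
qed

text \<open>Lifts with a common start and equal purity end at the same ordering, so they are
  homotopic upstairs by \<open>sc\<close>, and the homotopy projects.\<close>

lemma loop_class_pure_status:
  assumes X: "Hausdorff_space X" and n: "n \<le> 2"
    and sc: "\<And>x x'. pathin (config_space n X) x \<Longrightarrow> pathin (config_space n X) x' \<Longrightarrow> x' 0 = x 0 \<Longrightarrow> x' 1 = x 1 \<Longrightarrow>
      path_hom (config_space n X) x x'"
    and p: "loopin (unordered_config_space n X) c p" and r: "loopin (unordered_config_space n X) c r"
    and eq: "pure_loop n X p \<longleftrightarrow> pure_loop n X r"
  shows "loop_class (unordered_config_space n X) c p = loop_class (unordered_config_space n X) c r"
proof -
  let ?Y = "unordered_config_space n X"
  have pp: "pathin ?Y p" "p 0 = c" "p 1 = c" and rr: "pathin ?Y r" "r 0 = c" "r 1 = c" using p r by (auto simp: loopin_def)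
  obtain z where z: "z \<in> topspace (config_space n X)" "perm_orbit n z = c"
    using path_start_in_topspace[OF pp(1)] pp(2) unfolding topspace_unordered_config_space by force
  obtain x where x: "pathin (config_space n X) x" "\<And>t. t \<in> {0..1} \<Longrightarrow> perm_orbit n (x t) = p t" "x 0 = z"
    using config_lift_exists[OF X pp(1) z(1)] z(2) pp(2) by metis
  obtain x' where x': "pathin (config_space n X) x'" "\<And>t. t \<in> {0..1} \<Longrightarrow> perm_orbit n (x' t) = r t" "x' 0 = z"
    using config_lift_exists[OF X rr(1) z(1)] z(2) rr(2) by metis
  have "x 1 = z \<longleftrightarrow> x' 1 = z" using pure_loop_iff[OF X x(1,2)] pure_loop_iff[OF X x'(1,2)] x(3) x'(3) eq by simp
  moreover have "perm_orbit n (x 1) = c" "perm_orbit n (x' 1) = c" using x(2)[of 1] x'(2)[of 1] pp(3) rr(3) by simp_all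
  ultimately have "x' 1 = x 1" using orbit_le_2[OF n, of z "x' 1" "x 1"] z(2) by metis
  then have "path_hom (config_space n X) x x'" using sc[OF x(1) x'(1)] x(3) x'(3) by simp
  then obtain h where h: "continuous_map (top_of_set unit_square) (config_space n X) h"
    "\<And>s. h (0, s) = x s" "\<And>s. h (1, s) = x' s"
    "\<And>t. t \<in> {0..1} \<Longrightarrow> h (t, 0) = x 0" "\<And>t. t \<in> {0..1} \<Longrightarrow> h (t, 1) = x 1" using path_homD by blast
  have "path_hom ?Y p r"
    by (rule path_homI[OF continuous_map_compose[OF h(1) continuous_map_perm_orbit]]) (use h x(2) x'(2) in auto)
  then show ?thesis using loop_class_eq_iff[OF p r] by simp
qed

text \<open>With at most two strings over a surface whose configuration space is simply connected, a braid is determined by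
  its permutation.\<close>

lemma epi_by_permutation:
  assumes n: "n \<le> 2"
    and U: "Hausdorff_space U" "path_connected_space (config_space n U)"
    and X: "Hausdorff_space X" "path_connected_space (config_space n X)"
    and sc: "\<And>x x'. pathin (config_space n X) x \<Longrightarrow> pathin (config_space n X) x' \<Longrightarrow> x' 0 = x 0 \<Longrightarrow> x' 1 = x 1 \<Longrightarrow>
      path_hom (config_space n X) x x'"
    and c: "c \<in> topspace (unordered_config_space n U)" and d: "d \<in> topspace (unordered_config_space n X)"
  shows "\<exists>f. f \<in> epi (braid_group n U c) (braid_group n X d)"
proof -
  let ?Y = "unordered_config_space n U" and ?Z = "unordered_config_space n X"
  let ?G = "fundamental_group ?Y c" and ?H = "fundamental_group ?Z d"
  \<comment> \<open>A class goes to the class of the same purity, which exists by \<open>ex\<close>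
    and is unique by \<open>same\<close>.\<close>
  define f where "f A = (SOME B. \<exists>p r. loopin ?Y c p \<and> loopin ?Z d r \<and> A = loop_class ?Y c p \<and> B = loop_class ?Z d r \<and>
    (pure_loop n U p \<longleftrightarrow> pure_loop n X r))" for A
  have same: "loop_class ?Z d p = loop_class ?Z d r"
    if "loopin ?Z d p" "loopin ?Z d r" "pure_loop n X p \<longleftrightarrow> pure_loop n X r" for p r
    by (rule loop_class_pure_status[OF X(1) n _ that]) (rule sc)
  have f: "f (loop_class ?Y c p) = loop_class ?Z d r"
    if p: "loopin ?Y c p" and r: "loopin ?Z d r" and eq: "pure_loop n U p \<longleftrightarrow> pure_loop n X r" for p r
  proof -
    have "\<exists>B p' r'. loopin ?Y c p' \<and> loopin ?Z d r' \<and> loop_class ?Y c p = loop_class ?Y c p' \<and> B = loop_class ?Z d r' \<and>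
        (pure_loop n U p' \<longleftrightarrow> pure_loop n X r')" using that by blast
    from someI_ex[OF this] obtain p' r' where p': "loopin ?Y c p'" "loopin ?Z d r'" "loop_class ?Y c p = loop_class ?Y c p'"
      "f (loop_class ?Y c p) = loop_class ?Z d r'" "pure_loop n U p' \<longleftrightarrow> pure_loop n X r'" unfolding f_def by blast
    have "path_hom ?Y p p'" using loop_class_eq_iff[OF p p'(1)] p'(3) by simp
    from pure_loop_hom[OF U(1) this] have "pure_loop n X r' \<longleftrightarrow> pure_loop n X r" using eq p'(5) by simp
    from same[OF p'(2) r this] show ?thesis using p'(4) by simp
  qed
  have ex: "\<exists>r. loopin ?Z d r \<and> (pure_loop n U p \<longleftrightarrow> pure_loop n X r)" if p: "loopin ?Y c p" for p
    using pure_status_exists[OF X d, of "pure_loop n U p"] not_pure_loop[OF U(1) n p] by metis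
  have ex': "\<exists>p. loopin ?Y c p \<and> (pure_loop n U p \<longleftrightarrow> pure_loop n X r)" if r: "loopin ?Z d r" for r
    using pure_status_exists[OF U c, of "pure_loop n X r"] not_pure_loop[OF X(1) n r] by metis
  have "f \<in> hom ?G ?H"
  proof (rule homI)
    fix A assume "A \<in> carrier ?G"
    then obtain p where p: "loopin ?Y c p" "A = loop_class ?Y c p" unfolding fundamental_group_carrier by blast
    then show "f A \<in> carrier ?H" using ex f unfolding fundamental_group_carrier by blast
  next
    fix A B assume "A \<in> carrier ?G" "B \<in> carrier ?G"
    then obtain p p' where p: "loopin ?Y c p" "A = loop_class ?Y c p" "loopin ?Y c p'" "B = loop_class ?Y c p'"
      unfolding fundamental_group_carrier by blast
    obtain r r' where r: "loopin ?Z d r" "pure_loop n U p \<longleftrightarrow> pure_loop n X r" "loopin ?Z d r'" "pure_loop n U p' \<longleftrightarrow> pure_loop n X r'"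
      using ex[OF p(1)] ex[OF p(3)] by blast
    have "f (loop_class ?Y c (path_concat p p')) = loop_class ?Z d (path_concat r r')"
      by (rule f[OF loopin_concat[OF p(1,3)] loopin_concat[OF r(1,3)]])
        (use pure_loop_concat[OF U(1) n p(1,3)] pure_loop_concat[OF X(1) n r(1,3)] r in simp)
    then show "f (A \<otimes>\<^bsub>?G\<^esub> B) = f A \<otimes>\<^bsub>?H\<^esub> f B"
      unfolding p(2,4) fundamental_group_mult[OF p(1,3)] f[OF p(1) r(1,2)] f[OF p(3) r(3,4)] fundamental_group_mult[OF r(1,3)] .
  qed
  moreover have "carrier ?H \<subseteq> f ` carrier ?G"
  proof
    fix B assume "B \<in> carrier ?H"
    then obtain r where r: "loopin ?Z d r" "B = loop_class ?Z d r" unfolding fundamental_group_carrier by blast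
    obtain p where p: "loopin ?Y c p" "pure_loop n U p \<longleftrightarrow> pure_loop n X r" using ex'[OF r(1)] by blast
    have "B = f (loop_class ?Y c p)" using f[OF p(1) r(1) p(2)] r(2) by simp
    moreover have "loop_class ?Y c p \<in> carrier ?G" using p(1) unfolding fundamental_group_carrier by blast
    ultimately show "B \<in> f ` carrier ?G" by blast
  qed
  ultimately have "f \<in> epi ?G ?H" unfolding epi_def hom_def by blast
  then show ?thesis unfolding braid_group_def by blast
qed

text \<open>\<open>j\<close> and \<open>k\<close> exhibit \<open>Y\<close> as a retract of
  \<open>S\<close>, so homotopies can be found in \<open>S\<close> and brought back.\<close>

lemma path_hom_simply_connected:
  fixes S :: "'b::real_normed_vector set"
  assumes S: "simply_connected S" and j: "continuous_map (top_of_set S) Y j" and k: "continuous_map Y (top_of_set S) k"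
    and jk: "\<And>y. y \<in> topspace Y \<Longrightarrow> j (k y) = y"
    and x: "pathin Y x" "pathin Y x'" "x' 0 = x 0" "x' 1 = x 1"
  shows "path_hom Y x x'"
proof -
  have px: "path (k \<circ> y)" "path_image (k \<circ> y) \<subseteq> S" if "pathin Y y" for y
    using continuous_map_compose[OF that[unfolded pathin_def] k]
    by (auto simp: path_def path_image_def continuous_map_in_subtopology)
  have "homotopic_paths S (k \<circ> x) (k \<circ> x')"
    using S px[OF x(1)] px[OF x(2)] x(3,4) unfolding simply_connected_eq_homotopic_paths
    by (auto simp: pathstart_def pathfinish_def)
  then obtain h where h: "continuous_on unit_square h" "h \<in> unit_square \<rightarrow> S" "\<forall>s\<in>{0..1}. h (0, s) = (k \<circ> x) s"
    "\<forall>s\<in>{0..1}. h (1, s) = (k \<circ> x') s"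
    "\<forall>t\<in>{0..1}. pathstart (h \<circ> Pair t) = pathstart (k \<circ> x) \<and> pathfinish (h \<circ> Pair t) = pathfinish (k \<circ> x)"
    unfolding homotopic_paths by blast
  have "continuous_map (top_of_set unit_square) (top_of_set S) h" using h(1,2) by (auto simp: continuous_map_in_subtopology)
  then have c: "continuous_map (top_of_set unit_square) Y (j \<circ> h)" using j continuous_map_compose by blast
  have yt: "y s \<in> topspace Y" if "pathin Y y" "s \<in> {0..1}" for y s using that by (auto simp: pathin_def continuous_map_def)
  show ?thesis
    by (rule path_homI[OF c])
      (use h(3-5) jk yt[OF x(1)] yt[OF x(2)] in \<open>auto simp: pathstart_def pathfinish_def\<close>)
qed

text \<open>The second point can be moved from \<open>- u\<close> to \<open>v\<close> along the
  normalised segment, so the space of pairs is homotopy equivalent to the sphere of antipodal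
  pairs.\<close>

lemma simply_connected_distinct_pairs:
  "simply_connected {(u, v). u \<in> sphere (0::real^3) 1 \<and> v \<in> sphere 0 1 \<and> u \<noteq> v}" (is "simply_connected ?S")
proof -
  define w where "w t u v = (1 - t) *\<^sub>R (- u) + t *\<^sub>R v" for t and u v :: "real^3"
  \<comment> \<open>The segment from \<open>- u\<close> to \<open>v\<close> meets the closed ray
    from 0 through \<open>u\<close> only if \<open>v = u\<close>; so it can be normalised and never
    yields \<open>u\<close>.\<close>
  have w: "w t u v \<noteq> 0" "u \<noteq> sgn (w t u v)" if "t \<in> {0..1}" "(u, v) \<in> ?S" for t u v
  proof -
    have uv: "norm u = 1" "norm v = 1" "u \<noteq> v" using that(2) by auto
    have ne: "t *\<^sub>R v \<noteq> s *\<^sub>R u" if s: "s \<ge> 0" "t \<noteq> 0 \<or> s \<noteq> 0" for s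
    proof
      assume eq: "t *\<^sub>R v = s *\<^sub>R u"
      then have "norm (t *\<^sub>R v) = norm (s *\<^sub>R u)" by simp
      then have "t = s" using uv s \<open>t \<in> {0..1}\<close> by simp
      then show False using eq s(2) uv(3) by simp
    qed
    show "w t u v \<noteq> 0" using ne[of "1 - t"] that(1) by (auto simp: w_def algebra_simps)
    show "u \<noteq> sgn (w t u v)"
    proof
      assume s: "u = sgn (w t u v)"
      have "w t u v = norm (w t u v) *\<^sub>R sgn (w t u v)" by (simp add: sgn_div_norm \<open>w t u v \<noteq> 0\<close>)
      then have "w t u v = norm (w t u v) *\<^sub>R u" using s by metis
      then have tv: "t *\<^sub>R v = (norm (w t u v) + (1 - t)) *\<^sub>R u" by (simp add: w_def algebra_simps)
      have "0 < norm (w t u v)" using \<open>w t u v \<noteq> 0\<close> by simp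
      moreover have "t \<le> 1" using that(1) by simp
      ultimately have "0 \<le> norm (w t u v) + (1 - t)" "norm (w t u v) + (1 - t) \<noteq> 0" by linarith+
      then show False using ne tv by blast
    qed
  qed
  have neg: "u \<noteq> - u" if "norm u = 1" for u :: "real^3"
  proof
    assume "u = - u"
    then have "2 *\<^sub>R u = 0" by (simp only: scaleR_2 eq_neg_iff_add_eq_0)
    then show False using that by simp
  qed
  have "?S homotopy_eqv sphere (0::real^3) 1"
    unfolding homotopy_equivalent_space_def
  proof (intro exI conjI)
    show "continuous_map (top_of_set ?S) (top_of_set (sphere 0 1)) fst"
      by (auto simp: continuous_map_in_subtopology intro!: continuous_intros)
    show "continuous_map (top_of_set (sphere 0 1)) (top_of_set ?S) (\<lambda>u. (u, - u))"
      using neg by (simp add: continuous_map_in_subtopology image_subset_iff continuous_intros)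
    show "homotopic_with (\<lambda>_. True) (top_of_set (sphere 0 1)) (top_of_set (sphere 0 1)) (fst \<circ> (\<lambda>u. (u, - u))) id"
      by (simp add: o_def id_def[symmetric])
    let ?H = "\<lambda>z. (fst (snd z), sgn (w (fst z) (fst (snd z)) (snd (snd z))))"
    show "homotopic_with (\<lambda>_. True) (top_of_set ?S) (top_of_set ?S) ((\<lambda>u. (u, - u)) \<circ> fst) id"
    proof (subst homotopic_with, simp, intro exI conjI)
      have "continuous_on ({0..1} \<times> ?S) ?H"
        unfolding sgn_div_norm using w(1) by (intro continuous_intros) (auto simp: w_def intro!: continuous_intros)
      moreover have "?H ` ({0..1} \<times> ?S) \<subseteq> ?S" using w by (auto simp: norm_sgn)
      ultimately show "continuous_map (prod_topology (top_of_set {0..1}) (top_of_set ?S)) (top_of_set ?S) ?H"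
        by (auto simp: prod_topology_subtopology_eu continuous_map_in_subtopology)
    qed (auto simp: w_def sgn_div_norm)
  qed
  then show ?thesis
    using homotopy_eqv_simple_connectedness simply_connected_sphere[of "0::real^3" 1] by auto
qed

context sphere_homeo
begin

text \<open>The ordered configurations form a sphere for one point and the space of distinct pairs
  for two.\<close>

lemma sphere_config_simply_connected:
  assumes n: "n \<in> {1, 2}" and x: "pathin (config_space n X) x" "pathin (config_space n X) x'" "x' 0 = x 0" "x' 1 = x 1"
  shows "path_hom (config_space n X) x x'"
proof -
  obtain b where "homeomorphic_maps X (top_of_set (sphere 0 1)) a b" using homeo homeomorphic_map_maps by blast
  then have cb: "continuous_map (top_of_set (sphere 0 1)) X b" and ab: "\<And>p. p \<in> sphere 0 1 \<Longrightarrow> a (b p) = p"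
    and ba: "\<And>x. x \<in> topspace X \<Longrightarrow> b (a x) = x"
    by (auto simp: homeomorphic_maps_def)
  have ac: "continuous_map (config_space n X) euclidean (\<lambda>x. a (x i))" if "i < n" for i
    using continuous_map_compose[OF continuous_map_config_proj[OF that] a_cont] by (simp add: o_def)
  consider "n = 1" | "n = 2" using n by blast
  then show ?thesis
  proof cases
    case 1
    have "simply_connected (sphere (0::real^3) 1)" by (rule simply_connected_sphere) simp
    moreover have "continuous_map (top_of_set (sphere 0 1)) (config_space n X) (\<lambda>u. restrict (\<lambda>i. b u) {..<n})"
      unfolding continuous_map_config using cb 1 by (auto simp: inj_on_def)
    moreover have "continuous_map (config_space n X) (top_of_set (sphere 0 1)) (\<lambda>x. a (x 0))"
      using ac[of 0] 1 a_in by (auto simp: continuous_map_in_subtopology topspace_config_space)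
    moreover have "restrict (\<lambda>i. b (a (y 0))) {..<n} = y" if "y \<in> topspace (config_space n X)" for y
      using that 1 ba by (auto simp: topspace_config_space extensional_def fun_eq_iff)
    ultimately show ?thesis using path_hom_simply_connected x by blast
  next
    case 2
    let ?S = "{(u, v). u \<in> sphere (0::real^3) 1 \<and> v \<in> sphere 0 1 \<and> u \<noteq> v}"
    have "continuous_map (top_of_set ?S) (config_space n X) (\<lambda>z. restrict (\<lambda>i. b (if i = 0 then fst z else snd z)) {..<n})"
      unfolding continuous_map_config
    proof (intro conjI allI impI ballI)
      fix i assume i: "i < n"
      have "continuous_map (top_of_set ?S) (top_of_set (sphere 0 1)) (\<lambda>z. if i = 0 then fst z else snd z)"
        by (cases "i = 0") (auto simp: continuous_map_in_subtopology intro!: continuous_intros)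
      from continuous_map_compose[OF this cb] 
      show "continuous_map (top_of_set ?S) X (\<lambda>z. restrict (\<lambda>i. b (if i = 0 then fst z else snd z)) {..<n} i)"
        using i by (simp add: o_def)
    next
      fix z assume "z \<in> topspace (top_of_set ?S)"
      then have "b (fst z) \<noteq> b (snd z)" using ab by (auto) (metis mem_sphere_0)
      then show "inj_on (restrict (\<lambda>i. b (if i = 0 then fst z else snd z)) {..<n}) {..<n}"
        unfolding 2 by (auto simp: inj_on_def split: if_splits)
    qed simp
    moreover have "continuous_map (config_space n X) (top_of_set ?S) (\<lambda>x. (a (x 0), a (x 1)))"
      unfolding continuous_map_in_subtopology
    proof (intro conjI)
      show "continuous_map (config_space n X) euclidean (\<lambda>x. (a (x 0), a (x 1)))"
        using ac[of 0] ac[of 1] 2 by (simp add: continuous_map_pairwise o_def flip: prod_topology_euclidean)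
      show "(\<lambda>x. (a (x 0), a (x 1))) \<in> topspace (config_space n X) \<rightarrow> ?S"
      proof
        fix y assume y: "y \<in> topspace (config_space n X)"
        then have "inj_on y {..<2}" "y 0 \<in> topspace X" "y 1 \<in> topspace X"
          unfolding topspace_config_space 2 by auto
        moreover from this have "y 0 \<noteq> y 1" using inj_onD[of y "{..<2}" 0 1] by auto
        ultimately show "(a (y 0), a (y 1)) \<in> ?S" using a_in a_inj unfolding inj_on_def by auto
      qed
    qed
    moreover have "restrict (\<lambda>i. b (if i = 0 then fst (a (y 0), a (y 1)) else snd (a (y 0), a (y 1)))) {..<n} = y"
      if "y \<in> topspace (config_space n X)" for y
    proof
      fix i
      have "i = 0 \<or> i = 1 \<or> \<not> i < n" using 2 by auto
      then show "restrict (\<lambda>i. b (if i = 0 then fst (a (y 0), a (y 1)) else snd (a (y 0), a (y 1)))) {..<n} i = y i"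
        using that 2 ba by (auto simp: topspace_config_space extensional_def)
    qed
    ultimately show ?thesis using path_hom_simply_connected[OF simply_connected_distinct_pairs] x by blast
  qed
qed

end

theorem proposition1p2:
  fixes n g :: nat
    and U :: "'a topology" and \<Sigma> :: "'b topology"
    and c :: "(nat \<Rightarrow> 'a) set" and d :: "(nat \<Rightarrow> 'b) set"
  assumes "n \<ge> 1" and "g \<ge> 1"
    and "nonorientable_surface g U"
    and "orientable_surface (g - 1) \<Sigma>"
    and "c \<in> topspace (unordered_config_space n U)"
    and "d \<in> topspace (unordered_config_space n \<Sigma>)"
  shows "(\<exists>f. f \<in> epi (braid_group n U c) (braid_group n \<Sigma> d)) \<longleftrightarrow> g = 1 \<and> n \<in> {1, 2}"
proof -
  obtain qU where qU: "quotient_map (top_of_set (cball 0 1)) U qU"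
    "\<forall>z\<in>cball 0 1. \<forall>z'\<in>cball 0 1. qU z = qU z' \<longleftrightarrow> equivclp (edge_glued (projective_planes_scheme g)) z z'"
    using assms(3) unfolding nonorientable_surface_def polygon_surface_def by blast
  have U: "crosscap_polygon g U qU"
    by unfold_locales (use qU assms(2) in blast)+
  show ?thesis
  proof (cases "g = 1")
    case True
    then have "\<Sigma> homeomorphic_space top_of_set (sphere (0 :: real^3) 1)"
      using assms(4) by (simp add: orientable_surface_def)
    then obtain a where a: "sphere_homeo \<Sigma> a" unfolding homeomorphic_space sphere_homeo_def by blast
    interpret sphere_homeo \<Sigma> a by (rule a)
    interpret U: crosscap_polygon g U qU by (rule U)
    show ?thesis
    proof (cases "n \<le> 2")
      case n: True
      then have n12: "n \<in> {1, 2}" using assms(1) by auto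
      have "\<exists>f. f \<in> epi (braid_group n U c) (braid_group n \<Sigma> d)"
        by (rule epi_by_permutation[OF n U.Hausdorff_U U.path_connected_polygon_config Hausdorff_X path_connected_sphere_config
              sphere_config_simply_connected[OF n12] assms(5,6)])
      then show ?thesis using True n12 by simp
    next
      case False
      then show ?thesis using no_epi_to_sphere[of n U qU c d] U assms(5,6) True by auto
    qed
  next
    case False
    then obtain h where h: "g = Suc h" "h \<ge> 1" using assms(2) by (cases g) auto
    then have "polygon_surface (tori_scheme h) \<Sigma>" using assms(4) by (simp add: orientable_surface_def)
    then obtain q where q: "quotient_map (top_of_set (cball 0 1)) \<Sigma> q"
      "\<forall>z\<in>cball 0 1. \<forall>z'\<in>cball 0 1. q z = q z' \<longleftrightarrow> equivclp (edge_glued (tori_scheme h)) z z'"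
      unfolding polygon_surface_def by blast
    have "tori_polygon h \<Sigma> q"
      by unfold_locales (use q h(2) in blast)+
    then show ?thesis using no_epi_to_positive_genus[of n h U qU \<Sigma> q c d] U assms(1,5,6) False h by auto
  qed
qed

end
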